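(* Let $A\in\mathbb{R}_+^{n\times n}$. (i) (Both algebras) The set of extremals of $\operatorname{core}(A)$ is the union of the sets of extremals of $V(A^{\sigma_{\rho}},\rho^{\sigma_{\rho}})$ over all $\rho\in\Lambda(A)$. (ii) In nonnegative algebra, each spectral class $\mu$ of $A$ with cyclicity $\sigma_\mu$ corresponds to a set of $\sigma_\mu$ distinct normalized extremals of $\operatorname{core}(A)$ such that, for each of them, there exists an index in its support that belongs to $\mu$, and each index in its support has access to $\mu$. In max algebra, each critical component $\tilde\mu$ with cyclicity $\sigma_{\tilde\mu}$ associated with some $\rho\in\Lambda(A)$ corresponds to a set of $\sigma_{\tilde\mu}$ distinct normalized extremals of $\operatorname{core}(A)$, which are the (normalized) columns of $(A_\rho^{\sigma_\rho})^*$ with indices in $N_{\tilde\mu}$. (iii) (Both algebras) Each set of extremals described in (ii) forms a simple cycle under the action of $A$; that is, its elements can be ordered cyclically, as one cycle through all of them, so that $A$ maps each one to a positive multiple of the next. (iv) There are no normalized extremals of $\operatorname{core}(A)$ other than those described in (ii). In nonnegative algebra, the total number of normalized extremals of $\operatorname{core}(A)$ equals the sum of the cyclicities of all spectral classes of $A$. In max algebra, the total number of normalized extremals of $\operatorname{core}(A)$ equals the sum of the cyclicities of all critical components of $A$.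
   Context: Nonnegative algebra: the semiring $\mathbb{R}_+=[0,\infty)$ with usual addition and multiplication. Max algebra: $\mathbb{R}_+$ with addition $a\oplus b=\max(a,b)$ and usual multiplication. Sums, matrix products $Ax$, powers $A^k$ and spans are taken in the algebra considered (in max algebra $(A\otimes B)_{ij}=\max_k a_{ik}b_{kj}$ and $A^k$ is the $k$-th max-algebraic power). Cones and extremals: a cone is a subset of $\mathbb{R}_+^n$ closed under the addition of the algebra and under multiplication by scalars in $\mathbb{R}_+$. $\operatorname{span}(A)$ is the set of all combinations of the columns of $A$ with coefficients in $\mathbb{R}_+$; $\operatorname{core}(A)=\bigcap_{i\ge1}\operatorname{span}(A^i)$. A nonzero vector $z$ of a cone $V$ is an extremal of $V$ if: in nonnegative algebra, $z=u+v$ with $u,v\in V$ implies that $u$ and $v$ are both scalar multiples of $z$; in max algebra, $z=u\oplus v$ with $u,v\in V$ implies $z=u$ or $z=v$. A vector $x\in\mathbb{R}_+^n$ is normalized if $\max_i x_i=1$; its support is $\{i:x_i>0\}$. Eigencones: $\rho\in\mathbb{R}_+$ is an eigenvalue of $A$ if $Ax=\rho x$ for some nonzero $x\in\mathbb{R}_+^n$; $V(A,\rho)=\{x\in\mathbb{R}_+^n: Ax=\rho x\}$; $\Lambda(A)$ is the set of nonzero eigenvalues (in the algebra considered). Classes: $\mathcal{G}(A)$ is the weighted digraph on $\{1,\dots,n\}$ with an edge $(i,j)$ of weight $a_{ij}$ iff $a_{ij}\ne0$. The classes $\mu$ of $A$ correspond to the strongly connected components of $\mathcal{G}(A)$ (an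 isolated node without a loop counts as a component), with node sets $N_\mu$; $A_{\mu\mu}$ is the corresponding (irreducible) principal submatrix and its unique eigenvalue in the algebra considered is the Perron root $\rho_\mu$. Class $\mu$ accesses class $\nu$ ($\mu\to\nu$) if $\mu=\nu$ or there is a path in $\mathcal{G}(A)$ from a node of $\mu$ to a node of $\nu$; a node has access to $\nu$ if its class does. A class $\nu$ is spectral, associated with $\rho\neq0$ (or $(A,\rho)$-spectral), if $\rho_\nu=\rho$ and: in max algebra, $\mu\to\nu$ implies $\rho_\mu\le\rho_\nu$; in nonnegative algebra, $\mu\to\nu$, $\mu\ne\nu$ implies $\rho_\mu<\rho_\nu$. Cyclicity: the cyclicity of a strongly connected graph is the gcd of the lengths of its elementary cycles ($1$ for a single node without edges); for a graph with several strongly connected components it is the lcm of their cyclicities. The cyclicity of a class $\mu$ is that of $\mathcal{G}(A_{\mu\mu})$. Max algebra only: for a matrix $B$, $\lambda(B)$ is the maximum over cycles $C$ of $\mathcal{G}(B)$ of $w(C)^{1/l(C)}$ ($w$ = product of edge weights, $l$ = length), and the critical graph $\mathcal{C}(B)$ consists of all nodes and edges on cycles attaining this maximum. For $\rho\in\Lambda(A)$ let $M_\rho$ be the set of indices accessing some $(A,\rho)$-spectral class, and let $A_\rho$ be the $n\times n$ matrix with entries $\rho^{-1}a_{ij}$ for $i,j\in M_\rho$ and $0$ otherwise. The critical graph associated with $\rho$ is $\mathcal{C}(A_\rho)$; a critical component $\tilde\mu$ of $A$ is a strongly connected component of the critical graph associated with some $\rho\in\Lambda(A)$, with node set $N_{\tilde\mu}$.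 The Kleene star of $B$ is $B^*=I\oplus B\oplus B^{2}\oplus\cdots$ (max-algebraic powers), when it converges. Numbers $\sigma_\rho$: for $\rho\in\Lambda(A)$, $\sigma_\rho$ is, in nonnegative algebra, the lcm of the cyclicities of all spectral classes associated with $\rho$, and, in max algebra, the cyclicity of the critical graph associated with $\rho$. *)

theory Defs
  imports "HOL-Analysis.Analysis"
begin

text \<open>Both semirings have carrier \<open>[0, \<infinity>)\<close>; elements are represented by nonnegative reals.
  The values of the operations below are only meaningful on nonnegative arguments.\<close>

datatype algebra = Nonneg | MaxAlg

fun vadd :: "algebra \<Rightarrow> real ^ 'n \<Rightarrow> real ^ 'n \<Rightarrow> real ^ 'n" where
  "vadd Nonneg x y = x + y"
| "vadd MaxAlg x y = (\<chi> i. max (x $ i) (y $ i))"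

fun mv :: "algebra \<Rightarrow> real ^ 'n ^ 'n \<Rightarrow> real ^ 'n \<Rightarrow> real ^ 'n::finite" where
  "mv Nonneg A x = A *v x"
| "mv MaxAlg A x = (\<chi> i. MAX j. A $ i $ j * x $ j)"

fun mm :: "algebra \<Rightarrow> real ^ 'n ^ 'n \<Rightarrow> real ^ 'n ^ 'n \<Rightarrow> real ^ 'n ^ 'n::finite" where
  "mm Nonneg A B = A ** B"
| "mm MaxAlg A B = (\<chi> i j. MAX k. A $ i $ k * B $ k $ j)"

primrec mpow :: "algebra \<Rightarrow> real ^ 'n ^ 'n \<Rightarrow> nat \<Rightarrow> real ^ 'n ^ 'n::finite" where
  "mpow alg A 0 = mat 1"
| "mpow alg A (Suc k) = mm alg A (mpow alg A k)"

definition nonneg_vec :: "real ^ 'n \<Rightarrow> bool" where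
  "nonneg_vec x \<longleftrightarrow> (\<forall>i. 0 \<le> x $ i)"

definition nonneg_mat :: "real ^ 'n ^ 'm \<Rightarrow> bool" where
  "nonneg_mat A \<longleftrightarrow> (\<forall>i j. 0 \<le> A $ i $ j)"

text \<open>The combination of the columns of \<open>A\<close> with coefficients \<open>c $ j\<close> is the product of \<open>A\<close>
  with \<open>c\<close>.\<close>

definition col_span :: "algebra \<Rightarrow> real ^ 'n ^ 'n \<Rightarrow> (real ^ 'n::finite) set" where
  "col_span alg A = {mv alg A c |c. nonneg_vec c}"

definition core :: "algebra \<Rightarrow> real ^ 'n ^ 'n \<Rightarrow> (real ^ 'n::finite) set" where
  "core alg A = (\<Inter>k\<in>{1..}. col_span alg (mpow alg A k))"

fun trivial_decomposition :: "algebra \<Rightarrow> real ^ 'n \<Rightarrow> real ^ 'n \<Rightarrow> real ^ 'n \<Rightarrow> bool" where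
  "trivial_decomposition Nonneg z u v \<longleftrightarrow> (\<exists>a\<ge>0. u = a *\<^sub>R z) \<and> (\<exists>b\<ge>0. v = b *\<^sub>R z)"
| "trivial_decomposition MaxAlg z u v \<longleftrightarrow> z = u \<or> z = v"

definition extremals :: "algebra \<Rightarrow> (real ^ 'n) set \<Rightarrow> (real ^ 'n) set" where
  "extremals alg V =
    {z \<in> V. z \<noteq> 0 \<and> (\<forall>u\<in>V. \<forall>v\<in>V. z = vadd alg u v \<longrightarrow> trivial_decomposition alg z u v)}"

definition normalized :: "real ^ 'n::finite \<Rightarrow> bool" where
  "normalized x \<longleftrightarrow> nonneg_vec x \<and> (MAX i. x $ i) = 1"

definition normalization :: "real ^ 'n::finite \<Rightarrow> real ^ 'n" where
  "normalization x = (1 / (MAX i. x $ i)) *\<^sub>R x"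

definition support :: "real ^ 'n \<Rightarrow> 'n set" where
  "support x = {i. x $ i > 0}"

definition normalized_extremals :: "algebra \<Rightarrow> (real ^ 'n::finite) set \<Rightarrow> (real ^ 'n) set" where
  "normalized_extremals alg V = {x \<in> extremals alg V. normalized x}"

definition eigencone :: "algebra \<Rightarrow> real ^ 'n ^ 'n \<Rightarrow> real \<Rightarrow> (real ^ 'n::finite) set" where
  "eigencone alg A \<rho> = {x. nonneg_vec x \<and> mv alg A x = \<rho> *\<^sub>R x}"

definition Lambda :: "algebra \<Rightarrow> real ^ 'n ^ 'n::finite \<Rightarrow> real set" where
  "Lambda alg A = {\<rho>. \<rho> > 0 \<and> (\<exists>x\<in>eigencone alg A \<rho>. x \<noteq> 0)}"

definition restrict_mat :: "'n set \<Rightarrow> real ^ 'n ^ 'n \<Rightarrow> real ^ 'n ^ 'n" where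
  "restrict_mat N A = (\<chi> i j. if i \<in> N \<and> j \<in> N then A $ i $ j else 0)"

text \<open>The principal submatrix of \<open>A\<close> on \<open>N\<close> is represented by \<open>restrict_mat N A\<close> acting on the
  vectors that vanish outside \<open>N\<close>. The latter restriction matters: without it, zero would always be
  an eigenvalue for \<open>N \<noteq> UNIV\<close>.\<close>

definition submatrix_eigenvalue :: "algebra \<Rightarrow> real ^ 'n ^ 'n::finite \<Rightarrow> 'n set \<Rightarrow> real \<Rightarrow> bool" where
  "submatrix_eigenvalue alg A N \<rho> \<longleftrightarrow>
    \<rho> \<ge> 0 \<and> (\<exists>x\<in>eigencone alg (restrict_mat N A) \<rho>. x \<noteq> 0 \<and> (\<forall>i. i \<notin> N \<longrightarrow> x $ i = 0))"

definition perron_root :: "algebra \<Rightarrow> real ^ 'n ^ 'n::finite \<Rightarrow> 'n set \<Rightarrow> real" where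
  "perron_root alg A N = (THE \<rho>. submatrix_eigenvalue alg A N \<rho>)"

text \<open>A digraph is a pair of its node set and its edge set.\<close>

type_synonym 'a graph = "'a set \<times> ('a \<times> 'a) set"

abbreviation nodes :: "'a graph \<Rightarrow> 'a set" where "nodes \<equiv> fst"
abbreviation edges :: "'a graph \<Rightarrow> ('a \<times> 'a) set" where "edges \<equiv> snd"

definition induced_subgraph :: "'a graph \<Rightarrow> 'a set \<Rightarrow> 'a graph" where
  "induced_subgraph G N = (N, edges G \<inter> N \<times> N)"

definition sccs :: "'a graph \<Rightarrow> 'a graph set" where
  "sccs G = induced_subgraph G `
    (nodes G // {(i, j) \<in> nodes G \<times> nodes G. (i, j) \<in> (edges G)\<^sup>* \<and> (j, i) \<in> (edges G)\<^sup>*})"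

text \<open>A cycle is given by the list of its successive nodes, without repeating the first one at the
  end; its number of edges is then the length of the list.\<close>

definition cycle_edge :: "'a list \<Rightarrow> nat \<Rightarrow> 'a \<times> 'a" where
  "cycle_edge c k = (c ! k, c ! (Suc k mod length c))"

definition cycle_of :: "'a graph \<Rightarrow> 'a list \<Rightarrow> bool" where
  "cycle_of G c \<longleftrightarrow> c \<noteq> [] \<and> (\<forall>k<length c. cycle_edge c k \<in> edges G)"

definition elementary_cycle_of :: "'a graph \<Rightarrow> 'a list \<Rightarrow> bool" where
  "elementary_cycle_of G c \<longleftrightarrow> cycle_of G c \<and> distinct c"

text \<open>A strongly connected graph without edges consists of a single node.\<close>

definition sc_cyclicity :: "'a graph \<Rightarrow> nat" where
  "sc_cyclicity G = (if edges G = {} then 1 else Gcd (length ` {c. elementary_cycle_of G c}))"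

definition cyclicity :: "'a graph \<Rightarrow> nat" where
  "cyclicity G = Lcm (sc_cyclicity ` sccs G)"

definition graph_of :: "real ^ 'n ^ 'n \<Rightarrow> 'n graph" where
  "graph_of A = (UNIV, {(i, j). A $ i $ j \<noteq> 0})"

text \<open>A class is identified with the corresponding strongly connected component, which is also
  the digraph of the corresponding principal submatrix.\<close>

definition classes :: "real ^ 'n ^ 'n \<Rightarrow> 'n graph set" where
  "classes A = sccs (graph_of A)"

definition node_accesses :: "real ^ 'n ^ 'n \<Rightarrow> 'n \<Rightarrow> 'n graph \<Rightarrow> bool" where
  "node_accesses A i \<nu> \<longleftrightarrow> (\<exists>j\<in>nodes \<nu>. (i, j) \<in> (edges (graph_of A))\<^sup>*)"

definition class_accesses :: "real ^ 'n ^ 'n \<Rightarrow> 'n graph \<Rightarrow> 'n graph \<Rightarrow> bool" where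
  "class_accesses A \<mu> \<nu> \<longleftrightarrow> \<mu> = \<nu> \<or> (\<exists>i\<in>nodes \<mu>. node_accesses A i \<nu>)"

fun dominates :: "algebra \<Rightarrow> real ^ 'n ^ 'n::finite \<Rightarrow> 'n graph \<Rightarrow> bool" where
  "dominates Nonneg A \<nu> \<longleftrightarrow>
    (\<forall>\<mu>\<in>classes A. class_accesses A \<mu> \<nu> \<and> \<mu> \<noteq> \<nu> \<longrightarrow>
      perron_root Nonneg A (nodes \<mu>) < perron_root Nonneg A (nodes \<nu>))"
| "dominates MaxAlg A \<nu> \<longleftrightarrow>
    (\<forall>\<mu>\<in>classes A. class_accesses A \<mu> \<nu> \<longrightarrow>
      perron_root MaxAlg A (nodes \<mu>) \<le> perron_root MaxAlg A (nodes \<nu>))"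

definition spectral :: "algebra \<Rightarrow> real ^ 'n ^ 'n::finite \<Rightarrow> real \<Rightarrow> 'n graph \<Rightarrow> bool" where
  "spectral alg A \<rho> \<nu> \<longleftrightarrow>
    \<nu> \<in> classes A \<and> \<rho> \<noteq> 0 \<and> perron_root alg A (nodes \<nu>) = \<rho> \<and> dominates alg A \<nu>"

definition spectral_classes :: "algebra \<Rightarrow> real ^ 'n ^ 'n::finite \<Rightarrow> 'n graph set" where
  "spectral_classes alg A = {\<nu>. \<exists>\<rho>. spectral alg A \<rho> \<nu>}"

definition cycle_mean :: "real ^ 'n ^ 'n \<Rightarrow> 'n list \<Rightarrow> real" where
  "cycle_mean B c = root (length c) (\<Prod>k<length c. case cycle_edge c k of (i, j) \<Rightarrow> B $ i $ j)"

text \<open>The maximum exists whenever \<open>graph_of B\<close> has a cycle, although there are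
  infinitely many cycles.\<close>

definition max_cycle_mean :: "real ^ 'n ^ 'n \<Rightarrow> real" where
  "max_cycle_mean B = (GREATEST r. r \<in> cycle_mean B ` {c. cycle_of (graph_of B) c})"

definition critical_cycle :: "real ^ 'n ^ 'n \<Rightarrow> 'n list \<Rightarrow> bool" where
  "critical_cycle B c \<longleftrightarrow> cycle_of (graph_of B) c \<and> cycle_mean B c = max_cycle_mean B"

definition critical_graph :: "real ^ 'n ^ 'n \<Rightarrow> 'n graph" where
  "critical_graph B =
    (\<Union> (set ` {c. critical_cycle B c}),
     {cycle_edge c k |c k. critical_cycle B c \<and> k < length c})"

definition access_set :: "real ^ 'n ^ 'n::finite \<Rightarrow> real \<Rightarrow> 'n set" where
  "access_set A \<rho> = {i. \<exists>\<nu>. spectral MaxAlg A \<rho> \<nu> \<and> node_accesses A i \<nu>}"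

definition scaled_restriction :: "real ^ 'n ^ 'n::finite \<Rightarrow> real \<Rightarrow> real ^ 'n ^ 'n" where
  "scaled_restriction A \<rho> = (1 / \<rho>) *\<^sub>R restrict_mat (access_set A \<rho>) A"

definition assoc_critical_graph :: "real ^ 'n ^ 'n::finite \<Rightarrow> real \<Rightarrow> 'n graph" where
  "assoc_critical_graph A \<rho> = critical_graph (scaled_restriction A \<rho>)"

definition critical_components :: "real ^ 'n ^ 'n::finite \<Rightarrow> 'n graph set" where
  "critical_components A = (\<Union>\<rho>\<in>Lambda MaxAlg A. sccs (assoc_critical_graph A \<rho>))"

definition kleene_partial :: "real ^ 'n ^ 'n \<Rightarrow> nat \<Rightarrow> real ^ 'n ^ 'n::finite" where
  "kleene_partial B m = (\<chi> i j. MAX k\<in>{..m}. mpow MaxAlg B k $ i $ j)"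

definition kleene_converges :: "real ^ 'n ^ 'n::finite \<Rightarrow> bool" where
  "kleene_converges B \<longleftrightarrow> convergent (kleene_partial B)"

definition kleene_star :: "real ^ 'n ^ 'n \<Rightarrow> real ^ 'n ^ 'n::finite" where
  "kleene_star B = lim (kleene_partial B)"

fun sigma_num :: "algebra \<Rightarrow> real ^ 'n ^ 'n::finite \<Rightarrow> real \<Rightarrow> nat" where
  "sigma_num Nonneg A \<rho> = Lcm (sc_cyclicity ` {\<nu>. spectral Nonneg A \<rho> \<nu>})"
| "sigma_num MaxAlg A \<rho> = cyclicity (assoc_critical_graph A \<rho>)"

definition critical_star :: "real ^ 'n ^ 'n::finite \<Rightarrow> real \<Rightarrow> real ^ 'n ^ 'n" where
  "critical_star A \<rho> = kleene_star (mpow MaxAlg (scaled_restriction A \<rho>) (sigma_num MaxAlg A \<rho>))"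

definition critical_columns :: "real ^ 'n ^ 'n::finite \<Rightarrow> real \<Rightarrow> 'n graph \<Rightarrow> (real ^ 'n) set" where
  "critical_columns A \<rho> C = (\<lambda>j. normalization (column j (critical_star A \<rho>))) ` nodes C"

definition simple_cycle_under :: "algebra \<Rightarrow> real ^ 'n ^ 'n \<Rightarrow> (real ^ 'n::finite) set \<Rightarrow> bool" where
  "simple_cycle_under alg A X \<longleftrightarrow>
    (\<exists>xs. distinct xs \<and> set xs = X \<and>
      (\<forall>k<length xs. \<exists>c>0. mv alg A (xs ! k) = c *\<^sub>R xs ! (Suc k mod length xs)))"

end

theory Submission
  imports Defs
begin

text \<open>In both algebras the core is a finitely generated cone whose extremal rays are permuted by \<open>A\<close>.
Once this is known, the extremals satisfy \<open>A ^ p z = \<rho> ^ p z\<close> for some \<open>p\<close> and \<open>\<rho> > 0\<close>, and it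
remains to find the vectors with this property.

To see that the core is finitely generated, scale the columns of \<open>A ^ k\<close> to entry sum one and let
\<open>U\<close> be the limit of a subsequence. A vector of the core is, for every \<open>k\<close>, a combination of the scaled columns with bounded
coefficients, hence a combination of the columns of \<open>U\<close>; the same argument with \<open>A ^ (k + 1)\<close> shows
that \<open>A\<close> maps the core onto itself (\<open>core_finitely_generated\<close>). Take generators \<open>u j\<close> of minimal
number. Each \<open>u j\<close> is extremal and a combination of the images \<open>A u i\<close>, so it is a multiple of one of
them. Thus \<open>A\<close> permutes the generators up to positive factors
(\<open>core_generated_by_periodic_vectors\<close>). Moreover the sum of \<open>z\<close>, \<open>A z / \<rho>\<close>, ... over one period is an
eigenvector that dominates \<open>z\<close> (\<open>eigenvector_above_periodic\<close>).

In nonnegative algebra, let \<open>w\<close> be such an eigenvector. The classes that are final in its support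
are spectral for \<open>\<rho>\<close>. A vector \<open>d\<close> on this support with \<open>A ^ m d = \<rho> ^ m d\<close> is nonnegative if it
is nonnegative on the final classes, since the nodes where \<open>d / w\<close> is minimal form a set that walks
of length divisible by \<open>m\<close> within the support do not leave (\<open>nonneg_if_nonneg_on_final_classes\<close>). So \<open>z\<close> is
determined by its values on the spectral classes. There it is proportional to the Perron vector on
every cyclic class (\<open>ratio_constant_on_cyclic_class\<close>). The extremals are therefore, up to scaling,
the periodic vectors, supported on the nodes with access to one spectral class, that on this class
equal the Perron vector on one cyclic class and zero on the others; \<open>A\<close> moves each of them to the
preceding cyclic class.

In max algebra, for an eigenvalue \<open>\<rho>\<close> the closed walks of \<open>A\<^sub>\<rho>\<close> have weight at most one, with equality
for those in the critical graph. Let \<open>\<sigma>\<close> be the cyclicity of the critical graph, \<open>S\<close> the Kleene star of the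
power \<open>\<sigma>\<close> of \<open>A\<^sub>\<rho>\<close> and \<open>z\<close> a fixed vector of the power \<open>\<sigma> q\<close>. Critical closed walks of every large
length divisible by \<open>\<sigma>\<close> exist at a critical node \<open>j\<close>, which gives \<open>S i j * z j \<le> z i\<close>; and a walk
along which the maxima in the fixed point equation are attained leads from \<open>i\<close> to a critical \<open>j\<close> with
\<open>z i = S i j * z j\<close>. So the critical columns of \<open>S\<close> generate. Column \<open>j\<close> is extremal because no other
vector of the core lies below it and agrees with it at \<open>j\<close> (\<open>critical_column_extremal\<close>). Two critical
columns are proportional exactly if their nodes lie in the same cyclic class of the same critical
component (\<open>proportional_columns_iff\<close>), and \<open>A\<close> sends column \<open>j\<close> to a multiple of column \<open>i\<close> for each
critical edge \<open>(i, j)\<close>.\<close>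

section \<open>Sums in both algebras\<close>

text \<open>The addition of the algebra, iterated over the index type. Arguments that use only monotonicity,
homogeneity and continuity of this operation serve both algebras at once.\<close>

definition ssum :: "algebra \<Rightarrow> ('n::finite \<Rightarrow> real) \<Rightarrow> real" where
  "ssum alg f = (case alg of Nonneg \<Rightarrow> \<Sum>j\<in>UNIV. f j | MaxAlg \<Rightarrow> MAX j. f j)"

lemma mv_nth: "mv alg A x $ i = ssum alg (\<lambda>j. A $ i $ j * x $ j)"
  by (cases alg) (simp_all add: ssum_def matrix_vector_mult_def)

lemma mm_nth: "mm alg A B $ i $ j = ssum alg (\<lambda>k. A $ i $ k * B $ k $ j)"
  by (cases alg) (simp_all add: ssum_def matrix_matrix_mult_def)

lemma ssum_mono: "(\<And>j. f j \<le> g j) \<Longrightarrow> ssum alg f \<le> ssum alg g"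
proof (cases alg)
  case MaxAlg
  assume *: "\<And>j. f j \<le> g j"
  have "f j \<le> (MAX j. g j)" for j
    using *[of j] by (meson Max_ge finite_imageI finite rangeI order_trans)
  then show ?thesis using MaxAlg by (simp add: ssum_def)
qed (simp add: ssum_def sum_mono)

lemma ssum_ge: "(\<And>j. 0 \<le> f j) \<Longrightarrow> f j \<le> ssum alg f"
  by (cases alg) (simp_all add: ssum_def member_le_sum)

lemma ssum_nonneg: "(\<And>j. 0 \<le> f j) \<Longrightarrow> 0 \<le> ssum alg f"
  using ssum_ge[of f undefined alg] by (meson order_trans)

lemma ssum_scale: "0 \<le> a \<Longrightarrow> ssum alg (\<lambda>j. a * f j) = a * ssum alg f"
proof (cases alg)
  case MaxAlg
  assume "0 \<le> a"
  then have "mono (\<lambda>x. a * x)" by (simp add: mono_def mult_left_mono)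
  from mono_Max_commute[OF this, of "range f"] show ?thesis
    using MaxAlg by (simp add: ssum_def image_image)
qed (simp add: ssum_def sum_distrib_left)

lemma ssum_attained: "\<exists>j. f j = ssum MaxAlg f"
proof -
  have "Max (range f) \<in> range f" by (rule Max_in) auto
  then show ?thesis unfolding ssum_def algebra.case by force
qed

lemma ssum_Max_le_iff: "ssum MaxAlg f \<le> b \<longleftrightarrow> (\<forall>j. f j \<le> b)"
  by (auto simp: ssum_def)

lemma ssum_Max_ge: "(f j :: real) \<le> ssum MaxAlg f"
  by (simp add: ssum_def)

lemma ssum_const0 [simp]: "ssum alg (\<lambda>j. 0) = 0"
  by (cases alg) (simp_all add: ssum_def)

lemma ssum_pos_ex: "0 < ssum alg (f :: 'a::finite \<Rightarrow> real) \<Longrightarrow> \<exists>j. 0 < f j"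
proof (rule ccontr)
  assume *: "0 < ssum alg f" "\<nexists>j. 0 < f j"
  then have "ssum alg f \<le> ssum alg (\<lambda>j::'a. 0)" by (intro ssum_mono) (auto simp: not_less)
  then show False using * by simp
qed

lemma ssum_swap: "ssum alg (\<lambda>i. ssum alg (\<lambda>j. f i j)) = ssum alg (\<lambda>j. ssum alg (\<lambda>i. f i j))"
proof (cases alg)
  case MaxAlg
  have *: "ssum MaxAlg (\<lambda>i. ssum MaxAlg (\<lambda>j. f i j)) \<le> ssum MaxAlg (\<lambda>j. ssum MaxAlg (\<lambda>i. f i j))"
    for f :: "'x::finite \<Rightarrow> 'y::finite \<Rightarrow> real"
  proof -
    obtain i where i: "ssum MaxAlg (f i) = ssum MaxAlg (\<lambda>i. ssum MaxAlg (f i))"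
      by (rule exE[OF ssum_attained[of "\<lambda>i. ssum MaxAlg (f i)"]])
    obtain j where j: "f i j = ssum MaxAlg (f i)"
      by (rule exE[OF ssum_attained[of "f i"]])
    have "f i j \<le> ssum MaxAlg (\<lambda>i. f i j)" by (rule ssum_Max_ge)
    also have "\<dots> \<le> ssum MaxAlg (\<lambda>j. ssum MaxAlg (\<lambda>i. f i j))" by (rule ssum_Max_ge)
    finally show ?thesis unfolding i j .
  qed
  show ?thesis unfolding MaxAlg
    by (rule antisym) (rule *)+
qed (simp add: ssum_def, rule sum.swap)

lemma ssum_scale_right: "0 \<le> a \<Longrightarrow> ssum alg (\<lambda>j. f j * a) = ssum alg f * a"
  using ssum_scale[of a alg f] by (simp add: mult.commute)

lemma ssum_single:
  assumes "0 \<le> a" shows "ssum alg (\<lambda>j. if j = i then a else 0) = a"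
proof (cases alg)
  case MaxAlg
  show ?thesis unfolding MaxAlg
    using assms ssum_ge[of "\<lambda>j. if j = i then a else 0" i MaxAlg]
    by (intro antisym) (auto simp: ssum_Max_le_iff)
qed (simp add: ssum_def)

lemma tendsto_Max_image:
  fixes f :: "'a \<Rightarrow> 'b \<Rightarrow> real"
  assumes "finite S" "S \<noteq> {}" "\<And>j. j \<in> S \<Longrightarrow> ((\<lambda>x. f x j) \<longlongrightarrow> l j) F"
  shows "((\<lambda>x. Max (f x ` S)) \<longlongrightarrow> Max (l ` S)) F"
  using assms
proof (induction S rule: finite_ne_induct)
  case (insert x S)
  then have "((\<lambda>y. max (f y x) (Max (f y ` S))) \<longlongrightarrow> max (l x) (Max (l ` S))) F"
    by (intro tendsto_max) auto
  then show ?case using insert by simp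
qed simp

lemma tendsto_ssum:
  fixes f :: "'a \<Rightarrow> 'n::finite \<Rightarrow> real"
  assumes "\<And>j. ((\<lambda>x. f x j) \<longlongrightarrow> l j) F"
  shows "((\<lambda>x. ssum alg (f x)) \<longlongrightarrow> ssum alg l) F"
proof (cases alg)
  case Nonneg
  then show ?thesis using assms by (simp add: ssum_def tendsto_sum)
next
  case MaxAlg
  then show ?thesis using tendsto_Max_image[of UNIV f l F] assms by (simp add: ssum_def)
qed

lemma tendsto_mv:
  assumes "(A \<longlongrightarrow> B) F" "(x \<longlongrightarrow> y) F"
  shows "((\<lambda>k. mv alg (A k) (x k)) \<longlongrightarrow> mv alg B y) F"
  by (rule vec_tendstoI) (unfold mv_nth, intro tendsto_ssum tendsto_mult tendsto_vec_nth assms)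

section \<open>Matrices in both algebras\<close>

lemma vadd_nth: "vadd alg x y $ i = (case alg of Nonneg \<Rightarrow> x $ i + y $ i | MaxAlg \<Rightarrow> max (x $ i) (y $ i))"
  by (cases alg) simp_all

lemma mv_nonneg: "nonneg_mat A \<Longrightarrow> nonneg_vec x \<Longrightarrow> nonneg_vec (mv alg A x)"
  by (simp add: nonneg_vec_def nonneg_mat_def mv_nth ssum_nonneg)

lemma mm_nonneg: "nonneg_mat A \<Longrightarrow> nonneg_mat B \<Longrightarrow> nonneg_mat (mm alg A B)"
  by (simp add: nonneg_mat_def mm_nth ssum_nonneg)

lemma mpow_nonneg: "nonneg_mat A \<Longrightarrow> nonneg_mat (mpow alg A k)"
proof (induction k)
  case 0 then show ?case by (simp add: nonneg_mat_def mat_def)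
qed (simp add: mm_nonneg)

lemma mv_mono:
  assumes "nonneg_mat A" "\<And>i. x $ i \<le> y $ i"
  shows "mv alg A x $ i \<le> mv alg A y $ i"
  unfolding mv_nth using assms by (intro ssum_mono mult_left_mono) (auto simp: nonneg_mat_def)

lemma mv_scaleR: "0 \<le> a \<Longrightarrow> mv alg A (a *\<^sub>R x) = a *\<^sub>R mv alg A x"
  by (simp add: vec_eq_iff mv_nth ssum_scale[symmetric] algebra_simps)

lemma mv_scaleR_mat: "0 \<le> a \<Longrightarrow> mv alg (a *\<^sub>R A) x = a *\<^sub>R mv alg A x"
  by (simp add: vec_eq_iff mv_nth ssum_scale[symmetric] algebra_simps)

lemma mv_zero [simp]: "mv alg A 0 = 0"
  by (simp add: vec_eq_iff mv_nth)

lemma mv_axis: "nonneg_mat A \<Longrightarrow> mv alg A (axis j 1) $ i = A $ i $ j"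
proof -
  assume "nonneg_mat A"
  then have "ssum alg (\<lambda>k. if k = j then A $ i $ j else 0) = A $ i $ j"
    by (intro ssum_single) (simp add: nonneg_mat_def)
  moreover have "(\<lambda>k. if k = j then A $ i $ j else 0) = (\<lambda>k. A $ i $ k * axis j 1 $ k)"
    by (rule ext) (simp add: axis_def)
  ultimately show ?thesis by (simp add: mv_nth)
qed

lemma nonneg_axis [simp]: "nonneg_vec (axis j (1::real))"
  by (simp add: nonneg_vec_def axis_def)

lemma nonneg_zero [simp]: "nonneg_vec 0"
  by (simp add: nonneg_vec_def)

lemma mat_eqI:
  assumes "nonneg_mat A" "nonneg_mat B" "\<And>x. nonneg_vec x \<Longrightarrow> mv alg A x = mv alg B x"
  shows "A = B"
  unfolding vec_eq_iff
proof (intro allI)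
  fix i j
  show "A $ i $ j = B $ i $ j"
    using mv_axis[OF assms(1), of alg j i] mv_axis[OF assms(2), of alg j i] assms(3)[OF nonneg_axis, of j] by simp
qed

lemma mv_mm:
  assumes "nonneg_mat A" "nonneg_mat B" "nonneg_vec x"
  shows "mv alg (mm alg A B) x = mv alg A (mv alg B x)"
proof -
  have "ssum alg (\<lambda>j. ssum alg (\<lambda>k. A $ i $ k * B $ k $ j) * x $ j)
      = ssum alg (\<lambda>k. A $ i $ k * ssum alg (\<lambda>j. B $ k $ j * x $ j))" for i
  proof -
    have "ssum alg (\<lambda>j. ssum alg (\<lambda>k. A $ i $ k * B $ k $ j) * x $ j)
        = ssum alg (\<lambda>j. ssum alg (\<lambda>k. A $ i $ k * B $ k $ j * x $ j))"
      using assms by (simp add: ssum_scale_right nonneg_vec_def)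
    also have "\<dots> = ssum alg (\<lambda>k. ssum alg (\<lambda>j. A $ i $ k * B $ k $ j * x $ j))"
      by (rule ssum_swap)
    also have "\<dots> = ssum alg (\<lambda>k. A $ i $ k * ssum alg (\<lambda>j. B $ k $ j * x $ j))"
      using assms by (simp add: ssum_scale[symmetric] nonneg_mat_def mult.assoc)
    finally show ?thesis .
  qed
  then show ?thesis unfolding vec_eq_iff mv_nth mm_nth by blast
qed

lemma nonneg_mat1 [simp]: "nonneg_mat (mat 1)"
  by (simp add: nonneg_mat_def mat_def)

lemma mv_mat1: "nonneg_vec x \<Longrightarrow> mv alg (mat 1) x = x"
proof -
  assume "nonneg_vec x"
  have "mv alg (mat 1) x $ i = x $ i" for i
  proof -
    have "(\<lambda>j. mat 1 $ i $ j * x $ j) = (\<lambda>j. if j = i then x $ i else 0)"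
      by (rule ext) (simp add: mat_def)
    then show ?thesis using \<open>nonneg_vec x\<close> by (simp add: mv_nth ssum_single nonneg_vec_def)
  qed
  then show ?thesis by (simp add: vec_eq_iff)
qed

lemma nonneg_funpow: "nonneg_mat A \<Longrightarrow> nonneg_vec x \<Longrightarrow> nonneg_vec ((mv alg A ^^ k) x)"
  by (induction k) (auto intro: mv_nonneg)

lemma mv_mpow:
  assumes "nonneg_mat A" "nonneg_vec x"
  shows "mv alg (mpow alg A k) x = (mv alg A ^^ k) x"
proof (induction k)
  case 0
  show ?case using mv_mat1[OF assms(2)] by simp
next
  case (Suc k)
  show ?case using mv_mm[OF assms(1) mpow_nonneg[OF assms(1)] assms(2)] Suc by simp
qed

lemma mpow_nth: "nonneg_mat A \<Longrightarrow> mpow alg A k $ i $ j = (mv alg A ^^ k) (axis j 1) $ i"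
  using mv_axis[OF mpow_nonneg, of A alg alg k j i] mv_mpow[OF _ nonneg_axis, of A alg k j] by simp

lemma mpow_mult:
  assumes "nonneg_mat A" shows "mpow alg (mpow alg A m) k = mpow alg A (m * k)"
proof (rule mat_eqI[of _ _ alg])
  fix x :: "real^'a" assume x: "nonneg_vec x"
  have "(mv alg (mpow alg A m) ^^ k) x = (mv alg A ^^ (m * k)) x"
  proof (induction k)
    case (Suc k)
    have "(mv alg (mpow alg A m) ^^ Suc k) x = (mv alg A ^^ m) ((mv alg A ^^ (m * k)) x)"
      using Suc mv_mpow[OF assms nonneg_funpow[OF assms x]] by simp
    then show ?case using funpow_add[of m "m * k" "mv alg A"] by simp
  qed simp
  then show "mv alg (mpow alg (mpow alg A m) k) x = mv alg (mpow alg A (m * k)) x"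
    using mv_mpow[OF mpow_nonneg[OF assms] x] mv_mpow[OF assms x] by metis
qed (auto intro: mpow_nonneg assms)

lemma mpow_add:
  assumes "nonneg_mat A" shows "mpow alg A (a + b) = mm alg (mpow alg A a) (mpow alg A b)"
proof (rule mat_eqI[of _ _ alg])
  fix x :: "real^'a" assume x: "nonneg_vec x"
  have "mv alg (mpow alg A (a + b)) x = (mv alg A ^^ a) ((mv alg A ^^ b) x)"
    using mv_mpow[OF assms x] by (simp add: funpow_add)
  also have "\<dots> = mv alg (mm alg (mpow alg A a) (mpow alg A b)) x"
    using mv_mm[OF mpow_nonneg[OF assms] mpow_nonneg[OF assms] x] mv_mpow[OF assms x]
      mv_mpow[OF assms nonneg_funpow[OF assms x]] by simp
  finally show "mv alg (mpow alg A (a + b)) x = mv alg (mm alg (mpow alg A a) (mpow alg A b)) x" .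
qed (auto intro: mpow_nonneg mm_nonneg assms)

lemma mpow_1: assumes "nonneg_mat A" shows "mpow alg A (Suc 0) = A"
proof (rule mat_eqI[of _ _ alg])
  fix x :: "real^'a" assume x: "nonneg_vec x"
  show "mv alg (mpow alg A (Suc 0)) x = mv alg A x" using mv_mpow[OF assms x, of alg "Suc 0"] by simp
qed (use assms in \<open>auto intro: mpow_nonneg mm_nonneg\<close>)

lemma mpow_add_ge:
  assumes "nonneg_mat A"
  shows "mpow alg A a $ i $ k * mpow alg A b $ k $ j \<le> mpow alg A (a + b) $ i $ j"
  unfolding mpow_add[OF assms] mm_nth
  using mpow_nonneg[OF assms, of alg] by (intro ssum_ge) (simp add: nonneg_mat_def)

lemma mv_ge_term:
  assumes "nonneg_mat A" "nonneg_vec x" shows "A $ i $ j * x $ j \<le> mv alg A x $ i"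
  unfolding mv_nth using assms by (intro ssum_ge) (simp add: nonneg_vec_def nonneg_mat_def)

lemma mv_pos_iff:
  assumes "nonneg_mat A" "nonneg_vec x"
  shows "0 < mv alg A x $ i \<longleftrightarrow> (\<exists>j. 0 < A $ i $ j \<and> 0 < x $ j)"
proof
  assume "0 < mv alg A x $ i"
  then obtain j where "0 < A $ i $ j * x $ j" unfolding mv_nth using ssum_pos_ex by blast
  then show "\<exists>j. 0 < A $ i $ j \<and> 0 < x $ j" using assms
    by (metis nonneg_mat_def nonneg_vec_def zero_less_mult_iff not_less)
next
  assume "\<exists>j. 0 < A $ i $ j \<and> 0 < x $ j"
  then show "0 < mv alg A x $ i" using mv_ge_term[OF assms] by (meson mult_pos_pos order_less_le_trans)
qed

lemma mv_vadd:
  assumes "nonneg_mat A"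
  shows "mv alg A (vadd alg x y) = vadd alg (mv alg A x) (mv alg A y)"
proof (cases alg)
  case MaxAlg
  have "ssum MaxAlg (\<lambda>j. A $ i $ j * max (x $ j) (y $ j))
      = max (ssum MaxAlg (\<lambda>j. A $ i $ j * x $ j)) (ssum MaxAlg (\<lambda>j. A $ i $ j * y $ j))" (is "?l = max ?a ?b") for i
  proof (rule antisym)
    have A: "0 \<le> A $ i $ j" for j using assms by (simp add: nonneg_mat_def)
    have "A $ i $ j * max (x $ j) (y $ j) \<le> max ?a ?b" for j
      unfolding max_mult_distrib_left[of "A $ i $ j"] if_P[OF A] by (rule max.mono) (rule ssum_Max_ge)+
    then show "?l \<le> max ?a ?b" unfolding ssum_Max_le_iff by blast
  next
    have "0 \<le> A $ i $ j" for j using assms by (simp add: nonneg_mat_def)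
    then show "max ?a ?b \<le> ?l" by (intro max.boundedI ssum_mono mult_left_mono) auto
  qed
  then show ?thesis using MaxAlg by (simp add: vec_eq_iff mv_nth del: mv.simps)
next
  case Nonneg
  then show ?thesis by (simp add: matrix_vector_right_distrib)
qed

lemma vadd_nonneg: "nonneg_vec x \<Longrightarrow> nonneg_vec y \<Longrightarrow> nonneg_vec (vadd alg x y)"
  by (auto simp: nonneg_vec_def vadd_nth split: algebra.splits simp: le_max_iff_disj)

lemma vadd_ge:
  "nonneg_vec x \<Longrightarrow> nonneg_vec y \<Longrightarrow> x $ i \<le> vadd alg x y $ i \<and> y $ i \<le> vadd alg x y $ i"
  by (auto simp: nonneg_vec_def vadd_nth split: algebra.splits)

section \<open>Finite generation of the core\<close>

text \<open>Where a column of \<open>U\<close> vanishes, the coefficients do not matter and can be set to zero. At any other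
column some entry of \<open>M k\<close> stays away from zero, so the convergence of \<open>x\<close> bounds the coefficients, and
a convergent subsequence of them represents the limit.\<close>

lemma col_span_limit:
  fixes M :: "nat \<Rightarrow> real^'n^'n::finite"
  assumes M: "\<And>k. nonneg_mat (M k)" "M \<longlonglongrightarrow> U" and x: "x \<longlonglongrightarrow> x0"
    and c: "\<And>k. nonneg_vec (c k)" "\<And>k. x k = mv alg (M k) (c k)"
    and zero: "\<And>j k i. (\<forall>i. U $ i $ j = 0) \<Longrightarrow> M k $ i $ j = 0"
  shows "x0 \<in> col_span alg U"
proof -
  define c' where "c' k = (\<chi> j. if \<forall>i. U $ i $ j = 0 then 0 else c k $ j)" for k
  have c'0: "0 \<le> c' k $ j" for k j using c(1) by (simp add: c'_def nonneg_vec_def)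
  have xc': "x k = mv alg (M k) (c' k)" for k
  proof -
    have "(\<lambda>j. M k $ i $ j * c k $ j) = (\<lambda>j. M k $ i $ j * c' k $ j)" for i
      using zero by (intro ext) (auto simp: c'_def)
    then show ?thesis using c(2) by (simp add: vec_eq_iff mv_nth)
  qed
  have Ul: "(\<lambda>k. M k $ i $ j) \<longlonglongrightarrow> U $ i $ j" for i j
    by (intro tendsto_vec_nth M)
  have U0: "0 \<le> U $ i $ j" for i j
    using Ul[of i j] M(1) by (intro LIMSEQ_le_const) (auto simp: nonneg_mat_def)
  have "\<exists>b\<ge>0. \<forall>\<^sub>F k in sequentially. c' k $ j \<le> b" for j
  proof (cases "\<forall>i. U $ i $ j = 0")
    case True
    then show ?thesis by (intro exI[of _ 0]) (simp add: c'_def)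
  next
    case False
    then obtain i where i: "0 < U $ i $ j" using U0 by (metis order_le_less)
    have e1: "\<forall>\<^sub>F k in sequentially. U $ i $ j / 2 < M k $ i $ j"
      using Ul[of i j] i by (intro order_tendstoD(1)) auto
    have "(\<lambda>k. x k $ i) \<longlonglongrightarrow> x0 $ i" by (intro tendsto_vec_nth x)
    then have e2: "\<forall>\<^sub>F k in sequentially. x k $ i < \<bar>x0 $ i\<bar> + 1"
      by (intro order_tendstoD(2)) auto
    have "\<forall>\<^sub>F k in sequentially. c' k $ j \<le> (\<bar>x0 $ i\<bar> + 1) / (U $ i $ j / 2)"
      using e1 e2
    proof eventually_elim
      case (elim k)
      have "c' k $ j * (U $ i $ j / 2) \<le> c' k $ j * M k $ i $ j"
        using elim c'0 by (intro mult_left_mono) auto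
      also have "\<dots> \<le> x k $ i"
        using mv_ge_term[OF M(1), of "c' k" k i j] c'0 xc' by (simp add: nonneg_vec_def mult.commute)
      finally show ?case using elim i by (simp add: field_simps)
    qed
    then show ?thesis using i by (intro exI[of _ "(\<bar>x0 $ i\<bar> + 1) / (U $ i $ j / 2)"]) auto
  qed
  then obtain b where b: "\<And>j. 0 \<le> b j" "\<And>j. \<forall>\<^sub>F k in sequentially. c' k $ j \<le> b j" by metis
  have "\<forall>\<^sub>F k in sequentially. \<forall>j. c' k $ j \<le> b j"
    using b(2) by (simp add: eventually_all_finite)
  then obtain K where K: "\<And>k j. k \<ge> K \<Longrightarrow> c' k $ j \<le> b j"
    unfolding eventually_sequentially by blast
  have "norm (c' (k + K)) \<le> (\<Sum>j\<in>UNIV. b j)" for k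
  proof -
    have "norm (c' (k + K)) \<le> (\<Sum>j\<in>UNIV. \<bar>c' (k + K) $ j\<bar>)" by (rule norm_le_l1_cart)
    also have "\<dots> \<le> (\<Sum>j\<in>UNIV. b j)" using K[of "k + K"] c'0 by (intro sum_mono) simp
    finally show ?thesis .
  qed
  then have "bounded (range (\<lambda>k. c' (k + K)))" unfolding bounded_iff by blast
  then obtain l r where r: "strict_mono (r :: nat \<Rightarrow> nat)" and l: "((\<lambda>k. c' (k + K)) \<circ> r) \<longlonglongrightarrow> l"
    using bounded_imp_convergent_subsequence by blast
  have rK: "filterlim (\<lambda>k. r k + K) at_top sequentially"
    using r by (intro filterlim_subseq) (simp add: strict_mono_def)
  have "(\<lambda>k. mv alg (M (r k + K)) (c' (r k + K))) \<longlonglongrightarrow> mv alg U l"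
    using l filterlim_compose[OF M(2) rK] by (intro tendsto_mv) (auto simp: o_def)
  moreover have "(\<lambda>k. x (r k + K)) \<longlonglongrightarrow> x0" by (rule filterlim_compose[OF x rK])
  ultimately have eq: "x0 = mv alg U l" using xc' LIMSEQ_unique by simp
  have "0 \<le> l $ j" for j
    using tendsto_vec_nth[OF l, of j] c'0 by (intro LIMSEQ_le_const) auto
  then show ?thesis using eq by (auto simp: col_span_def nonneg_vec_def)
qed

lemma col_span_closed:
  fixes M :: "real^'n^'n::finite"
  assumes "nonneg_mat M" "x \<longlonglongrightarrow> x0" "\<And>k. x k \<in> col_span alg M"
  shows "x0 \<in> col_span alg M"
proof -
  have "\<forall>k. \<exists>c. nonneg_vec c \<and> x k = mv alg M c" using assms(3) by (auto simp: col_span_def)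
  then obtain c where "\<And>k. nonneg_vec (c k)" "\<And>k. x k = mv alg M (c k)" by metis
  then show ?thesis using assms(1,2) by (intro col_span_limit[of "\<lambda>k. M" M x]) auto
qed

lemma column_nth: "column j A $ i = A $ i $ j"
  by (simp add: column_def)

lemma column_mm: "column j (mm alg A B) = mv alg A (column j B)"
  by (simp add: vec_eq_iff column_nth mm_nth mv_nth)

lemma nonneg_column: "nonneg_mat A \<Longrightarrow> nonneg_vec (column j A)"
  by (simp add: nonneg_mat_def nonneg_vec_def column_nth)

lemma mv_axis_column: "nonneg_mat A \<Longrightarrow> mv alg A (axis j 1) = column j A"
  by (simp add: vec_eq_iff mv_axis column_nth)

lemma column_in_col_span: "nonneg_mat A \<Longrightarrow> column j A \<in> col_span alg A"
  unfolding col_span_def using mv_axis_column[of A alg j, symmetric]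
  by (intro CollectI exI[of _ "axis j 1"]) simp

lemma col_span_factor:
  assumes "\<And>j. column j W \<in> col_span alg M"
  obtains B where "nonneg_mat B" "W = mm alg M B"
proof -
  have "\<forall>j. \<exists>b. nonneg_vec b \<and> column j W = mv alg M b" using assms by (auto simp: col_span_def)
  then obtain b where b: "\<And>j. nonneg_vec (b j)" "\<And>j. column j W = mv alg M (b j)" by metis
  define B where "B = (\<chi> i j. b j $ i)"
  have "column j B = b j" for j by (simp add: B_def column_def vec_eq_iff)
  then have "column j W = column j (mm alg M B)" for j using b column_mm by metis
  then have "W = mm alg M B" by (simp add: vec_eq_iff column_def)
  moreover have "nonneg_mat B" using b(1) by (simp add: nonneg_mat_def nonneg_vec_def B_def)
  ultimately show ?thesis using that by blast
qed

lemma col_span_combination: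
  assumes "nonneg_mat M" "\<And>j. column j W \<in> col_span alg M" "nonneg_vec c"
  shows "mv alg W c \<in> col_span alg M"
proof -
  obtain B where B: "nonneg_mat B" "W = mm alg M B" using col_span_factor[OF assms(2)] by blast
  then show ?thesis using mv_mm[OF assms(1) B(1) assms(3)] mv_nonneg[OF B(1) assms(3)]
    by (auto simp: col_span_def)
qed

lemma col_span_mm:
  assumes "nonneg_mat A" "nonneg_mat U"
  shows "col_span alg (mm alg A U) = mv alg A ` col_span alg U"
proof -
  have "mv alg (mm alg A U) c = mv alg A (mv alg U c)" if "nonneg_vec c" for c
    using mv_mm[OF assms that] .
  then show ?thesis unfolding col_span_def image_def by (simp add: set_eq_iff) metis
qed

lemma coreE:
  assumes "x \<in> core alg A" "1 \<le> k"
  obtains y where "nonneg_vec y" "x = mv alg (mpow alg A k) y"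
proof -
  have "x \<in> col_span alg (mpow alg A k)" using assms unfolding core_def by blast
  then show ?thesis using that unfolding col_span_def by blast
qed

lemma core_combination:
  assumes "nonneg_mat A" "\<And>j. column j W \<in> core alg A" "nonneg_vec c"
  shows "mv alg W c \<in> core alg A"
  unfolding core_def
proof
  fix k :: nat assume "k \<in> {1..}"
  then have "column j W \<in> col_span alg (mpow alg A k)" for j using assms(2)[of j] unfolding core_def by blast
  then show "mv alg W c \<in> col_span alg (mpow alg A k)"
    using col_span_combination[OF mpow_nonneg] assms(1,3) by blast
qed

lemma core_nonneg: "nonneg_mat A \<Longrightarrow> x \<in> core alg A \<Longrightarrow> nonneg_vec x"
proof -
  assume "nonneg_mat A" "x \<in> core alg A"
  then obtain c where "nonneg_vec c" "x = mv alg (mpow alg A 1) c" using coreE[of x alg A 1] by blast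
  then show ?thesis using mv_nonneg[OF mpow_nonneg] \<open>nonneg_mat A\<close> by blast
qed

lemma core_mv:
  assumes A: "nonneg_mat A" and "x \<in> core alg A"
  shows "mv alg A x \<in> core alg A"
proof -
  have "mv alg A x \<in> col_span alg (mpow alg A k)" if "k \<ge> 1" for k
  proof -
    obtain y where y: "nonneg_vec y" "x = mv alg (mpow alg A k) y"
      using coreE[OF assms(2) \<open>k \<ge> 1\<close>] by blast
    have "mv alg A x = mv alg (mpow alg A k) (mv alg A y)"
      using y mv_mpow[OF A] mv_nonneg[OF A] funpow_swap1 by metis
    then show ?thesis using mv_nonneg[OF A y(1)] by (auto simp: col_span_def)
  qed
  then show ?thesis by (simp add: core_def)
qed

lemma core_vadd:
  assumes A: "nonneg_mat A" and xy: "x \<in> core alg A" "y \<in> core alg A"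
  shows "vadd alg x y \<in> core alg A"
proof -
  have "vadd alg x y \<in> col_span alg (mpow alg A k)" if k: "1 \<le> k" for k
  proof -
    obtain u where u: "nonneg_vec u" "x = mv alg (mpow alg A k) u" using coreE[OF xy(1) k] by blast
    obtain v where v: "nonneg_vec v" "y = mv alg (mpow alg A k) v" using coreE[OF xy(2) k] by blast
    have "vadd alg x y = mv alg (mpow alg A k) (vadd alg u v)" unfolding u(2) v(2) by (rule mv_vadd[OF mpow_nonneg[OF A], symmetric])
    then show ?thesis using vadd_nonneg[OF u(1) v(1)] unfolding col_span_def by blast
  qed
  then show ?thesis by (simp add: core_def)
qed

lemma core_scaleR:
  assumes "nonneg_mat A" "x \<in> core alg A" "0 \<le> a"
  shows "a *\<^sub>R x \<in> core alg A"
proof -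
  have "a *\<^sub>R x \<in> col_span alg (mpow alg A k)" if "k \<ge> 1" for k
  proof -
    obtain y where y: "nonneg_vec y" "x = mv alg (mpow alg A k) y"
      using coreE[OF assms(2) \<open>k \<ge> 1\<close>] by blast
    then have "a *\<^sub>R x = mv alg (mpow alg A k) (a *\<^sub>R y)" using assms by (simp add: mv_scaleR)
    moreover have "nonneg_vec (a *\<^sub>R y)" using y assms by (simp add: nonneg_vec_def)
    ultimately show ?thesis by (auto simp: col_span_def)
  qed
  then show ?thesis by (simp add: core_def)
qed

lemma power_zero_columns_stabilize:
  fixes A :: "real^'n^'n::finite" and alg
  assumes A: "nonneg_mat A"
  defines "Z \<equiv> \<lambda>k. {j. \<forall>i. mpow alg A k $ i $ j = 0}"
  obtains K where "\<And>k. k \<ge> K \<Longrightarrow> Z k = Z K"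
proof -
  have Zs: "Z k \<subseteq> Z (Suc k)" for k
    by (auto simp: Z_def mm_nth)
  have mono: "Z k \<subseteq> Z l" if "k \<le> l" for k l
    using lift_Suc_mono_le[of Z, OF Zs that] .
  have "card (Z k) < Suc CARD('n)" for k using card_mono[of UNIV "Z k"] by simp
  then obtain K where K: "\<And>k. card (Z k) \<le> card (Z K)"
    using ex_has_greatest_nat[of "\<lambda>_. True" 0 "\<lambda>k. card (Z k)" "Suc CARD('n)"] by blast
  have "Z k = Z K" if "k \<ge> K" for k
    using card_seteq[OF _ mono[OF that] K[of k]] by simp
  then show ?thesis using that by blast
qed

text \<open>The set of zero columns of \<open>A ^ k\<close> grows with \<open>k\<close> and becomes stationary, say from \<open>K\<close> on. If
\<open>u = A ^ K y\<close> and \<open>A u = 0\<close>, then \<open>y\<close> is supported on zero columns of \<open>A ^ (K + 1)\<close>, which are zero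
columns of \<open>A ^ K\<close>, so \<open>u = 0\<close>.\<close>

lemma core_mv_nonzero:
  fixes A :: "real^'n^'n::finite"
  assumes A: "nonneg_mat A" and u: "u \<in> core alg A" "u \<noteq> 0"
  shows "mv alg A u \<noteq> 0"
proof
  assume Au: "mv alg A u = 0"
  obtain K0 where K0: "\<And>k. k \<ge> K0 \<Longrightarrow> {j. \<forall>i. mpow alg A k $ i $ j = 0} = {j. \<forall>i. mpow alg A K0 $ i $ j = 0}"
    using power_zero_columns_stabilize[OF A, of alg] by blast
  define K where "K = Suc K0"
  have K: "{j. \<forall>i. mpow alg A (Suc K) $ i $ j = 0} = {j. \<forall>i. mpow alg A K $ i $ j = 0}"
    using K0[of "K"] K0[of "Suc K"] by (simp add: K_def)
  note P = mpow_nonneg[OF A, of alg]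
  obtain y where y: "nonneg_vec y" "u = mv alg (mpow alg A K) y"
    by (rule coreE[OF u(1), of K]) (simp add: K_def)
  obtain i where "u $ i > 0"
    using u(2) core_nonneg[OF A u(1)] by (auto simp: vec_eq_iff nonneg_vec_def order_less_le)
  then obtain j where j: "0 < mpow alg A K $ i $ j" "0 < y $ j"
    using mv_pos_iff[OF P y(1)] y(2) by blast
  then have "j \<notin> {j. \<forall>i. mpow alg A K $ i $ j = 0}" by force
  then have "j \<notin> {j. \<forall>i. mpow alg A (Suc K) $ i $ j = 0}" unfolding K .
  then obtain l where l: "mpow alg A (Suc K) $ l $ j \<noteq> 0" by blast
  then have "0 < mpow alg A (Suc K) $ l $ j" using P[of "Suc K"] by (metis nonneg_mat_def order_less_le)
  then have "0 < mv alg (mpow alg A (Suc K)) y $ l" using j mv_pos_iff[OF P y(1)] by blast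
  moreover have "mv alg (mpow alg A (Suc K)) y = mv alg A u"
    using y(2) mv_mm[OF A P y(1)] by simp
  ultimately show False using Au by simp
qed

lemma bounded_seq_mat:
  fixes M :: "nat \<Rightarrow> real^'n^'m"
  assumes "\<And>k i j. \<bar>M k $ i $ j\<bar> \<le> b"
  shows "bounded (range M)"
proof -
  have "norm (M k) \<le> (\<Sum>i\<in>(UNIV::'m set). \<Sum>j\<in>(UNIV::'n set). b)" for k
  proof -
    have "norm (M k) \<le> (\<Sum>i\<in>UNIV. norm (M k $ i))"
      unfolding norm_vec_def by (rule L2_set_le_sum) simp
    also have "\<dots> \<le> (\<Sum>i\<in>UNIV. \<Sum>j\<in>UNIV. \<bar>M k $ i $ j\<bar>)"
      by (intro sum_mono norm_le_l1_cart)
    also have "\<dots> \<le> (\<Sum>i\<in>(UNIV::'m set). \<Sum>j\<in>(UNIV::'n set). b)"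
      by (intro sum_mono assms)
    finally show ?thesis .
  qed
  then show ?thesis unfolding bounded_iff by blast
qed

text \<open>The matrix \<open>U\<close> is a limit of the powers of \<open>A\<close> with columns scaled to entry sum one. The last inclusion
says that \<open>A\<close> maps the core onto itself; it comes from the representations by \<open>A ^ (k + 1)\<close>, whose
coefficients stay bounded because \<open>A\<close> annihilates no nonzero column of \<open>U\<close>.\<close>

lemma core_finitely_generated:
  fixes A :: "real^'n^'n::finite"
  assumes A: "nonneg_mat A"
  obtains U where "nonneg_mat U" "core alg A = col_span alg U" "core alg A \<subseteq> col_span alg (mm alg A U)"
proof -
  note P = mpow_nonneg[OF A, of alg]
  have P0: "0 \<le> mpow alg A k $ i $ j" for k i j using P by (simp add: nonneg_mat_def)
  obtain K0 where K0: "\<And>k. k \<ge> K0 \<Longrightarrow> {j. \<forall>i. mpow alg A k $ i $ j = 0} = {j. \<forall>i. mpow alg A K0 $ i $ j = 0}"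
    using power_zero_columns_stabilize[OF A, of alg] by blast
  define K where "K = Suc K0"
  define Z where "Z = {j. \<forall>i. mpow alg A K $ i $ j = 0}"
  have Z: "j \<in> Z \<longleftrightarrow> (\<forall>i. mpow alg A k $ i $ j = 0)" if "k \<ge> K" for k j
    using K0[of k] K0[of K] that by (auto simp: Z_def K_def)
  define s where "s k j = (\<Sum>i\<in>UNIV. mpow alg A k $ i $ j)" for k j
  define N where "N k = (\<chi> i j. mpow alg A k $ i $ j / s k j)" for k
  have s0: "0 \<le> s k j" for k j unfolding s_def by (intro sum_nonneg P0)
  have sz: "s k j = 0 \<longleftrightarrow> (\<forall>i. mpow alg A k $ i $ j = 0)" for k j
    unfolding s_def using P0 by (subst sum_nonneg_eq_0_iff) auto
  have Ps: "mpow alg A k $ i $ j \<le> s k j" for k i j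
    unfolding s_def using P0 by (intro member_le_sum) auto
  have N0: "nonneg_mat (N k)" for k using P0 s0 by (simp add: nonneg_mat_def N_def)
  have N1: "N k $ i $ j \<le> 1" for k i j
    using Ps[of k i j] s0[of k j] P0[of k i j] by (auto simp: N_def divide_le_eq_1 order_less_le)
  have "bounded (range (\<lambda>k. N (k + K)))"
  proof (rule bounded_seq_mat)
    show "\<bar>N (k + K) $ i $ j\<bar> \<le> 1" for k i j using N0 N1 by (simp add: nonneg_mat_def)
  qed
  then obtain U r where r: "strict_mono (r :: nat \<Rightarrow> nat)" and "((\<lambda>k. N (k + K)) \<circ> r) \<longlonglongrightarrow> U"
    using bounded_imp_convergent_subsequence by blast
  define m where "m k = r k + K" for k
  have NU: "(\<lambda>k. N (m k)) \<longlonglongrightarrow> U" using \<open>_ \<longlonglongrightarrow> U\<close> by (simp add: o_def m_def)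
  have mK: "m k \<ge> K" "m k \<ge> k" "m k \<ge> 1" for k
    using seq_suble[OF r, of k] by (auto simp: m_def K_def)
  have NUl: "(\<lambda>k. N (m k) $ i $ j) \<longlonglongrightarrow> U $ i $ j" for i j
    by (intro tendsto_vec_nth NU)
  have U0: "nonneg_mat U"
    unfolding nonneg_mat_def
  proof (intro allI)
    fix i j show "0 \<le> U $ i $ j"
      using NUl[of i j] N0 by (intro LIMSEQ_le_const) (auto simp: nonneg_mat_def)
  qed
  \<comment> \<open>The columns outside \<open>Z\<close> keep the entry sum one in the limit.\<close>
  have Uz: "\<exists>i. U $ i $ j \<noteq> 0" if "j \<notin> Z" for j
  proof -
    have "(\<Sum>i\<in>UNIV. N (m k) $ i $ j) = 1" for k
    proof -
      have "s (m k) j \<noteq> 0" using that Z mK(1) sz by blast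
      then show ?thesis by (simp add: N_def sum_divide_distrib[symmetric] s_def[symmetric])
    qed
    moreover have "(\<lambda>k. \<Sum>i\<in>UNIV. N (m k) $ i $ j) \<longlonglongrightarrow> (\<Sum>i\<in>UNIV. U $ i $ j)"
      by (intro tendsto_sum NUl)
    ultimately have "(\<Sum>i\<in>UNIV. U $ i $ j) = 1" by (simp add: LIMSEQ_const_iff)
    then show ?thesis by (metis sum.neutral zero_neq_one)
  qed
  have NZ: "N (m k) $ i $ j = 0" if "j \<in> Z" for k i j
    using Z[OF mK(1), of j] that unfolding N_def by simp
  have Nc: "mv alg (mpow alg A k) y = mv alg (N k) (\<chi> j. s k j * y $ j)" for k y
  proof -
    have "mpow alg A k $ i $ j * y $ j = N k $ i $ j * (s k j * y $ j)" for i j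
      using sz[of k j] by (cases "s k j = 0") (simp_all add: N_def)
    then show ?thesis unfolding vec_eq_iff mv_nth vec_lambda_beta by presburger
  qed
  have sn: "nonneg_vec (\<chi> j. s k j * y $ j)" if "nonneg_vec y" for k y
    using that s0 by (simp add: nonneg_vec_def)
  \<comment> \<open>The columns of \<open>A ^ M\<close> lie in the span of \<open>A ^ l\<close> for all \<open>M \<ge> l\<close>, and this span is closed.\<close>
  have colU: "column j U \<in> core alg A" for j
    unfolding core_def
  proof
    fix l :: nat assume l: "l \<in> {1..}"
    have "column j (N (m (k + l))) \<in> col_span alg (mpow alg A l)" for k
    proof -
      define M where "M = m (k + l)"
      have Ml: "M = l + (M - l)" using mK(2)[of "k + l"] by (simp add: M_def)
      have e: "nonneg_vec ((1 / s M j) *\<^sub>R axis j 1)" using s0 by (simp add: nonneg_vec_def axis_def)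
      have "column j (N M) = (1 / s M j) *\<^sub>R column j (mpow alg A M)"
        by (simp add: vec_eq_iff column_nth N_def)
      also have "\<dots> = mv alg (mpow alg A M) ((1 / s M j) *\<^sub>R axis j 1)"
        using s0 by (simp add: mv_scaleR mv_axis_column P)
      also have "\<dots> = mv alg (mpow alg A l) (mv alg (mpow alg A (M - l)) ((1 / s M j) *\<^sub>R axis j 1))"
        using mv_mm[OF P P e] mpow_add[OF A] Ml by metis
      finally show ?thesis using mv_nonneg[OF P e] by (auto simp: col_span_def M_def)
    qed
    moreover have "(\<lambda>k. column j (N (m (k + l)))) \<longlonglongrightarrow> column j U"
    proof (rule vec_tendstoI)
      fix i
      show "(\<lambda>k. column j (N (m (k + l))) $ i) \<longlonglongrightarrow> column j U $ i"
        using LIMSEQ_ignore_initial_segment[OF NUl[of i j], of l] by (simp add: column_nth)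
    qed
    ultimately show "column j U \<in> col_span alg (mpow alg A l)" by (rule col_span_closed[OF P, rotated])
  qed
  have sub1: "col_span alg U \<subseteq> core alg A"
    using core_combination[OF A colU] by (auto simp: col_span_def)
  have ex: "\<exists>y. nonneg_vec y \<and> x = mv alg (mpow alg A k) y" if "x \<in> core alg A" "k \<ge> 1" for x k
    using coreE[OF that] by metis
  have sub2: "core alg A \<subseteq> col_span alg U"
  proof
    fix x assume "x \<in> core alg A"
    then have "\<forall>k. \<exists>y. nonneg_vec y \<and> x = mv alg (mpow alg A (m k)) y" using ex mK(3) by blast
    then obtain y where y: "\<And>k. nonneg_vec (y k)" "\<And>k. x = mv alg (mpow alg A (m k)) (y k)" by metis
    show "x \<in> col_span alg U"
    proof (rule col_span_limit[of "\<lambda>k. N (m k)" U "\<lambda>_. x" x "\<lambda>k. \<chi> j. s (m k) j * y k $ j"])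
      show "N (m k) $ i $ j = 0" if "\<forall>i. U $ i $ j = 0" for j k i using Uz NZ that by blast
    qed (use N0 NU sn y Nc in auto)
  qed
  have sub3: "core alg A \<subseteq> col_span alg (mm alg A U)"
  proof
    fix x assume "x \<in> core alg A"
    moreover have "Suc (m k) \<ge> 1" for k by simp
    ultimately have "\<forall>k. \<exists>y. nonneg_vec y \<and> x = mv alg (mpow alg A (Suc (m k))) y" using ex by blast
    then obtain y where y: "\<And>k. nonneg_vec (y k)" "\<And>k. x = mv alg (mpow alg A (Suc (m k))) (y k)" by metis
    have AN: "(\<lambda>k. mm alg A (N (m k))) \<longlonglongrightarrow> mm alg A U"
    proof (intro vec_tendstoI)
      fix i j show "(\<lambda>k. mm alg A (N (m k)) $ i $ j) \<longlonglongrightarrow> mm alg A U $ i $ j"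
        unfolding mm_nth by (intro tendsto_ssum tendsto_mult tendsto_const NUl)
    qed
    show "x \<in> col_span alg (mm alg A U)"
    proof (rule col_span_limit[of "\<lambda>k. mm alg A (N (m k))" "mm alg A U" "\<lambda>_. x" x "\<lambda>k. \<chi> j. s (m k) j * y k $ j"])
      show "mm alg A (N (m k)) $ i $ j = 0" if "\<forall>i. mm alg A U $ i $ j = 0" for j k i
      proof -
        have "mv alg A (column j U) = 0" using that by (simp add: column_mm[symmetric] vec_eq_iff column_nth)
        then have "column j U = 0" using core_mv_nonzero[OF A colU] by blast
        then have "j \<in> Z" using Uz by (auto simp: vec_eq_iff column_nth)
        then show ?thesis using NZ by (simp add: mm_nth)
      qed
      show "x = mv alg (mm alg A (N (m k))) (\<chi> j. s (m k) j * y k $ j)" for k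
        using y(2)[of k] mv_mm[OF A P y(1)] mv_mm[OF A N0 sn[OF y(1)]] Nc by simp
    qed (auto intro: mm_nonneg A N0 AN sn y)
  qed
  show ?thesis using that[OF U0] sub1 sub2 sub3 by blast
qed

section \<open>Permutation of the generators\<close>

definition drop_column :: "'n \<Rightarrow> real^'n^'n \<Rightarrow> real^'n^'n" where
  "drop_column j U = (\<chi> i k. if k = j then 0 else U $ i $ k)"

lemma mv_drop_column:
  assumes "nonneg_mat U" "nonneg_vec e"
  shows "mv alg U e = vadd alg ((e $ j) *\<^sub>R column j U) (mv alg (drop_column j U) e)"
proof (cases alg)
  case Nonneg
  have "(\<Sum>k\<in>UNIV. U $ i $ k * e $ k) = e $ j * U $ i $ j + (\<Sum>k\<in>UNIV. drop_column j U $ i $ k * e $ k)" for i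
  proof -
    have "(\<Sum>k\<in>UNIV. drop_column j U $ i $ k * e $ k) = (\<Sum>k\<in>UNIV-{j}. U $ i $ k * e $ k)"
      by (rule sum.mono_neutral_cong_right) (auto simp: drop_column_def)
    then show ?thesis using sum.remove[of UNIV j "\<lambda>k. U $ i $ k * e $ k"] by (simp add: mult.commute)
  qed
  then show ?thesis using Nonneg by (simp add: vec_eq_iff matrix_vector_mult_def column_nth)
next
  case MaxAlg
  have "ssum MaxAlg (\<lambda>k. U $ i $ k * e $ k)
      = max (e $ j * U $ i $ j) (ssum MaxAlg (\<lambda>k. drop_column j U $ i $ k * e $ k))" (is "?l = max ?a ?b") for i
  proof (rule antisym)
    have "U $ i $ k * e $ k \<le> max ?a ?b" for k
    proof (cases "k = j")
      case False
      then have "U $ i $ k * e $ k = drop_column j U $ i $ k * e $ k" by (simp add: drop_column_def)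
      also have "\<dots> \<le> ?b" by (rule ssum_Max_ge)
      finally show ?thesis by linarith
    qed (simp add: mult.commute)
    then show "?l \<le> max ?a ?b" unfolding ssum_Max_le_iff by blast
  next
    have "?a \<le> ?l" using ssum_Max_ge[of "\<lambda>k. U $ i $ k * e $ k" j] by (simp add: mult.commute)
    moreover have "?b \<le> ?l"
      using assms by (intro ssum_mono mult_right_mono) (auto simp: drop_column_def nonneg_mat_def nonneg_vec_def)
    ultimately show "max ?a ?b \<le> ?l" by simp
  qed
  then show ?thesis using MaxAlg by (simp add: vec_eq_iff mv_nth vadd_nth column_nth del: mv.simps vadd.simps)
qed

lemma nonneg_drop_column: "nonneg_mat U \<Longrightarrow> nonneg_mat (drop_column j U)"
  by (simp add: nonneg_mat_def drop_column_def)

text \<open>Zero columns are disregarded: the nonzero columns form a generating set of any size up to the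
dimension.\<close>

definition irredundant :: "algebra \<Rightarrow> real^'n^'n::finite \<Rightarrow> bool" where
  "irredundant alg U \<longleftrightarrow> (\<forall>j. column j U \<noteq> 0 \<longrightarrow> column j U \<notin> col_span alg (drop_column j U))"

text \<open>A term \<open>e j * u\<close> of \<open>u\<close> with \<open>e j < 1\<close> could be removed: in nonnegative algebra by solving for \<open>u\<close>, in
max algebra because it never attains the maximum.\<close>

lemma irredundant_coefficient_ge_1:
  assumes U: "nonneg_mat U" "irredundant alg U" and e: "nonneg_vec e"
    and u: "column j U \<noteq> 0" "column j U = mv alg U e"
  shows "1 \<le> e $ j"
proof (rule ccontr)
  assume "\<not> 1 \<le> e $ j"
  then have ej: "e $ j < 1" by simp
  let ?u = "column j U" and ?v = "mv alg (drop_column j U) e"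
  have eq: "?u = vadd alg ((e $ j) *\<^sub>R ?u) ?v"
    by (rule trans[OF u(2) mv_drop_column[OF U(1) e]])
  have v: "nonneg_vec ?v" by (intro mv_nonneg nonneg_drop_column U e)
  have "\<exists>a\<ge>0. ?u = a *\<^sub>R ?v"
  proof (cases alg)
    case Nonneg
    have "?u = (e $ j) *\<^sub>R ?u + ?v" using eq Nonneg by (simp del: mv.simps)
    then have "(1 - e $ j) *\<^sub>R ?u = ?v" unfolding scaleR_left_diff_distrib by (metis add_diff_cancel_left' scaleR_one)
    then have "?u = (1 / (1 - e $ j)) *\<^sub>R ?v" using ej 
      unfolding \<open>_ = ?v\<close>[symmetric] by simp
    then show ?thesis using ej by (intro exI[of _ "1 / (1 - e $ j)"]) auto
  next
    case MaxAlg
    have "?u $ i = ?v $ i" for i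
    proof -
      have "?u $ i = max (e $ j * ?u $ i) (?v $ i)"
        using arg_cong[OF eq, of "\<lambda>x. x $ i"] MaxAlg by (simp add: vadd_nth del: mv.simps)
      moreover have "0 \<le> ?u $ i" using U by (simp add: nonneg_mat_def column_nth)
      moreover have "e $ j * ?u $ i < ?u $ i" if "0 < ?u $ i" using that ej by simp
      moreover have "0 \<le> ?v $ i" using v by (simp add: nonneg_vec_def)
      ultimately show ?thesis by (smt (verit, best))
    qed
    then show ?thesis by (intro exI[of _ 1]) (simp add: vec_eq_iff)
  qed
  then obtain a where a: "a \<ge> 0" "?u = a *\<^sub>R ?v" by blast
  then have "?u = mv alg (drop_column j U) (a *\<^sub>R e)" by (simp add: mv_scaleR)
  moreover have "nonneg_vec (a *\<^sub>R e)" using a e by (simp add: nonneg_vec_def)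
  ultimately have "?u \<in> col_span alg (drop_column j U)" unfolding col_span_def by blast
  then show False using U(2) u(1) by (simp add: irredundant_def)
qed

text \<open>Irredundant columns are extremal, stated here for combinations of many vectors. Expand the columns of
\<open>W\<close> in those of \<open>U\<close>; the total coefficient of column \<open>j\<close> is then at least one. In max algebra a single
summand already reaches column \<open>j\<close>. In nonnegative algebra the other columns receive the coefficient
zero, so that each summand that contributes is a multiple of column \<open>j\<close>.\<close>

lemma irredundant_column_is_ray:
  fixes U W :: "real^'n^'n::finite"
  assumes U: "nonneg_mat U" "irredundant alg U" and c: "nonneg_vec c"
    and W: "\<And>i. column i W \<in> col_span alg U"
    and u: "column j U \<noteq> 0" "column j U = mv alg W c"
  shows "\<exists>i a. 0 < a \<and> column i W = a *\<^sub>R column j U"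
proof -
  obtain B where B: "nonneg_mat B" "W = mm alg U B" using col_span_factor[OF W] by blast
  define e where "e = mv alg B c"
  have e: "nonneg_vec e" unfolding e_def by (intro mv_nonneg B c)
  have ue: "column j U = mv alg U e" unfolding u(2) B(2) e_def by (rule mv_mm[OF U(1) B(1) c])
  note ej = irredundant_coefficient_ge_1[OF U e u(1) ue]
  have U0: "0 \<le> U $ l $ k" and B0: "0 \<le> B $ l $ k" and c0: "0 \<le> c $ k" for l k
    using U B c by (auto simp: nonneg_mat_def nonneg_vec_def)
  show ?thesis
  proof (cases alg)
    case MaxAlg
    obtain i where "B $ j $ i * c $ i = ssum MaxAlg (\<lambda>i. B $ j $ i * c $ i)"
      by (rule exE[OF ssum_attained[of "\<lambda>i. B $ j $ i * c $ i"]])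
    then have i: "1 \<le> B $ j $ i * c $ i" using ej MaxAlg by (simp add: e_def mv_nth del: mv.simps)
    then have ci: "0 < c $ i" using c0[of i] by (cases "c $ i = 0") auto
    have "c $ i * W $ l $ i = U $ l $ j" for l
    proof (rule antisym)
      show "c $ i * W $ l $ i \<le> U $ l $ j"
        using mv_ge_term[OF mm_nonneg[OF U(1) B(1)] c, of alg l i alg] u(2) B(2)
        by (simp add: column_def vec_eq_iff mult.commute)
      have "U $ l $ j * 1 \<le> U $ l $ j * (B $ j $ i * c $ i)" using i U0 by (intro mult_left_mono) auto
      also have "\<dots> = c $ i * (U $ l $ j * B $ j $ i)" by simp
      also have "\<dots> \<le> c $ i * W $ l $ i"
        unfolding B(2) mm_nth using U0 B0 by (intro mult_left_mono ssum_ge c0) simp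
      finally show "U $ l $ j \<le> c $ i * W $ l $ i" by simp
    qed
    then have "W $ l $ i = (1 / c $ i) * U $ l $ j" for l using ci by (simp add: field_simps)
    then have "column i W = (1 / c $ i) *\<^sub>R column j U" by (simp add: vec_eq_iff column_nth)
    then show ?thesis using ci by (intro exI[of _ i] exI[of _ "1 / c $ i"]) simp
  next
    case Nonneg
    have sum: "U $ l $ j = e $ j * U $ l $ j + (\<Sum>k\<in>UNIV-{j}. U $ l $ k * e $ k)" for l
    proof -
      have "U $ l $ j = (\<Sum>k\<in>UNIV. U $ l $ k * e $ k)"
        using arg_cong[OF ue, of "\<lambda>x. x $ l"] Nonneg by (simp add: matrix_vector_mult_def column_nth)
      then show ?thesis using sum.remove[of UNIV j "\<lambda>k. U $ l $ k * e $ k"] by (simp add: mult.commute)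
    qed
    have e0: "0 \<le> e $ k" for k using e by (simp add: nonneg_vec_def)
    have sum0: "(\<Sum>k\<in>UNIV-{j}. U $ l $ k * e $ k) = 0" for l
    proof -
      have "0 \<le> (\<Sum>k\<in>UNIV-{j}. U $ l $ k * e $ k)" using U0 e0 by (intro sum_nonneg) auto
      moreover have "1 * U $ l $ j \<le> e $ j * U $ l $ j" using ej U0 by (intro mult_right_mono) auto
      ultimately show ?thesis using sum[of l] by linarith
    qed
    have Ue: "U $ l $ k * e $ k = 0" if "k \<noteq> j" for l k
      using sum0[of l] U0 e0 that by (subst (asm) sum_nonneg_eq_0_iff) auto
    obtain i where i: "0 < B $ j $ i" "0 < c $ i"
    proof -
      have "0 < mv alg B c $ j" using ej by (simp add: e_def)
      then show ?thesis using mv_pos_iff[OF B(1) c] that by blast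
    qed
    have "U $ l $ k * B $ k $ i = 0" if "k \<noteq> j" for l k
    proof -
      have "B $ k $ i * c $ i \<le> e $ k" unfolding e_def by (rule mv_ge_term[OF B(1) c])
      then have "U $ l $ k * (B $ k $ i * c $ i) \<le> U $ l $ k * e $ k" using U0 by (intro mult_left_mono) auto
      moreover have "0 \<le> U $ l $ k * (B $ k $ i * c $ i)" using U0 B0 c0 by simp
      ultimately have "U $ l $ k * (B $ k $ i * c $ i) = 0" using Ue[OF that, of l] by linarith
      then show ?thesis using i by simp
    qed
    then have "(\<Sum>k\<in>UNIV. U $ l $ k * B $ k $ i) = (\<Sum>k\<in>{j}. U $ l $ k * B $ k $ i)" for l
      by (intro sum.mono_neutral_right) auto
    then have "column i W = B $ j $ i *\<^sub>R column j U"
      using B(2) Nonneg by (simp add: vec_eq_iff column_nth matrix_matrix_mult_def mult.commute)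
    then show ?thesis using i by blast
  qed
qed

text \<open>A generating matrix with the least number of nonzero columns is irredundant.\<close>

lemma core_irredundant_generators:
  fixes A :: "real^'n^'n::finite"
  assumes A: "nonneg_mat A"
  obtains U where "nonneg_mat U" "core alg A = col_span alg U"
    "core alg A \<subseteq> col_span alg (mm alg A U)" "irredundant alg U"
proof -
  define P where "P U \<longleftrightarrow> nonneg_mat U \<and> core alg A = col_span alg U" for U
  define N where "N U = card {j. column j U \<noteq> 0}" for U :: "real^'n^'n"
  obtain U0 where U0: "nonneg_mat U0" "core alg A = col_span alg U0" "core alg A \<subseteq> col_span alg (mm alg A U0)"
    using core_finitely_generated[OF A] by blast
  then have "P U0" by (simp add: P_def)
  then obtain U where U: "P U" "\<And>V. P V \<Longrightarrow> N U \<le> N V"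
    using ex_has_least_nat[of P U0 N] by blast
  have nU: "nonneg_mat U" and cU: "core alg A = col_span alg U" using U(1) by (auto simp: P_def)
  have "core alg A \<subseteq> col_span alg (mm alg A U)"
    using U0(2,3) cU col_span_mm[OF A U0(1)] col_span_mm[OF A nU] by metis
  moreover have "irredundant alg U"
    unfolding irredundant_def
  proof (intro allI impI notI)
    fix j assume j: "column j U \<noteq> 0" "column j U \<in> col_span alg (drop_column j U)"
    let ?V = "drop_column j U"
    have nV: "nonneg_mat ?V" using nU by (rule nonneg_drop_column)
    have colV: "column k ?V = (if k = j then 0 else column k U)" for k
      by (simp add: vec_eq_iff column_nth drop_column_def)
    have "column k U \<in> col_span alg ?V" for k
      using column_in_col_span[OF nV, of k alg] colV[of k] j(2) by (cases "k = j") auto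
    then have "col_span alg U \<subseteq> col_span alg ?V"
      using col_span_combination[OF nV] unfolding col_span_def[of alg U] by blast
    moreover have "column k ?V \<in> col_span alg U" for k
    proof (cases "k = j")
      case True
      have "column k ?V = mv alg U 0" using colV[of k] True by simp
      then show ?thesis using nonneg_zero unfolding col_span_def by blast
    qed (use column_in_col_span[OF nU] colV in simp)
    then have "col_span alg ?V \<subseteq> col_span alg U"
      using col_span_combination[OF nU] unfolding col_span_def[of alg ?V] by blast
    ultimately have "P ?V" using nV cU by (simp add: P_def)
    then have "N U \<le> N ?V" by (rule U(2))
    moreover have "N ?V < N U" unfolding N_def
      by (rule psubset_card_mono) (use j(1) colV in auto)
    ultimately show False by simp
  qed
  ultimately show ?thesis using that nU cU by blast
qed

text \<open>Each nonzero column is a multiple of the image of some nonzero column. This assignment is injective,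
since distinct irredundant columns are not proportional, so an iterate of it returns to the column.\<close>

lemma core_generators_permuted:
  fixes A U :: "real^'n^'n::finite"
  assumes A: "nonneg_mat A" and U: "nonneg_mat U" "irredundant alg U" "core alg A = col_span alg U"
    "core alg A \<subseteq> col_span alg (mm alg A U)" and j: "column j U \<noteq> 0"
  shows "\<exists>p\<ge>1. \<exists>b>0. mv alg (mpow alg A p) (column j U) = b *\<^sub>R column j U"
proof -
  let ?u = "\<lambda>j. column j U"
  define J where "J = {j. ?u j \<noteq> 0}"
  have "\<exists>i a. 0 < a \<and> mv alg A (?u i) = a *\<^sub>R ?u j" if "j \<in> J" for j
  proof -
    have uj: "?u j \<in> core alg A" using column_in_col_span[OF U(1)] U(3) by blast
    then obtain c where c: "nonneg_vec c" "?u j = mv alg (mm alg A U) c"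
      using U(4) by (auto simp: col_span_def)
    have "column i (mm alg A U) \<in> col_span alg U" for i
      using core_mv[OF A] column_in_col_span[OF U(1)] U(3) unfolding column_mm by blast
    from irredundant_column_is_ray[OF U(1,2) c(1) this _ c(2)] that
    show ?thesis by (auto simp: J_def column_mm)
  qed
  then obtain q a where qa: "\<And>j. j \<in> J \<Longrightarrow> 0 < a j \<and> mv alg A (?u (q j)) = a j *\<^sub>R ?u j" by metis
  have qJ: "q j \<in> J" if "j \<in> J" for j
  proof (rule ccontr)
    assume "q j \<notin> J"
    then have "?u (q j) = 0" by (simp add: J_def)
    then have "a j *\<^sub>R ?u j = 0" using qa[OF that] by (metis mv_zero)
    then show False using qa[OF that] that by (auto simp: J_def)
  qed
  \<comment> \<open>Extending \<open>q\<close> by the identity yields an injection of the finite index type.\<close>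
  define p where "p j = (if j \<in> J then q j else j)" for j
  have inj_q: "j = k" if "j \<in> J" "k \<in> J" "q j = q k" for j k
  proof (rule ccontr)
    assume "j \<noteq> k"
    have "a j *\<^sub>R ?u j = a k *\<^sub>R ?u k" using qa that by metis
    then have "(1 / a j) *\<^sub>R (a j *\<^sub>R ?u j) = (1 / a j) *\<^sub>R (a k *\<^sub>R ?u k)" by simp
    then have "?u j = (a k / a j) *\<^sub>R ?u k" using qa[OF that(1)] by simp
    moreover have "?u k = column k (drop_column j U)" using \<open>j \<noteq> k\<close>
      by (simp add: vec_eq_iff column_nth drop_column_def)
    moreover have "\<dots> = mv alg (drop_column j U) (axis k 1)"
      using mv_axis_column[OF nonneg_drop_column[OF U(1)]] by metis
    ultimately have "?u j = mv alg (drop_column j U) ((a k / a j) *\<^sub>R axis k 1)"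
      using qa[OF that(1)] qa[OF that(2)] by (simp add: mv_scaleR)
    moreover have "nonneg_vec ((a k / a j) *\<^sub>R axis k 1)"
      using qa[OF that(1)] qa[OF that(2)] by (simp add: nonneg_vec_def axis_def)
    ultimately have "?u j \<in> col_span alg (drop_column j U)" unfolding col_span_def by blast
    then show False using U(2) that(1) by (auto simp: irredundant_def J_def)
  qed
  have "inj p" by (rule injI) (use inj_q qJ in \<open>auto simp: p_def split: if_splits\<close>)
  then obtain n where n: "n > 0" "(p ^^ n) j = j" using funpow_inj_finite[of p j] by auto
  have jJ: "j \<in> J" using j by (simp add: J_def)
  have pJ: "(p ^^ n) j \<in> J" for n by (induction n) (simp_all add: jJ p_def qJ)
  have "\<exists>b>0. (mv alg A ^^ n) (?u ((p ^^ n) j)) = b *\<^sub>R ?u j" for n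
  proof (induction n)
    case 0 then show ?case by (intro exI[of _ 1]) simp
  next
    case (Suc n)
    then obtain b where b: "b > 0" "(mv alg A ^^ n) (?u ((p ^^ n) j)) = b *\<^sub>R ?u j" by blast
    let ?i = "(p ^^ n) j"
    have "mv alg A (?u (p ?i)) = a ?i *\<^sub>R ?u ?i" "0 < a ?i" using qa[OF pJ[of n]] pJ[of n] by (auto simp: p_def)
    moreover have "(mv alg A ^^ n) (c *\<^sub>R x) = c *\<^sub>R (mv alg A ^^ n) x" if "0 \<le> c" for c x
      using that by (induction n) (simp_all add: mv_scaleR)
    ultimately have "(mv alg A ^^ Suc n) (?u ((p ^^ Suc n) j)) = (a ?i * b) *\<^sub>R ?u j"
      using b(2) by (simp add: funpow_swap1)
    then show ?case using b(1) \<open>0 < a ?i\<close> by (intro exI[of _ "a ?i * b"]) auto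
  qed
  from this[of n] show ?thesis using n mv_mpow[OF A nonneg_column[OF U(1)]] by (intro exI[of _ n]) auto
qed

theorem core_generated_by_periodic_vectors:
  fixes A :: "real^'n^'n::finite"
  assumes A: "nonneg_mat A"
  obtains U where "nonneg_mat U" "core alg A = col_span alg U"
    "\<And>j. column j U \<noteq> 0 \<Longrightarrow> \<exists>p\<ge>1. \<exists>\<rho>>0. mv alg (mpow alg A p) (column j U) = \<rho> ^ p *\<^sub>R column j U"
proof -
  obtain U where U: "nonneg_mat U" "core alg A = col_span alg U"
    "core alg A \<subseteq> col_span alg (mm alg A U)" "irredundant alg U"
    using core_irredundant_generators[OF A] by blast
  have "\<exists>p\<ge>1. \<exists>\<rho>>0. mv alg (mpow alg A p) (column j U) = \<rho> ^ p *\<^sub>R column j U" if j: "column j U \<noteq> 0" for j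
  proof -
    obtain p b where p: "p \<ge> 1" "b > 0" "mv alg (mpow alg A p) (column j U) = b *\<^sub>R column j U"
      using core_generators_permuted[OF A U(1,4,2,3) j] by blast
    have "root p b > 0" "root p b ^ p = b" using p by auto
    then show ?thesis using p by metis
  qed
  then show ?thesis using that U by blast
qed

lemma periodic_mult:
  assumes A: "nonneg_mat A" and z: "nonneg_vec z" "mv alg (mpow alg A p) z = \<rho> ^ p *\<^sub>R z" "\<rho> > 0"
  shows "mv alg (mpow alg A (p * k)) z = \<rho> ^ (p * k) *\<^sub>R z"
proof (induction k)
  case 0
  show ?case using mv_mat1[OF z(1)] by simp
next
  case (Suc k)
  have "mv alg (mpow alg A (p * Suc k)) z = mv alg (mpow alg A p) (mv alg (mpow alg A (p * k)) z)"
    using mv_mm[OF mpow_nonneg[OF A] mpow_nonneg[OF A] z(1)] mpow_add[OF A, of alg p "p * k"] by simp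
  then show ?case using Suc z by (simp add: mv_scaleR power_add mult.commute)
qed

lemma vadd_commute: "vadd alg x y = vadd alg y x"
  by (cases alg) (auto simp: vec_eq_iff add.commute max.commute)

lemma vadd_assoc: "vadd alg (vadd alg x y) z = vadd alg x (vadd alg y z)"
  by (cases alg) (auto simp: vec_eq_iff add.assoc max.assoc)

text \<open>The vector \<open>w\<close> is the sum of \<open>z\<close>, \<open>A z / \<rho>\<close>, ..., \<open>A ^ (p - 1) z / \<rho> ^ (p - 1)\<close> in the algebra;
multiplication by \<open>A / \<rho>\<close> permutes these terms cyclically.\<close>

lemma eigenvector_above_periodic:
  assumes A: "nonneg_mat A" and z: "nonneg_vec z" "mv alg (mpow alg A p) z = \<rho> ^ p *\<^sub>R z"
    and p: "p \<ge> 1" and \<rho>: "\<rho> > 0"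
  obtains w where "nonneg_vec w" "\<And>i. z $ i \<le> w $ i" "mv alg A w = \<rho> *\<^sub>R w"
proof -
  define T where "T = mv alg ((1 / \<rho>) *\<^sub>R A)"
  have TA: "T x = (1 / \<rho>) *\<^sub>R mv alg A x" for x using \<rho> by (simp add: T_def mv_scaleR_mat)
  have A': "nonneg_mat ((1 / \<rho>) *\<^sub>R A)" using A \<rho> by (simp add: nonneg_mat_def)
  have Tn: "nonneg_vec (T x)" if "nonneg_vec x" for x unfolding T_def by (rule mv_nonneg[OF A' that])
  have Tv: "T (vadd alg x y) = vadd alg (T x) (T y)" for x y unfolding T_def by (rule mv_vadd[OF A'])
  have Tm: "T x $ i \<le> T y $ i" if "\<And>i. x $ i \<le> y $ i" for x y i unfolding T_def using mv_mono[OF A' that] .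
  have Tk: "(T ^^ k) x = (1 / \<rho> ^ k) *\<^sub>R (mv alg A ^^ k) x" for k x
    by (induction k) (use \<rho> in \<open>simp_all add: TA mv_scaleR\<close>)
  have Tp: "(T ^^ p) z = z" using z(2) mv_mpow[OF A z(1)] \<rho> by (simp add: Tk)
  have Tz: "nonneg_vec ((T ^^ k) z)" for k by (induction k) (simp_all add: z Tn)
  \<comment> \<open>The partial sums of \<open>z\<close>, \<open>T z\<close>, \<open>T (T z)\<close>, ...; the one with \<open>p\<close> terms is the eigenvector.\<close>
  define w where "w m = rec_nat z (\<lambda>k x. vadd alg x ((T ^^ Suc k) z)) m" for m
  have w0: "w 0 = z" and wS: "w (Suc m) = vadd alg (w m) ((T ^^ Suc m) z)" for m
    by (simp_all add: w_def)
  have wn: "nonneg_vec (w m)" for m by (induction m) (auto simp: w0 wS z Tz intro!: vadd_nonneg Tn)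
  have wz: "z $ i \<le> w m $ i" for m i
  proof (induction m)
    case (Suc m)
    then show ?case using vadd_ge[OF wn[of m] Tz[of "Suc m"], where alg=alg and i=i] unfolding wS by linarith
  qed (simp add: w0)
  have wT: "vadd alg z (T (w m)) = w (Suc m)" for m
  proof (induction m)
    case (Suc m)
    have "vadd alg z (T (w (Suc m))) = vadd alg (vadd alg z (T (w m))) (T ((T ^^ Suc m) z))"
      unfolding wS[of m] Tv vadd_assoc ..
    also have "\<dots> = w (Suc (Suc m))" unfolding Suc wS[of "Suc m"] by simp
    finally show ?case .
  qed (simp add: w0 wS)
  obtain m where m: "p = Suc m" using p by (cases p) auto
  have "vadd alg z (T (w m)) = vadd alg (w m) z" using wT[of m] Tp unfolding wS m by simp
  then have eq: "vadd alg z (T (w m)) = vadd alg z (w m)" by (simp add: vadd_commute)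
  have "z $ i \<le> T (w m) $ i" for i
  proof -
    have "(T ^^ m) z $ i \<le> w m $ i" for i
    proof (cases m)
      case (Suc k)
      then show ?thesis using vadd_ge[OF wn[of k] Tz[of "Suc k"], where alg=alg and i=i] unfolding Suc wS by blast
    qed (simp add: w0)
    then have "T ((T ^^ m) z) $ i \<le> T (w m) $ i" by (rule Tm)
    then show ?thesis using Tp m by simp
  qed
  then have z_T: "max (z $ i) (T (w m) $ i) = T (w m) $ i" for i by (simp add: max_absorb2)
  have "T (w m) = w m"
  proof (cases alg)
    case Nonneg
    then show ?thesis using eq by simp
  next
    case MaxAlg
    have "max (z $ i) (T (w m) $ i) = max (z $ i) (w m $ i)" for i
      using arg_cong[OF eq, of "\<lambda>x. x $ i"] MaxAlg by simp
    then show ?thesis using z_T wz[of _ m] by (simp add: vec_eq_iff max_absorb2)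
  qed
  then have "mv alg A (w m) = \<rho> *\<^sub>R w m" using \<rho> unfolding TA
    by (metis divide_self_if less_irrefl scaleR_one scaleR_scaleR times_divide_eq_right mult.right_neutral)
  then show ?thesis using that[OF wn wz] by blast
qed

section \<open>Perron vectors\<close>

lemma max_ratio_attained:
  fixes x y :: "real^'n::finite"
  assumes x: "nonneg_vec x" and y: "nonneg_vec y" "y \<noteq> 0" and supp: "\<And>i. 0 < y $ i \<Longrightarrow> 0 < x $ i"
  obtains t i where "0 < t" "0 < y $ i" "y $ i = t * x $ i" "\<And>j. y $ j \<le> t * x $ j"
proof -
  let ?S = "{i. 0 < y $ i}"
  have ne: "?S \<noteq> {}" using y by (auto simp: vec_eq_iff nonneg_vec_def order_less_le)
  define t where "t = Max ((\<lambda>i. y $ i / x $ i) ` ?S)"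
  have "t \<in> (\<lambda>i. y $ i / x $ i) ` ?S" unfolding t_def by (rule Max_in) (use ne in auto)
  then obtain i where i: "0 < y $ i" "t = y $ i / x $ i" by auto
  have t: "0 < t" using i supp[of i] by simp
  have "y $ j \<le> t * x $ j" for j
  proof (cases "0 < y $ j")
    case True
    then have "y $ j / x $ j \<le> t" unfolding t_def by (intro Max_ge) auto
    then show ?thesis using supp[OF True] by (simp add: field_simps)
  next
    case False
    then have "y $ j = 0" using y by (simp add: nonneg_vec_def order_less_le)
    then show ?thesis using t x by (simp add: nonneg_vec_def)
  qed
  moreover have "y $ i = t * x $ i" unfolding i(2) using supp[OF i(1)] by simp
  ultimately show ?thesis using that[OF t i(1)] by blast
qed

text \<open>Scale \<open>x\<close> until it touches \<open>y\<close> from above and compare both inequalities at a point of contact.\<close>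

lemma subeigenvalue_le:
  fixes M :: "real^'n^'n::finite"
  assumes M: "nonneg_mat M" and x: "nonneg_vec x" and y: "nonneg_vec y" "y \<noteq> 0"
    and supp: "\<And>i. 0 < y $ i \<Longrightarrow> 0 < x $ i"
    and sup: "\<And>i. 0 < y $ i \<Longrightarrow> mv alg M x $ i \<le> l * x $ i"
    and sub: "\<And>i. 0 < y $ i \<Longrightarrow> th * y $ i \<le> mv alg M y $ i"
  shows "th \<le> l"
proof -
  obtain t i where t: "0 < t" "0 < y $ i" "y $ i = t * x $ i" "\<And>j. y $ j \<le> t * x $ j"
    using max_ratio_attained[OF x y supp] by blast
  have "th * y $ i \<le> mv alg M y $ i" by (rule sub[OF t(2)])
  also have "\<dots> \<le> mv alg M (t *\<^sub>R x) $ i" using t(4) by (intro mv_mono[OF M]) simp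
  also have "\<dots> = t * mv alg M x $ i" using t(1) by (simp add: mv_scaleR)
  also have "\<dots> \<le> t * (l * x $ i)" using sup[OF t(2)] t(1) by (intro mult_left_mono) auto
  also have "\<dots> = l * y $ i" using t(3) by simp
  finally show ?thesis using t(2) by simp
qed

definition std_simplex :: "(real^'n::finite) set" where
  "std_simplex = {x. nonneg_vec x \<and> (\<Sum>i\<in>UNIV. x $ i) = 1}"

lemma simplex_compact: "compact (std_simplex :: (real^'n::finite) set)"
proof -
  have "bounded (std_simplex :: (real^'n) set)"
  proof -
    have "norm x \<le> 1" if "x \<in> std_simplex" for x :: "real^'n"
      using norm_le_l1_cart[of x] that by (simp add: std_simplex_def nonneg_vec_def)
    then show ?thesis unfolding bounded_iff by blast
  qed
  moreover have "closed (std_simplex :: (real^'n) set)"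
  proof -
    have eq: "(std_simplex :: (real^'n) set) = (\<Inter>i. {x. 0 \<le> x $ i}) \<inter> {x. (\<Sum>i\<in>UNIV. x $ i) = 1}"
      by (auto simp: std_simplex_def nonneg_vec_def)
    show ?thesis unfolding eq
      by (intro closed_Int closed_INT ballI closed_Collect_le closed_Collect_eq continuous_intros)
  qed
  ultimately show ?thesis by (simp add: compact_eq_bounded_closed)
qed

lemma simplex_convex: "convex std_simplex"
  unfolding convex_def
  by (auto simp: std_simplex_def nonneg_vec_def sum.distrib sum_distrib_left[symmetric])

lemma simplex_nonempty: "axis i 1 \<in> std_simplex"
proof -
  have "(\<Sum>j\<in>UNIV. axis i (1::real) $ j) = (\<Sum>j\<in>UNIV. if j = i then 1 else 0)"
    by (intro sum.cong) (auto simp: axis_def)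
  then show ?thesis by (simp add: std_simplex_def)
qed

lemma simplex_nonzero: "x \<in> std_simplex \<Longrightarrow> \<exists>i. 0 < x $ i"
proof (rule ccontr)
  assume x: "x \<in> std_simplex" "\<nexists>i. 0 < x $ i"
  then have "x $ i = 0" for i by (force simp: std_simplex_def nonneg_vec_def order_less_le)
  then show False using x(1) by (simp add: std_simplex_def)
qed

text \<open>Brouwer's fixed point theorem for \<open>M\<close> acting on the simplex with renormalization. Only continuity and
positivity enter, so that both algebras are covered.\<close>

lemma positive_matrix_eigenvector:
  fixes M :: "real^'n^'n::finite"
  assumes M: "\<And>i j. 0 < M $ i $ j"
  obtains x where "x \<in> std_simplex" "\<And>i. 0 < x $ i" "mv alg M x = (\<Sum>i\<in>UNIV. mv alg M x $ i) *\<^sub>R x"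
proof -
  define s where "s x = (\<Sum>i\<in>UNIV. mv alg M x $ i)" for x
  have M0: "nonneg_mat M" using M by (simp add: nonneg_mat_def less_imp_le)
  have pos: "0 < mv alg M x $ i" if "x \<in> std_simplex" for x i
    using mv_pos_iff[OF M0] simplex_nonzero[OF that] M that unfolding std_simplex_def by blast
  have spos: "0 < s x" if "x \<in> std_simplex" for x unfolding s_def by (intro sum_pos pos that) auto
  have cont: "continuous_on std_simplex (\<lambda>x. mv alg M x)"
    unfolding continuous_on_def by (intro ballI tendsto_mv tendsto_const tendsto_ident_at)
  have "continuous_on std_simplex (\<lambda>x. (1 / s x) *\<^sub>R mv alg M x)"
    unfolding s_def by (intro continuous_intros cont) (use spos s_def in force)
  moreover have "(\<lambda>x. (1 / s x) *\<^sub>R mv alg M x) \<in> std_simplex \<rightarrow> std_simplex"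
  proof
    fix x :: "real^'n" assume x: "x \<in> std_simplex"
    have "(\<Sum>i\<in>UNIV. mv alg M x $ i / s x) = 1"
      using spos[OF x] by (simp add: sum_divide_distrib[symmetric] s_def[symmetric])
    then show "(1 / s x) *\<^sub>R mv alg M x \<in> std_simplex"
      using spos[OF x] pos[OF x] by (simp add: std_simplex_def nonneg_vec_def less_imp_le)
  qed
  ultimately obtain x where x: "x \<in> std_simplex" "(1 / s x) *\<^sub>R mv alg M x = x"
    using brouwer[OF simplex_compact simplex_convex] simplex_nonempty by blast
  have eq: "mv alg M x = s x *\<^sub>R x"
    using arg_cong[OF x(2), of "\<lambda>y. s x *\<^sub>R y"] spos[OF x(1)] by simp
  have "0 < x $ i" for i
    using pos[OF x(1), of i] spos[OF x(1)] eq by (simp add: zero_less_mult_iff)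
  then show ?thesis using that x(1) eq unfolding s_def by blast
qed

text \<open>Perron--Frobenius without irreducibility: the eigenvector is a limit of positive eigenvectors of the
matrices \<open>M + \<epsilon>\<close>. By \<open>subeigenvalue_le\<close>, positivity makes each of the perturbed eigenvalues an upper bound of
the numbers \<open>th\<close>, and this bound survives the limit.\<close>

lemma nonneg_matrix_dominant_eigenvector:
  fixes M :: "real^'n^'n::finite"
  assumes M: "nonneg_mat M"
  obtains l x where "0 \<le> l" "nonneg_vec x" "x \<noteq> 0" "mv alg M x = l *\<^sub>R x"
    "\<And>th y. nonneg_vec y \<Longrightarrow> y \<noteq> 0 \<Longrightarrow> (\<And>i. th * y $ i \<le> mv alg M y $ i) \<Longrightarrow> th \<le> l"
proof -
  define e where "e k = inverse (real (Suc k))" for k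
  define P where "P k = (\<chi> i j. M $ i $ j + e k)" for k
  have Ppos: "0 < P k $ i $ j" for k i j using M by (simp add: P_def e_def nonneg_mat_def add_nonneg_pos)
  have P0: "nonneg_mat (P k)" for k using Ppos by (simp add: nonneg_mat_def less_imp_le)
  have "\<forall>k. \<exists>x. x \<in> std_simplex \<and> (\<forall>i. 0 < x $ i) \<and> mv alg (P k) x = (\<Sum>i\<in>UNIV. mv alg (P k) x $ i) *\<^sub>R x"
    using positive_matrix_eigenvector[OF Ppos] by metis
  then obtain x where x: "\<And>k. x k \<in> std_simplex" "\<And>k i. 0 < x k $ i"
    "\<And>k. mv alg (P k) (x k) = (\<Sum>i\<in>UNIV. mv alg (P k) (x k) $ i) *\<^sub>R x k" by metis
  define l where "l k = (\<Sum>i\<in>UNIV. mv alg (P k) (x k) $ i)" for k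
  have xl: "mv alg (P k) (x k) = l k *\<^sub>R x k" for k unfolding l_def by (rule x(3))
  obtain x0 r where r: "x0 \<in> std_simplex" "strict_mono (r :: nat \<Rightarrow> nat)" "(x \<circ> r) \<longlonglongrightarrow> x0"
    using simplex_compact x(1) unfolding compact_def by metis
  have rl: "filterlim r at_top sequentially" using r(2) by (rule filterlim_subseq)
  have "P \<longlonglongrightarrow> M"
  proof (intro vec_tendstoI)
    fix i j
    have "(\<lambda>k. M $ i $ j + e k) \<longlonglongrightarrow> M $ i $ j + 0"
      unfolding e_def by (intro tendsto_add tendsto_const LIMSEQ_inverse_real_of_nat)
    then show "(\<lambda>k. P k $ i $ j) \<longlonglongrightarrow> M $ i $ j" by (simp add: P_def)
  qed
  then have PM: "(\<lambda>k. P (r k)) \<longlonglongrightarrow> M" using rl by (rule filterlim_compose)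
  have xr: "(\<lambda>k. x (r k)) \<longlonglongrightarrow> x0" using r(3) by (simp add: o_def)
  have mvl: "(\<lambda>k. mv alg (P (r k)) (x (r k))) \<longlonglongrightarrow> mv alg M x0" by (rule tendsto_mv[OF PM xr])
  define l0 where "l0 = (\<Sum>i\<in>UNIV. mv alg M x0 $ i)"
  have ll: "(\<lambda>k. l (r k)) \<longlonglongrightarrow> l0" unfolding l_def l0_def by (intro tendsto_sum tendsto_vec_nth mvl)
  have "(\<lambda>k. l (r k) *\<^sub>R x (r k)) \<longlonglongrightarrow> l0 *\<^sub>R x0" by (intro tendsto_scaleR ll xr)
  with mvl have eq: "mv alg M x0 = l0 *\<^sub>R x0" unfolding xl by (rule LIMSEQ_unique)
  have x0: "nonneg_vec x0" "x0 \<noteq> 0" using r(1) simplex_nonzero[OF r(1)] by (auto simp: std_simplex_def)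
  have l0: "0 \<le> l0" unfolding l0_def using mv_nonneg[OF M x0(1)] by (intro sum_nonneg) (simp add: nonneg_vec_def)
  have "th \<le> l0" if y: "nonneg_vec y" "y \<noteq> 0" and th: "\<And>i. th * y $ i \<le> mv alg M y $ i" for th y
  proof -
    have "th \<le> l k" for k
    proof (rule subeigenvalue_le[OF P0, of "x k" y alg])
      show "nonneg_vec (x k)" using x(2) by (simp add: nonneg_vec_def less_imp_le)
      show "mv alg (P k) (x k) $ i \<le> l k * x k $ i" for i
        by (simp add: xl)
      have "mv alg M y $ i \<le> mv alg (P k) y $ i" for i
        unfolding mv_nth using y by (intro ssum_mono mult_right_mono) (auto simp: P_def e_def nonneg_vec_def)
      then show "th * y $ i \<le> mv alg (P k) y $ i" for i using th[of i] order_trans by blast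
    qed (use y x in auto)
    then show ?thesis using ll by (intro LIMSEQ_le_const) auto
  qed
  then show ?thesis using that l0 x0 eq by blast
qed

section \<open>Walks and strongly connected components\<close>

lemma mpow_pos_iff:
  assumes A: "nonneg_mat A"
  shows "0 < mpow alg A k $ i $ j \<longleftrightarrow> (i, j) \<in> edges (graph_of A) ^^ k"
proof (induction k arbitrary: i)
  case 0 then show ?case by (simp add: mat_def)
next
  case (Suc k)
  have "0 < mpow alg A (Suc k) $ i $ j \<longleftrightarrow> 0 < mv alg A (column j (mpow alg A k)) $ i"
    unfolding column_mm[symmetric] by (simp add: column_nth)
  also have "\<dots> \<longleftrightarrow> (\<exists>l. 0 < A $ i $ l \<and> 0 < mpow alg A k $ l $ j)"
    using mv_pos_iff[OF A nonneg_column[OF mpow_nonneg[OF A]]] by (simp add: column_nth)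
  also have "\<dots> \<longleftrightarrow> (\<exists>l. (i, l) \<in> edges (graph_of A) \<and> (l, j) \<in> edges (graph_of A) ^^ k)"
    using A Suc by (auto simp: graph_of_def nonneg_mat_def order_less_le)
  also have "\<dots> \<longleftrightarrow> (i, j) \<in> edges (graph_of A) ^^ Suc k"
    by (auto simp: relpow_commute[symmetric])
  finally show ?case .
qed

definition scc_of :: "'a graph \<Rightarrow> 'a \<Rightarrow> 'a graph" where
  "scc_of G i = induced_subgraph G {j \<in> nodes G. (i, j) \<in> (edges G)\<^sup>* \<and> (j, i) \<in> (edges G)\<^sup>*}"

lemma sccs_eq: "sccs G = scc_of G ` nodes G"
proof -
  have "{(i, j) \<in> nodes G \<times> nodes G. (i, j) \<in> (edges G)\<^sup>* \<and> (j, i) \<in> (edges G)\<^sup>*} `` {i}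
     = {j \<in> nodes G. (i, j) \<in> (edges G)\<^sup>* \<and> (j, i) \<in> (edges G)\<^sup>*}" if "i \<in> nodes G" for i
    using that by auto
  then show ?thesis unfolding sccs_def quotient_def scc_of_def by (auto simp: image_iff)
qed

lemma nodes_scc_of: "nodes (scc_of G i) = {j \<in> nodes G. (i, j) \<in> (edges G)\<^sup>* \<and> (j, i) \<in> (edges G)\<^sup>*}"
  by (simp add: scc_of_def induced_subgraph_def)

lemma edges_scc_of: "edges (scc_of G i) = edges G \<inter> nodes (scc_of G i) \<times> nodes (scc_of G i)"
  by (simp add: scc_of_def induced_subgraph_def)

lemma scc_of_eq: "j \<in> nodes (scc_of G i) \<Longrightarrow> scc_of G j = scc_of G i"
proof -
  assume "j \<in> nodes (scc_of G i)"
  then have "nodes (scc_of G j) = nodes (scc_of G i)"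
    unfolding nodes_scc_of by (auto intro: rtrancl_trans)
  then show ?thesis using edges_scc_of[of G i] edges_scc_of[of G j] by (simp add: prod_eq_iff)
qed

lemma sccs_unique:
  assumes "C \<in> sccs G" "C' \<in> sccs G" "i \<in> nodes C" "i \<in> nodes C'" shows "C = C'"
  using assms scc_of_eq unfolding sccs_eq by (metis imageE)

lemma scc_of_self: "i \<in> nodes G \<Longrightarrow> i \<in> nodes (scc_of G i) \<and> scc_of G i \<in> sccs G"
  by (simp add: nodes_scc_of sccs_eq)

definition strongly_connected :: "'a graph \<Rightarrow> bool" where
  "strongly_connected G \<longleftrightarrow> nodes G \<noteq> {} \<and> edges G \<subseteq> nodes G \<times> nodes G \<and>
     (\<forall>i\<in>nodes G. \<forall>j\<in>nodes G. (i, j) \<in> (edges G)\<^sup>*)"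

text \<open>A path between nodes of a component cannot leave the component.\<close>

lemma scc_strongly_connected:
  assumes G: "edges G \<subseteq> nodes G \<times> nodes G" and C: "C \<in> sccs G"
  shows "strongly_connected C"
proof -
  obtain r where r: "r \<in> nodes G" "C = scc_of G r" using C by (auto simp: sccs_eq)
  have "(i, j) \<in> (edges C)\<^sup>*" if ij: "i \<in> nodes C" "j \<in> nodes C" for i j
  proof -
    have "(i, j) \<in> (edges G)\<^sup>*" using ij unfolding r(2) nodes_scc_of by (auto intro: rtrancl_trans)
    then have "i \<in> nodes C \<longrightarrow> (i, j) \<in> (edges C)\<^sup>*"
    proof (induction rule: converse_rtrancl_induct)
      case base then show ?case by simp
    next
      case (step i k)
      show ?case
      proof
        assume i: "i \<in> nodes C"
        have "(k, r) \<in> (edges G)\<^sup>*"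
          using step(2) ij(2) unfolding r(2) nodes_scc_of by (auto intro: rtrancl_trans)
        moreover have "(r, k) \<in> (edges G)\<^sup>*"
          using step(1) i unfolding r(2) nodes_scc_of by (auto intro: rtrancl_into_rtrancl)
        ultimately have k: "k \<in> nodes C" using step(1) G unfolding r(2) nodes_scc_of by auto
        then have "(i, k) \<in> edges C" using step(1) i unfolding r(2) edges_scc_of by auto
        then show "(i, j) \<in> (edges C)\<^sup>*" using step(3) k by (auto intro: converse_rtrancl_into_rtrancl)
      qed
    qed
    then show ?thesis using ij by simp
  qed
  moreover have "edges C \<subseteq> nodes C \<times> nodes C" unfolding r(2) edges_scc_of by auto
  moreover have "r \<in> nodes C" using scc_of_self[OF r(1)] r(2) by simp
  ultimately show ?thesis by (auto simp: strongly_connected_def)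
qed

lemma walk_in_scc:
  assumes G: "edges G \<subseteq> nodes G \<times> nodes G" and C: "C \<in> sccs G"
    and ij: "(i, j) \<in> edges G ^^ l" "i \<in> nodes C" "j \<in> nodes C"
  shows "(i, j) \<in> edges C ^^ l"
  using ij
proof (induction l arbitrary: i)
  case (Suc l)
  obtain r where r: "C = scc_of G r" using C by (auto simp: sccs_eq)
  obtain k where k: "(i, k) \<in> edges G" "(k, j) \<in> edges G ^^ l" using relpow_Suc_D2[OF Suc(2)] by blast
  have "(r, k) \<in> (edges G)\<^sup>*" using Suc(3) k(1) unfolding r nodes_scc_of by auto
  moreover have "(k, r) \<in> (edges G)\<^sup>*"
    using Suc(4) relpow_imp_rtrancl[OF k(2)] unfolding r nodes_scc_of by auto
  ultimately have kN: "k \<in> nodes C" using k(1) G unfolding r nodes_scc_of by auto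
  then have "(i, k) \<in> edges C" using k(1) Suc(3) unfolding r edges_scc_of by blast
  then show ?case using Suc(1)[OF k(2) kN Suc(4)] by (rule relpow_Suc_I2)
qed simp

lemma strongly_connected_successor:
  assumes G: "strongly_connected G" "edges G \<noteq> {}" and i: "i \<in> nodes G"
  obtains j where "(i, j) \<in> edges G" "j \<in> nodes G"
proof -
  obtain a b where ab: "(a, b) \<in> edges G" using G(2) by auto
  have ab': "a \<in> nodes G" "b \<in> nodes G" using ab G(1) by (auto simp: strongly_connected_def)
  then have "(i, a) \<in> (edges G)\<^sup>*" using i G(1) by (auto simp: strongly_connected_def)
  then have "\<exists>j. (i, j) \<in> edges G" using ab by (cases rule: converse_rtranclE) auto
  then show ?thesis using that G(1) by (auto simp: strongly_connected_def)
qed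

lemma strongly_connected_predecessor:
  assumes G: "strongly_connected G" "edges G \<noteq> {}" and j: "j \<in> nodes G"
  obtains i where "(i, j) \<in> edges G" "i \<in> nodes G"
proof -
  obtain a b where ab: "(a, b) \<in> edges G" using G(2) by auto
  have ab': "a \<in> nodes G" "b \<in> nodes G" using ab G(1) by (auto simp: strongly_connected_def)
  then have "(b, j) \<in> (edges G)\<^sup>*" using j G(1) by (auto simp: strongly_connected_def)
  then have "\<exists>i. (i, j) \<in> edges G" using ab by (cases rule: rtranclE) auto
  then show ?thesis using that G(1) by (auto simp: strongly_connected_def)
qed

lemma strongly_connected_no_edges:
  "strongly_connected G \<Longrightarrow> edges G = {} \<Longrightarrow> i \<in> nodes G \<Longrightarrow> nodes G = {i}"
  by (auto simp: strongly_connected_def)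

section \<open>Cyclicity\<close>

lemma cycle_of_map:
  assumes "1 \<le> l" "f l = f 0" "\<And>t. t < l \<Longrightarrow> (f t, f (Suc t)) \<in> edges G"
  shows "cycle_of G (map f [0..<l])" "\<And>t. t < l \<Longrightarrow> cycle_edge (map f [0..<l]) t = (f t, f (Suc t))"
proof -
  show e: "cycle_edge (map f [0..<l]) t = (f t, f (Suc t))" if "t < l" for t
    using assms(1,2) that by (cases "Suc t = l") (auto simp: cycle_edge_def)
  show "cycle_of G (map f [0..<l])"
    using assms(1,3) by (auto simp: cycle_of_def e)
qed

lemma cycle_edge_mod:
  assumes "c \<noteq> []" "t < length c"
  shows "cycle_edge c t = (c ! (t mod length c), c ! (Suc t mod length c))"
  using assms by (simp add: cycle_edge_def)

lemma cycle_of_walk: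
  assumes "cycle_of G c"
  shows "(c ! 0, c ! 0) \<in> edges G ^^ length c"
proof -
  have c: "c \<noteq> []" "\<And>t. t < length c \<Longrightarrow> cycle_edge c t \<in> edges G" using assms by (auto simp: cycle_of_def)
  show ?thesis unfolding relpow_fun_conv
    by (rule exI[of _ "\<lambda>t. c ! (t mod length c)"]) (use c cycle_edge_mod[OF c(1)] in auto)
qed

text \<open>A closed walk that visits some node twice splits into two shorter closed walks, so its length is a sum
of lengths of elementary cycles.\<close>

lemma closed_walk_cyclicity_dvd:
  assumes "(i, i) \<in> edges G ^^ l" "edges G \<noteq> {}"
  shows "sc_cyclicity G dvd l"
  using assms(1)
proof (induction l arbitrary: i rule: less_induct)
  case (less l)
  obtain f where f: "f 0 = i" "f l = i" "\<And>t. t < l \<Longrightarrow> (f t, f (Suc t)) \<in> edges G"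
    using less(2) unfolding relpow_fun_conv by blast
  have sub: "(f a, f b) \<in> edges G ^^ (b - a)" if "a \<le> b" "b \<le> l" for a b
    unfolding relpow_fun_conv by (rule exI[of _ "\<lambda>t. f (a + t)"]) (use that f(3) in auto)
  show ?case
  proof (cases "l = 0 \<or> inj_on f {..<l}")
    case True
    then show ?thesis
    proof
      assume inj: "inj_on f {..<l}"
      show ?thesis
      proof (cases "l = 0")
        case False
        then have "cycle_of G (map f [0..<l])" using f by (intro cycle_of_map) auto
        then have "elementary_cycle_of G (map f [0..<l])"
          using inj by (simp add: elementary_cycle_of_def distinct_map atLeast0LessThan)
        then have "length (map f [0..<l]) \<in> length ` {c. elementary_cycle_of G c}" by blast
        then show ?thesis using assms(2) by (simp add: sc_cyclicity_def Gcd_dvd)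
      qed simp
    qed simp
  next
    case False
    then obtain a b where "a < l" "b < l" "a \<noteq> b" "f a = f b" by (auto simp: inj_on_def)
    then obtain a b where ab: "a < b" "b < l" "f a = f b" by (metis linorder_neqE_nat)
    have "(f a, f a) \<in> edges G ^^ (b - a)" using sub[of a b] ab by simp
    moreover have "b - a < l" using ab by simp
    ultimately have d1: "sc_cyclicity G dvd b - a" using less(1) by blast
    have "(f 0, f 0) \<in> edges G ^^ (a + (l - b))"
      using sub[of 0 a] sub[of b l] ab f(1,2) unfolding relpow_add by auto
    moreover have "a + (l - b) < l" using ab by simp
    ultimately have "sc_cyclicity G dvd a + (l - b)" using less(1) by blast
    then have "sc_cyclicity G dvd (b - a) + (a + (l - b))" using d1 by (rule dvd_add[rotated])
    then show ?thesis using ab by simp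
  qed
qed

lemma strongly_connected_closed_walk:
  assumes G: "strongly_connected G" "edges G \<noteq> {}" and i: "i \<in> nodes G"
  shows "\<exists>l\<ge>1. (i, i) \<in> edges G ^^ l"
proof -
  obtain j where j: "(i, j) \<in> edges G" "j \<in> nodes G" using strongly_connected_successor[OF G i] .
  have "(j, i) \<in> (edges G)\<^sup>*" using G(1) i j by (auto simp: strongly_connected_def)
  then obtain n where "(j, i) \<in> edges G ^^ n" using rtrancl_imp_relpow by blast
  then have "(i, i) \<in> edges G ^^ Suc n" using j(1) relpow_Suc_I2 by metis
  then show ?thesis by (metis le_add1 plus_1_eq_Suc)
qed

lemma cyclicity_pos:
  assumes G: "strongly_connected G" "edges G \<noteq> {}" shows "0 < sc_cyclicity G"
proof -
  obtain i where "i \<in> nodes G" using G(1) by (auto simp: strongly_connected_def)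
  then obtain l where l: "l \<ge> 1" "(i, i) \<in> edges G ^^ l" using strongly_connected_closed_walk[OF G] by blast
  then have "sc_cyclicity G dvd l" using closed_walk_cyclicity_dvd[OF l(2) G(2)] by simp
  then show ?thesis using \<open>l \<ge> 1\<close> by (intro Nat.gr0I) auto
qed

text \<open>The least positive difference \<open>g\<close> of two elements of \<open>S\<close> divides every element, as division with
remainder would otherwise produce a smaller difference; so \<open>g\<close> is the greatest common divisor. If \<open>x\<close>
and \<open>x + g\<close> belong to \<open>S\<close>, every large multiple of \<open>g\<close> is a sum of copies of these two.\<close>

lemma semigroup_contains_large_multiples:
  fixes S :: "nat set"
  assumes S0: "0 \<in> S" and Sadd: "\<And>a b. a \<in> S \<Longrightarrow> b \<in> S \<Longrightarrow> a + b \<in> S"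
    and pos: "m \<in> S" "0 < m"
  shows "\<exists>L. \<forall>l\<ge>L. Gcd S dvd l \<longrightarrow> l \<in> S"
proof -
  have Smult: "q * a \<in> S" if "a \<in> S" for q a
    by (induction q) (simp_all add: S0 Sadd that)
  define D where "D k \<longleftrightarrow> 0 < k \<and> (\<exists>x\<in>S. x + k \<in> S)" for k
  have "D m" using pos S0 by (auto simp: D_def intro!: bexI[of _ 0])
  define g where "g = (LEAST k. D k)"
  have Dg: "D g" unfolding g_def using \<open>D m\<close> by (rule LeastI)
  then obtain x where x: "x \<in> S" "x + g \<in> S" "0 < g" by (auto simp: D_def)
  have "g dvd s" if s: "s \<in> S" for s
  proof (rule ccontr)
    assume "\<not> g dvd s"
    then have r: "0 < s mod g" by (simp add: dvd_eq_mod_eq_0)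
    have "(s div g) * (x + g) \<in> S" "s + (s div g) * x \<in> S" using Smult Sadd x s by auto
    moreover have "s + (s div g) * x = (s div g) * (x + g) + s mod g"
      using div_mult_mod_eq[of s g] by (simp add: algebra_simps)
    ultimately have "D (s mod g)" using r unfolding D_def by metis
    then have "g \<le> s mod g" unfolding g_def by (rule Least_le)
    then show False using mod_less_divisor[OF x(3), of s] by (meson not_less)
  qed
  then have "g dvd Gcd S" by (simp add: Gcd_greatest)
  moreover have "Gcd S dvd g" using x Gcd_dvd[of x S] Gcd_dvd[of "x + g" S] by (simp add: dvd_add_right_iff)
  ultimately have g: "Gcd S = g" by (simp add: dvd_antisym)
  obtain n where n: "x = g * n" using Gcd_dvd[OF x(1)] g by (auto elim: dvdE)
  have "l \<in> S" if l: "l \<ge> g * (n * n)" "g dvd l" for l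
  proof -
    obtain t where t: "l = g * t" using l by (auto elim: dvdE)
    have tn: "n * n \<le> t" using l(1) t x(3) by simp
    show ?thesis
    proof (cases "n = 0")
      case True
      then have "g \<in> S" using x n by simp
      then show ?thesis using Smult[of g t] t by (simp add: mult.commute)
    next
      case False
      have "t mod n < n" using False by simp
      also have "n \<le> t div n" using tn False by (simp add: less_eq_div_iff_mult_less_eq)
      finally have le: "t mod n \<le> t div n" by simp
      then obtain k where k: "t div n = t mod n + k" using le_Suc_ex by blast
      have "t = (t mod n + k) * n + t mod n" using div_mult_mod_eq[of t n] k by simp
      then have "l = g * ((t mod n + k) * n + t mod n)" using t by simp
      also have "\<dots> = k * x + (t mod n) * (x + g)" unfolding n by (simp add: algebra_simps)
      finally have "l = k * x + (t mod n) * (x + g)" .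
      then show ?thesis using Smult[OF x(1)] Smult[OF x(2)] Sadd by simp
    qed
  qed
  then show ?thesis unfolding g by blast
qed

lemma walk_stays:
  assumes "edges G \<subseteq> nodes G \<times> nodes G" "i \<in> nodes G" "(i, j) \<in> edges G ^^ l"
  shows "j \<in> nodes G"
  using assms(3)
proof (cases l)
  case (Suc k)
  then obtain m where "(m, j) \<in> edges G" using assms(3) by auto
  then show ?thesis using assms(1) by auto
qed (use assms in auto)

lemma strongly_connected_walk:
  assumes "strongly_connected G" "i \<in> nodes G" "j \<in> nodes G"
  obtains l where "(i, j) \<in> edges G ^^ l"
  using assms rtrancl_imp_relpow unfolding strongly_connected_def by metis

text \<open>A detour from \<open>i\<close> to an elementary cycle and back is a closed walk with or without a tour around the
cycle; the difference of the two lengths is the length of the cycle.\<close>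

lemma closed_walk_lengths_Gcd:
  assumes G: "strongly_connected G" "edges G \<noteq> {}" and i: "i \<in> nodes G"
  shows "Gcd {l. (i, i) \<in> edges G ^^ l} = sc_cyclicity G"
proof (rule dvd_antisym)
  show "sc_cyclicity G dvd Gcd {l. (i, i) \<in> edges G ^^ l}"
    using closed_walk_cyclicity_dvd[OF _ G(2)] by (intro Gcd_greatest) auto
  have "Gcd {l. (i, i) \<in> edges G ^^ l} dvd length c" if c: "elementary_cycle_of G c" for c
  proof -
    let ?u = "c ! 0"
    have w: "(?u, ?u) \<in> edges G ^^ length c" and c0: "c \<noteq> []"
      using c cycle_of_walk[of G c] unfolding elementary_cycle_of_def cycle_of_def by blast+
    have "(?u, c ! (Suc 0 mod length c)) \<in> edges G"
      using c c0 by (force simp: elementary_cycle_of_def cycle_of_def cycle_edge_def)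
    then have u: "?u \<in> nodes G" using G(1) by (auto simp: strongly_connected_def)
    obtain a b where a: "(i, ?u) \<in> edges G ^^ a" and b: "(?u, i) \<in> edges G ^^ b"
      using strongly_connected_walk[OF G(1) i u] strongly_connected_walk[OF G(1) u i] by metis
    have "(i, i) \<in> edges G ^^ (a + b)" "(i, i) \<in> edges G ^^ (a + (length c + b))"
      using a b w unfolding relpow_add by blast+
    then have "Gcd {l. (i, i) \<in> edges G ^^ l} dvd a + b"
      "Gcd {l. (i, i) \<in> edges G ^^ l} dvd length c + (a + b)"
      by (auto intro!: Gcd_dvd simp: algebra_simps)
    then show ?thesis by (simp add: dvd_add_left_iff)
  qed
  then show "Gcd {l. (i, i) \<in> edges G ^^ l} dvd sc_cyclicity G"
    using G(2) unfolding sc_cyclicity_def by (auto intro!: Gcd_greatest)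
qed

lemma long_closed_walks:
  assumes G: "strongly_connected G" "edges G \<noteq> {}" and i: "i \<in> nodes G"
  shows "\<exists>L. \<forall>l\<ge>L. sc_cyclicity G dvd l \<longrightarrow> (i, i) \<in> edges G ^^ l"
proof -
  obtain m where m: "m \<ge> 1" "(i, i) \<in> edges G ^^ m" using strongly_connected_closed_walk[OF G i] by blast
  have "\<exists>L. \<forall>l\<ge>L. Gcd {l. (i, i) \<in> edges G ^^ l} dvd l \<longrightarrow> l \<in> {l. (i, i) \<in> edges G ^^ l}"
  proof (rule semigroup_contains_large_multiples)
    show "a + b \<in> {l. (i, i) \<in> edges G ^^ l}"
      if "a \<in> {l. (i, i) \<in> edges G ^^ l}" "b \<in> {l. (i, i) \<in> edges G ^^ l}" for a b
      using that relpow_add[of a b "edges G"] by auto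
  qed (use m in auto)
  then show ?thesis unfolding closed_walk_lengths_Gcd[OF G i] by simp
qed

text \<open>The length of a walk from a fixed root, modulo the cyclicity. It numbers the cyclic classes, and each
edge raises it by one.\<close>

definition cyclic_index :: "'a graph \<Rightarrow> 'a \<Rightarrow> nat" where
  "cyclic_index G i = (SOME l. (SOME r. r \<in> nodes G, i) \<in> edges G ^^ l) mod sc_cyclicity G"

context
  fixes G :: "'a graph"
  assumes G: "strongly_connected G" "edges G \<noteq> {}"
begin

lemma cyclic_index_less: "cyclic_index G i < sc_cyclicity G"
  unfolding cyclic_index_def using cyclicity_pos[OF G] by simp

lemma cyclic_index_walk:
  assumes i: "i \<in> nodes G" and w: "(i, j) \<in> edges G ^^ l"
  shows "cyclic_index G j = (cyclic_index G i + l) mod sc_cyclicity G"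
proof -
  define r where "r = (SOME r. r \<in> nodes G)"
  have r: "r \<in> nodes G" using G(1) unfolding r_def strongly_connected_def by (metis some_in_eq)
  have E: "edges G \<subseteq> nodes G \<times> nodes G" using G(1) by (simp add: strongly_connected_def)
  have j: "j \<in> nodes G" by (rule walk_stays[OF E i w])
  define p where "p k = (SOME l. (r, k) \<in> edges G ^^ l)" for k
  have p: "(r, k) \<in> edges G ^^ p k" if "k \<in> nodes G" for k
    unfolding p_def by (rule strongly_connected_walk[OF G(1) r that]) (rule someI)
  have ci: "cyclic_index G k = p k mod sc_cyclicity G" for k
    by (simp add: cyclic_index_def p_def r_def)
  obtain e where e: "(j, r) \<in> edges G ^^ e" using strongly_connected_walk[OF G(1) j r] .
  have "(r, r) \<in> edges G ^^ (p i + (l + e))" "(r, r) \<in> edges G ^^ (p j + e)"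
    using p[OF i] p[OF j] w e unfolding relpow_add by blast+
  then have "sc_cyclicity G dvd p i + (l + e)" "sc_cyclicity G dvd p j + e"
    using closed_walk_cyclicity_dvd[OF _ G(2)] by blast+
  then have "int (sc_cyclicity G) dvd int (p i + (l + e)) - int (p j + e)"
    by (intro dvd_diff) (simp_all add: int_dvd_int_iff del: of_nat_add)
  then have "int (p i + l) mod int (sc_cyclicity G) = int (p j) mod int (sc_cyclicity G)"
    unfolding mod_eq_dvd_iff by (simp add: algebra_simps)
  then have "(p i + l) mod sc_cyclicity G = p j mod sc_cyclicity G"
    by (metis of_nat_eq_iff of_nat_mod)
  then show ?thesis unfolding ci by (simp add: mod_add_left_eq)
qed

lemma cyclic_index_range: "cyclic_index G ` nodes G = {..<sc_cyclicity G}"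
proof
  show "cyclic_index G ` nodes G \<subseteq> {..<sc_cyclicity G}" using cyclic_index_less by auto
  show "{..<sc_cyclicity G} \<subseteq> cyclic_index G ` nodes G"
  proof
    fix k assume k: "k \<in> {..<sc_cyclicity G}"
    obtain i where i: "i \<in> nodes G" using G(1) by (auto simp: strongly_connected_def)
    have "\<exists>j\<in>nodes G. (i, j) \<in> edges G ^^ l" for l
    proof (induction l)
      case (Suc l)
      then show ?case using strongly_connected_successor[OF G] relpow_Suc_I by metis
    qed (use i in simp)
    then obtain j where j: "j \<in> nodes G" "(i, j) \<in> edges G ^^ (sc_cyclicity G - cyclic_index G i + k)"
      by blast
    have "cyclic_index G j = (sc_cyclicity G + k) mod sc_cyclicity G"
      using cyclic_index_walk[OF i j(2)] cyclic_index_less[of i] by simp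
    then show "k \<in> cyclic_index G ` nodes G" using j k by auto
  qed
qed

lemma long_walks:
  assumes i: "i \<in> nodes G" and j: "j \<in> nodes G"
  shows "\<exists>L. \<forall>l\<ge>L. cyclic_index G j = (cyclic_index G i + l) mod sc_cyclicity G \<longrightarrow> (i, j) \<in> edges G ^^ l"
proof -
  obtain e where e: "(i, j) \<in> edges G ^^ e" using strongly_connected_walk[OF G(1) i j] .
  obtain L where L: "\<And>l. l \<ge> L \<Longrightarrow> sc_cyclicity G dvd l \<Longrightarrow> (i, i) \<in> edges G ^^ l"
    using long_closed_walks[OF G i] by blast
  have "(i, j) \<in> edges G ^^ l"
    if l: "l \<ge> L + e" "cyclic_index G j = (cyclic_index G i + l) mod sc_cyclicity G" for l
  proof -
    have "(cyclic_index G i + e) mod sc_cyclicity G = (cyclic_index G i + l) mod sc_cyclicity G"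
      using cyclic_index_walk[OF i e] l(2) by simp
    then have "sc_cyclicity G dvd (cyclic_index G i + l) - (cyclic_index G i + e)"
      using l(1) by (subst mod_eq_dvd_iff_nat[symmetric]) auto
    then have "sc_cyclicity G dvd l - e" by simp
    then have "(i, i) \<in> edges G ^^ (l - e)" using L l(1) by simp
    then have "(i, j) \<in> edges G ^^ (l - e + e)" using e unfolding relpow_add by blast
    then show ?thesis using l(1) by simp
  qed
  then show ?thesis by blast
qed

end

section \<open>Perron roots of classes\<close>

lemma edges_graph_of: "nonneg_mat A \<Longrightarrow> (i, j) \<in> edges (graph_of A) \<longleftrightarrow> 0 < A $ i $ j"
  by (auto simp: graph_of_def nonneg_mat_def order_less_le)

lemma class_strongly_connected: "\<mu> \<in> classes A \<Longrightarrow> strongly_connected \<mu>"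
  unfolding classes_def by (rule scc_strongly_connected) (auto simp: graph_of_def)

lemma edges_class: "\<mu> \<in> classes A \<Longrightarrow> edges \<mu> = edges (graph_of A) \<inter> nodes \<mu> \<times> nodes \<mu>"
  unfolding classes_def sccs_eq using edges_scc_of by (metis imageE)

lemma class_mutual_access:
  assumes "\<mu> \<in> classes A" "i \<in> nodes \<mu>"
    "(i, j) \<in> (edges (graph_of A))\<^sup>*" "(j, i) \<in> (edges (graph_of A))\<^sup>*"
  shows "j \<in> nodes \<mu>"
proof -
  obtain r where r: "\<mu> = scc_of (graph_of A) r" using assms(1) by (auto simp: classes_def sccs_eq)
  have "\<mu> = scc_of (graph_of A) i" using scc_of_eq[of i "graph_of A" r] assms(2) r by simp
  then show ?thesis using assms(3,4) by (simp add: nodes_scc_of graph_of_def)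
qed

lemma class_access:
  assumes "\<mu> \<in> classes A" "i \<in> nodes \<mu>" "j \<in> nodes \<mu>"
  shows "(i, j) \<in> (edges (graph_of A))\<^sup>*"
proof -
  have "(i, j) \<in> (edges \<mu>)\<^sup>*"
    using class_strongly_connected[OF assms(1)] assms(2,3) by (auto simp: strongly_connected_def)
  then show ?thesis using edges_class[OF assms(1)] rtrancl_mono[of "edges \<mu>" "edges (graph_of A)"] by blast
qed

lemma restrict_nth: "restrict_mat N A $ i $ j = (if i \<in> N \<and> j \<in> N then A $ i $ j else 0)"
  by (simp add: restrict_mat_def)

lemma nonneg_restrict: "nonneg_mat A \<Longrightarrow> nonneg_mat (restrict_mat N A)"
  by (simp add: nonneg_mat_def restrict_nth)

lemma mv_restrict_outside: "i \<notin> N \<Longrightarrow> mv alg (restrict_mat N A) x $ i = 0"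
  by (simp add: mv_nth restrict_nth)

lemma mv_restrict_le:
  assumes "nonneg_mat A" "nonneg_vec x"
  shows "mv alg (restrict_mat N A) x $ i \<le> mv alg A x $ i"
  unfolding mv_nth using assms
  by (intro ssum_mono mult_right_mono) (auto simp: restrict_nth nonneg_mat_def nonneg_vec_def)

text \<open>The support of \<open>x\<close> is closed under predecessors in the class.\<close>

lemma submatrix_eigenvector_positive:
  assumes A: "nonneg_mat A" and m: "\<mu> \<in> classes A" and e: "edges \<mu> \<noteq> {}"
    and x: "nonneg_vec x" "x \<noteq> 0" "\<And>i. i \<notin> nodes \<mu> \<Longrightarrow> x $ i = 0"
    "mv alg (restrict_mat (nodes \<mu>) A) x = l *\<^sub>R x"
  shows "0 < x $ i \<longleftrightarrow> i \<in> nodes \<mu>" "0 < l"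
proof -
  note sc = class_strongly_connected[OF m]
  let ?R = "restrict_mat (nodes \<mu>) A"
  obtain k where k: "0 < x $ k" using x(1,2) by (auto simp: vec_eq_iff nonneg_vec_def order_less_le)
  have kN: "k \<in> nodes \<mu>" using k x(3)[of k] by force
  have Rp: "0 < mv alg ?R x $ a" if "(a, b) \<in> edges \<mu>" "0 < x $ b" for a b
  proof -
    have "0 < ?R $ a $ b" using that(1) edges_class[OF m] edges_graph_of[OF A] by (auto simp: restrict_nth)
    then show ?thesis using mv_pos_iff[OF nonneg_restrict[OF A] x(1)] that(2) by blast
  qed
  obtain a where "(a, k) \<in> edges \<mu>" using strongly_connected_predecessor[OF sc e kN] .
  then have "0 < l * x $ a" using Rp[OF _ k] x(4) by (metis vector_scaleR_component real_scaleR_def)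
  then show l: "0 < l" using x(1) by (metis nonneg_vec_def zero_less_mult_pos2 order_le_less mult_zero_right less_irrefl)
  have "0 < x $ i" if "i \<in> nodes \<mu>" for i
  proof -
    have "(i, k) \<in> (edges \<mu>)\<^sup>*" using sc that kN by (auto simp: strongly_connected_def)
    then show ?thesis
    proof (induction rule: converse_rtrancl_induct)
      case (step a b)
      then have "0 < l * x $ a" using Rp[of a b] x(4) by simp
      then show ?case using l by (simp add: zero_less_mult_iff)
    qed (rule k)
  qed
  then show "0 < x $ i \<longleftrightarrow> i \<in> nodes \<mu>" using x(3)[of i] by force
qed

text \<open>An eigenvalue exists by \<open>nonneg_matrix_dominant_eigenvector\<close> for the restricted matrix. It is
positive if the class has an edge, because the restricted matrix maps the indicator vector of the
class above a positive multiple of it. It is unique, as all eigenvectors are positive on the class and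
\<open>subeigenvalue_le\<close> applies in both directions.\<close>

lemma class_perron:
  fixes A :: "real^'n^'n::finite"
  assumes A: "nonneg_mat A" and m: "\<mu> \<in> classes A"
  shows "\<exists>x. nonneg_vec x \<and> (\<forall>i. 0 < x $ i \<longleftrightarrow> i \<in> nodes \<mu>) \<and>
      mv alg (restrict_mat (nodes \<mu>) A) x = perron_root alg A (nodes \<mu>) *\<^sub>R x"
    and "0 \<le> perron_root alg A (nodes \<mu>)"
    and "0 < perron_root alg A (nodes \<mu>) \<longleftrightarrow> edges \<mu> \<noteq> {}"
proof -
  note sc = class_strongly_connected[OF m]
  let ?N = "nodes \<mu>"
  let ?R = "restrict_mat ?N A"
  note R = nonneg_restrict[OF A, of ?N]
  obtain i0 where i0: "i0 \<in> ?N" using sc by (auto simp: strongly_connected_def)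
  define P where "P l x \<longleftrightarrow> 0 \<le> l \<and> nonneg_vec x \<and> x \<noteq> 0 \<and> (\<forall>i. i \<notin> ?N \<longrightarrow> x $ i = 0) \<and>
      mv alg ?R x = l *\<^sub>R x" for l x
  have PE: "submatrix_eigenvalue alg A ?N l \<longleftrightarrow> (\<exists>x. P l x)" for l
    by (auto simp: submatrix_eigenvalue_def P_def eigencone_def)
  have main: "\<exists>l. (\<exists>x. P l x) \<and> (\<forall>k y. P k y \<longrightarrow> k = l \<and> (\<forall>i. 0 < y $ i \<longleftrightarrow> i \<in> ?N)) \<and> (0 < l \<longleftrightarrow> edges \<mu> \<noteq> {})"
  proof (cases "edges \<mu> = {}")
    case True
    have N: "?N = {i0}" by (rule strongly_connected_no_edges[OF sc True i0])
    have "A $ i $ j = 0" if "i \<in> ?N" "j \<in> ?N" for i j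
    proof -
      have "(i, j) \<notin> edges (graph_of A)" using that True edges_class[OF m] by blast
      then show ?thesis by (simp add: graph_of_def)
    qed
    then have R0: "?R = 0" by (simp add: vec_eq_iff restrict_nth)
    have mv0: "mv alg 0 y = 0" for y :: "real^'n" by (simp add: vec_eq_iff mv_nth)
    have "P 0 (axis i0 1)"
      using N nonneg_axis unfolding P_def R0 mv0 by (auto simp: axis_def vec_eq_iff nonneg_vec_def)
    moreover have "k = 0 \<and> (\<forall>i. 0 < y $ i \<longleftrightarrow> i \<in> ?N)" if "P k y" for k y
    proof -
      have y: "nonneg_vec y" "y \<noteq> 0" "k *\<^sub>R y = 0" "\<And>i. i \<noteq> i0 \<Longrightarrow> y $ i = 0"
        using that N unfolding P_def R0 mv0 by auto
      then have "y $ i0 \<noteq> 0" by (metis vec_eq_iff zero_index)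
      then have "0 < y $ i0" using y(1) by (simp add: nonneg_vec_def order_less_le)
      then show ?thesis using y(2,3,4) N by (metis less_irrefl scaleR_eq_0_iff singletonD singletonI)
    qed
    ultimately show ?thesis using True by (intro exI[of _ 0]) blast
  next
    case False
    obtain l x where l: "0 \<le> l" and x: "nonneg_vec x" "x \<noteq> 0" "mv alg ?R x = l *\<^sub>R x"
      and dom: "\<And>th y. nonneg_vec y \<Longrightarrow> y \<noteq> 0 \<Longrightarrow> (\<And>i. th * y $ i \<le> mv alg ?R y $ i) \<Longrightarrow> th \<le> l"
      using nonneg_matrix_dominant_eigenvector[OF R, of alg] by metis
    define y :: "real^'n" where "y = (\<chi> i. if i \<in> ?N then 1 else 0)"
    have y: "nonneg_vec y" "y \<noteq> 0" using i0 by (auto simp: y_def nonneg_vec_def vec_eq_iff)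
    have Rpos: "0 < mv alg ?R y $ i" if "i \<in> ?N" for i
    proof -
      obtain j where j: "(i, j) \<in> edges \<mu>" "j \<in> ?N" using strongly_connected_successor[OF sc False \<open>i \<in> ?N\<close>] .
      then have "0 < ?R $ i $ j" using edges_class[OF m] edges_graph_of[OF A] \<open>i \<in> ?N\<close> by (auto simp: restrict_nth)
      then show ?thesis using mv_pos_iff[OF R y(1)] j(2) by (auto simp: y_def)
    qed
    \<comment> \<open>The restricted matrix maps the indicator vector \<open>y\<close> of the class above \<open>th\<close> times \<open>y\<close>.\<close>
    define th where "th = Min ((\<lambda>i. mv alg ?R y $ i) ` ?N)"
    have "0 < th" unfolding th_def using i0 Rpos by (subst Min_gr_iff) auto
    moreover have "th \<le> l"
    proof (rule dom[OF y])
      fix i show "th * y $ i \<le> mv alg ?R y $ i"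
      proof (cases "i \<in> ?N")
        case True
        then show ?thesis unfolding th_def by (auto simp: y_def intro!: Min_le)
      next
        case False
        then show ?thesis by (simp add: y_def mv_restrict_outside)
      qed
    qed
    ultimately have lpos: "0 < l" by simp
    have "x $ i = 0" if "i \<notin> ?N" for i
    proof -
      have "l * x $ i = 0" using mv_restrict_outside[OF that, of alg A x] x(3) by simp
      then show ?thesis using lpos by simp
    qed
    then have Plx: "P l x" using x l by (simp add: P_def)
    have supp: "(\<forall>i. 0 < z $ i \<longleftrightarrow> i \<in> ?N)" if "P k z" for k z
      using submatrix_eigenvector_positive(1)[OF A m False, of z alg k] that unfolding P_def by blast
    have le: "k \<le> k'" if "P k z" "P k' z'" for k k' z z'
      by (rule subeigenvalue_le[OF R, of z' z alg])
        (use supp[OF that(1)] supp[OF that(2)] that in \<open>auto simp: P_def\<close>)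
    show ?thesis
      by (rule exI[of _ l]) (use Plx supp le lpos False in \<open>blast intro: order_antisym\<close>)
  qed
  then obtain l where l: "\<exists>x. P l x" "\<And>k y. P k y \<Longrightarrow> k = l \<and> (\<forall>i. 0 < y $ i \<longleftrightarrow> i \<in> ?N)"
    "0 < l \<longleftrightarrow> edges \<mu> \<noteq> {}" by blast
  have "perron_root alg A ?N = l"
    unfolding perron_root_def PE by (rule the_equality) (use l in blast)+
  then show "\<exists>x. nonneg_vec x \<and> (\<forall>i. 0 < x $ i \<longleftrightarrow> i \<in> nodes \<mu>) \<and>
      mv alg (restrict_mat (nodes \<mu>) A) x = perron_root alg A (nodes \<mu>) *\<^sub>R x"
    and "0 \<le> perron_root alg A (nodes \<mu>)"
    and "0 < perron_root alg A (nodes \<mu>) \<longleftrightarrow> edges \<mu> \<noteq> {}"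
    using l unfolding P_def by blast+
qed

lemma perron_root_le:
  fixes A :: "real^'n^'n::finite"
  assumes A: "nonneg_mat A" and m: "\<mu> \<in> classes A"
    and w: "nonneg_vec w" "\<And>i. i \<in> nodes \<mu> \<Longrightarrow> 0 < w $ i"
      "\<And>i. i \<in> nodes \<mu> \<Longrightarrow> mv alg A w $ i \<le> l * w $ i"
  shows "perron_root alg A (nodes \<mu>) \<le> l"
proof -
  obtain y where y: "nonneg_vec y" "\<And>i. 0 < y $ i \<longleftrightarrow> i \<in> nodes \<mu>"
      "mv alg (restrict_mat (nodes \<mu>) A) y = perron_root alg A (nodes \<mu>) *\<^sub>R y"
    using class_perron(1)[OF A m] by blast
  obtain i where "i \<in> nodes \<mu>" using class_strongly_connected[OF m] by (auto simp: strongly_connected_def)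
  then have "y \<noteq> 0" using y(2)[of i] by auto
  then show ?thesis
  proof (rule subeigenvalue_le[OF nonneg_restrict[OF A] w(1) y(1), of alg "nodes \<mu>" l])
    show "mv alg (restrict_mat (nodes \<mu>) A) w $ i \<le> l * w $ i" if "0 < y $ i" for i
      using mv_restrict_le[OF A w(1), of alg "nodes \<mu>" i] w(3)[of i] y(2) that by force
  qed (use w y in auto)
qed

lemma perron_root_ge:
  fixes A :: "real^'n^'n::finite"
  assumes A: "nonneg_mat A" and m: "\<mu> \<in> classes A"
    and w: "nonneg_vec w" "i0 \<in> nodes \<mu>" "0 < w $ i0"
      "\<And>i. i \<in> nodes \<mu> \<Longrightarrow> l * w $ i \<le> mv alg (restrict_mat (nodes \<mu>) A) w $ i"
  shows "l \<le> perron_root alg A (nodes \<mu>)"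
proof -
  obtain y where y: "nonneg_vec y" "\<And>i. 0 < y $ i \<longleftrightarrow> i \<in> nodes \<mu>"
      "mv alg (restrict_mat (nodes \<mu>) A) y = perron_root alg A (nodes \<mu>) *\<^sub>R y"
    using class_perron(1)[OF A m] by blast
  define v where "v = (\<chi> i. if i \<in> nodes \<mu> then w $ i else 0)"
  have v: "nonneg_vec v" "v \<noteq> 0" using w(1,2,3) by (auto simp: v_def nonneg_vec_def vec_eq_iff intro!: exI[of _ i0])
  have "(\<lambda>j. restrict_mat (nodes \<mu>) A $ i $ j * v $ j) = (\<lambda>j. restrict_mat (nodes \<mu>) A $ i $ j * w $ j)" for i
    by (rule ext) (simp add: restrict_nth v_def)
  then have mvv: "mv alg (restrict_mat (nodes \<mu>) A) v = mv alg (restrict_mat (nodes \<mu>) A) w"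
    by (simp add: vec_eq_iff mv_nth)
  show ?thesis
  proof (rule subeigenvalue_le[OF nonneg_restrict[OF A] y(1) v, of alg "nodes \<mu>"])
    show "0 < y $ i" if "0 < v $ i" for i using that y(2) by (auto simp: v_def split: if_splits)
    show "l * v $ i \<le> mv alg (restrict_mat (nodes \<mu>) A) v $ i" if "0 < v $ i" for i
      using that w(4)[of i] unfolding mvv by (auto simp: v_def split: if_splits)
  qed (use y in auto)
qed

section \<open>Supports of eigenvectors\<close>

lemma eigenvector_support_backward:
  assumes A: "nonneg_mat A" and w: "nonneg_vec w" "mv alg A w = \<rho> *\<^sub>R w"
    and ij: "(i, j) \<in> (edges (graph_of A))\<^sup>*" "0 < w $ j"
  shows "0 < w $ i"
  using ij
proof (induction rule: converse_rtrancl_induct)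
  case (step a b)
  then have "0 < mv alg A w $ a" using mv_pos_iff[OF A w(1)] edges_graph_of[OF A] by blast
  then have "0 < \<rho> * w $ a" by (simp add: w(2))
  then show ?case using w(1) by (metis nonneg_vec_def order_le_less mult_zero_right less_irrefl)
qed simp

lemma periodic_in_core:
  assumes A: "nonneg_mat A" and z: "nonneg_vec z" "mv alg (mpow alg A p) z = \<rho> ^ p *\<^sub>R z"
    and p: "1 \<le> p" and \<rho>: "0 < \<rho>"
  shows "z \<in> core alg A"
  unfolding core_def
proof
  fix k :: nat assume "k \<in> {1..}"
  obtain l where l: "p * k = k + l" using p by (metis le_add_diff_inverse mult.commute mult_le_mono2 mult_1_right)
  let ?y = "(1 / \<rho> ^ (p * k)) *\<^sub>R z"
  have y: "nonneg_vec ?y" using z \<rho> by (simp add: nonneg_vec_def)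
  have "z = mv alg (mpow alg A (p * k)) ?y"
    using periodic_mult[OF A z \<rho>, of k] \<rho> by (simp add: mv_scaleR)
  also have "\<dots> = mv alg (mpow alg A k) (mv alg (mpow alg A l) ?y)"
    unfolding l mpow_add[OF A] by (rule mv_mm[OF mpow_nonneg[OF A] mpow_nonneg[OF A]]) (use y l in simp)
  finally show "z \<in> col_span alg (mpow alg A k)"
    using mv_nonneg[OF mpow_nonneg[OF A] y] unfolding col_span_def by blast
qed

text \<open>The class of \<open>i\<close> accesses no other class that meets \<open>S\<close>.\<close>

definition final_in :: "real^'n^'n \<Rightarrow> 'n set \<Rightarrow> 'n \<Rightarrow> bool" where
  "final_in A S i \<longleftrightarrow> i \<in> S \<and>
     (\<forall>j\<in>S. (i, j) \<in> (edges (graph_of A))\<^sup>* \<longrightarrow> (j, i) \<in> (edges (graph_of A))\<^sup>*)"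

lemma final_reachable:
  fixes A :: "real^'n^'n::finite"
  assumes "i \<in> S"
  obtains f where "final_in A S f" "(i, f) \<in> (edges (graph_of A))\<^sup>*"
proof -
  let ?E = "(edges (graph_of A))\<^sup>*"
  have "\<exists>f. final_in A S f \<and> (i, f) \<in> ?E"
    using assms
  proof (induction "card {j \<in> S. (i, j) \<in> ?E}" arbitrary: i rule: less_induct)
    case less
    show ?case
    proof (cases "final_in A S i")
      case True then show ?thesis by blast
    next
      case False
      then obtain j where j: "j \<in> S" "(i, j) \<in> ?E" "(j, i) \<notin> ?E" using less(2) by (auto simp: final_in_def)
      have "{k \<in> S. (j, k) \<in> ?E} \<subset> {k \<in> S. (i, k) \<in> ?E}"
        using j less(2) by (auto intro: rtrancl_trans)
      then have "card {k \<in> S. (j, k) \<in> ?E} < card {k \<in> S. (i, k) \<in> ?E}"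
        by (intro psubset_card_mono) auto
      then obtain f where "final_in A S f" "(j, f) \<in> ?E" using less(1) j(1) by blast
      then show ?thesis using j(2) by (blast intro: rtrancl_trans)
    qed
  qed
  then show ?thesis using that by blast
qed

lemma exit_edge:
  assumes "(i, j) \<in> E\<^sup>*" "i \<in> N" "j \<notin> N"
  obtains a b where "a \<in> N" "b \<notin> N" "(a, b) \<in> E" "(b, j) \<in> E\<^sup>*"
proof -
  have "\<exists>a b. a \<in> N \<and> b \<notin> N \<and> (a, b) \<in> E \<and> (b, j) \<in> E\<^sup>*"
    using assms by (induction rule: converse_rtrancl_induct) blast+
  then show ?thesis using that by blast
qed

lemma class_of: "i \<in> nodes (scc_of (graph_of A) i)" "scc_of (graph_of A) i \<in> classes A"
  using scc_of_self[of i "graph_of A"] by (simp_all add: classes_def graph_of_def)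

lemma classes_eq:
  "\<mu> \<in> classes A \<Longrightarrow> \<nu> \<in> classes A \<Longrightarrow> i \<in> nodes \<mu> \<Longrightarrow> i \<in> nodes \<nu> \<Longrightarrow> \<mu> = \<nu>"
  unfolding classes_def by (rule sccs_unique)

lemma walk_in_class:
  assumes m: "\<mu> \<in> classes A" and ij: "(i, j) \<in> edges (graph_of A) ^^ l" "i \<in> nodes \<mu>" "j \<in> nodes \<mu>"
  shows "(i, j) \<in> edges \<mu> ^^ l"
proof (rule walk_in_scc[OF _ _ ij])
  show "edges (graph_of A) \<subseteq> nodes (graph_of A) \<times> nodes (graph_of A)" by (simp add: graph_of_def)
  show "\<mu> \<in> sccs (graph_of A)" using m by (simp add: classes_def)
qed

section \<open>Cycles of normalized extremals\<close>

text \<open>The list that witnesses the cycle runs through the indices downwards, since \<open>A\<close> lowers the index.\<close>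

lemma simple_cycle_under_indexed:
  fixes h :: "nat \<Rightarrow> real^'n::finite"
  assumes d: "0 < d" and inj: "inj_on h {..<d}"
    and step: "\<And>k. k < d \<Longrightarrow> \<exists>c>0. mv alg A (h (Suc k mod d)) = c *\<^sub>R h k"
  shows "simple_cycle_under alg A (h ` {..<d})"
  unfolding simple_cycle_under_def
proof (rule exI[of _ "map h (rev [0..<d])"], intro conjI allI impI)
  let ?xs = "map h (rev [0..<d])"
  show "distinct ?xs" using inj by (simp add: distinct_map atLeast0LessThan)
  show "set ?xs = h ` {..<d}" by (simp add: atLeast0LessThan)
  fix k assume k: "k < length ?xs"
  have nth: "?xs ! j = h (d - Suc j)" if "j < d" for j using that by (simp add: rev_nth)
  show "\<exists>c>0. mv alg A (?xs ! k) = c *\<^sub>R ?xs ! (Suc k mod length ?xs)"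
  proof (cases "Suc k = d")
    case True
    then have "d - Suc 0 = k" by simp
    then show ?thesis using step[of k] k nth[of k] nth[of 0] True d by simp
  next
    case False
    then have "Suc k < d" using k by simp
    moreover from this have "Suc (d - Suc (Suc k)) = d - Suc k" by simp
    ultimately show ?thesis using step[of "d - Suc (Suc k)"] nth[of k] nth[of "Suc k"] by simp
  qed
qed

lemma Max_nth_pos:
  fixes x :: "real^'n::finite"
  assumes "nonneg_vec x" "x \<noteq> 0" shows "0 < (MAX i. x $ i)"
proof -
  obtain i where "0 < x $ i" using assms by (auto simp: vec_eq_iff nonneg_vec_def order_less_le)
  also have "x $ i \<le> (MAX i. x $ i)" by simp
  finally show ?thesis .
qed

lemma Max_nth_scaleR:
  fixes x :: "real^'n::finite"
  assumes "0 \<le> a" shows "(MAX i. (a *\<^sub>R x) $ i) = a * (MAX i. x $ i)"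
  using ssum_scale[OF assms, of MaxAlg "\<lambda>i. x $ i"] by (simp add: ssum_def)

lemma normalization_normalized:
  assumes "nonneg_vec x" "x \<noteq> 0" shows "normalized (normalization x)"
  unfolding normalized_def
proof
  note pos = Max_nth_pos[OF assms]
  show "nonneg_vec (normalization x)" using assms pos by (simp add: normalization_def nonneg_vec_def)
  show "(MAX i. normalization x $ i) = 1"
    unfolding normalization_def using pos by (subst Max_nth_scaleR) auto
qed

lemma normalization_scaleR:
  assumes "0 < a" shows "normalization (a *\<^sub>R x) = normalization x"
  unfolding normalization_def using assms by (subst Max_nth_scaleR) auto

lemma normalization_of_normalized: "normalized x \<Longrightarrow> normalization x = x"
  by (simp add: normalization_def normalized_def)

lemma normalization_multiple:
  assumes "nonneg_vec x" "x \<noteq> 0" obtains b where "0 < b" "normalization x = b *\<^sub>R x"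
  using Max_nth_pos[OF assms] that[of "1 / (MAX i. x $ i)"] by (simp add: normalization_def)

lemma normalized_extremals_eq:
  assumes X: "\<And>p. p \<in> I \<Longrightarrow> nonneg_vec (X p) \<and> X p \<noteq> 0"
    and ext: "extremals alg V = {a *\<^sub>R X p | a p. 0 < a \<and> p \<in> I}"
  shows "normalized_extremals alg V = (\<lambda>p. normalization (X p)) ` I"
proof
  show "normalized_extremals alg V \<subseteq> (\<lambda>p. normalization (X p)) ` I"
  proof
    fix z assume "z \<in> normalized_extremals alg V"
    then obtain a p where "z = a *\<^sub>R X p" "0 < a" "p \<in> I" "normalized z"
      unfolding normalized_extremals_def ext by blast
    then show "z \<in> (\<lambda>p. normalization (X p)) ` I"
      using normalization_of_normalized[of z] normalization_scaleR[of a "X p"] by (intro image_eqI[of _ _ p]) auto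
  qed
  show "(\<lambda>p. normalization (X p)) ` I \<subseteq> normalized_extremals alg V"
  proof
    fix z assume "z \<in> (\<lambda>p. normalization (X p)) ` I"
    then obtain p where p: "p \<in> I" "z = normalization (X p)" by blast
    obtain b where "0 < b" "z = b *\<^sub>R X p" using normalization_multiple X[OF p(1)] p(2) by metis
    moreover have "normalized z" unfolding p(2) by (rule normalization_normalized) (use X[OF p(1)] in auto)
    ultimately show "z \<in> normalized_extremals alg V"
      using p(1) unfolding normalized_extremals_def ext by blast
  qed
qed

section \<open>Spectral classes in nonnegative algebra\<close>

lemma class_in_support:
  assumes A: "nonneg_mat A" and w: "nonneg_vec w" "mv alg A w = \<rho> *\<^sub>R w"
    and m: "\<mu> \<in> classes A" "i \<in> nodes \<mu>" "(i, j) \<in> (edges (graph_of A))\<^sup>*" "0 < w $ j"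
    and k: "k \<in> nodes \<mu>"
  shows "0 < w $ k"
  using eigenvector_support_backward[OF A w _ m(4)] class_access[OF m(1) k m(2)] m(3) by (meson rtrancl_trans)

text \<open>If the Perron root were \<open>\<rho>\<close>, let a multiple of \<open>w\<close> touch the Perron vector from above. The equation at
a point of contact forces contact at all successors, hence on the whole class, and excludes any
contribution of \<open>w\<close> from outside the class, contrary to the edge \<open>(a, b)\<close>.\<close>

lemma perron_root_nonfinal:
  fixes A :: "real^'n^'n::finite"
  assumes A: "nonneg_mat A" and w: "nonneg_vec w" "A *v w = \<rho> *\<^sub>R w"
    and m: "\<mu> \<in> classes A" "\<And>i. i \<in> nodes \<mu> \<Longrightarrow> 0 < w $ i"
    and exit: "a \<in> nodes \<mu>" "b \<notin> nodes \<mu>" "(a, b) \<in> edges (graph_of A)" "0 < w $ b"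
  shows "perron_root Nonneg A (nodes \<mu>) < \<rho>"
proof -
  let ?r = "perron_root Nonneg A (nodes \<mu>)" and ?R = "restrict_mat (nodes \<mu>) A"
  have le: "?r \<le> \<rho>" by (rule perron_root_le[OF A m(1) w(1)]) (simp_all add: w(2) m(2))
  have "?r \<noteq> \<rho>"
  proof
    assume eq: "?r = \<rho>"
    obtain y where y: "nonneg_vec y" "\<And>i. 0 < y $ i \<longleftrightarrow> i \<in> nodes \<mu>" "mv Nonneg ?R y = \<rho> *\<^sub>R y"
      using class_perron(1)[OF A m(1), of Nonneg] eq by auto
    have "y \<noteq> 0" using y(2)[of a] exit(1) by auto
    then obtain t i0 where t: "0 < t" "0 < y $ i0" "y $ i0 = t * w $ i0" "\<And>j. y $ j \<le> t * w $ j"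
      using max_ratio_attained[OF w(1) y(1)] m(2) y(2) by metis
    have tight: "?R $ i $ j * y $ j = A $ i $ j * (t * w $ j)" if i: "i \<in> nodes \<mu>" "y $ i = t * w $ i" for i j
    proof -
      have le: "?R $ i $ j * y $ j \<le> A $ i $ j * (t * w $ j)" for j
        using A t(1,4) y(1) w(1) by (intro mult_mono) (auto simp: restrict_nth nonneg_mat_def nonneg_vec_def)
      have "(\<Sum>j\<in>UNIV. ?R $ i $ j * y $ j) = \<rho> * y $ i"
        using arg_cong[OF y(3), of "\<lambda>x. x $ i"] by (simp add: matrix_vector_mult_def)
      moreover have "(\<Sum>j\<in>UNIV. A $ i $ j * (t * w $ j)) = t * (\<rho> * w $ i)"
      proof -
        have "(\<Sum>j\<in>UNIV. A $ i $ j * w $ j) = \<rho> * w $ i"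
          using arg_cong[OF w(2), of "\<lambda>x. x $ i"] by (simp add: matrix_vector_mult_def)
        then show ?thesis by (simp add: sum_distrib_left[symmetric] mult.left_commute)
      qed
      ultimately have "(\<Sum>j\<in>UNIV. A $ i $ j * (t * w $ j) - ?R $ i $ j * y $ j) = 0"
        using i(2) by (simp add: sum_subtractf)
      then have "A $ i $ j * (t * w $ j) - ?R $ i $ j * y $ j = 0"
        by (subst (asm) sum_nonneg_eq_0_iff) (use le in auto)
      then show ?thesis by simp
    qed
    have all: "y $ i = t * w $ i" if "i \<in> nodes \<mu>" for i
    proof -
      have "(i0, i) \<in> (edges \<mu>)\<^sup>*"
        using class_strongly_connected[OF m(1)] t(2) y(2) that by (auto simp: strongly_connected_def)
      then show ?thesis
      proof (induction rule: rtrancl_induct)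
        case (step j k)
        then have jk: "j \<in> nodes \<mu>" "k \<in> nodes \<mu>" "0 < A $ j $ k"
          using edges_class[OF m(1)] edges_graph_of[OF A] by auto
        then show ?case using tight[OF jk(1) step(3), of k] by (simp add: restrict_nth)
      qed (rule t(3))
    qed
    have "0 < A $ a $ b" using exit(3) edges_graph_of[OF A] by blast
    then show False using tight[OF exit(1) all[OF exit(1)], of b] exit(2,4) t(1) by (simp add: restrict_nth)
  qed
  then show ?thesis using le by simp
qed

text \<open>In the support of \<open>w\<close> no edge leaves a final class, so \<open>w\<close> restricts to an eigenvector on it.\<close>

lemma final_class_root:
  fixes A :: "real^'n^'n::finite"
  assumes A: "nonneg_mat A" and w: "nonneg_vec w" "A *v w = \<rho> *\<^sub>R w"
    and f: "final_in A {i. 0 < w $ i} f" and m: "\<mu> \<in> classes A" "f \<in> nodes \<mu>"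
  shows "perron_root Nonneg A (nodes \<mu>) = \<rho>"
proof -
  have w': "mv Nonneg A w = \<rho> *\<^sub>R w" using w(2) by simp
  have wf: "0 < w $ f" using f by (simp add: final_in_def)
  have pos: "0 < w $ k" if "k \<in> nodes \<mu>" for k
    by (rule class_in_support[OF A w(1) w' m _ wf that]) simp
  have "mv Nonneg (restrict_mat (nodes \<mu>) A) w $ i = mv Nonneg A w $ i" if i: "i \<in> nodes \<mu>" for i
  proof -
    have eq: "restrict_mat (nodes \<mu>) A $ i $ j * w $ j = A $ i $ j * w $ j" for j
    proof (cases "j \<in> nodes \<mu>")
      case False
      have "A $ i $ j * w $ j = 0"
      proof (rule ccontr)
        assume "A $ i $ j * w $ j \<noteq> 0"
        then have "0 < w $ j" "(i, j) \<in> edges (graph_of A)"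
          using w(1) by (auto simp: graph_of_def nonneg_vec_def order_less_le)
        then have fj: "(f, j) \<in> (edges (graph_of A))\<^sup>*"
          using rtrancl_into_rtrancl[OF class_access[OF m(1,2) i]] by blast
        then have "(j, f) \<in> (edges (graph_of A))\<^sup>*" using f \<open>0 < w $ j\<close> by (simp add: final_in_def)
        then show False using class_mutual_access[OF m fj] False by simp
      qed
      then show ?thesis using False by (simp add: restrict_nth)
    qed (use i in \<open>simp add: restrict_nth\<close>)
    show ?thesis by (simp only: mv_nth eq)
  qed
  then have "\<rho> \<le> perron_root Nonneg A (nodes \<mu>)"
    using w(2) by (intro perron_root_ge[OF A m(1) w(1) m(2) wf]) simp
  moreover have "perron_root Nonneg A (nodes \<mu>) \<le> \<rho>"
    by (rule perron_root_le[OF A m(1) w(1)]) (simp_all add: w(2) pos)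
  ultimately show ?thesis by simp
qed

text \<open>Any other class that accesses the class of \<open>f\<close> lies in the support of \<open>w\<close> and has an edge leaving it
there, so \<open>perron_root_nonfinal\<close> applies.\<close>

lemma final_class_spectral:
  fixes A :: "real^'n^'n::finite"
  assumes A: "nonneg_mat A" and w: "nonneg_vec w" "A *v w = \<rho> *\<^sub>R w" and \<rho>: "0 < \<rho>"
    and f: "final_in A {i. 0 < w $ i} f"
  shows "spectral Nonneg A \<rho> (scc_of (graph_of A) f)"
proof -
  let ?\<nu> = "scc_of (graph_of A) f"
  have w': "mv Nonneg A w = \<rho> *\<^sub>R w" using w(2) by simp
  note \<nu> = class_of(2)[of A f] class_of(1)[of f A]
  have root: "perron_root Nonneg A (nodes ?\<nu>) = \<rho>" by (rule final_class_root[OF A w f \<nu>])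
  have wf: "0 < w $ f" using f by (simp add: final_in_def)
  have "perron_root Nonneg A (nodes \<mu>) < \<rho>"
    if m: "\<mu> \<in> classes A" "class_accesses A \<mu> ?\<nu>" "\<mu> \<noteq> ?\<nu>" for \<mu>
  proof -
    obtain i j where ij: "i \<in> nodes \<mu>" "j \<in> nodes ?\<nu>" "(i, j) \<in> (edges (graph_of A))\<^sup>*"
      using m(2,3) by (auto simp: class_accesses_def node_accesses_def)
    have wj: "0 < w $ j" by (rule class_in_support[OF A w(1) w' \<nu> _ wf ij(2)]) simp
    have pos: "0 < w $ k" if "k \<in> nodes \<mu>" for k
      by (rule class_in_support[OF A w(1) w' m(1) ij(1,3) wj that])
    have "j \<notin> nodes \<mu>" using classes_eq[OF m(1) \<nu>(1) _ ij(2)] m(3) by blast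
    then obtain a b where ab: "a \<in> nodes \<mu>" "b \<notin> nodes \<mu>" "(a, b) \<in> edges (graph_of A)"
      "(b, j) \<in> (edges (graph_of A))\<^sup>*" using exit_edge[OF ij(3,1)] by blast
    show ?thesis
      using perron_root_nonfinal[OF A w m(1) pos ab(1-3)] eigenvector_support_backward[OF A w(1) w' ab(4) wj] by blast
  qed
  then show ?thesis using root \<rho> \<nu>(1) by (simp add: spectral_def)
qed

lemma spectral_class:
  assumes A: "nonneg_mat A" and s: "spectral alg A \<rho> \<nu>"
  shows "\<nu> \<in> classes A" "0 < \<rho>" "edges \<nu> \<noteq> {}" "strongly_connected \<nu>" "0 < sc_cyclicity \<nu>"
proof -
  show m: "\<nu> \<in> classes A" using s by (simp add: spectral_def)
  show \<rho>: "0 < \<rho>" using s class_perron(2)[OF A m, of alg] by (auto simp: spectral_def)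
  show e: "edges \<nu> \<noteq> {}" using \<rho> s class_perron(3)[OF A m, of alg] by (auto simp: spectral_def)
  show "strongly_connected \<nu>" by (rule class_strongly_connected[OF m])
  then show "0 < sc_cyclicity \<nu>" using e by (rule cyclicity_pos)
qed

lemma node_in_class_accesses: "i \<in> nodes \<nu> \<Longrightarrow> node_accesses A i \<nu>"
  by (auto simp: node_accesses_def)

lemma node_accesses_backward:
  "(i, j) \<in> (edges (graph_of A))\<^sup>* \<Longrightarrow> node_accesses A j \<nu> \<Longrightarrow> node_accesses A i \<nu>"
  by (auto simp: node_accesses_def intro: rtrancl_trans)

lemma class_node_accesses:
  assumes "\<nu> \<in> classes A" "node_accesses A i \<nu>" "j \<in> nodes \<nu>"
  shows "(i, j) \<in> (edges (graph_of A))\<^sup>*"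
proof -
  obtain k where k: "k \<in> nodes \<nu>" "(i, k) \<in> (edges (graph_of A))\<^sup>*" using assms(2) by (auto simp: node_accesses_def)
  show ?thesis using k(2) class_access[OF assms(1) k(1) assms(3)] by (rule rtrancl_trans)
qed

text \<open>Take the dominant eigenvector of \<open>A\<close> restricted to the nodes that access \<open>\<nu>\<close>, with eigenvalue
\<open>l \<ge> \<rho>\<close>. A final class of its support has Perron root \<open>l\<close>, while all classes that access \<open>\<nu>\<close>, except
\<open>\<nu>\<close> itself, have smaller Perron roots than \<open>\<rho>\<close>. So this final class is \<open>\<nu>\<close>.\<close>

lemma spectral_class_eigenvector:
  fixes A :: "real^'n^'n::finite"
  assumes A: "nonneg_mat A" and s: "spectral Nonneg A \<rho> \<nu>"
  shows "\<exists>x. nonneg_vec x \<and> A *v x = \<rho> *\<^sub>R x \<and> (\<forall>i. 0 < x $ i \<longleftrightarrow> node_accesses A i \<nu>)"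
proof -
  note \<nu> = spectral_class[OF A s]
  have root: "perron_root Nonneg A (nodes \<nu>) = \<rho>" using s by (simp add: spectral_def)
  define N where "N = {i. node_accesses A i \<nu>}"
  let ?B = "restrict_mat N A"
  have sub: "nodes \<nu> \<subseteq> N" by (auto simp: N_def node_in_class_accesses)
  note B = nonneg_restrict[OF A, of N]
  obtain l x where l: "0 \<le> l" and x: "nonneg_vec x" "x \<noteq> 0" "mv Nonneg ?B x = l *\<^sub>R x"
    and dom: "\<And>th y. nonneg_vec y \<Longrightarrow> y \<noteq> 0 \<Longrightarrow> (\<And>i. th * y $ i \<le> mv Nonneg ?B y $ i) \<Longrightarrow> th \<le> l"
    using nonneg_matrix_dominant_eigenvector[OF B, of Nonneg] by metis
  have le: "\<rho> \<le> l"
  proof -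
    obtain y where y: "nonneg_vec y" "\<And>i. 0 < y $ i \<longleftrightarrow> i \<in> nodes \<nu>"
      "mv Nonneg (restrict_mat (nodes \<nu>) A) y = \<rho> *\<^sub>R y" using class_perron(1)[OF A \<nu>(1), of Nonneg] root by auto
    obtain k where "k \<in> nodes \<nu>" using \<nu>(4) by (auto simp: strongly_connected_def)
    then have "y \<noteq> 0" using y(2)[of k] by auto
    moreover have "\<rho> * y $ i \<le> mv Nonneg ?B y $ i" for i
    proof -
      have "mv Nonneg (restrict_mat (nodes \<nu>) A) y $ i \<le> mv Nonneg ?B y $ i"
        unfolding mv_nth using A y(1) sub
        by (intro ssum_mono mult_right_mono) (auto simp: restrict_nth nonneg_mat_def nonneg_vec_def)
      then show ?thesis unfolding y(3) by simp
    qed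
    ultimately show ?thesis using dom y(1) by blast
  qed
  then have lpos: "0 < l" using \<nu>(2) by simp
  have xN: "x $ i = 0" if "i \<notin> N" for i
  proof -
    have "l * x $ i = 0" using mv_restrict_outside[OF that, of Nonneg A x] unfolding x(3) by simp
    then show ?thesis using lpos by simp
  qed
  have "mv Nonneg A x $ i = l * x $ i" for i
  proof (cases "i \<in> N")
    case True
    have "(\<lambda>j. ?B $ i $ j * x $ j) = (\<lambda>j. A $ i $ j * x $ j)"
      by (rule ext) (use True xN in \<open>simp add: restrict_nth\<close>)
    then have "mv Nonneg ?B x $ i = mv Nonneg A x $ i" by (simp only: mv_nth)
    then show ?thesis unfolding x(3) by simp
  next
    case False
    have Ax0: "A $ i $ j * x $ j = 0" for j
    proof (cases "j \<in> N")
      case True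
      have "(i, j) \<notin> edges (graph_of A)"
        using node_accesses_backward[of i j A \<nu>] True False by (auto simp: N_def)
      then show ?thesis by (simp add: graph_of_def)
    qed (simp add: xN)
    then show ?thesis using xN[OF False] by (simp only: mv_nth Ax0 ssum_const0 mult_zero_right)
  qed
  then have Ax: "A *v x = l *\<^sub>R x" by (simp add: vec_eq_iff)
  then have Ax': "mv Nonneg A x = l *\<^sub>R x" by simp
  obtain i where "0 < x $ i" using x(1,2) by (auto simp: vec_eq_iff nonneg_vec_def order_less_le)
  then obtain f where f: "final_in A {i. 0 < x $ i} f" using final_reachable[of i "{i. 0 < x $ i}" A] by blast
  have xf: "0 < x $ f" using f by (simp add: final_in_def)
  then have fN: "node_accesses A f \<nu>" using xN[of f] by (force simp: N_def)
  have lf: "perron_root Nonneg A (nodes (scc_of (graph_of A) f)) = l"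
    by (rule final_class_root[OF A x(1) Ax f class_of(2) class_of(1)])
  have "scc_of (graph_of A) f = \<nu>"
  proof (rule ccontr)
    assume ne: "scc_of (graph_of A) f \<noteq> \<nu>"
    have "class_accesses A (scc_of (graph_of A) f) \<nu>"
      using fN class_of(1)[of f A] by (auto simp: class_accesses_def)
    then have "l < \<rho>" using s ne class_of(2)[of A f] lf by (auto simp: spectral_def)
    then show False using le by simp
  qed
  then have fv: "f \<in> nodes \<nu>" and "l = \<rho>" using class_of(1)[of f A] lf root by auto
  moreover have "0 < x $ i \<longleftrightarrow> node_accesses A i \<nu>" for i
  proof
    assume "0 < x $ i" then show "node_accesses A i \<nu>" using xN[of i] by (force simp: N_def)
  next
    assume "node_accesses A i \<nu>"
    then have "(i, f) \<in> (edges (graph_of A))\<^sup>*" using class_node_accesses[OF \<nu>(1)] fv by blast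
    then show "0 < x $ i" using eigenvector_support_backward[OF A x(1) Ax'] xf by blast
  qed
  ultimately show ?thesis using x(1) Ax by blast
qed

text \<open>A minimum principle. The nodes where \<open>d / w\<close> is minimal form a set that is closed under walks of
length divisible by \<open>m\<close> within the support of \<open>w\<close>, so it meets a final class. A negative minimum would
thus be attained on a final class.\<close>

lemma nonneg_if_nonneg_on_final_classes:
  fixes A :: "real^'n^'n::finite"
  assumes A: "nonneg_mat A" and w: "nonneg_vec w" "A *v w = \<rho> *\<^sub>R w" and \<rho>: "0 < \<rho>"
    and d: "\<And>i. d $ i \<noteq> 0 \<Longrightarrow> 0 < w $ i" "\<And>k. mpow Nonneg A (m * k) *v d = \<rho> ^ (m * k) *\<^sub>R d"
    and m: "1 \<le> m" and fin: "\<And>f. final_in A {i. 0 < w $ i} f \<Longrightarrow> 0 \<le> d $ f"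
  shows "0 \<le> d $ i"
proof (rule ccontr)
  assume neg: "\<not> 0 \<le> d $ i"
  let ?S = "{i. 0 < w $ i}" and ?E = "edges (graph_of A)"
  have w': "mv Nonneg A w = \<rho> *\<^sub>R w" using w(2) by simp
  have wk: "mpow Nonneg A k *v w = \<rho> ^ k *\<^sub>R w" for k
    using periodic_mult[OF A w(1), of Nonneg 1 \<rho> k] w' \<rho> by (simp add: mpow_1[OF A])
  define t where "t = Min ((\<lambda>i. d $ i / w $ i) ` ?S)"
  have iS: "i \<in> ?S" using d(1)[of i] neg by auto
  have "t \<in> (\<lambda>i. d $ i / w $ i) ` ?S" unfolding t_def by (rule Min_in) (use iS in auto)
  then obtain j where j: "0 < w $ j" "t = d $ j / w $ j" by auto
  have dt: "0 \<le> d $ k - t * w $ k" for k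
  proof (cases "k \<in> ?S")
    case True
    then have "t \<le> d $ k / w $ k" unfolding t_def by (intro Min_le) auto
    then show ?thesis using True by (simp add: field_simps)
  next
    case False
    then have "w $ k = 0" "d $ k = 0" using w(1) d(1)[of k] by (auto simp: nonneg_vec_def order_less_le)
    then show ?thesis by simp
  qed
  have "t \<le> d $ i / w $ i" unfolding t_def using iS by (intro Min_le) auto
  also have "\<dots> < 0" using neg iS by (simp add: divide_neg_pos)
  finally have tneg: "t < 0" .
  have closed: "d $ f = t * w $ f" if f: "(j, f) \<in> ?E ^^ (m * k)" for f k
  proof -
    let ?P = "mpow Nonneg A (m * k)"
    have "(\<Sum>l\<in>UNIV. ?P $ j $ l * (d $ l - t * w $ l)) = \<rho> ^ (m * k) * d $ j - t * (\<rho> ^ (m * k) * w $ j)"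
    proof -
      have "(\<Sum>l\<in>UNIV. ?P $ j $ l * d $ l) = \<rho> ^ (m * k) * d $ j"
        using arg_cong[OF d(2)[of k], of "\<lambda>x. x $ j"] by (simp add: matrix_vector_mult_def)
      moreover have "(\<Sum>l\<in>UNIV. ?P $ j $ l * w $ l) = \<rho> ^ (m * k) * w $ j"
        using arg_cong[OF wk[of "m * k"], of "\<lambda>x. x $ j"] by (simp add: matrix_vector_mult_def)
      ultimately show ?thesis
        by (simp add: right_diff_distrib sum_subtractf mult.left_commute sum_distrib_left[symmetric])
    qed
    also have "\<dots> = 0" using j by simp
    finally have "?P $ j $ f * (d $ f - t * w $ f) = 0"
      by (subst (asm) sum_nonneg_eq_0_iff)
        (use dt mpow_nonneg[OF A, of Nonneg] in \<open>auto simp: nonneg_mat_def\<close>)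
    moreover have "0 < ?P $ j $ f" using mpow_pos_iff[OF A] f by blast
    ultimately show ?thesis by simp
  qed
  obtain f where f: "final_in A ?S f" "(j, f) \<in> ?E\<^sup>*"
    using final_reachable[of j ?S A] j(1) by blast
  obtain l where l: "(j, f) \<in> ?E ^^ l" using f(2) rtrancl_imp_relpow by blast
  let ?\<nu> = "scc_of (graph_of A) f"
  note \<nu> = spectral_class[OF A final_class_spectral[OF A w \<rho> f(1)]]
  have "\<exists>g\<in>nodes ?\<nu>. (f, g) \<in> ?E ^^ e" for e
  proof (induction e)
    case 0 then show ?case using class_of(1)[of f A] by auto
  next
    case (Suc e)
    then obtain g where g: "g \<in> nodes ?\<nu>" "(f, g) \<in> ?E ^^ e" by blast
    obtain h where "(g, h) \<in> edges ?\<nu>" "h \<in> nodes ?\<nu>" using strongly_connected_successor[OF \<nu>(4,3) g(1)] .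
    then show ?case using g(2) edges_class[OF \<nu>(1)] by (auto intro!: bexI[of _ h])
  qed
  \<comment> \<open>Prolong the walk within the final class to length \<open>m * l\<close>.\<close>
  then obtain g where g: "g \<in> nodes ?\<nu>" "(f, g) \<in> ?E ^^ (m * l - l)" by blast
  have "(j, g) \<in> ?E ^^ (l + (m * l - l))" using l g(2) unfolding relpow_add by blast
  moreover have "l + (m * l - l) = m * l" using m by simp
  ultimately have dg: "d $ g = t * w $ g" using closed[of g l] by simp
  have gf: "(g, f) \<in> ?E\<^sup>*" "(f, g) \<in> ?E\<^sup>*"
    using class_access[OF \<nu>(1)] g(1) class_of(1)[of f A] by blast+
  have wg: "0 < w $ g"
    using eigenvector_support_backward[OF A w(1) w' gf(1)] f(1) by (simp add: final_in_def)
  have "final_in A ?S g"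
    using f(1) wg gf unfolding final_in_def by (blast intro: rtrancl_trans)
  then have "0 \<le> d $ g" by (rule fin)
  moreover have "t * w $ g < 0" using tneg wg by (simp add: mult_neg_pos)
  ultimately show False using dg by simp
qed

section \<open>Periodic vectors on a spectral class\<close>

definition class_eigenvector :: "real^'n^'n \<Rightarrow> real \<Rightarrow> 'n graph \<Rightarrow> real^'n::finite" where
  "class_eigenvector A \<rho> \<nu> = (SOME x. nonneg_vec x \<and> A *v x = \<rho> *\<^sub>R x \<and> (\<forall>i. 0 < x $ i \<longleftrightarrow> node_accesses A i \<nu>))"

lemma class_eigenvector:
  fixes A :: "real^'n^'n::finite"
  assumes A: "nonneg_mat A" and s: "spectral Nonneg A \<rho> \<nu>"
  shows "nonneg_vec (class_eigenvector A \<rho> \<nu>)" "A *v class_eigenvector A \<rho> \<nu> = \<rho> *\<^sub>R class_eigenvector A \<rho> \<nu>"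
    "0 < class_eigenvector A \<rho> \<nu> $ i \<longleftrightarrow> node_accesses A i \<nu>"
  using someI_ex[OF spectral_class_eigenvector[OF A s]] unfolding class_eigenvector_def[symmetric] by auto

lemma eigenvector_mpow:
  assumes A: "nonneg_mat A" and w: "nonneg_vec w" "A *v w = \<rho> *\<^sub>R w" and \<rho>: "0 < \<rho>"
  shows "mpow Nonneg A k *v w = \<rho> ^ k *\<^sub>R w"
  using periodic_mult[OF A w(1), of Nonneg 1 \<rho> k] w(2) \<rho> by (simp add: mpow_1[OF A])

lemma periodic_power:
  assumes A: "nonneg_mat A" and z: "nonneg_vec z" "mpow Nonneg A m *v z = \<rho> ^ m *\<^sub>R z" and \<rho>: "0 < \<rho>"
  shows "mpow Nonneg A (m * k) *v z = \<rho> ^ (m * k) *\<^sub>R z"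
  using periodic_mult[OF A z(1), of Nonneg m \<rho> k] z(2) \<rho> by simp

lemma final_in_access_set:
  fixes A :: "real^'n^'n::finite"
  assumes A: "nonneg_mat A" and s: "spectral Nonneg A \<rho> \<nu>"
    and f: "final_in A {i. 0 < class_eigenvector A \<rho> \<nu> $ i} f"
  shows "f \<in> nodes \<nu>"
proof -
  note \<nu> = spectral_class[OF A s]
  have fa: "node_accesses A f \<nu>" using f class_eigenvector(3)[OF A s] by (simp add: final_in_def)
  obtain j where j: "j \<in> nodes \<nu>" using \<nu>(4) by (auto simp: strongly_connected_def)
  have fj: "(f, j) \<in> (edges (graph_of A))\<^sup>*" by (rule class_node_accesses[OF \<nu>(1) fa j])
  have "0 < class_eigenvector A \<rho> \<nu> $ j" using class_eigenvector(3)[OF A s] node_in_class_accesses[OF j] by blast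
  then have "(j, f) \<in> (edges (graph_of A))\<^sup>*" using f fj by (simp add: final_in_def)
  then show ?thesis using class_mutual_access[OF \<nu>(1) j] fj by blast
qed

text \<open>The class \<open>\<nu>\<close> is the only final class among the nodes that access it, so the minimum principle applies
to both differences.\<close>

lemma periodic_unique_on_class:
  fixes A :: "real^'n^'n::finite"
  assumes A: "nonneg_mat A" and s: "spectral Nonneg A \<rho> \<nu>" and m: "1 \<le> m"
    and u: "nonneg_vec u" "mpow Nonneg A m *v u = \<rho> ^ m *\<^sub>R u" "\<And>i. 0 < u $ i \<Longrightarrow> node_accesses A i \<nu>"
    and v: "nonneg_vec v" "mpow Nonneg A m *v v = \<rho> ^ m *\<^sub>R v" "\<And>i. 0 < v $ i \<Longrightarrow> node_accesses A i \<nu>"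
    and eq: "\<And>i. i \<in> nodes \<nu> \<Longrightarrow> u $ i = v $ i"
  shows "u = v"
proof -
  note \<nu> = spectral_class[OF A s]
  note w = class_eigenvector[OF A s]
  have le: "0 \<le> (u - v) $ i"
    if u: "nonneg_vec u" "mpow Nonneg A m *v u = \<rho> ^ m *\<^sub>R u" "\<And>i. 0 < u $ i \<Longrightarrow> node_accesses A i \<nu>"
    and v: "nonneg_vec v" "mpow Nonneg A m *v v = \<rho> ^ m *\<^sub>R v" "\<And>i. 0 < v $ i \<Longrightarrow> node_accesses A i \<nu>"
    and eq: "\<And>i. i \<in> nodes \<nu> \<Longrightarrow> u $ i = v $ i" for u v i
  proof (rule nonneg_if_nonneg_on_final_classes[OF A w(1,2) \<nu>(2) _ _ m])
    show "0 < class_eigenvector A \<rho> \<nu> $ i" if "(u - v) $ i \<noteq> 0" for i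
    proof -
      have "0 < u $ i \<or> 0 < v $ i"
        using that u(1) v(1) by (cases "u $ i = 0"; cases "v $ i = 0") (auto simp: nonneg_vec_def order_less_le)
      then show ?thesis using u(3)[of i] v(3)[of i] w(3)[of i] by blast
    qed
    show "mpow Nonneg A (m * k) *v (u - v) = \<rho> ^ (m * k) *\<^sub>R (u - v)" for k
      using periodic_power[OF A u(1,2) \<nu>(2)] periodic_power[OF A v(1,2) \<nu>(2)]
      by (simp add: matrix_vector_mult_diff_distrib scaleR_right_diff_distrib)
    show "0 \<le> (u - v) $ f" if "final_in A {i. 0 < class_eigenvector A \<rho> \<nu> $ i} f" for f
      using eq[OF final_in_access_set[OF A s that]] by simp
  qed
  have "0 \<le> (u - v) $ i" "0 \<le> (v - u) $ i" for i
    by (rule le; use u v eq in simp)+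
  then have "u $ i = v $ i" for i by (simp add: order_antisym)
  then show ?thesis by (simp add: vec_eq_iff)
qed

text \<open>Walks of length \<open>l\<close> within \<open>\<nu>\<close> raise the cyclic index by \<open>l\<close>, and a walk that starts in \<open>\<nu>\<close> and ends at
a node that accesses \<open>\<nu>\<close> stays in \<open>\<nu>\<close>.\<close>

lemma power_on_cyclic_part:
  fixes A :: "real^'n^'n::finite"
  assumes A: "nonneg_mat A" and s: "spectral Nonneg A \<rho> \<nu>"
    and v: "\<And>i. v $ i \<noteq> 0 \<Longrightarrow> node_accesses A i \<nu>"
    "\<And>i. i \<in> nodes \<nu> \<Longrightarrow> v $ i = (if cyclic_index \<nu> i = k then class_eigenvector A \<rho> \<nu> $ i else 0)"
    and i: "i \<in> nodes \<nu>"
  shows "(mpow Nonneg A l *v v) $ i =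
    (if (cyclic_index \<nu> i + l) mod sc_cyclicity \<nu> = k then \<rho> ^ l * class_eigenvector A \<rho> \<nu> $ i else 0)"
proof -
  note \<nu> = spectral_class[OF A s]
  note w = class_eigenvector[OF A s]
  let ?P = "mpow Nonneg A l" and ?x = "class_eigenvector A \<rho> \<nu>"
  have reach: "j \<in> nodes \<nu> \<and> cyclic_index \<nu> j = (cyclic_index \<nu> i + l) mod sc_cyclicity \<nu>"
    if j: "node_accesses A j \<nu>" "?P $ i $ j \<noteq> 0" for j
  proof -
    have "0 < ?P $ i $ j" using j(2) mpow_nonneg[OF A, of Nonneg l] by (simp add: nonneg_mat_def order_less_le)
    then have wk: "(i, j) \<in> edges (graph_of A) ^^ l" using mpow_pos_iff[OF A] by blast
    have jn: "j \<in> nodes \<nu>"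
      by (rule class_mutual_access[OF \<nu>(1) i relpow_imp_rtrancl[OF wk] class_node_accesses[OF \<nu>(1) j(1) i]])
    then show ?thesis using cyclic_index_walk[OF \<nu>(4,3) i walk_in_class[OF \<nu>(1) wk i jn]] by simp
  qed
  have xa: "node_accesses A j \<nu>" if "?x $ j \<noteq> 0" for j
    using that w(1) w(3)[of j] by (simp add: nonneg_vec_def order_less_le)
  show ?thesis
  proof (cases "(cyclic_index \<nu> i + l) mod sc_cyclicity \<nu> = k")
    case True
    have eq: "?P $ i $ j * v $ j = ?P $ i $ j * ?x $ j" for j
    proof (cases "?P $ i $ j = 0 \<or> \<not> node_accesses A j \<nu>")
      case True
      then show ?thesis using v(1)[of j] xa[of j] by (cases "v $ j = 0"; cases "?x $ j = 0") auto
    next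
      case False
      then show ?thesis using reach[of j] v(2)[of j] \<open>_ mod _ = k\<close> by auto
    qed
    then have "(?P *v v) $ i = (?P *v ?x) $ i" by (simp only: matrix_vector_mult_def vec_lambda_beta eq)
    then show ?thesis using True eigenvector_mpow[OF A w(1,2) \<nu>(2), of l] by simp
  next
    case False
    have "?P $ i $ j * v $ j = 0" for j
      using reach[of j] v(1)[of j] v(2)[of j] False by (cases "?P $ i $ j = 0 \<or> v $ j = 0") auto
    then have "(?P *v v) $ i = 0" by (simp only: matrix_vector_mult_def vec_lambda_beta sum.neutral_const)
    then show ?thesis using False by simp
  qed
qed

text \<open>Restrict the eigenvector of \<open>\<nu>\<close> to the cyclic class number \<open>k\<close> and iterate \<open>A ^ d / \<rho> ^ d\<close>, where \<open>d\<close>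
is the cyclicity of \<open>\<nu>\<close>. On \<open>\<nu>\<close> the iterates do not change; elsewhere they increase, and they are
bounded by the eigenvector. So they converge, to a fixed vector.\<close>

lemma cyclic_extremal_exists:
  fixes A :: "real^'n^'n::finite"
  assumes A: "nonneg_mat A" and s: "spectral Nonneg A \<rho> \<nu>"
  shows "\<exists>X. nonneg_vec X \<and> mpow Nonneg A (sc_cyclicity \<nu>) *v X = \<rho> ^ sc_cyclicity \<nu> *\<^sub>R X \<and>
    (\<forall>i. 0 < X $ i \<longrightarrow> node_accesses A i \<nu>) \<and>
    (\<forall>i\<in>nodes \<nu>. X $ i = (if cyclic_index \<nu> i = k then class_eigenvector A \<rho> \<nu> $ i else 0))"
proof -
  note \<nu> = spectral_class[OF A s]
  note w = class_eigenvector[OF A s]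
  let ?x = "class_eigenvector A \<rho> \<nu>" and ?d = "sc_cyclicity \<nu>"
  let ?P = "mpow Nonneg A ?d"
  define y where "y = (\<chi> i. if i \<in> nodes \<nu> \<and> cyclic_index \<nu> i = k then ?x $ i else 0)"
  define T where "T v = (1 / \<rho> ^ ?d) *\<^sub>R (?P *v v)" for v
  have x0: "0 \<le> ?x $ i" for i using w(1) by (simp add: nonneg_vec_def)
  have Tm: "T u $ i \<le> T v $ i" if "\<And>i. u $ i \<le> v $ i" for u v i
    using mv_mono[OF mpow_nonneg[OF A] that, of Nonneg Nonneg] \<nu>(2)
    by (simp add: T_def divide_right_mono)
  have Tx: "T ?x = ?x" using eigenvector_mpow[OF A w(1,2) \<nu>(2), of ?d] \<nu>(2) by (simp add: T_def)
  have T0: "0 \<le> T v $ i" if "nonneg_vec v" for v i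
    using mv_nonneg[OF mpow_nonneg[OF A] that, of Nonneg Nonneg] \<nu>(2) by (simp add: T_def nonneg_vec_def)
  define Y where "Y n = (T ^^ n) y" for n
  have YS: "Y (Suc n) = T (Y n)" for n by (simp add: Y_def)
  have Yx: "Y n $ i \<le> ?x $ i" for n i
  proof (induction n arbitrary: i)
    case 0 show ?case using x0 by (simp add: Y_def y_def)
  next
    case (Suc n)
    have "T (Y n) $ i \<le> T ?x $ i" by (rule Tm[OF Suc])
    then show ?case unfolding YS Tx .
  qed
  have Y0: "0 \<le> Y n $ i" for n i
  proof (cases n)
    case 0 then show ?thesis using x0 by (simp add: Y_def y_def)
  next
    case (Suc m)
    have "nonneg_vec (Y m)" for m
    proof (induction m)
      case 0 show ?case using x0 by (simp add: Y_def y_def nonneg_vec_def)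
    next
      case (Suc m) then show ?case unfolding YS nonneg_vec_def[of "T _"] using T0 by blast
    qed
    then show ?thesis unfolding Suc YS using T0 by blast
  qed
  have Ya: "node_accesses A i \<nu>" if "Y n $ i \<noteq> 0" for n i
    using that Y0[of n i] Yx[of n i] w(3)[of i] by simp
  have Yv: "Y n $ i = (if cyclic_index \<nu> i = k then ?x $ i else 0)" if i: "i \<in> nodes \<nu>" for n i
    using i
  proof (induction n arbitrary: i)
    case 0 then show ?case by (simp add: Y_def y_def)
  next
    case (Suc n)
    have "(cyclic_index \<nu> i + ?d) mod ?d = cyclic_index \<nu> i"
      using cyclic_index_less[OF \<nu>(4,3)] by simp
    then have "(?P *v Y n) $ i = (if cyclic_index \<nu> i = k then \<rho> ^ ?d * ?x $ i else 0)"
      using power_on_cyclic_part[OF A s Ya[of n] Suc(1) Suc(2), where l="?d"] by simp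
    then show ?case unfolding YS T_def using \<nu>(2) by auto
  qed
  have inc: "Y n $ i \<le> Y (Suc n) $ i" for n i
  proof (induction n arbitrary: i)
    case 0
    show ?case
    proof (cases "i \<in> nodes \<nu>")
      case True then show ?thesis using Yv by simp
    next
      case False then show ?thesis using Y0[of "Suc 0" i] by (simp add: Y_def y_def)
    qed
  next
    case (Suc n)
    then show ?case unfolding YS[of n] YS[of "Suc n"] using Tm by blast
  qed
  have "\<exists>l. (\<lambda>n. Y n $ i) \<longlonglongrightarrow> l" for i
  proof -
    have "incseq (\<lambda>n. Y n $ i)" by (rule incseq_SucI) (rule inc)
    moreover have "\<forall>n. Y n $ i \<le> ?x $ i" using Yx by blast
    ultimately show ?thesis using incseq_convergent[of "\<lambda>n. Y n $ i" "?x $ i"] by blast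
  qed
  then obtain l where l: "\<And>i. (\<lambda>n. Y n $ i) \<longlonglongrightarrow> l i" by metis
  define X where "X = (\<chi> i. l i)"
  have YX: "Y \<longlonglongrightarrow> X" by (rule vec_tendstoI) (simp add: X_def l)
  have Xl: "X $ i = l i" for i by (simp add: X_def)
  have X0: "nonneg_vec X"
    unfolding nonneg_vec_def Xl
  proof
    fix i show "0 \<le> l i" by (rule LIMSEQ_le_const[OF l]) (use Y0 in blast)
  qed
  have "(\<lambda>n. mv Nonneg ?P (Y n)) \<longlonglongrightarrow> mv Nonneg ?P X" by (intro tendsto_mv tendsto_const YX)
  then have "(\<lambda>n. T (Y n)) \<longlonglongrightarrow> T X" unfolding T_def by (simp add: tendsto_scaleR)
  moreover have "(\<lambda>n. T (Y n)) \<longlonglongrightarrow> X" using LIMSEQ_Suc[OF YX] by (simp add: YS)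
  ultimately have "T X = X" by (rule LIMSEQ_unique)
  then have "\<rho> ^ ?d *\<^sub>R T X = \<rho> ^ ?d *\<^sub>R X" by simp
  then have PX: "?P *v X = \<rho> ^ ?d *\<^sub>R X" using \<nu>(2) by (simp add: T_def)
  have Xa: "node_accesses A i \<nu>" if "0 < X $ i" for i
  proof -
    have "l i \<le> ?x $ i" using l[of i] Yx by (intro LIMSEQ_le_const2) auto
    then show ?thesis using that w(3)[of i] Xl by simp
  qed
  have "X $ i = (if cyclic_index \<nu> i = k then ?x $ i else 0)" if "i \<in> nodes \<nu>" for i
  proof -
    have "(\<lambda>n. Y n $ i) = (\<lambda>n. if cyclic_index \<nu> i = k then ?x $ i else 0)" using Yv[OF that] by simp
    then show ?thesis using l[of i] unfolding Xl by (simp add: LIMSEQ_const_iff)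
  qed
  then show ?thesis using X0 PX Xa by blast
qed

definition cyclic_extremal :: "real^'n^'n \<Rightarrow> real \<Rightarrow> 'n graph \<Rightarrow> nat \<Rightarrow> real^'n::finite" where
  "cyclic_extremal A \<rho> \<nu> k = (SOME X. nonneg_vec X \<and>
    mpow Nonneg A (sc_cyclicity \<nu>) *v X = \<rho> ^ sc_cyclicity \<nu> *\<^sub>R X \<and>
    (\<forall>i. 0 < X $ i \<longrightarrow> node_accesses A i \<nu>) \<and>
    (\<forall>i\<in>nodes \<nu>. X $ i = (if cyclic_index \<nu> i = k then class_eigenvector A \<rho> \<nu> $ i else 0)))"

lemma cyclic_extremal:
  fixes A :: "real^'n^'n::finite"
  assumes A: "nonneg_mat A" and s: "spectral Nonneg A \<rho> \<nu>"
  shows "nonneg_vec (cyclic_extremal A \<rho> \<nu> k)"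
    "mpow Nonneg A (sc_cyclicity \<nu>) *v cyclic_extremal A \<rho> \<nu> k = \<rho> ^ sc_cyclicity \<nu> *\<^sub>R cyclic_extremal A \<rho> \<nu> k"
    "0 < cyclic_extremal A \<rho> \<nu> k $ i \<Longrightarrow> node_accesses A i \<nu>"
    "i \<in> nodes \<nu> \<Longrightarrow> cyclic_extremal A \<rho> \<nu> k $ i = (if cyclic_index \<nu> i = k then class_eigenvector A \<rho> \<nu> $ i else 0)"
  using someI_ex[OF cyclic_extremal_exists[OF A s, of k]] unfolding cyclic_extremal_def[symmetric] by auto

lemma cyclic_extremal_support_meets_class:
  fixes A :: "real^'n^'n::finite"
  assumes A: "nonneg_mat A" and s: "spectral Nonneg A \<rho> \<nu>" and k: "k < sc_cyclicity \<nu>"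
  obtains i where "i \<in> nodes \<nu>" "cyclic_index \<nu> i = k" "0 < cyclic_extremal A \<rho> \<nu> k $ i"
proof -
  note \<nu> = spectral_class[OF A s]
  obtain i where i: "i \<in> nodes \<nu>" "cyclic_index \<nu> i = k"
    using cyclic_index_range[OF \<nu>(4,3)] k by (metis imageE lessThan_iff)
  then have "0 < cyclic_extremal A \<rho> \<nu> k $ i"
    using cyclic_extremal(4)[OF A s i(1), of k] class_eigenvector(3)[OF A s, of i] node_in_class_accesses[OF i(1), of A] by simp
  then show ?thesis using that i by blast
qed

text \<open>Both sides are fixed by the same power of \<open>A / \<rho>\<close> and agree on \<open>\<nu>\<close>.\<close>

lemma mv_cyclic_extremal:
  fixes A :: "real^'n^'n::finite"
  assumes A: "nonneg_mat A" and s: "spectral Nonneg A \<rho> \<nu>" and k: "k < sc_cyclicity \<nu>"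
  shows "A *v cyclic_extremal A \<rho> \<nu> (Suc k mod sc_cyclicity \<nu>) = \<rho> *\<^sub>R cyclic_extremal A \<rho> \<nu> k"
proof -
  note \<nu> = spectral_class[OF A s]
  let ?d = "sc_cyclicity \<nu>" let ?Y = "cyclic_extremal A \<rho> \<nu> (Suc k mod ?d)" and ?X = "cyclic_extremal A \<rho> \<nu> k"
  note X = cyclic_extremal[OF A s]
  have nAY: "nonneg_vec (A *v ?Y)" using mv_nonneg[OF A X(1), of Nonneg] by simp
  have Xz: "node_accesses A i \<nu>" if "?Y $ i \<noteq> 0" for i
    using that X(1)[of "Suc k mod ?d"] X(3)[of "Suc k mod ?d" i] by (simp add: nonneg_vec_def order_less_le)
  show ?thesis
  proof (rule periodic_unique_on_class[OF A s])
    show "1 \<le> ?d" using \<nu>(5) by simp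
    show "nonneg_vec (A *v ?Y)" by (rule nAY)
    show "nonneg_vec (\<rho> *\<^sub>R ?X)" using X(1)[of k] \<nu>(2) by (simp add: nonneg_vec_def)
    show "mpow Nonneg A ?d *v (A *v ?Y) = \<rho> ^ ?d *\<^sub>R (A *v ?Y)"
    proof -
      have "mpow Nonneg A ?d *v (A *v ?Y) = A *v (mpow Nonneg A ?d *v ?Y)"
        using mv_mpow[OF A X(1), of Nonneg] mv_mpow[OF A nAY, of Nonneg]
          funpow_swap1[where f="mv Nonneg A" and n="?d" and x="?Y"] by simp
      then show ?thesis using X(2) by (simp add: matrix_vector_mult_scaleR)
    qed
    show "mpow Nonneg A ?d *v (\<rho> *\<^sub>R ?X) = \<rho> ^ ?d *\<^sub>R (\<rho> *\<^sub>R ?X)"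
      using X(2) by (simp add: matrix_vector_mult_scaleR)
    show "node_accesses A i \<nu>" if "0 < (\<rho> *\<^sub>R ?X) $ i" for i
      using that X(3)[of k i] \<nu>(2) by (simp add: zero_less_mult_iff)
    show "node_accesses A i \<nu>" if pos: "0 < (A *v ?Y) $ i" for i
    proof -
      obtain j where "0 < A $ i $ j" "0 < ?Y $ j" using pos mv_pos_iff[OF A X(1)[of "Suc k mod ?d"], of Nonneg i] by auto
      then show ?thesis using node_accesses_backward[of i j A \<nu>] X(3) edges_graph_of[OF A] by blast
    qed
    show "(A *v ?Y) $ i = (\<rho> *\<^sub>R ?X) $ i" if i: "i \<in> nodes \<nu>" for i
    proof -
      have "(cyclic_index \<nu> i + 1) mod ?d = Suc k mod ?d \<longleftrightarrow> cyclic_index \<nu> i = k"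
        using cyclic_index_less[OF \<nu>(4,3), of i] k by (auto simp: mod_Suc split: if_splits)
      then show ?thesis
        using power_on_cyclic_part[OF A s Xz X(4) i, where l=1] X(4)[OF i, of k]
        by (simp add: mpow_1[OF A])
    qed
  qed
qed

lemma cyclic_extremal_power:
  assumes A: "nonneg_mat A" and s: "spectral Nonneg A \<rho> \<nu>" and m: "sc_cyclicity \<nu> dvd m"
  shows "mpow Nonneg A m *v cyclic_extremal A \<rho> \<nu> k = \<rho> ^ m *\<^sub>R cyclic_extremal A \<rho> \<nu> k"
  using periodic_power[OF A cyclic_extremal(1,2)[OF A s] spectral_class(2)[OF A s]] m by (auto elim!: dvdE)

lemma relpow_subset:
  fixes R :: "('a \<times> 'a) set"
  assumes "(i, j) \<in> R ^^ l" "R \<subseteq> S" shows "(i, j) \<in> S ^^ l"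
  using assms(1)
proof (induction l arbitrary: j)
  case (Suc l)
  then show ?case using assms(2) by auto
qed simp

text \<open>For a suitable multiple \<open>M\<close> of \<open>m\<close> all entries of \<open>A ^ M\<close> between nodes of one cyclic class are
positive. At a node of this class where \<open>z / x\<close>, with \<open>x\<close> the eigenvector of \<open>\<nu>\<close>, has its minimum \<open>t\<close>,
the equation for \<open>z - t x\<close> has only nonnegative terms, and so \<open>z = t x\<close> on the whole cyclic class.\<close>

lemma ratio_constant_on_cyclic_class:
  fixes A :: "real^'n^'n::finite"
  assumes A: "nonneg_mat A" and s: "spectral Nonneg A \<rho> \<nu>" and m: "sc_cyclicity \<nu> dvd m" "1 \<le> m"
    and z: "nonneg_vec z" "mpow Nonneg A m *v z = \<rho> ^ m *\<^sub>R z"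
    and fin: "\<And>i j. i \<in> nodes \<nu> \<Longrightarrow> (i, j) \<in> (edges (graph_of A))\<^sup>* \<Longrightarrow> 0 < z $ j \<Longrightarrow> j \<in> nodes \<nu>"
  shows "\<exists>t\<ge>0. \<forall>i\<in>nodes \<nu>. cyclic_index \<nu> i = k \<longrightarrow> z $ i = t * class_eigenvector A \<rho> \<nu> $ i"
proof -
  note \<nu> = spectral_class[OF A s]
  note w = class_eigenvector[OF A s]
  let ?x = "class_eigenvector A \<rho> \<nu>" and ?d = "sc_cyclicity \<nu>"
  define C where "C = {i \<in> nodes \<nu>. cyclic_index \<nu> i = k}"
  have Cpos: "0 < ?x $ i" if "i \<in> C" for i using that w(3)[of i] node_in_class_accesses[of i \<nu> A] by (simp add: C_def)
  show ?thesis
  proof (cases "C = {}")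
    case True then show ?thesis by (intro exI[of _ 0]) (auto simp: C_def)
  next
    case False
    have "\<forall>i\<in>C. \<forall>j\<in>C. \<exists>L. \<forall>l\<ge>L. ?d dvd l \<longrightarrow> (i, j) \<in> edges \<nu> ^^ l"
    proof (intro ballI)
      fix i j assume ij: "i \<in> C" "j \<in> C"
      obtain L where L: "\<And>l. l \<ge> L \<Longrightarrow> cyclic_index \<nu> j = (cyclic_index \<nu> i + l) mod ?d \<Longrightarrow> (i, j) \<in> edges \<nu> ^^ l"
        using long_walks[OF \<nu>(4,3), of i j] ij unfolding C_def by blast
      have "(cyclic_index \<nu> i + l) mod ?d = cyclic_index \<nu> j" if "?d dvd l" for l
        using that ij cyclic_index_less[OF \<nu>(4,3), of i] by (auto simp: C_def elim!: dvdE)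
      then show "\<exists>L. \<forall>l\<ge>L. ?d dvd l \<longrightarrow> (i, j) \<in> edges \<nu> ^^ l" using L by metis
    qed
    then obtain L where L: "\<And>i j l. i \<in> C \<Longrightarrow> j \<in> C \<Longrightarrow> l \<ge> L i j \<Longrightarrow> ?d dvd l \<Longrightarrow> (i, j) \<in> edges \<nu> ^^ l"
      by metis
    \<comment> \<open>The sum is a convenient common bound of the lengths \<open>L i j\<close>.\<close>
    define M where "M = m * (\<Sum>i\<in>UNIV. \<Sum>j\<in>UNIV. L i j)"
    have LM: "L i j \<le> M" for i j
    proof -
      have "L i j \<le> (\<Sum>j\<in>UNIV. L i j)" by (rule member_le_sum) auto
      also have "\<dots> \<le> (\<Sum>i\<in>UNIV. \<Sum>j\<in>UNIV. L i j)"
        by (rule member_le_sum[of i UNIV "\<lambda>i. \<Sum>j\<in>UNIV. L i j"]) auto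
      also have "\<dots> \<le> M" unfolding M_def using m(2) by simp
      finally show ?thesis .
    qed
    let ?P = "mpow Nonneg A M"
    have dM: "?d dvd M" unfolding M_def using m(1) by simp
    have zM: "?P *v z = \<rho> ^ M *\<^sub>R z" unfolding M_def by (rule periodic_power[OF A z \<nu>(2)])
    have xM: "?P *v ?x = \<rho> ^ M *\<^sub>R ?x" by (rule eigenvector_mpow[OF A w(1,2) \<nu>(2)])
    have P0: "0 \<le> ?P $ i $ j" for i j using mpow_nonneg[OF A, of Nonneg] by (simp add: nonneg_mat_def)
    have CC: "j \<in> C" if i: "i \<in> C" and j: "j \<in> nodes \<nu>" "(i, j) \<in> edges (graph_of A) ^^ M" for i j
    proof -
      have "(i, j) \<in> edges \<nu> ^^ M" using walk_in_class[OF \<nu>(1) j(2)] i j(1) by (simp add: C_def)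
      then have "cyclic_index \<nu> j = (cyclic_index \<nu> i + M) mod ?d"
        using cyclic_index_walk[OF \<nu>(4,3), of i j M] i by (simp add: C_def)
      then show ?thesis using i j(1) dM cyclic_index_less[OF \<nu>(4,3), of i] by (auto simp: C_def elim!: dvdE)
    qed
    have out: "?P $ i $ j * z $ j = 0 \<and> ?P $ i $ j * ?x $ j = 0" if i: "i \<in> C" and j: "j \<notin> C" for i j
    proof (cases "?P $ i $ j = 0")
      case False
      then have wk: "(i, j) \<in> edges (graph_of A) ^^ M"
        using mpow_pos_iff[OF A, of Nonneg M i j] P0[of i j] by (simp add: order_less_le)
      have iv: "i \<in> nodes \<nu>" using i by (simp add: C_def)
      have "j \<notin> nodes \<nu>" using CC[OF i _ wk] j by blast
      moreover have "j \<in> nodes \<nu>" if "node_accesses A j \<nu>"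
        by (rule class_mutual_access[OF \<nu>(1) iv relpow_imp_rtrancl[OF wk] class_node_accesses[OF \<nu>(1) that iv]])
      ultimately have "\<not> 0 < z $ j" "\<not> 0 < ?x $ j"
        using fin[OF iv relpow_imp_rtrancl[OF wk]] w(3) by blast+
      then show ?thesis using z(1) w(1) by (simp add: nonneg_vec_def order_less_le)
    qed simp
    define t where "t = Min ((\<lambda>i. z $ i / ?x $ i) ` C)"
    have "t \<in> (\<lambda>i. z $ i / ?x $ i) ` C" unfolding t_def by (rule Min_in) (use False in auto)
    then obtain i where i: "i \<in> C" "t = z $ i / ?x $ i" by blast
    have ti: "z $ i = t * ?x $ i" using i Cpos[OF i(1)] by simp
    have t0: "0 \<le> t" unfolding i(2) using z(1) Cpos[OF i(1)] by (simp add: nonneg_vec_def)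
    have le: "0 \<le> z $ j - t * ?x $ j" if "j \<in> C" for j
    proof -
      have "t \<le> z $ j / ?x $ j" unfolding t_def using that by (intro Min_le) auto
      then show ?thesis using Cpos[OF that] by (simp add: field_simps)
    qed
    have "(\<Sum>j\<in>UNIV. ?P $ i $ j * (z $ j - t * ?x $ j)) = \<rho> ^ M * z $ i - t * (\<rho> ^ M * ?x $ i)"
    proof -
      have "(\<Sum>l\<in>UNIV. ?P $ i $ l * z $ l) = \<rho> ^ M * z $ i"
        using arg_cong[OF zM, of "\<lambda>x. x $ i"] by (simp add: matrix_vector_mult_def)
      moreover have "(\<Sum>l\<in>UNIV. ?P $ i $ l * ?x $ l) = \<rho> ^ M * ?x $ i"
        using arg_cong[OF xM, of "\<lambda>x. x $ i"] by (simp add: matrix_vector_mult_def)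
      ultimately show ?thesis
        by (simp add: right_diff_distrib sum_subtractf mult.left_commute sum_distrib_left[symmetric])
    qed
    also have "\<dots> = 0" using ti by simp
    finally have sum0: "(\<Sum>j\<in>UNIV. ?P $ i $ j * (z $ j - t * ?x $ j)) = 0" .
    have nn: "0 \<le> ?P $ i $ j * (z $ j - t * ?x $ j)" for j
    proof (cases "j \<in> C")
      case True then show ?thesis using P0 le by simp
    next
      case False then show ?thesis using out[OF i(1) False] by (auto simp: right_diff_distrib)
    qed
    have "z $ j = t * ?x $ j" if j: "j \<in> C" for j
    proof -
      have "?P $ i $ j * (z $ j - t * ?x $ j) = 0"
        using sum0 nn by (subst (asm) sum_nonneg_eq_0_iff) auto
      moreover have "(i, j) \<in> edges (graph_of A) ^^ M"
      proof -
        have "(i, j) \<in> edges \<nu> ^^ M" by (rule L[OF i(1) j LM dM])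
        moreover have "edges \<nu> \<subseteq> edges (graph_of A)" using edges_class[OF \<nu>(1)] by blast
        ultimately show ?thesis using relpow_subset by metis
      qed
      ultimately show ?thesis using mpow_pos_iff[OF A, of Nonneg M i j] by simp
    qed
    then show ?thesis using t0 by (intro exI[of _ t]) (auto simp: C_def)
  qed
qed

section \<open>Extremals in nonnegative algebra\<close>

text \<open>An extremal is a multiple of any generator that occurs in it. Conversely, \<open>indep\<close> says that a generator
admits only the trivial representation, so its summands are multiples of it.\<close>

lemma extremals_of_independent_generators:
  fixes X :: "'p \<Rightarrow> real^'n"
  assumes I: "finite I" and X: "\<And>p. p \<in> I \<Longrightarrow> X p \<noteq> 0"
    and W: "W = {\<Sum>p\<in>I. a p *\<^sub>R X p | a. \<forall>p\<in>I. 0 \<le> a p}"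
    and indep: "\<And>p b. p \<in> I \<Longrightarrow> \<forall>q\<in>I. 0 \<le> b q \<Longrightarrow> X p = (\<Sum>q\<in>I. b q *\<^sub>R X q) \<Longrightarrow> \<forall>q\<in>I. q \<noteq> p \<longrightarrow> b q = (0::real)"
  shows "extremals Nonneg W = {a *\<^sub>R X p | a p. 0 < a \<and> p \<in> I}"
proof
  show "extremals Nonneg W \<subseteq> {a *\<^sub>R X p | a p. 0 < a \<and> p \<in> I}"
  proof
    fix z assume z: "z \<in> extremals Nonneg W"
    then have zW: "z \<in> W" and z0: "z \<noteq> 0" unfolding extremals_def by simp_all
    obtain a where a: "\<forall>p\<in>I. 0 \<le> a p" "z = (\<Sum>p\<in>I. a p *\<^sub>R X p)"
      using zW unfolding W by (elim CollectE exE conjE)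
    have "(\<Sum>p\<in>I. a p *\<^sub>R X p) \<noteq> 0" using a(2) z0 by simp
    then obtain p where p: "p \<in> I" "a p *\<^sub>R X p \<noteq> 0"
      by (rule sum.not_neutral_contains_not_neutral)
    define u where "u = a p *\<^sub>R X p"
    define v where "v = (\<Sum>q\<in>I-{p}. a q *\<^sub>R X q)"
    have zuv: "z = vadd Nonneg u v" using a(2) sum.remove[OF I p(1)] by (simp add: u_def v_def)
    have "u = (\<Sum>q\<in>I. (if q = p then a p else 0) *\<^sub>R X q)"
      unfolding u_def using I p(1) by (simp add: if_distrib[of "\<lambda>c. c *\<^sub>R _"] sum.delta cong: if_cong)
    then have uW: "u \<in> W" unfolding W using a(1) p(1) by (intro CollectI exI[of _ "\<lambda>q. if q = p then a p else 0"]) auto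
    have "v = (\<Sum>q\<in>I. (if q = p then 0 else a q) *\<^sub>R X q)"
      unfolding v_def using I by (intro sum.mono_neutral_cong_left) auto
    then have vW: "v \<in> W" unfolding W using a(1) by (intro CollectI exI[of _ "\<lambda>q. if q = p then 0 else a q"]) auto
    obtain c where c: "c \<ge> 0" "u = c *\<^sub>R z"
      using z uW vW zuv unfolding extremals_def by auto
    have "c \<noteq> 0" using c(2) p(2) by (auto simp: u_def)
    then have cpos: "0 < c" using c(1) by simp
    have ap: "0 < a p" using a(1) p by (metis order_le_less scaleR_zero_left)
    have "z = (1 / c) *\<^sub>R u" using c(2) cpos by simp
    then have "z = (a p / c) *\<^sub>R X p" by (simp add: u_def)
    then show "z \<in> {a *\<^sub>R X p | a p. 0 < a \<and> p \<in> I}" using p(1) cpos ap by (intro CollectI exI[of _ "a p / c"] exI[of _ p]) simp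
  qed
next
  show "{a *\<^sub>R X p | a p. 0 < a \<and> p \<in> I} \<subseteq> extremals Nonneg W"
  proof
    fix z assume "z \<in> {a *\<^sub>R X p | a p. 0 < a \<and> p \<in> I}"
    then obtain a p where z: "z = a *\<^sub>R X p" "0 < a" "p \<in> I" by blast
    have "z = (\<Sum>q\<in>I. (if q = p then a else 0) *\<^sub>R X q)"
      unfolding z(1) using I z(3) by (simp add: if_distrib[of "\<lambda>c. c *\<^sub>R _"] sum.delta cong: if_cong)
    then have zW: "z \<in> W" unfolding W using z(2) by (intro CollectI exI[of _ "\<lambda>q. if q = p then a else 0"]) auto
    have triv: "\<exists>c\<ge>0. u = c *\<^sub>R z" if u: "u \<in> W" and v: "v \<in> W" and zuv: "z = u + v" for u v
    proof -
      obtain b where b: "\<forall>q\<in>I. 0 \<le> b q" "u = (\<Sum>q\<in>I. b q *\<^sub>R X q)" using u unfolding W by (elim CollectE exE conjE)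
      obtain c where c: "\<forall>q\<in>I. 0 \<le> c q" "v = (\<Sum>q\<in>I. c q *\<^sub>R X q)" using v unfolding W by (elim CollectE exE conjE)
      have "X p = (1 / a) *\<^sub>R (u + v)" using zuv[symmetric] z(1,2) by simp
      also have "\<dots> = (\<Sum>q\<in>I. ((b q + c q) / a) *\<^sub>R X q)"
        unfolding b(2) c(2) sum.distrib[symmetric] scaleR_sum_right by (simp add: scaleR_add_left add_divide_distrib scaleR_add_right)
      finally have "\<forall>q\<in>I. q \<noteq> p \<longrightarrow> (b q + c q) / a = 0"
        using b(1) c(1) z(2,3) by (intro indep) auto
      then have "b q = 0" if "q \<in> I" "q \<noteq> p" for q
        using that b(1) c(1) z(2) by (metis add_nonneg_eq_0_iff divide_eq_0_iff less_irrefl)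
      then have "u = (\<Sum>q\<in>{p}. b q *\<^sub>R X q)"
        unfolding b(2) using I z(3) by (intro sum.mono_neutral_right) auto
      then have "u = (b p / a) *\<^sub>R z" using z(1,2) by simp
      then show ?thesis using b(1) z(2,3) by (intro exI[of _ "b p / a"]) simp
    qed
    have "trivial_decomposition Nonneg z u v" if "u \<in> W" "v \<in> W" "z = vadd Nonneg u v" for u v
      using triv[of u v] triv[of v u] that by (simp add: add.commute)
    moreover have "z \<noteq> 0" using z X by simp
    ultimately show "z \<in> extremals Nonneg W" using zW unfolding extremals_def by blast
  qed
qed

text \<open>The pair \<open>(\<nu>, k)\<close> stands for the cyclic class number \<open>k\<close> of the spectral class \<open>\<nu>\<close>.\<close>

definition spectral_index :: "real^'n^'n::finite \<Rightarrow> ('n graph \<times> nat) set" where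
  "spectral_index A = (SIGMA \<nu>:spectral_classes Nonneg A. {..<sc_cyclicity \<nu>})"

definition spectral_index_of :: "real^'n^'n::finite \<Rightarrow> real \<Rightarrow> ('n graph \<times> nat) set" where
  "spectral_index_of A \<rho> = (SIGMA \<nu>:{\<nu>. spectral Nonneg A \<rho> \<nu>}. {..<sc_cyclicity \<nu>})"

definition class_extremal :: "real^'n^'n \<Rightarrow> 'n graph \<times> nat \<Rightarrow> real^'n::finite" where
  "class_extremal A p = cyclic_extremal A (perron_root Nonneg A (nodes (fst p))) (fst p) (snd p)"

lemma finite_classes: "finite (classes (A :: real^'n^'n::finite))"
  unfolding classes_def sccs_eq by simp

lemma finite_spectral: "finite {\<nu>. spectral alg A \<rho> \<nu>}" "finite (spectral_classes alg A)"
  by (rule finite_subset[OF _ finite_classes[of A]], auto simp: spectral_def spectral_classes_def)+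

lemma spectral_classesD: "\<nu> \<in> spectral_classes alg A \<Longrightarrow> spectral alg A (perron_root alg A (nodes \<nu>)) \<nu>"
  by (auto simp: spectral_classes_def spectral_def)

lemma spectral_index_of_subset: "spectral_index_of A \<rho> \<subseteq> spectral_index A"
  by (auto simp: spectral_index_of_def spectral_index_def spectral_classes_def)

lemma class_extremal_spectral: "spectral Nonneg A \<rho> \<nu> \<Longrightarrow> class_extremal A (\<nu>, k) = cyclic_extremal A \<rho> \<nu> k"
  by (simp add: class_extremal_def spectral_def)

lemma finite_spectral_index: "finite (spectral_index A)" "finite (spectral_index_of A \<rho>)"
  by (auto simp: spectral_index_def spectral_index_of_def finite_spectral)

lemma spectral_indexE:
  assumes "p \<in> spectral_index A"
  obtains \<nu> k \<rho> where "p = (\<nu>, k)" "spectral Nonneg A \<rho> \<nu>" "k < sc_cyclicity \<nu>" "class_extremal A p = cyclic_extremal A \<rho> \<nu> k"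
proof -
  obtain \<nu> k where p: "p = (\<nu>, k)" "\<nu> \<in> spectral_classes Nonneg A" "k < sc_cyclicity \<nu>"
    using assms by (auto simp: spectral_index_def)
  note s = spectral_classesD[OF p(2)]
  show ?thesis by (rule that[OF p(1) s p(3)]) (simp add: p(1) class_extremal_spectral[OF s])
qed

lemma class_extremal_nonzero:
  assumes A: "nonneg_mat A" and p: "p \<in> spectral_index A"
  shows "nonneg_vec (class_extremal A p)" "class_extremal A p \<noteq> 0"
proof -
  obtain \<nu> k \<rho> where s: "p = (\<nu>, k)" "spectral Nonneg A \<rho> \<nu>" "k < sc_cyclicity \<nu>" "class_extremal A p = cyclic_extremal A \<rho> \<nu> k"
    using spectral_indexE[OF p] .
  show "nonneg_vec (class_extremal A p)" unfolding s(4) by (rule cyclic_extremal(1)[OF A s(2)])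
  obtain i where "0 < cyclic_extremal A \<rho> \<nu> k $ i" using cyclic_extremal_support_meets_class[OF A s(2,3)] by blast
  then show "class_extremal A p \<noteq> 0" unfolding s(4) by auto
qed

lemma spectral_cyclicity_dvd:
  fixes A :: "real^'n^'n::finite"
  assumes A: "nonneg_mat A"
  shows "spectral Nonneg A \<rho> \<nu> \<Longrightarrow> sc_cyclicity \<nu> dvd sigma_num Nonneg A \<rho>" "1 \<le> sigma_num Nonneg A \<rho>"
proof -
  show "spectral Nonneg A \<rho> \<nu> \<Longrightarrow> sc_cyclicity \<nu> dvd sigma_num Nonneg A \<rho>" by (auto intro: dvd_Lcm)
  have "0 \<notin> sc_cyclicity ` {\<nu>. spectral Nonneg A \<rho> \<nu>}" using spectral_class(5)[OF A] by force
  then have "Lcm (sc_cyclicity ` {\<nu>. spectral Nonneg A \<rho> \<nu>}) \<noteq> 0"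
    using Lcm_0_iff[of "sc_cyclicity ` {\<nu>. spectral Nonneg A \<rho> \<nu>}"] finite_spectral(1) by auto
  then show "1 \<le> sigma_num Nonneg A \<rho>" unfolding sigma_num.simps by linarith
qed

text \<open>Let \<open>w\<close> be an eigenvector above \<open>z\<close>. Its final classes are spectral for \<open>\<rho>\<close>, and no edge within its
support leaves a spectral class, so \<open>z\<close> is proportional to the class eigenvector on each cyclic class.
The combination with these factors agrees with \<open>z\<close> on the final classes, hence everywhere by the
minimum principle.\<close>

lemma periodic_vector_decomposition:
  fixes A :: "real^'n^'n::finite"
  assumes A: "nonneg_mat A" and \<rho>: "0 < \<rho>" and m: "1 \<le> m" "\<And>\<nu>. spectral Nonneg A \<rho> \<nu> \<Longrightarrow> sc_cyclicity \<nu> dvd m"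
    and z: "nonneg_vec z" "mpow Nonneg A m *v z = \<rho> ^ m *\<^sub>R z"
  shows "\<exists>a. (\<forall>p\<in>spectral_index_of A \<rho>. 0 \<le> a p) \<and> z = (\<Sum>p\<in>spectral_index_of A \<rho>. a p *\<^sub>R class_extremal A p)"
proof -
  let ?E = "edges (graph_of A)"
  obtain w where w: "nonneg_vec w" "\<And>i. z $ i \<le> w $ i" "mv Nonneg A w = \<rho> *\<^sub>R w"
    using eigenvector_above_periodic[OF A z(1), of Nonneg m \<rho>] z(2) m(1) \<rho> by auto
  have w': "A *v w = \<rho> *\<^sub>R w" using w(3) by simp
  let ?S = "{i. 0 < w $ i}"
  have zS: "0 < w $ i" if "0 < z $ i" for i using w(2)[of i] that by simp
  have fin: "j \<in> nodes \<nu>"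
    if s: "spectral Nonneg A \<rho> \<nu>" and ij: "i \<in> nodes \<nu>" "(i, j) \<in> ?E\<^sup>*" "0 < w $ j" for \<nu> i j
  proof (rule ccontr)
    assume "j \<notin> nodes \<nu>"
    note \<nu> = spectral_class[OF A s]
    obtain a b where ab: "a \<in> nodes \<nu>" "b \<notin> nodes \<nu>" "(a, b) \<in> ?E" "(b, j) \<in> ?E\<^sup>*"
      using exit_edge[OF ij(2,1) \<open>j \<notin> nodes \<nu>\<close>] by blast
    have "perron_root Nonneg A (nodes \<nu>) < \<rho>"
      using perron_root_nonfinal[OF A w(1) w' \<nu>(1) class_in_support[OF A w(1,3) \<nu>(1) ij] ab(1-3)]
        eigenvector_support_backward[OF A w(1,3) ab(4) ij(3)] by blast
    then show False using s by (simp add: spectral_def)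
  qed
  have "\<exists>t\<ge>0. \<forall>i\<in>nodes (fst p). cyclic_index (fst p) i = snd p \<longrightarrow> z $ i = t * class_eigenvector A \<rho> (fst p) $ i"
    if "p \<in> spectral_index_of A \<rho>" for p
  proof -
    have s: "spectral Nonneg A \<rho> (fst p)" using that by (auto simp: spectral_index_of_def)
    show ?thesis by (rule ratio_constant_on_cyclic_class[OF A s m(2)[OF s] m(1) z]) (use fin[OF s] zS in blast)
  qed
  then obtain a where a: "\<And>p. p \<in> spectral_index_of A \<rho> \<Longrightarrow> 0 \<le> a p"
    "\<And>p i. p \<in> spectral_index_of A \<rho> \<Longrightarrow> i \<in> nodes (fst p) \<Longrightarrow> cyclic_index (fst p) i = snd p \<Longrightarrow>
       z $ i = a p * class_eigenvector A \<rho> (fst p) $ i" by metis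
  have X: "nonneg_vec (class_extremal A p)" "mpow Nonneg A m *v class_extremal A p = \<rho> ^ m *\<^sub>R class_extremal A p"
    if "p \<in> spectral_index_of A \<rho>" for p
  proof -
    have s: "spectral Nonneg A \<rho> (fst p)" using that by (auto simp: spectral_index_of_def)
    have e: "class_extremal A p = cyclic_extremal A \<rho> (fst p) (snd p)" using class_extremal_spectral[OF s, of "snd p"] by simp
    show "nonneg_vec (class_extremal A p)" "mpow Nonneg A m *v class_extremal A p = \<rho> ^ m *\<^sub>R class_extremal A p"
      unfolding e using cyclic_extremal(1)[OF A s] cyclic_extremal_power[OF A s m(2)[OF s]] by auto
  qed
  let ?I = "spectral_index_of A \<rho>"
  define y where "y = (\<Sum>p\<in>?I. a p *\<^sub>R class_extremal A p)"
  have y0: "nonneg_vec y" unfolding y_def nonneg_vec_def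
    using a(1) X(1) by (auto simp: nonneg_vec_def intro!: sum_nonneg)
  have ym: "mpow Nonneg A m *v y = \<rho> ^ m *\<^sub>R y"
    unfolding y_def using X(2)
    by (simp add: linear_sum[OF matrix_vector_mul_linear] matrix_vector_mult_scaleR scaleR_sum_right mult.commute)
  have term0: "\<exists>j\<in>nodes (fst p). 0 < z $ j \<and> node_accesses A i (fst p)"
    if p: "p \<in> ?I" "a p * class_extremal A p $ i \<noteq> 0" for p i
  proof -
    have s: "spectral Nonneg A \<rho> (fst p)" "snd p < sc_cyclicity (fst p)" using p(1) by (auto simp: spectral_index_of_def)
    have e: "class_extremal A p = cyclic_extremal A \<rho> (fst p) (snd p)" using class_extremal_spectral[OF s(1), of "snd p"] by simp
    have "0 < class_extremal A p $ i" using p(2) X(1)[OF p(1)] by (auto simp: nonneg_vec_def order_less_le)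
    then have acc: "node_accesses A i (fst p)" unfolding e by (rule cyclic_extremal(3)[OF A s(1)])
    obtain j where j: "j \<in> nodes (fst p)" "cyclic_index (fst p) j = snd p" "0 < cyclic_extremal A \<rho> (fst p) (snd p) $ j"
      using cyclic_extremal_support_meets_class[OF A s] by blast
    have "0 < class_eigenvector A \<rho> (fst p) $ j" using class_eigenvector(3)[OF A s(1)] node_in_class_accesses[OF j(1)] by blast
    moreover have "0 < a p" using a(1)[OF p(1)] p(2) by (auto simp: order_less_le)
    ultimately have "0 < z $ j" using a(2)[OF p(1) j(1,2)] by simp
    then show ?thesis using j(1) acc by blast
  qed
  have yS: "0 < w $ i" if yi: "y $ i \<noteq> 0" for i
  proof -
    have "(\<Sum>p\<in>?I. a p * class_extremal A p $ i) \<noteq> 0" using yi unfolding y_def by simp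
    then obtain p where p: "p \<in> ?I" "a p * class_extremal A p $ i \<noteq> 0"
      by (rule sum.not_neutral_contains_not_neutral)
    obtain j where j: "j \<in> nodes (fst p)" "0 < z $ j" "node_accesses A i (fst p)" using term0[OF p] by blast
    have "fst p \<in> classes A" using p(1) by (auto simp: spectral_index_of_def spectral_def)
    then have "(i, j) \<in> ?E\<^sup>*" using class_node_accesses j by blast
    then show ?thesis using eigenvector_support_backward[OF A w(1,3)] zS[OF j(2)] by blast
  qed
  have yf: "y $ f = z $ f" if f: "final_in A ?S f" for f
  proof -
    let ?\<nu> = "scc_of (graph_of A) f"
    have s: "spectral Nonneg A \<rho> ?\<nu>" by (rule final_class_spectral[OF A w(1) w' \<rho> f])
    note \<nu> = spectral_class[OF A s]
    have fv: "f \<in> nodes ?\<nu>" by (rule class_of(1))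
    let ?p = "(?\<nu>, cyclic_index ?\<nu> f)"
    have pI: "?p \<in> ?I" using s cyclic_index_less[OF \<nu>(4,3)] by (simp add: spectral_index_of_def)
    have zero: "a p * class_extremal A p $ f = 0" if p: "p \<in> ?I" "p \<noteq> ?p" for p
    proof (rule ccontr)
      assume ne: "a p * class_extremal A p $ f \<noteq> 0"
      obtain j where j: "j \<in> nodes (fst p)" "0 < z $ j" "node_accesses A f (fst p)" using term0[OF p(1) ne] by blast
      have sp: "spectral Nonneg A \<rho> (fst p)" using p(1) by (auto simp: spectral_index_of_def)
      then have pc: "fst p \<in> classes A" by (simp add: spectral_def)
      have "(f, j) \<in> ?E\<^sup>*" using class_node_accesses[OF pc j(3,1)] .
      then have "j \<in> nodes ?\<nu>" using fin[OF s fv _ zS[OF j(2)]] by blast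
      then have "fst p = ?\<nu>" using classes_eq[OF pc \<nu>(1) j(1)] by blast
      moreover from this have "class_extremal A p = cyclic_extremal A \<rho> ?\<nu> (snd p)"
        using class_extremal_spectral[OF s, of "snd p"] by (metis prod.collapse)
      ultimately show False using ne p(2) cyclic_extremal(4)[OF A s fv, of "snd p"]
        by (cases p) (auto split: if_splits)
    qed
    have "y $ f = (\<Sum>p\<in>?I. a p * class_extremal A p $ f)" unfolding y_def by simp
    also have "\<dots> = (\<Sum>p\<in>{?p}. a p * class_extremal A p $ f)"
      by (rule sum.mono_neutral_right) (use pI finite_spectral_index(2)[of A \<rho>] zero in blast)+
    also have "\<dots> = a ?p * class_eigenvector A \<rho> ?\<nu> $ f"
      using class_extremal_spectral[OF s, of "cyclic_index ?\<nu> f"] cyclic_extremal(4)[OF A s fv] by simp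
    also have "\<dots> = z $ f" using a(2)[OF pI, of f] fv by simp
    finally show ?thesis .
  qed
  have le: "0 \<le> (u - v) $ i"
    if uv: "u = z \<and> v = y \<or> u = y \<and> v = z" for u v i
  proof (rule nonneg_if_nonneg_on_final_classes[OF A w(1) w' \<rho> _ _ m(1)])
    show "0 < w $ i" if "(u - v) $ i \<noteq> 0" for i
    proof -
      have "z $ i \<noteq> 0 \<or> y $ i \<noteq> 0" using that uv by auto
      then show ?thesis using yS[of i] zS[of i] z(1) by (auto simp: nonneg_vec_def order_less_le)
    qed
    show "mpow Nonneg A (m * k) *v (u - v) = \<rho> ^ (m * k) *\<^sub>R (u - v)" for k
      using uv periodic_power[OF A z \<rho>] periodic_power[OF A y0 ym \<rho>]
      by (auto simp: matrix_vector_mult_diff_distrib scaleR_right_diff_distrib)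
    show "0 \<le> (u - v) $ f" if "final_in A ?S f" for f using yf[OF that] uv by auto
  qed
  have "z $ i = y $ i" for i using le[of z y i] le[of y z i] by simp
  then have "z = y" by (simp add: vec_eq_iff)
  then show ?thesis using a(1) unfolding y_def by blast
qed

text \<open>Restrict the equation to the class \<open>\<nu>\<close> of \<open>p\<close>. A contributing term of another class \<open>\<nu>'\<close> vanishes
there: it lies below the left-hand side, so \<open>\<nu>'\<close> accesses \<open>\<nu>\<close>, and \<open>\<nu>\<close> cannot access \<open>\<nu>'\<close> as well. The
terms of \<open>\<nu>\<close> live on disjoint cyclic classes. So the coefficient of \<open>p\<close> is one and the other terms sum
to zero.\<close>

lemma class_extremals_independent:
  fixes A :: "real^'n^'n::finite"
  assumes A: "nonneg_mat A" and p: "p \<in> spectral_index A" and b: "\<forall>q\<in>spectral_index A. 0 \<le> b q"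
    and eq: "class_extremal A p = (\<Sum>q\<in>spectral_index A. b q *\<^sub>R class_extremal A q)"
  shows "\<forall>q\<in>spectral_index A. q \<noteq> p \<longrightarrow> b q = 0"
proof -
  let ?I = "spectral_index A" and ?X = "class_extremal A"
  obtain \<nu> k \<rho> where s: "p = (\<nu>, k)" "spectral Nonneg A \<rho> \<nu>" "k < sc_cyclicity \<nu>" "?X p = cyclic_extremal A \<rho> \<nu> k"
    using spectral_indexE[OF p] .
  note \<nu> = spectral_class[OF A s(2)]
  have fI: "finite ?I" by (rule finite_spectral_index)
  have X0: "0 \<le> ?X q $ i" if "q \<in> ?I" for q i
    using class_extremal_nonzero(1)[OF A that] by (simp add: nonneg_vec_def)
  have le: "b q * ?X q $ i \<le> ?X p $ i" if "q \<in> ?I" for q i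
  proof -
    have "b q * ?X q $ i \<le> (\<Sum>q\<in>?I. b q * ?X q $ i)"
      using that b X0 fI by (intro member_le_sum) auto
    also have "\<dots> = ?X p $ i" using arg_cong[OF eq, of "\<lambda>x. x $ i"] by simp
    finally show ?thesis .
  qed
  have vanish: "?X q $ i = 0 \<or> b q = 0" if q: "q \<in> ?I" "fst q \<noteq> \<nu>" and i: "i \<in> nodes \<nu>" for q i
  proof (rule ccontr)
    assume ne: "\<not> (?X q $ i = 0 \<or> b q = 0)"
    obtain \<nu>' k' \<rho>' where t: "q = (\<nu>', k')" "spectral Nonneg A \<rho>' \<nu>'" "k' < sc_cyclicity \<nu>'" "?X q = cyclic_extremal A \<rho>' \<nu>' k'"
      using spectral_indexE[OF q(1)] .
    note \<nu>' = spectral_class[OF A t(2)]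
    have bq: "0 < b q" using ne b q(1) by (auto simp: order_less_le)
    have "0 < ?X q $ i" using ne X0[OF q(1), of i] by (simp add: order_less_le)
    then have acc1: "node_accesses A i \<nu>'" unfolding t(4) by (rule cyclic_extremal(3)[OF A t(2)])
    obtain j where j: "j \<in> nodes \<nu>'" "0 < ?X q $ j"
      using cyclic_extremal_support_meets_class[OF A t(2,3)] t(4) by metis
    have "0 < b q * ?X q $ j" using bq j(2) by simp
    also have "\<dots> \<le> ?X p $ j" by (rule le[OF q(1)])
    finally have "node_accesses A j \<nu>" unfolding s(4) by (rule cyclic_extremal(3)[OF A s(2)])
    then have "(j, i) \<in> (edges (graph_of A))\<^sup>*" using class_node_accesses[OF \<nu>(1) _ i] by blast
    moreover have "(i, j) \<in> (edges (graph_of A))\<^sup>*" using class_node_accesses[OF \<nu>'(1) acc1 j(1)] .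
    ultimately have "j \<in> nodes \<nu>" using class_mutual_access[OF \<nu>(1) i] by blast
    then have "\<nu>' = \<nu>" using classes_eq[OF \<nu>'(1) \<nu>(1) j(1)] by blast
    then show False using q(2) t(1) by simp
  qed
  have same: "b q = 0" if q: "q \<in> ?I" "fst q = \<nu>" "q \<noteq> p" for q
  proof -
    obtain k' where k': "q = (\<nu>, k')" "k' \<noteq> k" "k' < sc_cyclicity \<nu>"
      using q s(1) by (cases q) (auto simp: spectral_index_def)
    have Xq: "?X q = cyclic_extremal A \<rho> \<nu> k'" unfolding k'(1) by (rule class_extremal_spectral[OF s(2)])
    obtain i where i: "i \<in> nodes \<nu>" "cyclic_index \<nu> i = k'" "0 < ?X q $ i"
      using cyclic_extremal_support_meets_class[OF A s(2) k'(3)] Xq by metis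
    have "?X p $ i = 0" unfolding s(4) using cyclic_extremal(4)[OF A s(2) i(1), of k] i(2) k'(2) by simp
    then have "b q * ?X q $ i \<le> 0" using le[OF q(1), of i] by simp
    then show ?thesis using i(3) b q(1) by (meson mult_le_0_iff not_less order_antisym)
  qed
  obtain i where i: "i \<in> nodes \<nu>" "0 < ?X p $ i"
    using cyclic_extremal_support_meets_class[OF A s(2,3)] s(4) by metis
  have split: "?X p $ l = b p * ?X p $ l + (\<Sum>q\<in>?I-{p}. b q * ?X q $ l)" for l
    using arg_cong[OF eq, of "\<lambda>x. x $ l"] sum.remove[OF fI p, of "\<lambda>q. b q * ?X q $ l"] by simp
  have "b q * ?X q $ i = 0" if "q \<in> ?I - {p}" for q
    using that same[of q] vanish[of q i] i(1) by (cases "fst q = \<nu>") auto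
  then have "(\<Sum>q\<in>?I-{p}. b q * ?X q $ i) = 0" by (intro sum.neutral) blast
  then have "?X p $ i = b p * ?X p $ i" using split[of i] by simp
  then have bp: "b p = 1" using i(2) by simp
  have "b q = 0" if q: "q \<in> ?I" "q \<noteq> p" for q
  proof -
    obtain l where l: "0 < ?X q $ l"
      using class_extremal_nonzero[OF A q(1)] by (auto simp: vec_eq_iff nonneg_vec_def order_less_le)
    have "(\<Sum>q\<in>?I-{p}. b q * ?X q $ l) = 0" using split[of l] bp by simp
    then have "b q * ?X q $ l = 0"
      by (subst (asm) sum_nonneg_eq_0_iff) (use fI b X0 q in auto)
    then show ?thesis using l by simp
  qed
  then show ?thesis by blast
qed

lemma mem_sum_cone:
  fixes W :: "(real^'n) set"
  assumes "\<And>x y. x \<in> W \<Longrightarrow> y \<in> W \<Longrightarrow> x + y \<in> W" "0 \<in> W" "finite I" "\<And>p. p \<in> I \<Longrightarrow> f p \<in> W"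
  shows "(\<Sum>p\<in>I. f p) \<in> W"
  using assms(3,4) by (induction I rule: finite_induct) (auto intro: assms(1,2))

lemma zero_in_core: "0 \<in> core alg A"
proof -
  have "\<exists>c. 0 = mv alg (mpow alg A k) c \<and> nonneg_vec c" for k by (rule exI[of _ 0]) simp
  then show ?thesis by (auto simp: core_def col_span_def)
qed

text \<open>The periods of the generators vary; passing to a common multiple with \<open>\<sigma>\<^sub>\<rho>\<close> makes
\<open>periodic_vector_decomposition\<close> applicable to each of them.\<close>

lemma core_Nonneg_eq:
  fixes A :: "real^'n^'n::finite"
  assumes A: "nonneg_mat A"
  shows "core Nonneg A = {\<Sum>p\<in>spectral_index A. a p *\<^sub>R class_extremal A p | a. \<forall>p\<in>spectral_index A. 0 \<le> a p}"
    (is "_ = ?W")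
proof
  let ?I = "spectral_index A" and ?X = "class_extremal A"
  have XC: "?X p \<in> core Nonneg A" if p: "p \<in> ?I" for p
  proof -
    obtain \<nu> k \<rho> where s: "p = (\<nu>, k)" "spectral Nonneg A \<rho> \<nu>" "k < sc_cyclicity \<nu>" "?X p = cyclic_extremal A \<rho> \<nu> k"
      using spectral_indexE[OF p] .
    show ?thesis unfolding s(4)
    proof (rule periodic_in_core[OF A cyclic_extremal(1)[OF A s(2)]])
      show "mv Nonneg (mpow Nonneg A (sc_cyclicity \<nu>)) (cyclic_extremal A \<rho> \<nu> k)
          = \<rho> ^ sc_cyclicity \<nu> *\<^sub>R cyclic_extremal A \<rho> \<nu> k"
        using cyclic_extremal(2)[OF A s(2)] by simp
      show "1 \<le> sc_cyclicity \<nu>" "0 < \<rho>" using spectral_class(2,5)[OF A s(2)] by simp_all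
    qed
  qed
  show "?W \<subseteq> core Nonneg A"
  proof
    fix x assume "x \<in> ?W"
    then obtain a where a: "\<forall>p\<in>?I. 0 \<le> a p" "x = (\<Sum>p\<in>?I. a p *\<^sub>R ?X p)" by (elim CollectE exE conjE)
    show "x \<in> core Nonneg A" unfolding a(2)
      by (rule mem_sum_cone) (use core_vadd[OF A, where alg = Nonneg] zero_in_core finite_spectral_index core_scaleR[OF A XC] a(1) in auto)
  qed
  obtain U where U: "nonneg_mat U" "core Nonneg A = col_span Nonneg U"
    "\<And>j. column j U \<noteq> 0 \<Longrightarrow> \<exists>p\<ge>1. \<exists>\<rho>>0. mv Nonneg (mpow Nonneg A p) (column j U) = \<rho> ^ p *\<^sub>R column j U"
    using core_generated_by_periodic_vectors[OF A] by blast
  have Wadd: "x + y \<in> ?W" if xy: "x \<in> ?W" "y \<in> ?W" for x y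
  proof -
    obtain a where a: "\<forall>p\<in>?I. 0 \<le> a p" "x = (\<Sum>p\<in>?I. a p *\<^sub>R ?X p)" using xy(1) by (elim CollectE exE conjE)
    obtain b where b: "\<forall>p\<in>?I. 0 \<le> b p" "y = (\<Sum>p\<in>?I. b p *\<^sub>R ?X p)" using xy(2) by (elim CollectE exE conjE)
    have "x + y = (\<Sum>p\<in>?I. (a p + b p) *\<^sub>R ?X p)" unfolding a b by (simp add: sum.distrib scaleR_add_left)
    then show ?thesis using a(1) b(1) by (intro CollectI exI[of _ "\<lambda>p. a p + b p"]) auto
  qed
  have Wscale: "c *\<^sub>R x \<in> ?W" if x: "x \<in> ?W" and c: "0 \<le> c" for x c
  proof -
    obtain a where a: "\<forall>p\<in>?I. 0 \<le> a p" "x = (\<Sum>p\<in>?I. a p *\<^sub>R ?X p)" using x by (elim CollectE exE conjE)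
    have "c *\<^sub>R x = (\<Sum>p\<in>?I. (c * a p) *\<^sub>R ?X p)" unfolding a by (simp add: scaleR_sum_right)
    then show ?thesis using a(1) c by (intro CollectI exI[of _ "\<lambda>p. c * a p"]) auto
  qed
  have W0: "0 \<in> ?W" by (intro CollectI exI[of _ "\<lambda>p. 0"]) auto
  have colW: "column j U \<in> ?W" for j
  proof (cases "column j U = 0")
    case True then show ?thesis using W0 by simp
  next
    case False
    then obtain p \<rho> where p: "p \<ge> 1" "\<rho> > 0" "mpow Nonneg A p *v column j U = \<rho> ^ p *\<^sub>R column j U"
      using U(3)[OF False] unfolding mv.simps by blast
    let ?m = "p * sigma_num Nonneg A \<rho>"
    have m1: "1 \<le> ?m" using p(1) spectral_cyclicity_dvd(2)[OF A, of \<rho>] by (metis mult_le_mono mult_1)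
    have m2: "sc_cyclicity \<nu> dvd ?m" if "spectral Nonneg A \<rho> \<nu>" for \<nu>
      using spectral_cyclicity_dvd(1)[OF A that] by (rule dvd_mult)
    obtain a where a: "\<forall>q\<in>spectral_index_of A \<rho>. 0 \<le> a q"
      "column j U = (\<Sum>q\<in>spectral_index_of A \<rho>. a q *\<^sub>R ?X q)"
      using periodic_vector_decomposition[OF A p(2) m1 m2 nonneg_column[OF U(1)]
          periodic_power[OF A nonneg_column[OF U(1)] p(3,2)]] by blast
    have "column j U = (\<Sum>q\<in>?I. (if q \<in> spectral_index_of A \<rho> then a q else 0) *\<^sub>R ?X q)"
      unfolding a(2) by (intro sum.mono_neutral_cong_left) (use finite_spectral_index(1)[of A] spectral_index_of_subset[of A \<rho>] in auto)
    then show ?thesis using a(1)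
      by (intro CollectI exI[of _ "\<lambda>q. if q \<in> spectral_index_of A \<rho> then a q else 0"]) auto
  qed
  show "core Nonneg A \<subseteq> ?W"
  proof
    fix x assume "x \<in> core Nonneg A"
    then obtain c where c: "nonneg_vec c" "x = U *v c" unfolding U(2) col_span_def by auto
    have "x = (\<Sum>j\<in>UNIV. c $ j *\<^sub>R column j U)"
      unfolding c(2) by (simp add: matrix_mult_sum scalar_mult_eq_scaleR)
    also have "\<dots> \<in> ?W"
      by (rule mem_sum_cone[OF Wadd W0 _ Wscale[OF colW]]) (use c(1) in \<open>auto simp: nonneg_vec_def\<close>)
    finally show "x \<in> ?W" .
  qed
qed

lemma extremals_core_Nonneg:
  fixes A :: "real^'n^'n::finite"
  assumes A: "nonneg_mat A"
  shows "extremals Nonneg (core Nonneg A) = {a *\<^sub>R class_extremal A p | a p. 0 < a \<and> p \<in> spectral_index A}"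
  by (rule extremals_of_independent_generators[OF finite_spectral_index(1) class_extremal_nonzero(2)[OF A]
      core_Nonneg_eq[OF A] class_extremals_independent[OF A]])

lemma eigencone_Nonneg_eq:
  fixes A :: "real^'n^'n::finite"
  assumes A: "nonneg_mat A" and \<rho>: "0 < \<rho>"
  defines "s \<equiv> sigma_num Nonneg A \<rho>"
  shows "eigencone Nonneg (mpow Nonneg A s) (\<rho> ^ s) =
    {\<Sum>p\<in>spectral_index_of A \<rho>. a p *\<^sub>R class_extremal A p | a. \<forall>p\<in>spectral_index_of A \<rho>. 0 \<le> a p}" (is "?V = ?W")
proof
  let ?I = "spectral_index_of A \<rho>" and ?X = "class_extremal A"
  show "?V \<subseteq> ?W"
  proof
    fix z assume "z \<in> ?V"
    then have z: "nonneg_vec z" "mpow Nonneg A s *v z = \<rho> ^ s *\<^sub>R z" by (auto simp: eigencone_def)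
    show "z \<in> ?W"
      using periodic_vector_decomposition[OF A \<rho> spectral_cyclicity_dvd(2)[OF A] spectral_cyclicity_dvd(1)[OF A] z(1) z(2)[unfolded s_def]]
      by auto
  qed
  show "?W \<subseteq> ?V"
  proof
    fix z assume "z \<in> ?W"
    then obtain a where a: "\<forall>p\<in>?I. 0 \<le> a p" "z = (\<Sum>p\<in>?I. a p *\<^sub>R ?X p)" by (elim CollectE exE conjE)
    have X: "?X p \<in> ?V" if "p \<in> ?I" for p
    proof -
      have sp: "spectral Nonneg A \<rho> (fst p)" using that by (auto simp: spectral_index_of_def)
      have e: "?X p = cyclic_extremal A \<rho> (fst p) (snd p)" using class_extremal_spectral[OF sp, of "snd p"] by simp
      show ?thesis unfolding e eigencone_def s_def
        using cyclic_extremal(1)[OF A sp] cyclic_extremal_power[OF A sp spectral_cyclicity_dvd(1)[OF A sp]] by simp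
    qed
    show "z \<in> ?V" unfolding a(2)
    proof (rule mem_sum_cone)
      show "x + y \<in> ?V" if "x \<in> ?V" "y \<in> ?V" for x y
        using that by (auto simp: eigencone_def nonneg_vec_def matrix_vector_right_distrib scaleR_add_right)
      show "a p *\<^sub>R ?X p \<in> ?V" if "p \<in> ?I" for p
        using X[OF that] a(1) that by (auto simp: eigencone_def nonneg_vec_def matrix_vector_mult_scaleR)
    qed (auto simp: eigencone_def finite_spectral_index)
  qed
qed

lemma extremals_eigencone_Nonneg:
  fixes A :: "real^'n^'n::finite"
  assumes A: "nonneg_mat A" and \<rho>: "0 < \<rho>"
  defines "s \<equiv> sigma_num Nonneg A \<rho>"
  shows "extremals Nonneg (eigencone Nonneg (mpow Nonneg A s) (\<rho> ^ s)) =
    {a *\<^sub>R class_extremal A p | a p. 0 < a \<and> p \<in> spectral_index_of A \<rho>}"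
  unfolding s_def
proof (rule extremals_of_independent_generators[OF finite_spectral_index(2) _ eigencone_Nonneg_eq[OF A \<rho>]])
  let ?I = "spectral_index_of A \<rho>" and ?X = "class_extremal A"
  note sub = spectral_index_of_subset[of A \<rho>]
  show "?X p \<noteq> 0" if "p \<in> ?I" for p using class_extremal_nonzero(2)[OF A] sub that by blast
  show "\<forall>q\<in>?I. q \<noteq> p \<longrightarrow> b q = 0"
    if p: "p \<in> ?I" and b: "\<forall>q\<in>?I. 0 \<le> b q" and eq: "?X p = (\<Sum>q\<in>?I. b q *\<^sub>R ?X q)" for p b
  proof -
    define b' where "b' q = (if q \<in> ?I then b q else 0)" for q
    have "?X p = (\<Sum>q\<in>spectral_index A. b' q *\<^sub>R ?X q)"
      unfolding eq by (intro sum.mono_neutral_cong_left) (use finite_spectral_index sub in \<open>auto simp: b'_def\<close>)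
    then have "\<forall>q\<in>spectral_index A. q \<noteq> p \<longrightarrow> b' q = 0"
      using p b sub by (intro class_extremals_independent[OF A]) (auto simp: b'_def)
    then show ?thesis using sub by (auto simp: b'_def)
  qed
qed

lemma spectral_index_Union:
  fixes A :: "real^'n^'n::finite"
  assumes A: "nonneg_mat A"
  shows "spectral_index A = (\<Union>\<rho>\<in>Lambda Nonneg A. spectral_index_of A \<rho>)"
proof
  show "(\<Union>\<rho>\<in>Lambda Nonneg A. spectral_index_of A \<rho>) \<subseteq> spectral_index A" using spectral_index_of_subset by blast
  show "spectral_index A \<subseteq> (\<Union>\<rho>\<in>Lambda Nonneg A. spectral_index_of A \<rho>)"
  proof
    fix p assume "p \<in> spectral_index A"
    then obtain \<nu> k \<rho> where s: "p = (\<nu>, k)" "spectral Nonneg A \<rho> \<nu>" "k < sc_cyclicity \<nu>" using spectral_indexE by metis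
    note \<nu> = spectral_class[OF A s(2)]
    obtain i where "i \<in> nodes \<nu>" using \<nu>(4) by (auto simp: strongly_connected_def)
    then have "0 < class_eigenvector A \<rho> \<nu> $ i" using class_eigenvector(3)[OF A s(2)] node_in_class_accesses by blast
    then have "class_eigenvector A \<rho> \<nu> \<noteq> 0" by auto
    then have "\<rho> \<in> Lambda Nonneg A"
      using class_eigenvector(1,2)[OF A s(2)] \<nu>(2) unfolding Lambda_def eigencone_def by auto
    then show "p \<in> (\<Union>\<rho>\<in>Lambda Nonneg A. spectral_index_of A \<rho>)" using s by (auto simp: spectral_index_of_def)
  qed
qed

theorem extremals_core_Nonneg_eigencones:
  fixes A :: "real^'n^'n::finite"
  assumes A: "nonneg_mat A"
  shows "extremals Nonneg (core Nonneg A) = (\<Union>\<rho>\<in>Lambda Nonneg A.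
     extremals Nonneg (eigencone Nonneg (mpow Nonneg A (sigma_num Nonneg A \<rho>)) (\<rho> ^ sigma_num Nonneg A \<rho>)))"
proof -
  have "extremals Nonneg (eigencone Nonneg (mpow Nonneg A (sigma_num Nonneg A \<rho>)) (\<rho> ^ sigma_num Nonneg A \<rho>))
      = {a *\<^sub>R class_extremal A p | a p. 0 < a \<and> p \<in> spectral_index_of A \<rho>}" if "\<rho> \<in> Lambda Nonneg A" for \<rho>
    using extremals_eigencone_Nonneg[OF A, of \<rho>] that by (simp add: Lambda_def)
  then have "(\<Union>\<rho>\<in>Lambda Nonneg A.
     extremals Nonneg (eigencone Nonneg (mpow Nonneg A (sigma_num Nonneg A \<rho>)) (\<rho> ^ sigma_num Nonneg A \<rho>)))
     = (\<Union>\<rho>\<in>Lambda Nonneg A. {a *\<^sub>R class_extremal A p | a p. 0 < a \<and> p \<in> spectral_index_of A \<rho>})"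
    by (rule SUP_cong[OF refl])
  also have "\<dots> = extremals Nonneg (core Nonneg A)"
    unfolding extremals_core_Nonneg[OF A] spectral_index_Union[OF A] by blast
  finally show ?thesis ..
qed

definition class_extremals :: "real^'n^'n \<Rightarrow> 'n graph \<Rightarrow> (real^'n::finite) set" where
  "class_extremals A \<nu> = (\<lambda>k. normalization (class_extremal A (\<nu>, k))) ` {..<sc_cyclicity \<nu>}"

lemma normalized_extremals_core_Nonneg:
  fixes A :: "real^'n^'n::finite"
  assumes A: "nonneg_mat A"
  shows "normalized_extremals Nonneg (core Nonneg A) = (\<Union>\<nu>\<in>spectral_classes Nonneg A. class_extremals A \<nu>)"
proof -
  have "normalized_extremals Nonneg (core Nonneg A) = (\<lambda>p. normalization (class_extremal A p)) ` spectral_index A"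
    by (rule normalized_extremals_eq[OF _ extremals_core_Nonneg[OF A]]) (use class_extremal_nonzero[OF A] in auto)
  then show ?thesis by (auto simp: spectral_index_def class_extremals_def)
qed

text \<open>The extremals of \<open>\<nu>\<close> are distinct because on \<open>\<nu>\<close> they are supported on different cyclic classes.\<close>

lemma class_extremals_properties:
  fixes A :: "real^'n^'n::finite"
  assumes A: "nonneg_mat A" and m: "\<nu> \<in> spectral_classes Nonneg A"
  shows "card (class_extremals A \<nu>) = sc_cyclicity \<nu>"
    "x \<in> class_extremals A \<nu> \<Longrightarrow> support x \<inter> nodes \<nu> \<noteq> {} \<and> (\<forall>i\<in>support x. node_accesses A i \<nu>)"
    "simple_cycle_under Nonneg A (class_extremals A \<nu>)"
proof -
  let ?d = "sc_cyclicity \<nu>"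
  obtain \<rho> where s: "spectral Nonneg A \<rho> \<nu>" using m by (auto simp: spectral_classes_def)
  note \<nu> = spectral_class[OF A s]
  let ?X = "cyclic_extremal A \<rho> \<nu>"
  have eq: "class_extremals A \<nu> = (\<lambda>k. normalization (?X k)) ` {..<?d}"
    unfolding class_extremals_def class_extremal_spectral[OF s] ..
  have nz: "nonneg_vec (?X k)" "?X k \<noteq> 0" if "k < ?d" for k
    using cyclic_extremal(1)[OF A s] cyclic_extremal_support_meets_class[OF A s that] by (blast, force)
  have norm: "\<exists>b>0. normalization (?X k) = b *\<^sub>R ?X k" if "k < ?d" for k
    using normalization_multiple[OF nz[OF that]] by metis
  have inj: "inj_on (\<lambda>k. normalization (?X k)) {..<?d}"
  proof (rule inj_onI)
    fix k l assume kl: "k \<in> {..<?d}" "l \<in> {..<?d}" "normalization (?X k) = normalization (?X l)"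
    obtain i where i: "i \<in> nodes \<nu>" "cyclic_index \<nu> i = k" "0 < ?X k $ i"
      using cyclic_extremal_support_meets_class[OF A s] kl(1) by (metis lessThan_iff)
    obtain b c where "0 < b" "normalization (?X k) = b *\<^sub>R ?X k" "0 < c" "normalization (?X l) = c *\<^sub>R ?X l"
      using norm kl by (metis lessThan_iff)
    then have "b * ?X k $ i = c * ?X l $ i" using kl(3) by (metis vector_scaleR_component real_scaleR_def)
    then have "?X l $ i \<noteq> 0" using i(3) \<open>0 < b\<close> by auto
    then show "k = l" using cyclic_extremal(4)[OF A s i(1), of l] i(2) by (auto split: if_splits)
  qed
  show "card (class_extremals A \<nu>) = ?d" unfolding eq card_image[OF inj] by simp
  show "support x \<inter> nodes \<nu> \<noteq> {} \<and> (\<forall>i\<in>support x. node_accesses A i \<nu>)" if x: "x \<in> class_extremals A \<nu>"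
  proof -
    obtain k where k: "k < ?d" "x = normalization (?X k)" using x unfolding eq by blast
    obtain b where b: "0 < b" "x = b *\<^sub>R ?X k" using norm[OF k(1)] k(2) by auto
    have supp: "support x = {i. 0 < ?X k $ i}" unfolding support_def b(2) using b(1) by (auto simp: zero_less_mult_iff)
    show ?thesis unfolding supp
      using cyclic_extremal_support_meets_class[OF A s k(1)] cyclic_extremal(3)[OF A s] by blast
  qed
  show "simple_cycle_under Nonneg A (class_extremals A \<nu>)"
    unfolding eq
  proof (rule simple_cycle_under_indexed[OF \<nu>(5) inj])
    fix k assume k: "k < ?d"
    have "Suc k mod ?d < ?d" using \<nu>(5) by simp
    then obtain b c where b: "0 < b" "normalization (?X (Suc k mod ?d)) = b *\<^sub>R ?X (Suc k mod ?d)"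
      and c: "0 < c" "normalization (?X k) = c *\<^sub>R ?X k" using norm k by metis
    have "mv Nonneg A (normalization (?X (Suc k mod ?d))) = (b * \<rho> / c) *\<^sub>R normalization (?X k)"
      unfolding b(2) c(2) using mv_cyclic_extremal[OF A s k] c(1) by (simp add: matrix_vector_mult_scaleR)
    then show "\<exists>c>0. mv Nonneg A (normalization (?X (Suc k mod ?d))) = c *\<^sub>R normalization (?X k)"
      using b(1) c(1) \<nu>(2) by (intro exI[of _ "b * \<rho> / c"]) simp
  qed
qed

lemma class_extremals_disjoint:
  fixes A :: "real^'n^'n::finite"
  assumes A: "nonneg_mat A" and m: "\<mu> \<in> spectral_classes Nonneg A" "\<nu> \<in> spectral_classes Nonneg A" "\<mu> \<noteq> \<nu>"
  shows "class_extremals A \<mu> \<inter> class_extremals A \<nu> = {}"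
proof (rule ccontr)
  assume "class_extremals A \<mu> \<inter> class_extremals A \<nu> \<noteq> {}"
  then obtain x where x: "x \<in> class_extremals A \<mu>" "x \<in> class_extremals A \<nu>" by blast
  have c: "\<mu> \<in> classes A" "\<nu> \<in> classes A" using m by (auto simp: spectral_classes_def spectral_def)
  obtain i where i: "i \<in> nodes \<mu>" "node_accesses A i \<nu>"
    using class_extremals_properties(2)[OF A m(1) x(1)] class_extremals_properties(2)[OF A m(2) x(2)] by blast
  obtain j where j: "j \<in> nodes \<nu>" "node_accesses A j \<mu>"
    using class_extremals_properties(2)[OF A m(1) x(1)] class_extremals_properties(2)[OF A m(2) x(2)] by blast
  have "j \<in> nodes \<mu>"
    by (rule class_mutual_access[OF c(1) i(1) class_node_accesses[OF c(2) i(2) j(1)] class_node_accesses[OF c(1) j(2) i(1)]])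
  then show False using classes_eq[OF c _ j(1)] m(3) by blast
qed

theorem extremals_by_spectral_class:
  fixes A :: "real^'n^'n::finite"
  assumes A: "nonneg_mat A"
  shows "\<exists>X :: 'n graph \<Rightarrow> (real ^ 'n) set.
        (\<forall>\<mu>\<in>spectral_classes Nonneg A.
           X \<mu> \<subseteq> normalized_extremals Nonneg (core Nonneg A) \<and>
           card (X \<mu>) = sc_cyclicity \<mu> \<and>
           (\<forall>x\<in>X \<mu>. support x \<inter> nodes \<mu> \<noteq> {} \<and> (\<forall>i\<in>support x. node_accesses A i \<mu>)) \<and>
           simple_cycle_under Nonneg A (X \<mu>)) \<and>
        normalized_extremals Nonneg (core Nonneg A) \<subseteq> (\<Union>\<mu>\<in>spectral_classes Nonneg A. X \<mu>) \<and>
        finite (normalized_extremals Nonneg (core Nonneg A)) \<and>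
        card (normalized_extremals Nonneg (core Nonneg A)) =
          (\<Sum>\<mu>\<in>spectral_classes Nonneg A. sc_cyclicity \<mu>)"
proof (rule exI[of _ "class_extremals A"], intro conjI ballI)
  note eq = normalized_extremals_core_Nonneg[OF A]
  have fin: "finite (class_extremals A \<nu>)" for \<nu> by (simp add: class_extremals_def)
  show "finite (normalized_extremals Nonneg (core Nonneg A))"
    unfolding eq using finite_spectral(2) fin by blast
  show "card (normalized_extremals Nonneg (core Nonneg A)) = (\<Sum>\<mu>\<in>spectral_classes Nonneg A. sc_cyclicity \<mu>)"
    unfolding eq using class_extremals_disjoint[OF A] class_extremals_properties(1)[OF A] fin finite_spectral(2)[of Nonneg A]
    by (subst card_UN_disjoint) auto
qed (use normalized_extremals_core_Nonneg[OF A] class_extremals_properties[OF A] in auto)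

section \<open>Weights of walks in max algebra\<close>

lemma walk_weight_le_mpow:
  assumes B: "nonneg_mat B" and ab: "a \<le> b"
  shows "(\<Prod>t=a..<b. B $ f t $ f (Suc t)) \<le> mpow MaxAlg B (b - a) $ f a $ f b"
  using ab
proof (induction b rule: dec_induct)
  case base
  show ?case by (simp add: mat_def)
next
  case (step b)
  have "(\<Prod>t=a..<Suc b. B $ f t $ f (Suc t)) = (\<Prod>t=a..<b. B $ f t $ f (Suc t)) * B $ f b $ f (Suc b)"
    using step(1) by simp
  also have "\<dots> \<le> mpow MaxAlg B (b - a) $ f a $ f b * mpow MaxAlg B (Suc 0) $ f b $ f (Suc b)"
    unfolding mpow_1[OF B] using step B by (intro mult_right_mono) (auto simp: nonneg_mat_def)
  also have "\<dots> \<le> mpow MaxAlg B (b - a + Suc 0) $ f a $ f (Suc b)" by (rule mpow_add_ge[OF B])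
  also have "b - a + Suc 0 = Suc b - a" using step(1) by simp
  finally show ?case .
qed

lemma mpow_Suc_attained: "\<exists>l. mpow MaxAlg B (Suc k) $ i $ j = B $ i $ l * mpow MaxAlg B k $ l $ j"
proof -
  have "mpow MaxAlg B (Suc k) $ i $ j = ssum MaxAlg (\<lambda>l. B $ i $ l * mpow MaxAlg B k $ l $ j)"
    by (simp only: mpow.simps mm_nth)
  then show ?thesis using ssum_attained[of "\<lambda>l. B $ i $ l * mpow MaxAlg B k $ l $ j"] by metis
qed

lemma mpow_attained_by_walk:
  assumes B: "nonneg_mat B" and pos: "0 < mpow MaxAlg B k $ i $ j"
  shows "\<exists>f. f 0 = i \<and> f k = j \<and> mpow MaxAlg B k $ i $ j = (\<Prod>t<k. B $ f t $ f (Suc t))"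
  using pos
proof (induction k arbitrary: i)
  case 0
  then have "i = j" by (simp add: mat_def split: if_splits)
  then show ?case by (intro exI[of _ "\<lambda>_. i"]) (simp add: mat_def)
next
  case (Suc k)
  obtain l where l: "mpow MaxAlg B (Suc k) $ i $ j = B $ i $ l * mpow MaxAlg B k $ l $ j"
    using mpow_Suc_attained by blast
  have "0 \<le> B $ i $ l" "0 \<le> mpow MaxAlg B k $ l $ j" using B mpow_nonneg[OF B, of MaxAlg k] by (auto simp: nonneg_mat_def)
  then have "0 < mpow MaxAlg B k $ l $ j" using Suc(2) unfolding l by (simp add: zero_less_mult_iff)
  then obtain f where f: "f 0 = l" "f k = j" "mpow MaxAlg B k $ l $ j = (\<Prod>t<k. B $ f t $ f (Suc t))"
    using Suc(1) by blast
  show ?case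
    by (rule exI[of _ "case_nat i f"]) (simp add: l f prod.lessThan_Suc_shift del: mpow.simps prod.lessThan_Suc)
qed

lemma mpow_Max_nonneg: "nonneg_mat B \<Longrightarrow> 0 \<le> mpow MaxAlg B k $ i $ j"
  using mpow_nonneg[of B MaxAlg k] by (simp add: nonneg_mat_def)

text \<open>Starting at \<open>i\<close>, follow indices at which the maxima in \<open>F z = z\<close> are attained, until one repeats.\<close>

lemma tight_cycle_exists:
  fixes F :: "real^'n^'n::finite"
  assumes F: "nonneg_mat F" and z: "nonneg_vec z" "mv MaxAlg F z = z" and i: "0 < z $ i"
  obtains a p j where "1 \<le> p" "z $ i \<le> mpow MaxAlg F a $ i $ j * z $ j" "1 \<le> mpow MaxAlg F p $ j $ j" "0 < z $ j"
proof -
  have "\<exists>l. z $ i = F $ i $ l * z $ l" for i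
  proof -
    have "z $ i = ssum MaxAlg (\<lambda>l. F $ i $ l * z $ l)" using arg_cong[OF z(2), of "\<lambda>x. x $ i"] by (simp only: mv_nth)
    then show ?thesis using ssum_attained[of "\<lambda>l. F $ i $ l * z $ l"] by metis
  qed
  then obtain g where g: "\<And>i. z $ i = F $ i $ g i * z $ g i" by metis
  define h where "h t = (g ^^ t) i" for t
  have h: "h 0 = i" "h (Suc t) = g (h t)" for t by (simp_all add: h_def)
  have tight: "z $ h t \<le> mpow MaxAlg F e $ h t $ h (t + e) * z $ h (t + e)" for t e
  proof (induction e)
    case 0 show ?case by (simp add: mat_def)
  next
    case (Suc e)
    have zs: "z $ h (t + e) = F $ h (t + e) $ h (t + Suc e) * z $ h (t + Suc e)" using g[of "h (t + e)"] h(2) by simp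
    have "z $ h t \<le> mpow MaxAlg F e $ h t $ h (t + e) * mpow MaxAlg F (Suc 0) $ h (t + e) $ h (t + Suc e) * z $ h (t + Suc e)"
      using Suc unfolding mpow_1[OF F] mult.assoc zs[symmetric] .
    also have "\<dots> \<le> mpow MaxAlg F (e + Suc 0) $ h t $ h (t + Suc e) * z $ h (t + Suc e)"
      using z(1) by (intro mult_right_mono mpow_add_ge[OF F]) (simp add: nonneg_vec_def)
    finally show ?case by simp
  qed
  have pos: "0 < z $ h t" for t
  proof -
    have "0 < mpow MaxAlg F t $ h 0 $ h (0 + t) * z $ h (0 + t)" using tight[of 0 t] i h(1) by simp
    then show ?thesis using z(1) by (auto simp: nonneg_vec_def order_less_le)
  qed
  have "finite (range h)" by simp
  then have "\<not> inj h" using finite_imageD infinite_UNIV_nat by blast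
  then obtain a b where "h a = h b" "a \<noteq> b" unfolding inj_def by blast
  then obtain a b where ab: "h a = h b" "a < b" by (metis linorder_neqE_nat)
  have "z $ h a * 1 \<le> z $ h a * mpow MaxAlg F (b - a) $ h a $ h a"
    using tight[of a "b - a"] ab by (simp add: mult.commute)
  then have "1 \<le> mpow MaxAlg F (b - a) $ h a $ h a" using pos[of a] by (simp only: mult_le_cancel_left_pos)
  then show ?thesis using that[of "b - a" a "h a"] tight[of 0 a] h(1) pos ab(2) by simp
qed

text \<open>Cutting a closed walk out of a walk does not decrease the weight, because closed walks have weight at
most one. So all maxima are attained by short walks.\<close>

lemma mpow_bounded_by_short:
  fixes B :: "real^'n^'n::finite"
  assumes B: "nonneg_mat B" and diag: "\<And>k j. mpow MaxAlg B k $ j $ j \<le> 1"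
  shows "\<exists>k'\<le>CARD('n). mpow MaxAlg B k $ i $ j \<le> mpow MaxAlg B k' $ i $ j"
proof (induction k rule: less_induct)
  case (less k)
  note P0 = mpow_Max_nonneg[OF B]
  show ?case
  proof (cases "k \<le> CARD('n) \<or> mpow MaxAlg B k $ i $ j = 0")
    case True
    then show ?thesis using P0[of 0 i j] by (metis le0 order_refl)
  next
    case False
    then have "0 < mpow MaxAlg B k $ i $ j" using P0[of k i j] by linarith
    then obtain f where f: "f 0 = i" "f k = j" "mpow MaxAlg B k $ i $ j = (\<Prod>t<k. B $ f t $ f (Suc t))"
      using mpow_attained_by_walk[OF B] by blast
    have "\<not> inj_on f {..<k}"
    proof
      assume "inj_on f {..<k}"
      then have "card {..<k} \<le> CARD('n)" by (intro card_inj_on_le[of f]) auto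
      then show False using False by simp
    qed
    then obtain a b where "f a = f b" "a \<noteq> b" "a < k" "b < k" unfolding inj_on_def by blast
    then obtain a b where ab: "f a = f b" "a < b" "b < k" by (metis linorder_neqE_nat)
    define w where "w x y = (\<Prod>t=x..<y. B $ f t $ f (Suc t))" for x y
    have w: "w x y \<le> mpow MaxAlg B (y - x) $ f x $ f y" "0 \<le> w x y" if "x \<le> y" for x y
      unfolding w_def using walk_weight_le_mpow[OF B that, of f] B by (auto intro!: prod_nonneg simp: nonneg_mat_def)
    have "w 0 k = w 0 a * (w a b * w b k)"
      unfolding w_def using ab by (simp add: prod.atLeastLessThan_concat)
    also have "\<dots> \<le> w 0 a * (1 * w b k)"
      using w[of a b] w[of 0 a] w[of b k] diag[of "b - a" "f a"] ab
      by (intro mult_left_mono mult_right_mono) (auto intro: order_trans)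
    also have "\<dots> = w 0 a * w b k" by simp
    also have "\<dots> \<le> mpow MaxAlg B a $ f 0 $ f a * mpow MaxAlg B (k - b) $ f b $ f k"
      using w[of 0 a] w[of b k] ab by (intro mult_mono) (auto intro: P0)
    also have "\<dots> \<le> mpow MaxAlg B (a + (k - b)) $ i $ j"
      using mpow_add_ge[OF B, of MaxAlg a "f 0" "f a" "k - b" "f k"] ab(1) f(1,2) by simp
    finally have "mpow MaxAlg B k $ i $ j \<le> mpow MaxAlg B (a + (k - b)) $ i $ j"
      unfolding f(3) w_def by (simp add: atLeast0LessThan)
    moreover have "a + (k - b) < k" using ab by simp
    ultimately show ?thesis using less[of "a + (k - b)"] order_trans by blast
  qed
qed

lemma kleene_partial_nth: "kleene_partial B m $ i $ j = (MAX k\<in>{..m}. mpow MaxAlg B k $ i $ j)"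
  by (simp add: kleene_partial_def)

lemma kleene_star_bounded:
  fixes B :: "real^'n^'n::finite"
  assumes B: "nonneg_mat B" and diag: "\<And>k j. mpow MaxAlg B k $ j $ j \<le> 1"
  shows "kleene_converges B" "mpow MaxAlg B k $ i $ j \<le> kleene_star B $ i $ j"
    "\<exists>k. kleene_star B $ i $ j = mpow MaxAlg B k $ i $ j"
proof -
  have eq: "kleene_partial B m = kleene_partial B CARD('n)" if "CARD('n) \<le> m" for m
    unfolding vec_eq_iff
  proof (intro allI)
    fix i j
    show "kleene_partial B m $ i $ j = kleene_partial B CARD('n) $ i $ j"
      unfolding kleene_partial_nth
    proof (rule order_antisym)
      show "(MAX k\<in>{..m}. mpow MaxAlg B k $ i $ j) \<le> (MAX k\<in>{..CARD('n)}. mpow MaxAlg B k $ i $ j)"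
      proof (rule Max.boundedI)
        fix x assume "x \<in> (\<lambda>k. mpow MaxAlg B k $ i $ j) ` {..m}"
        then obtain k where "x = mpow MaxAlg B k $ i $ j" by blast
        then obtain k' where k': "k' \<le> CARD('n)" "x \<le> mpow MaxAlg B k' $ i $ j"
          using mpow_bounded_by_short[OF B diag] by metis
        have "mpow MaxAlg B k' $ i $ j \<le> (MAX k\<in>{..CARD('n)}. mpow MaxAlg B k $ i $ j)"
          using k'(1) by (intro Max_ge) auto
        then show "x \<le> (MAX k\<in>{..CARD('n)}. mpow MaxAlg B k $ i $ j)" using k'(2) by simp
      qed auto
      show "(MAX k\<in>{..CARD('n)}. mpow MaxAlg B k $ i $ j) \<le> (MAX k\<in>{..m}. mpow MaxAlg B k $ i $ j)"
        using that by (intro Max_mono image_mono) auto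
    qed
  qed
  have lim: "kleene_partial B \<longlonglongrightarrow> kleene_partial B CARD('n)"
    by (rule tendsto_eventually) (unfold eventually_sequentially, use eq in blast)
  then show "kleene_converges B" unfolding kleene_converges_def convergent_def by blast
  have star: "kleene_star B = kleene_partial B CARD('n)" unfolding kleene_star_def using lim by (rule limI)
  obtain k' where k': "k' \<le> CARD('n)" "mpow MaxAlg B k $ i $ j \<le> mpow MaxAlg B k' $ i $ j"
    using mpow_bounded_by_short[OF B diag] by metis
  have "mpow MaxAlg B k' $ i $ j \<le> kleene_star B $ i $ j"
    unfolding star kleene_partial_nth using k'(1) by (intro Max_ge) auto
  then show "mpow MaxAlg B k $ i $ j \<le> kleene_star B $ i $ j" using k'(2) by simp
  have "kleene_star B $ i $ j \<in> (\<lambda>k. mpow MaxAlg B k $ i $ j) ` {..CARD('n)}"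
    unfolding star kleene_partial_nth by (rule Max_in) auto
  then show "\<exists>k. kleene_star B $ i $ j = mpow MaxAlg B k $ i $ j" by blast
qed

section \<open>Max-algebraic matrices with maximal cycle mean one\<close>

text \<open>The situation of \<open>A\<^sub>\<rho>\<close>: no closed walk has weight above one, and some closed walk has weight one.\<close>

locale normalized_max_matrix =
  fixes B :: "real^'n^'n::finite"
  assumes nonneg: "nonneg_mat B"
    and diag: "mpow MaxAlg B k $ j $ j \<le> 1"
    and critical: "\<exists>j k. 1 \<le> k \<and> mpow MaxAlg B k $ j $ j = 1"
begin

abbreviation P :: "nat \<Rightarrow> 'n \<Rightarrow> 'n \<Rightarrow> real" where "P k i j \<equiv> mpow MaxAlg B k $ i $ j"

lemma P_nonneg: "0 \<le> P k i j" by (rule mpow_Max_nonneg[OF nonneg])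

lemma P_mult: "P a i k * P b k j \<le> P (a + b) i j" by (rule mpow_add_ge[OF nonneg])

lemma P_cycle: "P a i j * P b j i \<le> 1" using P_mult[of a i j b i] diag[of "a + b" i] by simp

lemma P_1: "P (Suc 0) i j = B $ i $ j" by (simp only: mpow_1[OF nonneg])

lemma cycle_weight:
  assumes c: "cycle_of (graph_of B) c"
  defines "u \<equiv> \<lambda>t. c ! (t mod length c)"
  shows "(\<Prod>k<length c. case cycle_edge c k of (i, j) \<Rightarrow> B $ i $ j) = (\<Prod>t=0..<length c. B $ u t $ u (Suc t))"
    "u (length c) = u 0" "t < length c \<Longrightarrow> cycle_edge c t = (u t, u (Suc t))"
proof -
  have c0: "c \<noteq> []" using c by (simp add: cycle_of_def)
  show e: "cycle_edge c t = (u t, u (Suc t))" if "t < length c" for t using cycle_edge_mod[OF c0 that] by (simp add: u_def)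
  show "(\<Prod>k<length c. case cycle_edge c k of (i, j) \<Rightarrow> B $ i $ j) = (\<Prod>t=0..<length c. B $ u t $ u (Suc t))"
    unfolding atLeast0LessThan by (intro prod.cong) (auto simp: e)
  show "u (length c) = u 0" using c0 by (simp add: u_def)
qed

lemma cycle_weight_le:
  assumes c: "cycle_of (graph_of B) c"
  shows "(\<Prod>k<length c. case cycle_edge c k of (i, j) \<Rightarrow> B $ i $ j) \<le> 1"
proof -
  let ?u = "\<lambda>t. c ! (t mod length c)"
  have "(\<Prod>t=0..<length c. B $ ?u t $ ?u (Suc t)) \<le> P (length c - 0) (?u 0) (?u (length c))"
    by (rule walk_weight_le_mpow[OF nonneg]) simp
  also have "\<dots> \<le> 1" using cycle_weight(2)[OF c] diag by simp
  finally show ?thesis using cycle_weight(1)[OF c] by simp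
qed

lemma unit_cycle:
  assumes f: "f 0 = f l" "1 \<le> l" "(\<Prod>t<l. B $ f t $ f (Suc t)) = 1"
  shows "cycle_of (graph_of B) (map f [0..<l])"
    "(\<Prod>k<l. case cycle_edge (map f [0..<l]) k of (i, j) \<Rightarrow> B $ i $ j) = 1"
    "t < l \<Longrightarrow> cycle_edge (map f [0..<l]) t = (f t, f (Suc t))"
proof -
  have e: "(f t, f (Suc t)) \<in> edges (graph_of B)" if "t < l" for t
  proof -
    have "B $ f t $ f (Suc t) \<noteq> 0" using f(3) that by (metis finite_lessThan lessThan_iff prod_zero_iff zero_neq_one)
    then show ?thesis by (simp add: graph_of_def)
  qed
  show "cycle_of (graph_of B) (map f [0..<l])" by (rule cycle_of_map[OF f(2) f(1)[symmetric] e])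
  show c: "cycle_edge (map f [0..<l]) t = (f t, f (Suc t))" if "t < l" for t
    by (rule cycle_of_map(2)[OF f(2) f(1)[symmetric] e that])
  show "(\<Prod>k<l. case cycle_edge (map f [0..<l]) k of (i, j) \<Rightarrow> B $ i $ j) = 1"
    unfolding f(3)[symmetric] by (intro prod.cong) (auto simp: c)
qed

lemma max_cycle_mean_1: "max_cycle_mean B = 1"
  unfolding max_cycle_mean_def
proof (rule Greatest_equality)
  obtain j k where k: "1 \<le> k" "P k j j = 1" using critical by blast
  then obtain f where f: "f 0 = j" "f k = j" "(\<Prod>t<k. B $ f t $ f (Suc t)) = 1"
    using mpow_attained_by_walk[OF nonneg, of k j j] by auto
  have "cycle_mean B (map f [0..<k]) = 1"
    unfolding cycle_mean_def using unit_cycle(2)[of f k] f k(1) by simp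
  then show "1 \<in> cycle_mean B ` {c. cycle_of (graph_of B) c}"
    using unit_cycle(1)[of f k] f k(1) by (intro image_eqI[of _ _ "map f [0..<k]"]) auto
next
  fix r assume "r \<in> cycle_mean B ` {c. cycle_of (graph_of B) c}"
  then obtain c where c: "cycle_of (graph_of B) c" "r = cycle_mean B c" by blast
  have "0 < length c" using c(1) by (simp add: cycle_of_def)
  then show "r \<le> 1" unfolding c(2) cycle_mean_def using cycle_weight_le[OF c(1)] by simp
qed

lemma critical_cycle_iff:
  "critical_cycle B c \<longleftrightarrow> cycle_of (graph_of B) c \<and> (\<Prod>k<length c. case cycle_edge c k of (i, j) \<Rightarrow> B $ i $ j) = 1"
proof -
  have "0 < length c" if "cycle_of (graph_of B) c" using that by (simp add: cycle_of_def)
  then show ?thesis unfolding critical_cycle_def max_cycle_mean_1 cycle_mean_def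
    using real_root_eq_1_iff by blast
qed

abbreviation Ec :: "('n \<times> 'n) set" where "Ec \<equiv> edges (critical_graph B)"
abbreviation Nc :: "'n set" where "Nc \<equiv> nodes (critical_graph B)"

lemma critical_graph_edge: "(i, j) \<in> Ec \<longleftrightarrow> (\<exists>c k. critical_cycle B c \<and> k < length c \<and> cycle_edge c k = (i, j))"
  unfolding critical_graph_def by (auto simp: eq_commute)

lemma critical_graph_node: "i \<in> Nc \<longleftrightarrow> (\<exists>c. critical_cycle B c \<and> i \<in> set c)"
  unfolding critical_graph_def by auto

lemma critical_edges_subset: "Ec \<subseteq> Nc \<times> Nc"
proof
  fix e assume "e \<in> Ec"
  then obtain i j c k where c: "e = (i, j)" "critical_cycle B c" "k < length c" "cycle_edge c k = (i, j)"
    using critical_graph_edge by (metis surj_pair)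
  have "Suc k mod length c < length c" using c(3) by (intro mod_less_divisor) auto
  then have "i \<in> set c" "j \<in> set c" using c(3,4) by (auto simp: cycle_edge_def)
  then show "e \<in> Nc \<times> Nc" using c(1,2) critical_graph_node by blast
qed

text \<open>The remainder of a critical cycle through an edge is a return walk of reciprocal weight. Conversely, the
edge followed by such a walk is a critical cycle.\<close>

lemma critical_edge_iff: "(i, j) \<in> Ec \<longleftrightarrow> (\<exists>k. B $ i $ j * P k j i = 1)"
proof
  assume "(i, j) \<in> Ec"
  then obtain c t where c: "critical_cycle B c" "t < length c" "cycle_edge c t = (i, j)"
    using critical_graph_edge by blast
  then have cyc: "cycle_of (graph_of B) c" by (simp add: critical_cycle_iff)
  define u where "u t = c ! (t mod length c)" for t
  note cw = cycle_weight[OF cyc, folded u_def]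
  let ?w = "\<lambda>t. B $ u t $ u (Suc t)" and ?l = "length c"
  have ij: "u t = i" "u (Suc t) = j" using cw(3)[OF c(2)] c(3) by auto
  have w0: "0 \<le> prod ?w S" for S using nonneg by (auto simp: nonneg_mat_def intro!: prod_nonneg)
  have "1 = prod ?w {0..<?l}" using c(1) cw(1) by (simp add: critical_cycle_iff)
  also have "\<dots> = prod ?w {0..<t} * prod ?w {t..<?l}" using c(2) by (simp add: prod.atLeastLessThan_concat)
  also have "prod ?w {t..<?l} = B $ i $ j * prod ?w {Suc t..<?l}"
    using prod.atLeast_Suc_lessThan[OF c(2), of ?w] ij by simp
  also have "prod ?w {0..<t} * (B $ i $ j * prod ?w {Suc t..<?l}) = B $ i $ j * (prod ?w {Suc t..<?l} * prod ?w {0..<t})"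
    by simp
  also have "\<dots> \<le> B $ i $ j * (P (?l - Suc t) j (u 0) * P (t - 0) (u 0) i)"
    using walk_weight_le_mpow[OF nonneg, of "Suc t" ?l u] walk_weight_le_mpow[OF nonneg, of 0 t u] c(2) ij cw(2) nonneg w0 P_nonneg
    by (intro mult_left_mono mult_mono) (auto simp: nonneg_mat_def)
  also have "\<dots> \<le> B $ i $ j * P (?l - Suc t + (t - 0)) j i"
    using nonneg by (intro mult_left_mono P_mult) (simp add: nonneg_mat_def)
  finally have "1 \<le> B $ i $ j * P (?l - Suc t + (t - 0)) j i" .
  moreover have "B $ i $ j * P (?l - Suc t + (t - 0)) j i \<le> 1" using P_cycle[of "Suc 0" i j] by (simp only: P_1)
  ultimately show "\<exists>k. B $ i $ j * P k j i = 1" by (metis order_antisym)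
next
  assume "\<exists>k. B $ i $ j * P k j i = 1"
  then obtain k where k: "B $ i $ j * P k j i = 1" by blast
  then have "P k j i \<noteq> 0" by auto
  then have "0 < P k j i" using P_nonneg[of k j i] by simp
  then obtain f where f: "f 0 = j" "f k = i" "P k j i = (\<Prod>t<k. B $ f t $ f (Suc t))"
    using mpow_attained_by_walk[OF nonneg] by blast
  let ?h = "case_nat i f"
  have h: "?h 0 = ?h (Suc k)" "1 \<le> Suc k" using f by simp_all
  have p: "(\<Prod>t<Suc k. B $ ?h t $ ?h (Suc t)) = 1"
    using k f by (simp add: prod.lessThan_Suc_shift del: prod.lessThan_Suc)
  note uc = unit_cycle[OF h p]
  have "critical_cycle B (map ?h [0..<Suc k])" using uc(1,2) by (simp add: critical_cycle_iff)
  moreover have "cycle_edge (map ?h [0..<Suc k]) 0 = (i, j)" using uc(3)[of 0] f(1) by simp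
  ultimately show "(i, j) \<in> Ec" using critical_graph_edge by (metis length_map length_upt minus_nat.diff_0 zero_less_Suc)
qed

lemma critical_node_iff: "i \<in> Nc \<longleftrightarrow> (\<exists>k\<ge>1. P k i i = 1)"
proof
  assume "i \<in> Nc"
  then obtain c t where c: "critical_cycle B c" "t < length c" "i = c ! t"
    using critical_graph_node by (metis in_set_conv_nth)
  then have "(i, c ! (Suc t mod length c)) \<in> Ec" using critical_graph_edge by (auto simp: cycle_edge_def)
  then obtain j k where jk: "B $ i $ j * P k j i = 1" using critical_edge_iff by blast
  then have "1 \<le> P (Suc 0 + k) i i" using P_mult[of "Suc 0" i j k i] by (simp only: P_1)
  then have "P (Suc 0 + k) i i = 1" using diag by (simp add: order_antisym del: mpow.simps add_Suc)
  then show "\<exists>k\<ge>1. P k i i = 1" by (intro exI[of _ "Suc 0 + k"]) (simp del: mpow.simps)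
next
  assume "\<exists>k\<ge>1. P k i i = 1"
  then obtain k where k: "P (Suc k) i i = 1" by (metis One_nat_def Suc_le_D)
  obtain l where "P (Suc k) i i = B $ i $ l * P k l i" using mpow_Suc_attained by blast
  then have "(i, l) \<in> Ec" using critical_edge_iff k by metis
  then show "i \<in> Nc" using critical_edges_subset by blast
qed

text \<open>Each edge of a walk attaining \<open>P a i j\<close> lies on a closed walk of weight one.\<close>

lemma critical_walk:
  assumes "P a i j * P b j i = 1"
  shows "(i, j) \<in> Ec ^^ a"
  using assms
proof (induction a arbitrary: i b)
  case 0
  then show ?case by (simp add: mat_def split: if_splits)
next
  case (Suc a)
  obtain l where l: "P (Suc a) i j = B $ i $ l * P a l j" using mpow_Suc_attained by blast
  have Bp: "0 \<le> B $ i $ l" using nonneg by (simp add: nonneg_mat_def)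
  have "1 = B $ i $ l * (P a l j * P b j i)" using Suc(2) unfolding l by simp
  also have "\<dots> \<le> B $ i $ l * P (a + b) l i" using Bp by (intro mult_left_mono P_mult)
  finally have "1 \<le> B $ i $ l * P (a + b) l i" .
  moreover have "B $ i $ l * P (a + b) l i \<le> 1" using P_cycle[of "Suc 0" i l] by (simp only: P_1)
  ultimately have "B $ i $ l * P (a + b) l i = 1" by (rule order_antisym[rotated])
  then have il: "(i, l) \<in> Ec" using critical_edge_iff by blast
  have "P a l j * (P b j i * P (Suc 0) i l) = (B $ i $ l * P a l j) * P b j i" unfolding P_1 by (simp only: mult_ac)
  then have "1 = P a l j * (P b j i * P (Suc 0) i l)" using Suc(2) unfolding l by simp
  also have "\<dots> \<le> P a l j * P (b + Suc 0) j l" using P_nonneg by (intro mult_left_mono P_mult)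
  finally have "P a l j * P (b + Suc 0) j l = 1" using P_cycle[of a l j] by (intro order_antisym)
  then have "(l, j) \<in> Ec ^^ a" by (rule Suc(1))
  then show ?case by (rule relpow_Suc_I2[OF il])
qed

lemma critical_walk_return:
  assumes "(i, j) \<in> Ec ^^ a"
  shows "\<exists>b. P a i j * P b j i = 1"
  using assms
proof (induction a arbitrary: i)
  case 0
  then show ?case by (intro exI[of _ 0]) (simp add: mat_def)
next
  case (Suc a)
  obtain l where l: "(i, l) \<in> Ec" "(l, j) \<in> Ec ^^ a" using relpow_Suc_D2[OF Suc(2)] by blast
  obtain k where k: "B $ i $ l * P k l i = 1" using l(1) critical_edge_iff by blast
  obtain b where b: "P a l j * P b j l = 1" using Suc(1)[OF l(2)] by blast
  have "(P (Suc 0) i l * P a l j) * (P b j l * P k l i) = (B $ i $ l * P k l i) * (P a l j * P b j l)"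
    unfolding P_1 by (simp only: mult_ac)
  then have "1 = (P (Suc 0) i l * P a l j) * (P b j l * P k l i)" unfolding k b by simp
  also have "\<dots> \<le> P (Suc 0 + a) i j * P (b + k) j i"
    using P_nonneg by (intro mult_mono P_mult mult_nonneg_nonneg)
  finally have "P (Suc a) i j * P (b + k) j i = 1" using P_cycle[of "Suc a" i j "b + k"] by (simp del: mpow.simps)
  then show ?case by blast
qed

text \<open>Each of the two walks has some return walk of reciprocal weight. The four weights multiply to one, and
every closed walk contributes at most one.\<close>

lemma critical_walks_product:
  assumes "(i, j) \<in> Ec ^^ a" "(j, i) \<in> Ec ^^ b"
  shows "P a i j * P b j i = 1"
proof -
  obtain b' where b': "P a i j * P b' j i = 1" using critical_walk_return[OF assms(1)] by blast
  obtain a' where a': "P b j i * P a' i j = 1" using critical_walk_return[OF assms(2)] by blast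
  have "(P a i j * P b j i) * (P b' j i * P a' i j) = (P a i j * P b' j i) * (P b j i * P a' i j)"
    by (simp only: mult_ac)
  then have "1 = (P a i j * P b j i) * (P b' j i * P a' i j)" unfolding a' b' by simp
  also have "\<dots> \<le> (P a i j * P b j i) * 1"
    using P_nonneg by (intro mult_left_mono P_cycle mult_nonneg_nonneg)
  finally show ?thesis using P_cycle[of a i j b] by simp
qed

lemma critical_reach_sym: "(i, j) \<in> Ec\<^sup>* \<Longrightarrow> (j, i) \<in> Ec\<^sup>*"
proof -
  assume "(i, j) \<in> Ec\<^sup>*"
  then obtain a where "(i, j) \<in> Ec ^^ a" using rtrancl_imp_relpow by blast
  then obtain b where "P a i j * P b j i = 1" using critical_walk_return by blast
  then have "(j, i) \<in> Ec ^^ b" using critical_walk[of b j i a] by (simp add: mult.commute)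
  then show ?thesis by (rule relpow_imp_rtrancl)
qed

lemma critical_closed_walk: "i \<in> Nc \<Longrightarrow> \<exists>k\<ge>1. (i, i) \<in> Ec ^^ k"
proof -
  assume "i \<in> Nc"
  then obtain k where k: "k \<ge> 1" "P k i i = 1" using critical_node_iff by blast
  then have "P k i i * P 0 i i = 1" by (simp add: mat_def)
  then have "(i, i) \<in> Ec ^^ k" by (rule critical_walk)
  then show ?thesis using k(1) by blast
qed

lemma critical_component:
  assumes C: "C \<in> sccs (critical_graph B)"
  shows "strongly_connected C" "edges C \<noteq> {}" "nodes C \<subseteq> Nc" "edges C \<subseteq> Ec"
proof -
  show sc: "strongly_connected C" by (rule scc_strongly_connected[OF critical_edges_subset C])
  obtain r where r: "r \<in> Nc" "C = scc_of (critical_graph B) r" using C by (auto simp: sccs_eq)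
  show "nodes C \<subseteq> Nc" unfolding r(2) nodes_scc_of by auto
  show "edges C \<subseteq> Ec" unfolding r(2) edges_scc_of by auto
  have rC: "r \<in> nodes C" using scc_of_self[OF r(1)] r(2) by simp
  obtain k where k: "k \<ge> 1" "(r, r) \<in> Ec ^^ k" using critical_closed_walk[OF r(1)] by blast
  have "(r, r) \<in> edges C ^^ k" by (rule walk_in_scc[OF critical_edges_subset C k(2) rC rC])
  moreover obtain k' where "k = Suc k'" using k(1) by (metis One_nat_def Suc_le_D)
  ultimately show "edges C \<noteq> {}" by auto
qed

definition \<sigma> :: nat where "\<sigma> = cyclicity (critical_graph B)"

lemma cyclicity_dvd_sigma: "C \<in> sccs (critical_graph B) \<Longrightarrow> sc_cyclicity C dvd \<sigma>"
  unfolding \<sigma>_def cyclicity_def by (auto intro: dvd_Lcm)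

lemma sigma_pos: "1 \<le> \<sigma>"
proof -
  have "0 \<notin> sc_cyclicity ` sccs (critical_graph B)"
    using cyclicity_pos[OF critical_component(1,2)] by force
  moreover have "finite (sccs (critical_graph B))" unfolding sccs_eq by simp
  ultimately have "Lcm (sc_cyclicity ` sccs (critical_graph B)) \<noteq> 0"
    using Lcm_0_iff[of "sc_cyclicity ` sccs (critical_graph B)"] by auto
  then show ?thesis unfolding \<sigma>_def cyclicity_def by linarith
qed

text \<open>By \<open>star_attained\<close>, the entries are the maximal weights of walks of length divisible by \<open>\<sigma>\<close>.\<close>

definition star :: "real^'n^'n" where "star = kleene_star (mpow MaxAlg B \<sigma>)"

lemma mpow_sigma: "mpow MaxAlg (mpow MaxAlg B \<sigma>) k $ i $ j = P (\<sigma> * k) i j"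
  by (simp only: mpow_mult[OF nonneg])

lemma star_converges: "kleene_converges (mpow MaxAlg B \<sigma>)"
  and star_ge: "P (\<sigma> * k) i j \<le> star $ i $ j"
  and star_attained: "\<exists>k. star $ i $ j = P (\<sigma> * k) i j"
  unfolding star_def
  by (rule kleene_star_bounded[OF mpow_nonneg[OF nonneg, of MaxAlg \<sigma>], unfolded mpow_sigma, OF diag])+

lemma star_diag: "star $ j $ j = 1"
proof (rule order_antisym)
  show "star $ j $ j \<le> 1" using star_attained[of j j] diag by metis
  have "P (\<sigma> * 0) j j = 1" by (simp add: mat_def)
  then show "1 \<le> star $ j $ j" using star_ge[of 0 j j] by simp
qed

lemma star_nonneg: "0 \<le> star $ i $ j" using star_attained[of i j] P_nonneg by metis

lemma component_of: "j \<in> Nc \<Longrightarrow> \<exists>C\<in>sccs (critical_graph B). j \<in> nodes C"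
  using scc_of_self by metis

lemma critical_long_return:
  assumes j: "j \<in> Nc" shows "\<exists>R. \<forall>r\<ge>R. P (\<sigma> * r) j j = 1"
proof -
  obtain C where C: "C \<in> sccs (critical_graph B)" "j \<in> nodes C" using component_of[OF j] by blast
  note cc = critical_component[OF C(1)]
  obtain L where L: "\<And>l. l \<ge> L \<Longrightarrow> sc_cyclicity C dvd l \<Longrightarrow> (j, j) \<in> edges C ^^ l"
    using long_closed_walks[OF cc(1,2) C(2)] by blast
  have "P (\<sigma> * r) j j = 1" if r: "r \<ge> L" for r
  proof -
    have "\<sigma> * r \<ge> L" using r sigma_pos by (metis mult_le_mono mult_1 order_trans)
    moreover have "sc_cyclicity C dvd \<sigma> * r" using cyclicity_dvd_sigma[OF C(1)] by simp
    ultimately have "(j, j) \<in> edges C ^^ (\<sigma> * r)" using L by blast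
    then have w: "(j, j) \<in> Ec ^^ (\<sigma> * r)" using cc(4) by (rule relpow_subset)
    have "P (\<sigma> * r) j j * P (\<sigma> * r) j j = 1" by (rule critical_walks_product[OF w w])
    then have "(P (\<sigma> * r) j j)\<^sup>2 = 1" by (simp only: power2_eq_square)
    then show ?thesis using P_nonneg[of "\<sigma> * r" j j] unfolding power2_eq_1_iff by linarith
  qed
  then show ?thesis by blast
qed

lemma mpow_fix_power:
  assumes z: "nonneg_vec z" "mv MaxAlg (mpow MaxAlg B m) z = z"
  shows "mv MaxAlg (mpow MaxAlg B (m * k)) z = z"
  using periodic_mult[OF nonneg z(1), of MaxAlg m 1 k] z(2) by simp

text \<open>The walk that attains \<open>star i j\<close> can be extended at \<open>j\<close> by a critical closed walk, without changing its
weight, to a length divisible by \<open>\<sigma> q\<close>. The corresponding power fixes \<open>z\<close>.\<close>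

lemma star_column_below:
  assumes z: "nonneg_vec z" "mv MaxAlg (mpow MaxAlg B (\<sigma> * q)) z = z" and q: "1 \<le> q" and j: "j \<in> Nc"
  shows "star $ i $ j * z $ j \<le> z $ i"
proof -
  obtain k where k: "star $ i $ j = P (\<sigma> * k) i j" using star_attained by blast
  obtain R where R: "\<And>r. r \<ge> R \<Longrightarrow> P (\<sigma> * r) j j = 1" using critical_long_return[OF j] by blast
  \<comment> \<open>This makes \<open>k + r\<close> a multiple of \<open>q\<close> and keeps \<open>r \<ge> R\<close>.\<close>
  define r where "r = k * (q - 1) + q * R"
  have "1 * R \<le> q * R" using q by (intro mult_le_mono) auto
  then have rR: "r \<ge> R" unfolding r_def by linarith
  have kq: "k + k * (q - 1) = k * q" using q by (cases q) auto
  have "k + r = q * (k + R)"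
    unfolding r_def add.assoc[symmetric] kq by (simp add: add_mult_distrib2 mult.commute)
  then have kr: "\<sigma> * k + \<sigma> * r = \<sigma> * q * (k + R)" by (metis add_mult_distrib2 mult.assoc)
  have "star $ i $ j \<le> P (\<sigma> * k + \<sigma> * r) i j"
    using P_mult[of "\<sigma> * k" i j "\<sigma> * r" j] R[OF rR] k by simp
  then have "star $ i $ j * z $ j \<le> P (\<sigma> * q * (k + R)) i j * z $ j"
    unfolding kr using z(1) by (intro mult_right_mono) (auto simp: nonneg_vec_def)
  also have "\<dots> \<le> mv MaxAlg (mpow MaxAlg B (\<sigma> * q * (k + R))) z $ i"
    by (rule mv_ge_term[OF mpow_nonneg[OF nonneg] z(1)])
  also have "\<dots> = z $ i" by (simp only: mpow_fix_power[OF z])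
  finally show ?thesis .
qed

lemma star_column_eigenvector:
  assumes j: "j \<in> Nc"
  shows "mv MaxAlg (mpow MaxAlg B \<sigma>) (column j star) = column j star"
  unfolding vec_eq_iff
proof
  fix i
  have le: "P \<sigma> i l * star $ l $ j \<le> star $ i $ j" for l
  proof -
    obtain k where k: "star $ l $ j = P (\<sigma> * k) l j" using star_attained by blast
    have "P \<sigma> i l * star $ l $ j \<le> P (\<sigma> + \<sigma> * k) i j" unfolding k by (rule P_mult)
    also have "\<dots> \<le> star $ i $ j" using star_ge[of "Suc k" i j] by simp
    finally show ?thesis .
  qed
  have eq: "mv MaxAlg (mpow MaxAlg B \<sigma>) (column j star) $ i = ssum MaxAlg (\<lambda>l. P \<sigma> i l * star $ l $ j)"
    by (simp only: mv_nth column_nth)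
  show "mv MaxAlg (mpow MaxAlg B \<sigma>) (column j star) $ i = column j star $ i"
    unfolding eq column_nth
  proof (rule order_antisym)
    show "ssum MaxAlg (\<lambda>l. P \<sigma> i l * star $ l $ j) \<le> star $ i $ j" unfolding ssum_Max_le_iff using le by blast
    obtain k where k: "star $ i $ j = P (\<sigma> * k) i j" using star_attained by blast
    obtain R where R: "\<And>r. r \<ge> R \<Longrightarrow> P (\<sigma> * r) j j = 1" using critical_long_return[OF j] by blast
    have "star $ i $ j \<le> P (\<sigma> * k + \<sigma> * Suc R) i j"
      using P_mult[of "\<sigma> * k" i j "\<sigma> * Suc R" j] R[of "Suc R"] k by simp
    also have "\<sigma> * k + \<sigma> * Suc R = \<sigma> + \<sigma> * (k + R)" by (simp add: algebra_simps)
    also have "P (\<sigma> + \<sigma> * (k + R)) i j = ssum MaxAlg (\<lambda>l. P \<sigma> i l * P (\<sigma> * (k + R)) l j)"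
      by (simp only: mpow_add[OF nonneg] mm_nth)
    also have "\<dots> \<le> ssum MaxAlg (\<lambda>l. P \<sigma> i l * star $ l $ j)"
      by (intro ssum_mono mult_left_mono star_ge P_nonneg)
    finally show "star $ i $ j \<le> ssum MaxAlg (\<lambda>l. P \<sigma> i l * star $ l $ j)" .
  qed
qed

lemma column_star_nonneg: "nonneg_vec (column j star)" using star_nonneg by (simp add: nonneg_vec_def column_nth)

text \<open>The closed walk found by \<open>tight_cycle_exists\<close> has weight one, so its nodes are critical.\<close>

lemma generated_by_critical_columns:
  assumes z: "nonneg_vec z" "mv MaxAlg (mpow MaxAlg B (\<sigma> * q)) z = z" and q: "1 \<le> q" and i: "0 < z $ i"
  shows "\<exists>j\<in>Nc. 0 < z $ j \<and> star $ i $ j * z $ j = z $ i"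
proof -
  obtain a p j where t: "1 \<le> p" "z $ i \<le> mpow MaxAlg (mpow MaxAlg B (\<sigma> * q)) a $ i $ j * z $ j"
    "1 \<le> mpow MaxAlg (mpow MaxAlg B (\<sigma> * q)) p $ j $ j" "0 < z $ j"
    by (rule tight_cycle_exists[OF mpow_nonneg[OF nonneg] z i])
  have "P (\<sigma> * q * p) j j = 1"
    using t(3) diag by (intro order_antisym) (simp_all only: mpow_mult[OF nonneg])
  moreover have "1 \<le> \<sigma> * q * p" using sigma_pos q t(1) by (simp add: Suc_le_eq)
  ultimately have j: "j \<in> Nc" using critical_node_iff by blast
  have "z $ i \<le> P (\<sigma> * (q * a)) i j * z $ j" using t(2) by (simp only: mpow_mult[OF nonneg] mult.assoc)
  also have "\<dots> \<le> star $ i $ j * z $ j" using t(4) by (intro mult_right_mono star_ge) simp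
  finally have "star $ i $ j * z $ j = z $ i" using star_column_below[OF z q j, of i] by simp
  then show ?thesis using j t(4) by blast
qed

lemma star_transitive: "j \<in> Nc \<Longrightarrow> star $ l $ i * star $ i $ j \<le> star $ l $ j" if "i \<in> Nc" for i j l
  using star_column_below[of "column j star" 1 i l] column_star_nonneg star_column_eigenvector that by (simp add: column_nth)

text \<open>Proportionality of the columns, read off at \<open>i\<close> and \<open>j\<close>, gives \<open>star i j * star j i = 1\<close>. The two walks
that attain these entries then form a critical closed walk whose two parts have length divisible by
\<open>\<sigma>\<close>. Conversely, critical walks of such lengths in both directions bound each column by a multiple of
the other, and the product of the two factors is one.\<close>

lemma proportional_columns_iff:
  assumes i: "i \<in> Nc" and j: "j \<in> Nc"
  shows "(\<exists>c. column i star = c *\<^sub>R column j star) \<longleftrightarrow>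
    (\<exists>C\<in>sccs (critical_graph B). i \<in> nodes C \<and> j \<in> nodes C \<and> cyclic_index C i = cyclic_index C j)"
proof
  assume "\<exists>c. column i star = c *\<^sub>R column j star"
  then obtain c where c: "column i star = c *\<^sub>R column j star" by blast
  have ci: "star $ l $ i = c * star $ l $ j" for l using arg_cong[OF c, of "\<lambda>x. x $ l"] by (simp add: column_nth)
  have "star $ i $ j * star $ j $ i = 1" using ci[of i] ci[of j] star_diag by (simp add: mult.commute)
  moreover obtain a where a: "star $ i $ j = P (\<sigma> * a) i j" using star_attained by blast
  moreover obtain b where "star $ j $ i = P (\<sigma> * b) j i" using star_attained by blast
  ultimately have "P (\<sigma> * a) i j * P (\<sigma> * b) j i = 1" by simp
  then have w: "(i, j) \<in> Ec ^^ (\<sigma> * a)" by (rule critical_walk)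
  obtain C where C: "C \<in> sccs (critical_graph B)" "i \<in> nodes C" using component_of[OF i] by blast
  note cc = critical_component[OF C(1)]
  have jC: "j \<in> nodes C"
  proof -
    obtain r where r: "C = scc_of (critical_graph B) r" using C(1) by (auto simp: sccs_eq)
    have "(r, j) \<in> Ec\<^sup>*" using C(2) relpow_imp_rtrancl[OF w] unfolding r nodes_scc_of by auto
    then show ?thesis using critical_reach_sym j unfolding r nodes_scc_of by blast
  qed
  have "(i, j) \<in> edges C ^^ (\<sigma> * a)" by (rule walk_in_scc[OF critical_edges_subset C(1) w C(2) jC])
  then have "cyclic_index C j = (cyclic_index C i + \<sigma> * a) mod sc_cyclicity C"
    by (rule cyclic_index_walk[OF cc(1,2) C(2)])
  moreover obtain e where "\<sigma> = sc_cyclicity C * e" using cyclicity_dvd_sigma[OF C(1)] by (auto elim: dvdE)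
  ultimately have "cyclic_index C i = cyclic_index C j"
    using cyclic_index_less[OF cc(1,2), of i] by (simp add: mult.assoc)
  then show "\<exists>C\<in>sccs (critical_graph B). i \<in> nodes C \<and> j \<in> nodes C \<and> cyclic_index C i = cyclic_index C j"
    using C jC by blast
next
  assume "\<exists>C\<in>sccs (critical_graph B). i \<in> nodes C \<and> j \<in> nodes C \<and> cyclic_index C i = cyclic_index C j"
  then obtain C where C: "C \<in> sccs (critical_graph B)" "i \<in> nodes C" "j \<in> nodes C" "cyclic_index C i = cyclic_index C j" by blast
  note cc = critical_component[OF C(1)]
  have walk: "\<exists>k. (x, y) \<in> Ec ^^ (\<sigma> * k)"
    if xy: "x \<in> nodes C" "y \<in> nodes C" "cyclic_index C x = cyclic_index C y" for x y
  proof -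
    obtain L where L: "\<And>l. l \<ge> L \<Longrightarrow> cyclic_index C y = (cyclic_index C x + l) mod sc_cyclicity C \<Longrightarrow> (x, y) \<in> edges C ^^ l"
      using long_walks[OF cc(1,2) xy(1,2)] by blast
    have "\<sigma> * L \<ge> L" using sigma_pos by simp
    moreover obtain e where "\<sigma> = sc_cyclicity C * e" using cyclicity_dvd_sigma[OF C(1)] by (auto elim: dvdE)
    then have "cyclic_index C y = (cyclic_index C x + \<sigma> * L) mod sc_cyclicity C"
      using cyclic_index_less[OF cc(1,2), of y] xy(3) by (simp add: mult.assoc)
    ultimately have "(x, y) \<in> edges C ^^ (\<sigma> * L)" using L by blast
    then show ?thesis using relpow_subset[OF _ cc(4)] by blast
  qed
  obtain a where a: "(i, j) \<in> Ec ^^ (\<sigma> * a)" using walk C by blast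
  obtain b where b: "(j, i) \<in> Ec ^^ (\<sigma> * b)" using walk[of j i] C by auto
  have "1 = P (\<sigma> * a) i j * P (\<sigma> * b) j i" using critical_walks_product[OF a b] by simp
  also have "\<dots> \<le> star $ i $ j * star $ j $ i" using star_ge star_nonneg P_nonneg by (intro mult_mono) auto
  finally have "1 \<le> star $ i $ j * star $ j $ i" .
  moreover have "star $ i $ j * star $ j $ i \<le> 1" using star_transitive[OF j i, of i] star_diag by simp
  ultimately have one: "star $ i $ j * star $ j $ i = 1" by simp
  have eq: "star $ l $ i = star $ j $ i * star $ l $ j" for l
  proof (rule order_antisym)
    have "star $ l $ i = (star $ l $ i * star $ i $ j) * star $ j $ i" using one by (simp add: mult.assoc)
    also have "\<dots> \<le> star $ l $ j * star $ j $ i" using star_nonneg by (intro mult_right_mono star_transitive[OF i j])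
    finally show "star $ l $ i \<le> star $ j $ i * star $ l $ j" by (simp add: mult.commute)
    show "star $ j $ i * star $ l $ j \<le> star $ l $ i" using star_transitive[OF j i, of l] by (simp add: mult.commute)
  qed
  have "column i star $ l = (star $ j $ i *\<^sub>R column j star) $ l" for l
    unfolding column_nth vector_scaleR_component real_scaleR_def by (rule eq)
  then have "column i star = star $ j $ i *\<^sub>R column j star" unfolding vec_eq_iff by blast
  then show "\<exists>c. column i star = c *\<^sub>R column j star" by blast
qed

text \<open>One inequality is \<open>star_column_below\<close> for the fixed vector \<open>B (column j)\<close>. For the other one, close the
edge by a critical walk from \<open>j\<close> to \<open>i\<close> of length \<open>-1\<close> modulo \<open>\<sigma>\<close>, which has weight \<open>1 / B i j\<close>.\<close>

lemma mv_column_star: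
  assumes ij: "(i, j) \<in> Ec"
  shows "mv MaxAlg B (column j star) = B $ i $ j *\<^sub>R column i star" and "0 < B $ i $ j"
proof -
  have i: "i \<in> Nc" and j: "j \<in> Nc" using ij critical_edges_subset by auto
  have Bij: "0 \<le> B $ i $ j" using nonneg by (simp add: nonneg_mat_def)
  obtain k where "B $ i $ j * P k j i = 1" using ij critical_edge_iff by blast
  then show Bpos: "0 < B $ i $ j" using Bij by (auto simp: order_less_le)
  let ?u = "mv MaxAlg B (column j star)"
  have u: "nonneg_vec ?u" by (rule mv_nonneg[OF nonneg column_star_nonneg])
  have "mv MaxAlg (mpow MaxAlg B \<sigma>) ?u = ?u"
  proof -
    have "mv MaxAlg (mpow MaxAlg B \<sigma>) ?u = (mv MaxAlg B ^^ \<sigma>) ?u" by (rule mv_mpow[OF nonneg u])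
    also have "\<dots> = mv MaxAlg B ((mv MaxAlg B ^^ \<sigma>) (column j star))" by (rule funpow_swap1[symmetric])
    also have "(mv MaxAlg B ^^ \<sigma>) (column j star) = mv MaxAlg (mpow MaxAlg B \<sigma>) (column j star)"
      by (rule mv_mpow[OF nonneg column_star_nonneg, symmetric])
    also have "\<dots> = column j star" by (rule star_column_eigenvector[OF j])
    finally show ?thesis .
  qed
  note u_fix = this
  have below: "star $ l $ i * ?u $ i \<le> ?u $ l" for l
    by (rule star_column_below[OF u _ order_refl i]) (simp only: mult_1_right u_fix)
  obtain C where C: "C \<in> sccs (critical_graph B)" "i \<in> nodes C" using component_of[OF i] by blast
  note cc = critical_component[OF C(1)]
  have jC: "j \<in> nodes C"
  proof -
    obtain r where r: "C = scc_of (critical_graph B) r" using C(1) by (auto simp: sccs_eq)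
    have "(r, j) \<in> Ec\<^sup>*" using C(2) ij unfolding r nodes_scc_of by auto
    then show ?thesis using critical_reach_sym j unfolding r nodes_scc_of by blast
  qed
  have "(i, j) \<in> edges C ^^ 1" using walk_in_scc[OF critical_edges_subset C(1) _ C(2) jC, of 1] ij by simp
  then have cij: "cyclic_index C j = (cyclic_index C i + 1) mod sc_cyclicity C"
    by (rule cyclic_index_walk[OF cc(1,2) C(2)])
  obtain L where L: "\<And>l. l \<ge> L \<Longrightarrow> cyclic_index C i = (cyclic_index C j + l) mod sc_cyclicity C \<Longrightarrow> (j, i) \<in> edges C ^^ l"
    using long_walks[OF cc(1,2) jC C(2)] by blast
  \<comment> \<open>The length of a walk that closes the edge \<open>(i, j)\<close> to a length divisible by \<open>\<sigma>\<close>.\<close>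
  define r where "r = \<sigma> * Suc L - 1"
  have "Suc L \<le> \<sigma> * Suc L" using mult_le_mono1[OF sigma_pos, of "Suc L"] by (simp only: mult_1)
  then have r: "r + 1 = \<sigma> * Suc L" "r \<ge> L" unfolding r_def by linarith+
  obtain e where e: "\<sigma> = sc_cyclicity C * e" using cyclicity_dvd_sigma[OF C(1)] by (auto elim: dvdE)
  have "(cyclic_index C j + r) mod sc_cyclicity C = (cyclic_index C i + (r + 1)) mod sc_cyclicity C"
    unfolding cij by (simp add: mod_simps add_ac)
  also have "\<dots> = cyclic_index C i"
    unfolding r(1) e mult.assoc mod_mult_self2 using cyclic_index_less[OF cc(1,2), of i] by simp
  finally have "(j, i) \<in> edges C ^^ r" using L r(2) by metis
  then have "(j, i) \<in> Ec ^^ r" using cc(4) by (rule relpow_subset)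
  then have one: "B $ i $ j * P r j i = 1"
    using critical_walks_product[of i j "Suc 0" r] ij P_1[of i j] by simp
  have "?u $ l \<le> B $ i $ j * star $ l $ i" for l
  proof -
    have "B $ l $ m * star $ m $ j \<le> B $ i $ j * star $ l $ i" for m
    proof -
      obtain k where k: "star $ m $ j = P (\<sigma> * k) m j" using star_attained by blast
      have "B $ i $ j * (P (Suc 0) l m * P (\<sigma> * k) m j * P r j i)
          = (B $ i $ j * P r j i) * (P (Suc 0) l m * P (\<sigma> * k) m j)" by (simp only: mult_ac)
      then have "B $ l $ m * star $ m $ j = B $ i $ j * (P (Suc 0) l m * P (\<sigma> * k) m j * P r j i)"
        unfolding k P_1 one by simp
      also have "\<dots> \<le> B $ i $ j * P (Suc 0 + \<sigma> * k + r) l i"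
      proof (intro mult_left_mono Bij)
        have "P (Suc 0) l m * P (\<sigma> * k) m j * P r j i \<le> P (Suc 0 + \<sigma> * k) l j * P r j i"
          by (intro mult_right_mono P_mult P_nonneg)
        also have "\<dots> \<le> P (Suc 0 + \<sigma> * k + r) l i" by (rule P_mult)
        finally show "P (Suc 0) l m * P (\<sigma> * k) m j * P r j i \<le> P (Suc 0 + \<sigma> * k + r) l i" .
      qed
      also have "Suc 0 + \<sigma> * k + r = \<sigma> * (k + Suc L)" using r(1) by (simp add: algebra_simps)
      also have "B $ i $ j * P (\<sigma> * (k + Suc L)) l i \<le> B $ i $ j * star $ l $ i"
        by (intro mult_left_mono Bij star_ge)
      finally show ?thesis .
    qed
    then show ?thesis by (simp only: mv_nth ssum_Max_le_iff column_nth) blast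
  qed
  moreover have "B $ i $ j * star $ l $ i \<le> ?u $ l" for l
  proof -
    have "B $ i $ j * 1 \<le> ?u $ i" using mv_ge_term[OF nonneg column_star_nonneg[of j], of i j MaxAlg] star_diag by (simp add: column_nth del: mv.simps)
    then have "star $ l $ i * B $ i $ j \<le> star $ l $ i * ?u $ i" using star_nonneg by (intro mult_left_mono) (auto simp del: mv.simps)
    also have "\<dots> \<le> ?u $ l" by (rule below)
    finally show ?thesis by (simp add: mult.commute del: mv.simps)
  qed
  ultimately have "?u $ l = (B $ i $ j *\<^sub>R column i star) $ l" for l
    unfolding vector_scaleR_component real_scaleR_def column_nth by (rule order_antisym)
  then show "?u = B $ i $ j *\<^sub>R column i star" unfolding vec_eq_iff by blast
qed

end

section \<open>Eigenvalues in max algebra\<close>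

text \<open>Multiply the inequalities \<open>A i j * x j \<le> \<rho>\<^sub>\<mu> * x i\<close> for the Perron vector \<open>x\<close> along a closed walk.\<close>

lemma power_diag_le_root:
  fixes A :: "real^'n^'n::finite"
  assumes A: "nonneg_mat A" and m: "\<mu> \<in> classes A" "j \<in> nodes \<mu>"
  shows "mpow MaxAlg A p $ j $ j \<le> perron_root MaxAlg A (nodes \<mu>) ^ p"
proof -
  let ?r = "perron_root MaxAlg A (nodes \<mu>)" and ?R = "restrict_mat (nodes \<mu>) A"
  obtain x where x: "nonneg_vec x" "\<And>i. 0 < x $ i \<longleftrightarrow> i \<in> nodes \<mu>" "mv MaxAlg ?R x = ?r *\<^sub>R x"
    using class_perron(1)[OF A m(1)] by blast
  have r0: "0 \<le> ?r" by (rule class_perron(2)[OF A m(1)])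
  show ?thesis
  proof (cases "mpow MaxAlg A p $ j $ j = 0")
    case False
    then have "0 < mpow MaxAlg A p $ j $ j" using mpow_Max_nonneg[OF A, of p j j] by simp
    then obtain f where f: "f 0 = j" "f p = j" "mpow MaxAlg A p $ j $ j = (\<Prod>t<p. A $ f t $ f (Suc t))"
      using mpow_attained_by_walk[OF A] by blast
    have edge: "(f t, f (Suc t)) \<in> edges (graph_of A)" if "t < p" for t
    proof -
      have "A $ f t $ f (Suc t) \<noteq> 0" using f(3) False that by (metis finite_lessThan lessThan_iff prod_zero_iff)
      then show ?thesis by (simp add: graph_of_def)
    qed
    have reach: "(f a, f b) \<in> (edges (graph_of A))\<^sup>*" if "a \<le> b" "b \<le> p" for a b
      using that
    proof (induction b rule: dec_induct)
      case (step b)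
      then show ?case using edge[of b] by (meson Suc_le_lessD less_imp_le rtrancl_into_rtrancl)
    qed simp
    have node: "f t \<in> nodes \<mu>" if "t \<le> p" for t
      using class_mutual_access[OF m(1,2)] reach[of 0 t] reach[of t p] that f(1,2) by simp
    have le: "A $ f t $ f (Suc t) * x $ f (Suc t) \<le> ?r * x $ f t" if "t < p" for t
    proof -
      have "?R $ f t $ f (Suc t) * x $ f (Suc t) \<le> mv MaxAlg ?R x $ f t"
        by (rule mv_ge_term[OF nonneg_restrict[OF A] x(1)])
      then show ?thesis unfolding x(3) using node[of t] node[of "Suc t"] that by (simp add: restrict_nth)
    qed
    have "(\<Prod>t<k. A $ f t $ f (Suc t)) * x $ f k \<le> ?r ^ k * x $ f 0" if "k \<le> p" for k
      using that
    proof (induction k)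
      case (Suc k)
      have "(\<Prod>t<Suc k. A $ f t $ f (Suc t)) * x $ f (Suc k)
          = (\<Prod>t<k. A $ f t $ f (Suc t)) * (A $ f k $ f (Suc k) * x $ f (Suc k))" by simp
      also have "\<dots> \<le> (\<Prod>t<k. A $ f t $ f (Suc t)) * (?r * x $ f k)"
        using Suc(2) A by (intro mult_left_mono le prod_nonneg) (auto simp: nonneg_mat_def)
      also have "\<dots> = ?r * ((\<Prod>t<k. A $ f t $ f (Suc t)) * x $ f k)" by simp
      also have "\<dots> \<le> ?r * (?r ^ k * x $ f 0)" using Suc r0 by (intro mult_left_mono) auto
      finally show ?case by simp
    qed simp
    from this[of p] have "mpow MaxAlg A p $ j $ j * x $ j \<le> ?r ^ p * x $ j" unfolding f(3)[symmetric] by (simp only: f(1,2) order_refl)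
    then show ?thesis using x(2)[of j] m(2) by simp
  qed (use r0 in simp)
qed

lemma access_set_backward:
  "(i, j) \<in> (edges (graph_of A))\<^sup>* \<Longrightarrow> j \<in> access_set A \<rho> \<Longrightarrow> i \<in> access_set A \<rho>"
  unfolding access_set_def using node_accesses_backward by blast

lemma access_set_root_le:
  assumes m: "\<mu> \<in> classes A" "j \<in> nodes \<mu>" "j \<in> access_set A \<rho>"
  shows "perron_root MaxAlg A (nodes \<mu>) \<le> \<rho>"
proof -
  obtain \<nu> where \<nu>: "spectral MaxAlg A \<rho> \<nu>" "node_accesses A j \<nu>" using m(3) unfolding access_set_def by blast
  have "class_accesses A \<mu> \<nu>" using m(2) \<nu>(2) by (auto simp: class_accesses_def)
  then show ?thesis using \<nu>(1) m(1) by (auto simp: spectral_def)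
qed

lemma mpow_scaleR_Max:
  assumes A: "nonneg_mat A" and c: "0 \<le> c"
  shows "mpow alg (c *\<^sub>R A) k $ i $ j = c ^ k * mpow alg A k $ i $ j"
proof -
  have cA: "nonneg_mat (c *\<^sub>R A)" using A c by (simp add: nonneg_mat_def)
  have "(mv alg (c *\<^sub>R A) ^^ k) x = c ^ k *\<^sub>R (mv alg A ^^ k) x" for x
    by (induction k) (simp_all add: mv_scaleR_mat mv_scaleR c)
  then show ?thesis by (simp add: mpow_nth[OF A] mpow_nth[OF cA])
qed

lemma eigenvector_tight_cycle:
  fixes A :: "real^'n^'n::finite"
  assumes A: "nonneg_mat A" and \<rho>: "0 < \<rho>" and w: "nonneg_vec w" "mv MaxAlg A w = \<rho> *\<^sub>R w" and i: "0 < w $ i"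
  shows "\<exists>j p. (i, j) \<in> (edges (graph_of A))\<^sup>* \<and> 1 \<le> p \<and> \<rho> ^ p \<le> mpow MaxAlg A p $ j $ j \<and> 0 < w $ j"
proof -
  let ?F = "(1 / \<rho>) *\<^sub>R A"
  have F: "nonneg_mat ?F" using A \<rho> by (simp add: nonneg_mat_def)
  have Fw: "mv MaxAlg ?F w = w" using w(2) \<rho> by (simp add: mv_scaleR_mat del: mv.simps)
  obtain a p j where t: "1 \<le> p" "w $ i \<le> mpow MaxAlg ?F a $ i $ j * w $ j" "1 \<le> mpow MaxAlg ?F p $ j $ j" "0 < w $ j"
    by (rule tight_cycle_exists[OF F w(1) Fw i])
  have "0 < mpow MaxAlg ?F a $ i $ j * w $ j" using t(2) i by linarith
  then have "0 < mpow MaxAlg ?F a $ i $ j" using t(4) by (simp only: zero_less_mult_pos2)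
  then have "0 < mpow MaxAlg A a $ i $ j"
    unfolding mpow_scaleR_Max[OF A order_less_imp_le[OF divide_pos_pos[OF zero_less_one \<rho>]]]
    using \<rho> by (simp add: zero_less_mult_iff zero_less_divide_iff power_one_over)
  then have "(i, j) \<in> edges (graph_of A) ^^ a" using mpow_pos_iff[OF A] by blast
  then have "(i, j) \<in> (edges (graph_of A))\<^sup>*" by (rule relpow_imp_rtrancl)
  moreover have "\<rho> ^ p \<le> mpow MaxAlg A p $ j $ j"
    using t(3) \<rho> unfolding mpow_scaleR_Max[OF A order_less_imp_le[OF divide_pos_pos[OF zero_less_one \<rho>]]]
    by (simp add: power_one_over field_simps)
  ultimately show ?thesis using t by blast
qed

lemma power_le_base: "0 < (a::real) \<Longrightarrow> 0 \<le> b \<Longrightarrow> 1 \<le> p \<Longrightarrow> a ^ p \<le> b ^ p \<Longrightarrow> a \<le> b"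
  by (rule power_le_imp_le_base[of a "p - 1" b]) simp_all

text \<open>The closed walk found by \<open>tight_cycle_exists\<close> has mean at least \<open>\<rho>\<close>, so its class has a Perron root of
at least \<open>\<rho>\<close>. All classes that access it lie in the support of \<open>w\<close>, where Perron roots are at most
\<open>\<rho>\<close>.\<close>

lemma eigenvector_spectral_class_Max:
  fixes A :: "real^'n^'n::finite"
  assumes A: "nonneg_mat A" and \<rho>: "0 < \<rho>" and w: "nonneg_vec w" "mv MaxAlg A w = \<rho> *\<^sub>R w" and i: "0 < w $ i"
  shows "\<exists>j p. (i, j) \<in> (edges (graph_of A))\<^sup>* \<and> 1 \<le> p \<and> \<rho> ^ p \<le> mpow MaxAlg A p $ j $ j \<and>
    spectral MaxAlg A \<rho> (scc_of (graph_of A) j)"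
proof -
  obtain j p where j: "(i, j) \<in> (edges (graph_of A))\<^sup>*" "1 \<le> p" "\<rho> ^ p \<le> mpow MaxAlg A p $ j $ j" "0 < w $ j"
    using eigenvector_tight_cycle[OF A \<rho> w i] by blast
  let ?\<nu> = "scc_of (graph_of A) j"
  note \<nu> = class_of(2)[of A j] class_of(1)[of j A]
  have le: "perron_root MaxAlg A (nodes \<mu>) \<le> \<rho>" if m: "\<mu> \<in> classes A" "k \<in> nodes \<mu>" "(k, j) \<in> (edges (graph_of A))\<^sup>*" for \<mu> k
    by (rule perron_root_le[OF A m(1) w(1)]) (use class_in_support[OF A w m j(4)] w(2) in \<open>auto simp del: mv.simps\<close>)
  have "\<rho> ^ p \<le> perron_root MaxAlg A (nodes ?\<nu>) ^ p" using power_diag_le_root[OF A \<nu>, of p] j(3) by linarith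
  then have "\<rho> \<le> perron_root MaxAlg A (nodes ?\<nu>)"
    by (rule power_le_base[OF \<rho> class_perron(2)[OF A \<nu>(1)] j(2)])
  then have root: "perron_root MaxAlg A (nodes ?\<nu>) = \<rho>" using le[OF \<nu>] by simp
  have "perron_root MaxAlg A (nodes \<mu>) \<le> \<rho>" if m: "\<mu> \<in> classes A" "class_accesses A \<mu> ?\<nu>" for \<mu>
  proof -
    obtain k where k: "k \<in> nodes \<mu>" "node_accesses A k ?\<nu>"
    proof (cases "\<mu> = ?\<nu>")
      case True
      then show ?thesis using that[of j] \<nu>(2) node_in_class_accesses by blast
    next
      case False
      then show ?thesis using m(2) that by (auto simp: class_accesses_def)
    qed
    show ?thesis by (rule le[OF m(1) k(1) class_node_accesses[OF \<nu>(1) k(2) \<nu>(2)]])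
  qed
  then have "spectral MaxAlg A \<rho> ?\<nu>" using root \<rho> \<nu>(1) by (simp add: spectral_def)
  then show ?thesis using j by blast
qed

lemma periodic_support_in_access_set:
  fixes A :: "real^'n^'n::finite"
  assumes A: "nonneg_mat A" and \<rho>: "0 < \<rho>" and m: "1 \<le> m"
    and z: "nonneg_vec z" "mv MaxAlg (mpow MaxAlg A m) z = \<rho> ^ m *\<^sub>R z" and i: "0 < z $ i"
  shows "i \<in> access_set A \<rho>"
proof -
  obtain w where w: "nonneg_vec w" "\<And>i. z $ i \<le> w $ i" "mv MaxAlg A w = \<rho> *\<^sub>R w"
    using eigenvector_above_periodic[OF A z m \<rho>] by blast
  have "0 < w $ i" using w(2)[of i] i by linarith
  then obtain j where j: "(i, j) \<in> (edges (graph_of A))\<^sup>*" "spectral MaxAlg A \<rho> (scc_of (graph_of A) j)"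
    using eigenvector_spectral_class_Max[OF A \<rho> w(1,3)] by blast
  have "j \<in> access_set A \<rho>"
    using j(2) node_in_class_accesses[OF class_of(1)[of j A]] unfolding access_set_def by blast
  then show ?thesis using access_set_backward[OF j(1)] by blast
qed

lemma nonneg_scaled_restriction: "nonneg_mat A \<Longrightarrow> 0 < \<rho> \<Longrightarrow> nonneg_mat (scaled_restriction A \<rho>)"
  by (simp add: scaled_restriction_def restrict_nth nonneg_mat_def)

text \<open>The access set is closed under predecessors, so the powers of \<open>A\<close> keep vectors supported on it and act
on them like those of \<open>\<rho> A\<^sub>\<rho>\<close>.\<close>

lemma mpow_scaled_restriction:
  fixes A :: "real^'n^'n::finite"
  assumes A: "nonneg_mat A" and \<rho>: "0 < \<rho>" and z: "nonneg_vec z" "\<And>i. 0 < z $ i \<Longrightarrow> i \<in> access_set A \<rho>"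
  shows "mv MaxAlg (mpow MaxAlg A k) z = \<rho> ^ k *\<^sub>R mv MaxAlg (mpow MaxAlg (scaled_restriction A \<rho>) k) z"
proof -
  let ?B = "scaled_restriction A \<rho>" and ?M = "access_set A \<rho>"
  note B = nonneg_scaled_restriction[OF A \<rho>]
  have step: "mv MaxAlg A x = \<rho> *\<^sub>R mv MaxAlg ?B x \<and> (\<forall>i. 0 < mv MaxAlg ?B x $ i \<longrightarrow> i \<in> ?M)"
    if x: "nonneg_vec x" "\<And>i. 0 < x $ i \<Longrightarrow> i \<in> ?M" for x
  proof
    have "A $ i $ j * x $ j = (\<rho> *\<^sub>R ?B) $ i $ j * x $ j" for i j
    proof (cases "A $ i $ j = 0 \<or> x $ j = 0")
      case True
      then show ?thesis by (auto simp: scaled_restriction_def restrict_nth)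
    next
      case False
      then have "j \<in> ?M" using x(1) x(2)[of j] by (simp add: nonneg_vec_def order_less_le)
      moreover from this have "i \<in> ?M" using access_set_backward[of i j A \<rho>] False by (auto simp: graph_of_def)
      ultimately show ?thesis using \<rho> by (simp add: scaled_restriction_def restrict_nth)
    qed
    then have "mv MaxAlg A x = mv MaxAlg (\<rho> *\<^sub>R ?B) x" unfolding vec_eq_iff mv_nth by presburger
    then show "mv MaxAlg A x = \<rho> *\<^sub>R mv MaxAlg ?B x" using \<rho> mv_scaleR_mat[of \<rho> MaxAlg ?B x] by (simp del: mv.simps)
    show "\<forall>i. 0 < mv MaxAlg ?B x $ i \<longrightarrow> i \<in> ?M"
    proof (intro allI impI)
      fix i assume "0 < mv MaxAlg ?B x $ i"
      then obtain j where "0 < ?B $ i $ j" using mv_pos_iff[OF B x(1)] by blast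
      then show "i \<in> ?M" by (auto simp: scaled_restriction_def restrict_nth split: if_splits)
    qed
  qed
  have "(mv MaxAlg A ^^ k) z = \<rho> ^ k *\<^sub>R (mv MaxAlg ?B ^^ k) z \<and> (\<forall>i. 0 < (mv MaxAlg ?B ^^ k) z $ i \<longrightarrow> i \<in> ?M)"
  proof (induction k)
    case 0 then show ?case using z(2) by simp
  next
    case (Suc k)
    let ?y = "(mv MaxAlg ?B ^^ k) z"
    have y: "nonneg_vec ?y" by (rule nonneg_funpow[OF B z(1)])
    have st: "mv MaxAlg A ?y = \<rho> *\<^sub>R mv MaxAlg ?B ?y" "\<forall>i. 0 < mv MaxAlg ?B ?y $ i \<longrightarrow> i \<in> ?M"
      using step[OF y] Suc by blast+
    have "(mv MaxAlg A ^^ Suc k) z = mv MaxAlg A (\<rho> ^ k *\<^sub>R ?y)" using Suc by (simp del: mv.simps)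
    also have "\<dots> = \<rho> ^ k *\<^sub>R mv MaxAlg A ?y" using \<rho> by (intro mv_scaleR) simp
    also have "\<dots> = \<rho> ^ Suc k *\<^sub>R (mv MaxAlg ?B ^^ Suc k) z" unfolding st(1) by (simp add: mult.commute del: mv.simps)
    finally show ?case using st(2) by (simp del: mv.simps)
  qed
  then show ?thesis unfolding mv_mpow[OF A z(1)] mv_mpow[OF B z(1)] by blast
qed

lemma mpow_scaled_restriction_column:
  fixes A :: "real^'n^'n::finite"
  assumes A: "nonneg_mat A" and \<rho>: "0 < \<rho>" and j: "j \<in> access_set A \<rho>"
  shows "mpow MaxAlg A k $ i $ j = \<rho> ^ k * mpow MaxAlg (scaled_restriction A \<rho>) k $ i $ j"
proof -
  have "mv MaxAlg (mpow MaxAlg A k) (axis j 1) = \<rho> ^ k *\<^sub>R mv MaxAlg (mpow MaxAlg (scaled_restriction A \<rho>) k) (axis j 1)"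
    by (rule mpow_scaled_restriction[OF A \<rho> nonneg_axis]) (use j in \<open>auto simp: axis_def split: if_splits\<close>)
  then have "mv MaxAlg (mpow MaxAlg A k) (axis j 1) $ i
      = \<rho> ^ k * mv MaxAlg (mpow MaxAlg (scaled_restriction A \<rho>) k) (axis j 1) $ i"
    by (simp del: mv.simps)
  then show ?thesis by (simp only: mv_axis mpow_nonneg[OF A] mpow_nonneg[OF nonneg_scaled_restriction[OF A \<rho>]])
qed

lemma Lambda_pos: "\<rho> \<in> Lambda alg A \<Longrightarrow> 0 < \<rho>"
  by (simp add: Lambda_def)

lemma Lambda_Max_witness:
  fixes A :: "real^'n^'n::finite"
  assumes A: "nonneg_mat A" and \<rho>: "\<rho> \<in> Lambda MaxAlg A"
  shows "\<exists>j p. 1 \<le> p \<and> \<rho> ^ p \<le> mpow MaxAlg A p $ j $ j \<and> spectral MaxAlg A \<rho> (scc_of (graph_of A) j)"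
proof -
  obtain w where w: "nonneg_vec w" "mv MaxAlg A w = \<rho> *\<^sub>R w" "w \<noteq> 0"
    using \<rho> unfolding Lambda_def eigencone_def by blast
  obtain i where "0 < w $ i" using w(1,3) by (auto simp: vec_eq_iff nonneg_vec_def order_less_le)
  then show ?thesis using eigenvector_spectral_class_Max[OF A Lambda_pos[OF \<rho>] w(1,2)] by blast
qed

lemma finite_Lambda_Max:
  fixes A :: "real^'n^'n::finite"
  assumes A: "nonneg_mat A" shows "finite (Lambda MaxAlg A)"
proof (rule finite_subset)
  show "Lambda MaxAlg A \<subseteq> (\<lambda>\<nu>. perron_root MaxAlg A (nodes \<nu>)) ` classes A"
  proof
    fix \<rho> assume "\<rho> \<in> Lambda MaxAlg A"
    then obtain j where "spectral MaxAlg A \<rho> (scc_of (graph_of A) j)" using Lambda_Max_witness[OF A] by blast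
    then show "\<rho> \<in> (\<lambda>\<nu>. perron_root MaxAlg A (nodes \<nu>)) ` classes A" by (auto simp: spectral_def)
  qed
qed (simp add: finite_classes)

text \<open>All classes in the access set have a Perron root of at most \<open>\<rho>\<close>, which bounds the closed walks, and
the closed walk provided by an eigenvector has weight one.\<close>

lemma scaled_restriction_normalized:
  fixes A :: "real^'n^'n::finite"
  assumes A: "nonneg_mat A" and \<rho>: "\<rho> \<in> Lambda MaxAlg A"
  shows "normalized_max_matrix (scaled_restriction A \<rho>)"
proof
  note \<rho>0 = Lambda_pos[OF \<rho>]
  let ?B = "scaled_restriction A \<rho>"
  note B = nonneg_scaled_restriction[OF A \<rho>0]
  show "nonneg_mat ?B" by (rule B)
  show le: "mpow MaxAlg ?B k $ j $ j \<le> 1" for k j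
  proof (cases "j \<in> access_set A \<rho>")
    case True
    have "\<rho> ^ k * mpow MaxAlg ?B k $ j $ j = mpow MaxAlg A k $ j $ j"
      by (rule mpow_scaled_restriction_column[OF A \<rho>0 True, symmetric])
    also have "\<dots> \<le> perron_root MaxAlg A (nodes (scc_of (graph_of A) j)) ^ k"
      by (rule power_diag_le_root[OF A class_of(2,1)])
    also have "\<dots> \<le> \<rho> ^ k"
      by (intro power_mono access_set_root_le[OF class_of(2,1) True] class_perron(2)[OF A class_of(2)])
    finally have "\<rho> ^ k * mpow MaxAlg ?B k $ j $ j \<le> \<rho> ^ k * 1" by simp
    then show ?thesis using \<rho>0 by (simp only: mult_le_cancel_left_pos zero_less_power)
  next
    case False
    show ?thesis
    proof (cases k)
      case 0 then show ?thesis by (simp add: mat_def)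
    next
      case (Suc l)
      obtain m where "mpow MaxAlg ?B (Suc l) $ j $ j = ?B $ j $ m * mpow MaxAlg ?B l $ m $ j"
        using mpow_Suc_attained by blast
      moreover have "?B $ j $ m = 0" using False by (simp add: scaled_restriction_def restrict_nth)
      ultimately show ?thesis unfolding Suc by simp
    qed
  qed
  obtain j p where j: "1 \<le> p" "\<rho> ^ p \<le> mpow MaxAlg A p $ j $ j" "spectral MaxAlg A \<rho> (scc_of (graph_of A) j)"
    using Lambda_Max_witness[OF A \<rho>] by blast
  have jM: "j \<in> access_set A \<rho>"
    using j(3) node_in_class_accesses[OF class_of(1)[of j A]] unfolding access_set_def by blast
  have "\<rho> ^ p * 1 \<le> \<rho> ^ p * mpow MaxAlg ?B p $ j $ j"
    using j(2) unfolding mpow_scaled_restriction_column[OF A \<rho>0 jM] by simp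
  then have "1 \<le> mpow MaxAlg ?B p $ j $ j" using \<rho>0 by (simp only: mult_le_cancel_left_pos zero_less_power)
  then have "mpow MaxAlg ?B p $ j $ j = 1" using le[of p j] by simp
  then show "\<exists>j k. 1 \<le> k \<and> mpow MaxAlg ?B k $ j $ j = 1" using j(1) by blast
qed

section \<open>Critical columns\<close>

context
  fixes A :: "real^'n^'n::finite" and \<rho> :: real
  assumes A: "nonneg_mat A" and \<rho>: "\<rho> \<in> Lambda MaxAlg A"
begin

interpretation nm: normalized_max_matrix "scaled_restriction A \<rho>"
  by (rule scaled_restriction_normalized[OF A \<rho>])

lemma critical_star_eq: "critical_star A \<rho> = nm.star" "sigma_num MaxAlg A \<rho> = nm.\<sigma>"
  by (simp_all add: critical_star_def nm.star_def nm.\<sigma>_def assoc_critical_graph_def)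

lemma critical_star_converges: "kleene_converges (mpow MaxAlg (scaled_restriction A \<rho>) (sigma_num MaxAlg A \<rho>))"
  unfolding critical_star_eq(2) by (rule nm.star_converges)

lemma sigma_Max_pos: "1 \<le> sigma_num MaxAlg A \<rho>"
  unfolding critical_star_eq(2) by (rule nm.sigma_pos)

lemma critical_star_diag: "critical_star A \<rho> $ j $ j = 1"
  unfolding critical_star_eq(1) by (rule nm.star_diag)

lemma critical_star_column: "nonneg_vec (column j (critical_star A \<rho>))" "column j (critical_star A \<rho>) \<noteq> 0"
proof -
  show "nonneg_vec (column j (critical_star A \<rho>))" unfolding critical_star_eq(1) by (rule nm.column_star_nonneg)
  have "column j (critical_star A \<rho>) $ j \<noteq> 0" by (simp add: column_nth critical_star_diag)
  then show "column j (critical_star A \<rho>) \<noteq> 0" by auto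
qed

lemma critical_node_power: "j \<in> nodes (assoc_critical_graph A \<rho>) \<Longrightarrow> \<exists>k\<ge>1. mpow MaxAlg A k $ j $ j = \<rho> ^ k"
  and critical_node_in_access_set: "j \<in> nodes (assoc_critical_graph A \<rho>) \<Longrightarrow> j \<in> access_set A \<rho>"
proof -
  assume "j \<in> nodes (assoc_critical_graph A \<rho>)"
  then obtain k where k: "k \<ge> 1" "mpow MaxAlg (scaled_restriction A \<rho>) k $ j $ j = 1"
    unfolding assoc_critical_graph_def nm.critical_node_iff by blast
  obtain l where l: "k = Suc l" using k(1) by (metis One_nat_def Suc_le_D)
  obtain m where "mpow MaxAlg (scaled_restriction A \<rho>) (Suc l) $ j $ j
      = scaled_restriction A \<rho> $ j $ m * mpow MaxAlg (scaled_restriction A \<rho>) l $ m $ j"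
    using mpow_Suc_attained by blast
  then have "scaled_restriction A \<rho> $ j $ m \<noteq> 0" using k(2) unfolding l by auto
  then show jM: "j \<in> access_set A \<rho>" by (auto simp: scaled_restriction_def restrict_nth split: if_splits)
  show "\<exists>k\<ge>1. mpow MaxAlg A k $ j $ j = \<rho> ^ k"
    using k mpow_scaled_restriction_column[OF A Lambda_pos[OF \<rho>] jM] by (intro exI[of _ k]) (simp del: mpow.simps)
qed

lemma periodic_scaled:
  assumes u: "nonneg_vec u" "mv MaxAlg (mpow MaxAlg A m) u = \<rho> ^ m *\<^sub>R u" and m: "1 \<le> m"
  shows "mv MaxAlg (mpow MaxAlg (scaled_restriction A \<rho>) m) u = u"
proof -
  note \<rho>0 = Lambda_pos[OF \<rho>]
  have "\<rho> ^ m *\<^sub>R u = \<rho> ^ m *\<^sub>R mv MaxAlg (mpow MaxAlg (scaled_restriction A \<rho>) m) u"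
    unfolding u(2)[symmetric]
    by (rule mpow_scaled_restriction[OF A \<rho>0 u(1) periodic_support_in_access_set[OF A \<rho>0 m u]])
  then show ?thesis using \<rho>0 by (simp del: mv.simps)
qed

lemma critical_column_below:
  assumes u: "nonneg_vec u" "mv MaxAlg (mpow MaxAlg A (sigma_num MaxAlg A \<rho> * q)) u = \<rho> ^ (sigma_num MaxAlg A \<rho> * q) *\<^sub>R u"
    and q: "1 \<le> q" and j: "j \<in> nodes (assoc_critical_graph A \<rho>)"
  shows "u $ j * critical_star A \<rho> $ i $ j \<le> u $ i"
proof -
  have m: "1 \<le> sigma_num MaxAlg A \<rho> * q" using mult_le_mono[OF sigma_Max_pos q] by simp
  show ?thesis
    using nm.star_column_below[OF u(1) periodic_scaled[OF u m, unfolded critical_star_eq(2)] q, of j i] j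
    unfolding critical_star_eq assoc_critical_graph_def by (simp add: mult.commute)
qed

lemma critical_column_tight:
  assumes u: "nonneg_vec u" "mv MaxAlg (mpow MaxAlg A (sigma_num MaxAlg A \<rho> * q)) u = \<rho> ^ (sigma_num MaxAlg A \<rho> * q) *\<^sub>R u"
    and q: "1 \<le> q" and i: "0 < u $ i"
  shows "\<exists>j\<in>nodes (assoc_critical_graph A \<rho>). 0 < u $ j \<and> u $ j * critical_star A \<rho> $ i $ j = u $ i"
proof -
  have m: "1 \<le> sigma_num MaxAlg A \<rho> * q" using mult_le_mono[OF sigma_Max_pos q] by simp
  show ?thesis
    using nm.generated_by_critical_columns[OF u(1) periodic_scaled[OF u m, unfolded critical_star_eq(2)] q i]
    unfolding critical_star_eq assoc_critical_graph_def by (simp add: mult.commute)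
qed

lemma critical_column_support:
  assumes j: "j \<in> nodes (assoc_critical_graph A \<rho>)" and i: "0 < critical_star A \<rho> $ i $ j"
  shows "i \<in> access_set A \<rho>"
proof -
  let ?B = "scaled_restriction A \<rho>"
  have "mv MaxAlg (mpow MaxAlg ?B nm.\<sigma>) (column j nm.star) $ i = nm.star $ i $ j"
    using nm.star_column_eigenvector[of j] j by (simp add: assoc_critical_graph_def column_nth del: mv.simps)
  then have "0 < mv MaxAlg (mpow MaxAlg ?B nm.\<sigma>) (column j nm.star) $ i" using i unfolding critical_star_eq(1) by simp
  then obtain l where l: "0 < mpow MaxAlg ?B nm.\<sigma> $ i $ l"
    using mv_pos_iff[OF mpow_nonneg[OF nm.nonneg] nm.column_star_nonneg] by blast
  obtain t where t: "nm.\<sigma> = Suc t" using nm.sigma_pos by (metis One_nat_def Suc_le_D)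
  obtain m where "mpow MaxAlg ?B (Suc t) $ i $ l = ?B $ i $ m * mpow MaxAlg ?B t $ m $ l" using mpow_Suc_attained by blast
  then have "?B $ i $ m \<noteq> 0" using l unfolding t by auto
  then show ?thesis by (auto simp: scaled_restriction_def restrict_nth split: if_splits)
qed

lemma critical_column_in_eigencone:
  assumes j: "j \<in> nodes (assoc_critical_graph A \<rho>)"
  shows "mv MaxAlg (mpow MaxAlg A (sigma_num MaxAlg A \<rho>)) (column j (critical_star A \<rho>))
    = \<rho> ^ sigma_num MaxAlg A \<rho> *\<^sub>R column j (critical_star A \<rho>)"
proof -
  have "mv MaxAlg (mpow MaxAlg A (sigma_num MaxAlg A \<rho>)) (column j (critical_star A \<rho>))
    = \<rho> ^ sigma_num MaxAlg A \<rho> *\<^sub>R mv MaxAlg (mpow MaxAlg (scaled_restriction A \<rho>) (sigma_num MaxAlg A \<rho>)) (column j (critical_star A \<rho>))"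
    by (rule mpow_scaled_restriction[OF A Lambda_pos[OF \<rho>] critical_star_column(1)])
      (use critical_column_support[OF j] in \<open>simp add: column_nth\<close>)
  also have "mv MaxAlg (mpow MaxAlg (scaled_restriction A \<rho>) (sigma_num MaxAlg A \<rho>)) (column j (critical_star A \<rho>)) = column j (critical_star A \<rho>)"
    unfolding critical_star_eq by (rule nm.star_column_eigenvector) (use j in \<open>simp add: assoc_critical_graph_def\<close>)
  finally show ?thesis .
qed

lemma mv_critical_column:
  assumes e: "(i, j) \<in> edges (assoc_critical_graph A \<rho>)"
  shows "\<exists>c>0. mv MaxAlg A (column j (critical_star A \<rho>)) = c *\<^sub>R column i (critical_star A \<rho>)"
proof -
  note \<rho>0 = Lambda_pos[OF \<rho>]
  have e': "(i, j) \<in> nm.Ec" using e by (simp add: assoc_critical_graph_def)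
  then have j: "j \<in> nodes (assoc_critical_graph A \<rho>)" using nm.critical_edges_subset by (auto simp: assoc_critical_graph_def)
  have "mv MaxAlg (mpow MaxAlg A (Suc 0)) (column j (critical_star A \<rho>))
    = \<rho> ^ Suc 0 *\<^sub>R mv MaxAlg (mpow MaxAlg (scaled_restriction A \<rho>) (Suc 0)) (column j (critical_star A \<rho>))"
    by (rule mpow_scaled_restriction[OF A \<rho>0 critical_star_column(1)])
      (use critical_column_support[OF j] in \<open>simp add: column_nth\<close>)
  then have "mv MaxAlg A (column j (critical_star A \<rho>)) = \<rho> *\<^sub>R mv MaxAlg (scaled_restriction A \<rho>) (column j (critical_star A \<rho>))"
    by (simp only: mpow_1[OF A] mpow_1[OF nm.nonneg] power_Suc0_right)
  also have "\<dots> = (\<rho> * scaled_restriction A \<rho> $ i $ j) *\<^sub>R column i (critical_star A \<rho>)"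
    unfolding critical_star_eq nm.mv_column_star(1)[OF e'] by simp
  finally show ?thesis using nm.mv_column_star(2)[OF e'] \<rho>0 by (intro exI[of _ "\<rho> * scaled_restriction A \<rho> $ i $ j"]) simp
qed

lemma critical_columns_proportional_iff:
  assumes "i \<in> nodes (assoc_critical_graph A \<rho>)" "j \<in> nodes (assoc_critical_graph A \<rho>)"
  shows "normalization (column i (critical_star A \<rho>)) = normalization (column j (critical_star A \<rho>)) \<longleftrightarrow>
    (\<exists>C\<in>sccs (assoc_critical_graph A \<rho>). i \<in> nodes C \<and> j \<in> nodes C \<and> cyclic_index C i = cyclic_index C j)"
proof -
  let ?k = "\<lambda>i. column i (critical_star A \<rho>)"
  have "normalization (?k i) = normalization (?k j) \<longleftrightarrow> (\<exists>c. ?k i = c *\<^sub>R ?k j)"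
  proof
    assume eq: "normalization (?k i) = normalization (?k j)"
    obtain b where b: "0 < b" "normalization (?k i) = b *\<^sub>R ?k i" using normalization_multiple[OF critical_star_column] by metis
    obtain c where c: "0 < c" "normalization (?k j) = c *\<^sub>R ?k j" using normalization_multiple[OF critical_star_column] by metis
    have "?k i = (1 / b) *\<^sub>R (b *\<^sub>R ?k i)" using b(1) by simp
    also have "b *\<^sub>R ?k i = c *\<^sub>R ?k j" using eq b(2) c(2) by simp
    finally show "\<exists>c. ?k i = c *\<^sub>R ?k j" by (metis scaleR_scaleR)
  next
    assume "\<exists>c. ?k i = c *\<^sub>R ?k j"
    then obtain c where c: "?k i = c *\<^sub>R ?k j" by blast
    have "1 = c * critical_star A \<rho> $ i $ j"
      using arg_cong[OF c, of "\<lambda>x. x $ i"] critical_star_diag by (simp add: column_nth)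
    moreover have "0 \<le> critical_star A \<rho> $ i $ j" using critical_star_column(1)[of j] by (simp add: nonneg_vec_def column_nth)
    ultimately have "0 < c" by (metis mult_le_0_iff not_less zero_less_one)
    then show "normalization (?k i) = normalization (?k j)" unfolding c by (rule normalization_scaleR)
  qed
  also have "\<dots> \<longleftrightarrow> (\<exists>C\<in>sccs (assoc_critical_graph A \<rho>). i \<in> nodes C \<and> j \<in> nodes C \<and> cyclic_index C i = cyclic_index C j)"
    unfolding critical_star_eq assoc_critical_graph_def
    by (rule nm.proportional_columns_iff) (use assms in \<open>simp_all add: assoc_critical_graph_def\<close>)
  finally show ?thesis .
qed

lemma assoc_critical_component:
  assumes "C \<in> sccs (assoc_critical_graph A \<rho>)"
  shows "strongly_connected C" "edges C \<noteq> {}" "nodes C \<subseteq> nodes (assoc_critical_graph A \<rho>)"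
    "edges C \<subseteq> edges (assoc_critical_graph A \<rho>)"
  using nm.critical_component[of C] assms unfolding assoc_critical_graph_def by auto

lemma assoc_critical_component_of:
  "j \<in> nodes (assoc_critical_graph A \<rho>) \<Longrightarrow> \<exists>C\<in>sccs (assoc_critical_graph A \<rho>). j \<in> nodes C"
  unfolding assoc_critical_graph_def by (rule nm.component_of)

lemma closed_critical_walk_power:
  assumes "(j, j) \<in> edges (assoc_critical_graph A \<rho>) ^^ k" "j \<in> nodes (assoc_critical_graph A \<rho>)"
  shows "mpow MaxAlg A k $ j $ j = \<rho> ^ k"
proof -
  have "mpow MaxAlg (scaled_restriction A \<rho>) k $ j $ j * mpow MaxAlg (scaled_restriction A \<rho>) 0 $ j $ j = 1"
    using nm.critical_walks_product[of j j k 0] assms(1) by (simp add: assoc_critical_graph_def)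
  then have "mpow MaxAlg (scaled_restriction A \<rho>) k $ j $ j = 1" by (simp add: mat_def)
  then show ?thesis
    using mpow_scaled_restriction_column[OF A Lambda_pos[OF \<rho>] critical_node_in_access_set[OF assms(2)]] by simp
qed

text \<open>The columns of one cyclic class have the same normalization, so they are indexed by the cyclic classes.
A critical edge into \<open>node (k + 1)\<close> starts in the class number \<open>k\<close>, which yields the action of \<open>A\<close>.\<close>

lemma critical_columns_of_component:
  assumes C: "C \<in> sccs (assoc_critical_graph A \<rho>)"
  shows "card (critical_columns A \<rho> C) = sc_cyclicity C" "simple_cycle_under MaxAlg A (critical_columns A \<rho> C)"
proof -
  note cc = assoc_critical_component[OF C]
  let ?d = "sc_cyclicity C" and ?\<phi> = "\<lambda>j. normalization (column j (critical_star A \<rho>))"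
  define node where "node k = (SOME j. j \<in> nodes C \<and> cyclic_index C j = k)" for k
  have node: "node k \<in> nodes C" "cyclic_index C (node k) = k" if "k < ?d" for k
  proof -
    have "\<exists>j. j \<in> nodes C \<and> cyclic_index C j = k" using cyclic_index_range[OF cc(1,2)] that by (metis imageE lessThan_iff)
    then have "node k \<in> nodes C \<and> cyclic_index C (node k) = k" unfolding node_def by (rule someI_ex)
    then show "node k \<in> nodes C" "cyclic_index C (node k) = k" by auto
  qed
  have \<phi>: "?\<phi> i = ?\<phi> j \<longleftrightarrow> cyclic_index C i = cyclic_index C j" if ij: "i \<in> nodes C" "j \<in> nodes C" for i j
  proof -
    have "i \<in> nodes (assoc_critical_graph A \<rho>)" "j \<in> nodes (assoc_critical_graph A \<rho>)" using ij cc(3) by auto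
    note iff = critical_columns_proportional_iff[OF this]
    show ?thesis unfolding iff using sccs_unique[OF C _ ij(1)] C ij by blast
  qed
  let ?h = "\<lambda>k. ?\<phi> (node k)"
  have inj: "inj_on ?h {..<?d}"
  proof (rule inj_onI)
    fix k l assume "k \<in> {..<?d}" "l \<in> {..<?d}" "?h k = ?h l"
    then show "k = l" using \<phi>[of "node k" "node l"] node by simp
  qed
  have "\<exists>k<?d. ?\<phi> j = ?h k" if j: "j \<in> nodes C" for j
    using \<phi>[OF j node(1)] node(2) cyclic_index_less[OF cc(1,2), of j] by metis
  then have img: "critical_columns A \<rho> C = ?h ` {..<?d}"
    unfolding critical_columns_def using node(1) by auto
  show "card (critical_columns A \<rho> C) = ?d" unfolding img card_image[OF inj] by simp
  show "simple_cycle_under MaxAlg A (critical_columns A \<rho> C)"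
    unfolding img
  proof (rule simple_cycle_under_indexed[OF cyclicity_pos[OF cc(1,2)] inj])
    fix k assume k: "k < ?d"
    have k': "Suc k mod ?d < ?d" using k by (intro mod_less_divisor) simp
    let ?j = "node (Suc k mod ?d)"
    obtain i where i: "(i, ?j) \<in> edges C" "i \<in> nodes C" using strongly_connected_predecessor[OF cc(1,2) node(1)[OF k']] .
    have "cyclic_index C ?j = (cyclic_index C i + 1) mod ?d"
      using cyclic_index_walk[OF cc(1,2) i(2), of ?j 1] i(1) by simp
    then have "Suc (cyclic_index C i) mod ?d = Suc k mod ?d" using node(2)[OF k'] by simp
    then have "cyclic_index C i = k"
      using cyclic_index_less[OF cc(1,2), of i] k by (auto simp: mod_Suc split: if_splits)
    then have hk: "?\<phi> i = ?h k" using \<phi>[OF i(2) node(1)[OF k]] node(2)[OF k] by simp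
    obtain c where c: "0 < c" "mv MaxAlg A (column ?j (critical_star A \<rho>)) = c *\<^sub>R column i (critical_star A \<rho>)"
      using mv_critical_column i(1) cc(4) by blast
    obtain b where b: "0 < b" "?\<phi> ?j = b *\<^sub>R column ?j (critical_star A \<rho>)" using normalization_multiple[OF critical_star_column] by metis
    obtain a where a: "0 < a" "?\<phi> i = a *\<^sub>R column i (critical_star A \<rho>)" using normalization_multiple[OF critical_star_column] by metis
    have "mv MaxAlg A (?h (Suc k mod ?d)) = (b * c / a) *\<^sub>R ?h k"
      unfolding hk[symmetric] b(2) a(2) using a(1) b(1) c(2) by (simp add: mv_scaleR del: mv.simps)
    then show "\<exists>c>0. mv MaxAlg A (?h (Suc k mod ?d)) = c *\<^sub>R ?h k"
      using a(1) b(1) c(1) by (intro exI[of _ "b * c / a"]) simp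
  qed
qed

end

section \<open>Extremals in max algebra\<close>

text \<open>Suppose that \<open>z\<close> is the maximum of finitely many members of \<open>W\<close> different from \<open>z\<close>. Adding them one by
one, extremality of \<open>z\<close> keeps all partial maxima different from \<open>z\<close>.\<close>

lemma extremal_Max_attained:
  fixes W :: "(real^'n::finite) set"
  assumes z: "z \<in> extremals MaxAlg W" "nonneg_vec z"
    and W: "\<And>x y. x \<in> W \<Longrightarrow> y \<in> W \<Longrightarrow> vadd MaxAlg x y \<in> W" "\<And>x. x \<in> W \<Longrightarrow> nonneg_vec x"
    and g: "\<And>i. 0 < z $ i \<Longrightarrow> \<exists>y\<in>G. y \<in> W \<and> (\<forall>k. y $ k \<le> z $ k) \<and> y $ i = z $ i"
  shows "z \<in> G"
proof (rule ccontr)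
  assume zG: "z \<notin> G"
  let ?S = "{i. 0 < z $ i}"
  have z0: "z \<noteq> 0" and ext: "\<And>u v. u \<in> W \<Longrightarrow> v \<in> W \<Longrightarrow> z = vadd MaxAlg u v \<Longrightarrow> z = u \<or> z = v"
    using z(1) by (auto simp: extremals_def simp del: vadd.simps)
  have "\<forall>i. \<exists>y. 0 < z $ i \<longrightarrow> y \<in> G \<and> y \<in> W \<and> (\<forall>k. y $ k \<le> z $ k) \<and> y $ i = z $ i" using g by blast
  then obtain y where y: "\<And>i. 0 < z $ i \<Longrightarrow> y i \<in> G \<and> y i \<in> W \<and> (\<forall>k. y i $ k \<le> z $ k) \<and> y i $ i = z $ i" by metis
  have ne: "?S \<noteq> {}" using z0 z(2) by (auto simp: vec_eq_iff nonneg_vec_def order_less_le)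
  have "(\<chi> k. Max ((\<lambda>i. y i $ k) ` T)) \<in> W \<and> (\<chi> k. Max ((\<lambda>i. y i $ k) ` T)) \<noteq> z" if "finite T" "T \<noteq> {}" "T \<subseteq> ?S" for T
    using that
  proof (induction T rule: finite_ne_induct)
    case (singleton i)
    then have "y i \<in> G" "y i \<in> W" using y by auto
    moreover have "(\<chi> k. Max ((\<lambda>i. y i $ k) ` {i})) = y i" by (simp add: vec_eq_iff)
    ultimately show ?case using zG by auto
  next
    case (insert i T)
    let ?u = "\<chi> k. Max ((\<lambda>i. y i $ k) ` T)"
    have yi: "y i \<in> G" "y i \<in> W" using y insert by auto
    have u: "?u \<in> W" "?u \<noteq> z" using insert by auto
    have eq: "(\<chi> k. Max ((\<lambda>i. y i $ k) ` insert i T)) = vadd MaxAlg (y i) ?u"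
      using insert(1,2) by (simp add: vec_eq_iff)
    have "vadd MaxAlg (y i) ?u \<noteq> z" using ext[OF yi(2) u(1)] u(2) zG yi(1) by metis
    then show ?case unfolding eq using W(1)[OF yi(2) u(1)] by blast
  qed
  from this[of ?S] have S: "(\<chi> k. Max ((\<lambda>i. y i $ k) ` ?S)) \<in> W" "(\<chi> k. Max ((\<lambda>i. y i $ k) ` ?S)) \<noteq> z"
    using ne by auto
  have "Max ((\<lambda>i. y i $ k) ` ?S) = z $ k" for k
  proof (rule order_antisym)
    show "Max ((\<lambda>i. y i $ k) ` ?S) \<le> z $ k" using ne y by (intro Max.boundedI) auto
    show "z $ k \<le> Max ((\<lambda>i. y i $ k) ` ?S)"
    proof (cases "0 < z $ k")
      case True
      then have "z $ k = y k $ k" using y by simp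
      also have "\<dots> \<le> Max ((\<lambda>i. y i $ k) ` ?S)" using True by (intro Max_ge) auto
      finally show ?thesis .
    next
      case False
      have "0 \<le> (\<chi> k. Max ((\<lambda>i. y i $ k) ` ?S)) $ k" using W(2)[OF S(1)] unfolding nonneg_vec_def by blast
      then show ?thesis using False by simp
    qed
  qed
  then show False using S(2) by (simp add: vec_eq_iff)
qed

text \<open>The pair \<open>(\<rho>, j)\<close> stands for the node \<open>j\<close> of the critical graph associated with \<open>\<rho>\<close>.\<close>

definition critical_index :: "real^'n^'n::finite \<Rightarrow> (real \<times> 'n) set" where
  "critical_index A = (SIGMA \<rho>:Lambda MaxAlg A. nodes (assoc_critical_graph A \<rho>))"

definition critical_column :: "real^'n^'n::finite \<Rightarrow> real \<times> 'n \<Rightarrow> real^'n" where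
  "critical_column A p = column (snd p) (critical_star A (fst p))"

lemma critical_column_nonzero:
  assumes A: "nonneg_mat A" and p: "p \<in> critical_index A"
  shows "nonneg_vec (critical_column A p)" "critical_column A p \<noteq> 0"
proof -
  have "fst p \<in> Lambda MaxAlg A" using p by (auto simp: critical_index_def)
  then show "nonneg_vec (critical_column A p)" "critical_column A p \<noteq> 0"
    unfolding critical_column_def using critical_star_column[OF A] by blast+
qed

lemma critical_column_in_core:
  assumes A: "nonneg_mat A" and p: "p \<in> critical_index A"
  shows "critical_column A p \<in> core MaxAlg A"
proof -
  have r: "fst p \<in> Lambda MaxAlg A" "snd p \<in> nodes (assoc_critical_graph A (fst p))" using p by (auto simp: critical_index_def)
  show ?thesis unfolding critical_column_def
    by (rule periodic_in_core[OF A critical_star_column(1)[OF A r(1)] critical_column_in_eigencone[OF A r] sigma_Max_pos[OF A r(1)] Lambda_pos[OF r(1)]])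
qed

text \<open>In the representation of \<open>z\<close> by periodic generators one term attains the entry at \<open>i\<close>; replace that
generator by a critical column that is tight for it at \<open>i\<close>.\<close>

lemma core_Max_generated:
  fixes A :: "real^'n^'n::finite"
  assumes A: "nonneg_mat A" and z: "z \<in> core MaxAlg A" and i: "0 < z $ i"
  shows "\<exists>a p. 0 < a \<and> p \<in> critical_index A \<and> (\<forall>k. a * critical_column A p $ k \<le> z $ k) \<and> a * critical_column A p $ i = z $ i"
proof -
  obtain U where U: "nonneg_mat U" "core MaxAlg A = col_span MaxAlg U"
    "\<And>j. column j U \<noteq> 0 \<Longrightarrow> \<exists>p\<ge>1. \<exists>\<rho>>0. mv MaxAlg (mpow MaxAlg A p) (column j U) = \<rho> ^ p *\<^sub>R column j U"
    using core_generated_by_periodic_vectors[OF A] by blast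
  obtain c where c: "nonneg_vec c" "z = mv MaxAlg U c" using z unfolding U(2) col_span_def by blast
  have "z $ i = ssum MaxAlg (\<lambda>j. U $ i $ j * c $ j)" unfolding c(2) by (rule mv_nth)
  then obtain j where j: "U $ i $ j * c $ j = z $ i" using ssum_attained[of "\<lambda>j. U $ i $ j * c $ j"] by metis
  let ?u = "column j U"
  have u0: "nonneg_vec ?u" by (rule nonneg_column[OF U(1)])
  have cj: "0 \<le> c $ j" using c(1) by (simp add: nonneg_vec_def)
  have "0 < U $ i $ j * c $ j" using j i by simp
  then have ui: "0 < ?u $ i" "0 < c $ j" using cj U(1) by (auto simp: zero_less_mult_iff column_nth nonneg_mat_def not_less)
  then have "?u \<noteq> 0" by auto
  then obtain p \<rho> where p: "p \<ge> 1" "\<rho> > 0" "mv MaxAlg (mpow MaxAlg A p) ?u = \<rho> ^ p *\<^sub>R ?u" using U(3) by blast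
  obtain w where w: "nonneg_vec w" "\<And>i. ?u $ i \<le> w $ i" "mv MaxAlg A w = \<rho> *\<^sub>R w"
    using eigenvector_above_periodic[OF A u0 p(3,1,2)] by blast
  have "w \<noteq> 0" using w(2)[of i] ui(1) by auto
  then have r: "\<rho> \<in> Lambda MaxAlg A" using w p(2) unfolding Lambda_def eigencone_def by blast
  let ?s = "sigma_num MaxAlg A \<rho>"
  have ps: "mv MaxAlg (mpow MaxAlg A (?s * p)) ?u = \<rho> ^ (?s * p) *\<^sub>R ?u"
    using periodic_mult[OF A u0 p(3,2), of ?s] by (simp only: mult.commute)
  obtain l where l: "l \<in> nodes (assoc_critical_graph A \<rho>)" "0 < ?u $ l" "?u $ l * critical_star A \<rho> $ i $ l = ?u $ i"
    using critical_column_tight[OF A r u0 ps p(1) ui(1)] by blast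
  have "c $ j * ?u $ l * critical_column A (\<rho>, l) $ k \<le> z $ k" for k
  proof -
    have "?u $ l * critical_star A \<rho> $ k $ l \<le> ?u $ k" by (rule critical_column_below[OF A r u0 ps p(1) l(1)])
    then have "c $ j * (?u $ l * critical_star A \<rho> $ k $ l) \<le> c $ j * ?u $ k" using cj by (rule mult_left_mono)
    also have "\<dots> \<le> z $ k" unfolding c(2) using mv_ge_term[OF U(1) c(1), of k j] by (simp only: column_nth mult.commute)
    finally show ?thesis by (simp add: critical_column_def column_nth mult.assoc)
  qed
  moreover have "c $ j * ?u $ l * critical_column A (\<rho>, l) $ i = z $ i"
  proof -
    have "c $ j * ?u $ l * critical_column A (\<rho>, l) $ i = c $ j * (?u $ l * critical_star A \<rho> $ i $ l)"
      by (simp add: critical_column_def column_nth)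
    also have "\<dots> = z $ i" unfolding l(3) j[symmetric] by (simp add: column_nth)
    finally show ?thesis .
  qed
  moreover have "(\<rho>, l) \<in> critical_index A" using r l(1) by (simp add: critical_index_def)
  moreover have "0 < c $ j * ?u $ l" using ui(2) l(2) by simp
  ultimately show ?thesis by blast
qed

lemma periodic_eigenvalue_unique:
  fixes A :: "real^'n^'n::finite"
  assumes A: "nonneg_mat A" and x: "nonneg_vec x" "x \<noteq> 0"
    and 1: "mv alg (mpow alg A s) x = \<rho> ^ s *\<^sub>R x" "1 \<le> s" "0 < \<rho>"
    and 2: "mv alg (mpow alg A t) x = \<rho>' ^ t *\<^sub>R x" "1 \<le> t" "0 < \<rho>'"
  shows "\<rho> = \<rho>'"
proof -
  have "\<rho> ^ (s * t) *\<^sub>R x = \<rho>' ^ (s * t) *\<^sub>R x"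
    using periodic_mult[OF A x(1) 1(1,3), of t] periodic_mult[OF A x(1) 2(1,3), of s] by (simp add: mult.commute)
  then have eq: "\<rho> ^ (s * t) = \<rho>' ^ (s * t)" using x(2) by simp
  have "0 < s * t" using 1(2) 2(2) by simp
  then show ?thesis using power_eq_imp_eq_base[OF eq] 1(3) 2(3) by simp
qed

text \<open>Let \<open>y\<close> be a multiple of a critical column for some \<open>\<rho>'\<close> that lies below \<open>u\<close> and agrees with it at the
node \<open>j\<close> of \<open>p\<close>. The inequality between \<open>y\<close> and the column of \<open>p\<close> yields \<open>\<rho>' \<le> \<rho>\<close>, and critical
closed walks at \<open>j\<close> yield \<open>\<rho> \<le> \<rho>'\<close>. So \<open>critical_column_below\<close> applies to \<open>y\<close> and shows that the
column of \<open>p\<close> lies below \<open>y\<close>.\<close>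

lemma critical_column_extremal:
  fixes A :: "real^'n^'n::finite"
  assumes A: "nonneg_mat A" and p: "p \<in> critical_index A"
    and u: "u \<in> core MaxAlg A" "\<And>k. u $ k \<le> critical_column A p $ k" "u $ snd p = critical_column A p $ snd p"
  shows "u = critical_column A p"
proof -
  obtain \<rho> j where pj: "p = (\<rho>, j)" by (cases p)
  have r: "\<rho> \<in> Lambda MaxAlg A" "j \<in> nodes (assoc_critical_graph A \<rho>)" using p by (auto simp: critical_index_def pj)
  let ?x = "critical_column A p"
  have xj: "?x $ j = 1" by (simp add: critical_column_def column_nth pj critical_star_diag[OF A r(1)])
  obtain a q where a: "0 < a" "q \<in> critical_index A" "\<And>k. a * critical_column A q $ k \<le> u $ k" "a * critical_column A q $ j = u $ j"
    using core_Max_generated[OF A u(1), of j] u(3) xj by (auto simp: pj)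
  obtain \<rho>' l where ql: "q = (\<rho>', l)" by (cases q)
  have r': "\<rho>' \<in> Lambda MaxAlg A" "l \<in> nodes (assoc_critical_graph A \<rho>')" using a(2) by (auto simp: critical_index_def ql)
  define y where "y = a *\<^sub>R critical_column A q"
  have y0: "nonneg_vec y" using critical_column_nonzero(1)[OF A a(2)] a(1) by (simp add: y_def nonneg_vec_def)
  have yj: "y $ j = 1" using a(4) u(3) xj by (simp add: y_def pj)
  have yu: "y $ k \<le> u $ k" for k using a(3) by (simp add: y_def)
  let ?s = "sigma_num MaxAlg A \<rho>" and ?t = "sigma_num MaxAlg A \<rho>'"
  note pos = Lambda_pos[OF r(1)] Lambda_pos[OF r'(1)]
  have yt: "mv MaxAlg (mpow MaxAlg A ?t) y = \<rho>' ^ ?t *\<^sub>R y"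
    unfolding y_def critical_column_def ql
    using critical_column_in_eigencone[OF A r'] a(1) by (simp add: mv_scaleR del: mv.simps sigma_num.simps)
  have xs: "mv MaxAlg (mpow MaxAlg A ?s) ?x = \<rho> ^ ?s *\<^sub>R ?x"
    unfolding critical_column_def pj using critical_column_in_eigencone[OF A r] by (simp del: mv.simps sigma_num.simps)
  have x0: "nonneg_vec ?x" by (rule critical_column_nonzero(1)[OF A p])
  note s1 = sigma_Max_pos[OF A r(1)] and t1 = sigma_Max_pos[OF A r'(1)]
  obtain k where k: "k \<ge> 1" "mpow MaxAlg A k $ j $ j = \<rho> ^ k" using critical_node_power[OF A r] by blast
  have "\<rho> \<le> \<rho>'"
  proof -
    have "\<rho> ^ (k * ?t) \<le> mpow MaxAlg A (k * ?t) $ j $ j"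
    proof -
      have "(\<rho> ^ k) ^ n \<le> mpow MaxAlg A (k * n) $ j $ j" for n
      proof (induction n)
        case 0 show ?case by (simp add: mat_def)
      next
        case (Suc n)
        have "(\<rho> ^ k) ^ Suc n \<le> mpow MaxAlg A k $ j $ j * mpow MaxAlg A (k * n) $ j $ j"
          using Suc k(2) pos(1) by (simp add: mult_left_mono)
        also have "\<dots> \<le> mpow MaxAlg A (k + k * n) $ j $ j" by (rule mpow_add_ge[OF A])
        finally show ?case by simp
      qed
      from this[of ?t] show ?thesis by (simp only: power_mult)
    qed
    also have "\<dots> = mpow MaxAlg A (k * ?t) $ j $ j * y $ j" using yj by simp
    also have "\<dots> \<le> mv MaxAlg (mpow MaxAlg A (k * ?t)) y $ j" by (rule mv_ge_term[OF mpow_nonneg[OF A] y0])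
    also have "\<dots> = \<rho>' ^ (k * ?t)"
      using periodic_mult[OF A y0 yt pos(2), of k] yj by (simp add: mult.commute del: mv.simps sigma_num.simps)
    finally have "\<rho> ^ (k * ?t) \<le> \<rho>' ^ (k * ?t)" .
    then show ?thesis by (rule power_le_base[OF pos(1) less_imp_le[OF pos(2)], rotated]) (use mult_le_mono[OF k(1) t1] in simp)
  qed
  moreover have "\<rho>' \<le> \<rho>"
  proof -
    have "mv MaxAlg (mpow MaxAlg A (?t * ?s)) y $ j \<le> mv MaxAlg (mpow MaxAlg A (?t * ?s)) ?x $ j"
      by (rule mv_mono[OF mpow_nonneg[OF A]]) (use yu u(2) order_trans in blast)
    moreover have "mv MaxAlg (mpow MaxAlg A (?t * ?s)) y = \<rho>' ^ (?t * ?s) *\<^sub>R y" by (rule periodic_mult[OF A y0 yt pos(2)])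
    moreover have "mv MaxAlg (mpow MaxAlg A (?s * ?t)) ?x = \<rho> ^ (?s * ?t) *\<^sub>R ?x" by (rule periodic_mult[OF A x0 xs pos(1)])
    ultimately have "\<rho>' ^ (?t * ?s) \<le> \<rho> ^ (?t * ?s)" using xj yj by (simp add: mult.commute del: mv.simps sigma_num.simps)
    then show ?thesis by (rule power_le_base[OF pos(2) less_imp_le[OF pos(1)], rotated]) (use mult_le_mono[OF t1 s1] in simp)
  qed
  ultimately have eq: "\<rho>' = \<rho>" by simp
  have yq: "mv MaxAlg (mpow MaxAlg A (?s * 1)) y = \<rho> ^ (?s * 1) *\<^sub>R y" using yt unfolding eq by (simp only: mult_1_right)
  have "?x $ k \<le> y $ k" for k
    using critical_column_below[OF A r(1) y0 yq order_refl r(2), of k] yj by (simp add: critical_column_def column_nth pj)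
  then have "u $ k = ?x $ k" for k using yu[of k] u(2)[of k] by (meson order_antisym order_trans)
  then show ?thesis by (simp add: vec_eq_iff)
qed

lemma critical_column_in_extremals:
  fixes A :: "real^'n^'n::finite"
  assumes A: "nonneg_mat A" and p: "p \<in> critical_index A" and a: "0 < a"
    and W: "W \<subseteq> core MaxAlg A" "a *\<^sub>R critical_column A p \<in> W"
  shows "a *\<^sub>R critical_column A p \<in> extremals MaxAlg W"
proof -
  let ?z = "a *\<^sub>R critical_column A p"
  have z0: "?z \<noteq> 0" using critical_column_nonzero(2)[OF A p] a by simp
  have key: "?z = u" if u: "u \<in> W" and z: "\<And>k. u $ k \<le> ?z $ k" "u $ snd p = ?z $ snd p" for u
  proof -
    have "(1 / a) *\<^sub>R u = critical_column A p"
    proof (rule critical_column_extremal[OF A p])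
      show "(1 / a) *\<^sub>R u \<in> core MaxAlg A" using core_scaleR[OF A, of u MaxAlg "1 / a"] u W(1) a by auto
      show "((1 / a) *\<^sub>R u) $ k \<le> critical_column A p $ k" for k using z(1)[of k] a by (simp add: field_simps)
      show "((1 / a) *\<^sub>R u) $ snd p = critical_column A p $ snd p" using z(2) a by (simp add: field_simps)
    qed
    then have "a *\<^sub>R ((1 / a) *\<^sub>R u) = ?z" by simp
    then show ?thesis using a by simp
  qed
  have "?z = u \<or> ?z = v" if uv: "u \<in> W" "v \<in> W" "?z = vadd MaxAlg u v" for u v
  proof -
    have max: "?z $ k = max (u $ k) (v $ k)" for k using arg_cong[OF uv(3), of "\<lambda>x. x $ k"] by simp
    have "u $ k \<le> ?z $ k" "v $ k \<le> ?z $ k" for k unfolding max by simp_all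
    moreover have "u $ snd p = ?z $ snd p \<or> v $ snd p = ?z $ snd p" unfolding max by (simp add: max_def)
    ultimately show ?thesis using key[OF uv(1)] key[OF uv(2)] by blast
  qed
  then show ?thesis using W(2) z0 unfolding extremals_def by (simp del: vadd.simps)
qed

lemma extremals_Max_eq:
  fixes A :: "real^'n^'n::finite"
  assumes A: "nonneg_mat A" and I: "I \<subseteq> critical_index A" and W: "W \<subseteq> core MaxAlg A"
    and add: "\<And>x y. x \<in> W \<Longrightarrow> y \<in> W \<Longrightarrow> vadd MaxAlg x y \<in> W"
    and X: "\<And>a p. 0 < a \<Longrightarrow> p \<in> I \<Longrightarrow> a *\<^sub>R critical_column A p \<in> W"
    and gen: "\<And>z i. z \<in> W \<Longrightarrow> 0 < z $ i \<Longrightarrow>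
      \<exists>a p. 0 < a \<and> p \<in> I \<and> (\<forall>k. a * critical_column A p $ k \<le> z $ k) \<and> a * critical_column A p $ i = z $ i"
  shows "extremals MaxAlg W = {a *\<^sub>R critical_column A p | a p. 0 < a \<and> p \<in> I}" (is "_ = ?G")
proof
  show "extremals MaxAlg W \<subseteq> ?G"
  proof
    fix z assume z: "z \<in> extremals MaxAlg W"
    then have zW: "z \<in> W" by (simp add: extremals_def)
    have nn: "nonneg_vec x" if "x \<in> W" for x using core_nonneg[OF A] W that by blast
    show "z \<in> ?G"
    proof (rule extremal_Max_attained[OF z nn[OF zW] add nn])
      fix i assume "0 < z $ i"
      then obtain a p where ap: "0 < a" "p \<in> I" "\<forall>k. a * critical_column A p $ k \<le> z $ k" "a * critical_column A p $ i = z $ i"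
        using gen[OF zW] by blast
      have "a *\<^sub>R critical_column A p \<in> ?G" using ap(1,2) by blast
      then show "\<exists>y\<in>?G. y \<in> W \<and> (\<forall>k. y $ k \<le> z $ k) \<and> y $ i = z $ i"
        by (rule bexI[rotated]) (use ap(3,4) X[OF ap(1,2)] in simp)
    qed
  qed
  show "?G \<subseteq> extremals MaxAlg W"
    using critical_column_in_extremals[OF A _ _ W] X I by blast
qed

lemma extremals_core_Max:
  fixes A :: "real^'n^'n::finite"
  assumes A: "nonneg_mat A"
  shows "extremals MaxAlg (core MaxAlg A) = {a *\<^sub>R critical_column A p | a p. 0 < a \<and> p \<in> critical_index A}"
proof (rule extremals_Max_eq[OF A order_refl order_refl])
  show "vadd MaxAlg x y \<in> core MaxAlg A" if "x \<in> core MaxAlg A" "y \<in> core MaxAlg A" for x y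
    by (rule core_vadd[OF A that])
  show "a *\<^sub>R critical_column A p \<in> core MaxAlg A" if "0 < a" "p \<in> critical_index A" for a p
    using core_scaleR[OF A critical_column_in_core[OF A that(2)]] that(1) by simp
qed (rule core_Max_generated[OF A])

lemma extremals_eigencone_Max:
  fixes A :: "real^'n^'n::finite"
  assumes A: "nonneg_mat A" and r: "\<rho> \<in> Lambda MaxAlg A"
  shows "extremals MaxAlg (eigencone MaxAlg (mpow MaxAlg A (sigma_num MaxAlg A \<rho>)) (\<rho> ^ sigma_num MaxAlg A \<rho>)) =
    {a *\<^sub>R critical_column A p | a p. 0 < a \<and> p \<in> {\<rho>} \<times> nodes (assoc_critical_graph A \<rho>)}" (is "extremals MaxAlg ?V = _")
proof (rule extremals_Max_eq[OF A])
  let ?s = "sigma_num MaxAlg A \<rho>"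
  note r0 = Lambda_pos[OF r] and s1 = sigma_Max_pos[OF A r]
  show "{\<rho>} \<times> nodes (assoc_critical_graph A \<rho>) \<subseteq> critical_index A" using r by (auto simp: critical_index_def)
  have V: "z \<in> ?V \<longleftrightarrow> nonneg_vec z \<and> mv MaxAlg (mpow MaxAlg A ?s) z = \<rho> ^ ?s *\<^sub>R z" for z
    unfolding eigencone_def by simp
  show "?V \<subseteq> core MaxAlg A" using V periodic_in_core[OF A _ _ s1 r0] by blast
  show "vadd MaxAlg x y \<in> ?V" if xy: "x \<in> ?V" "y \<in> ?V" for x y
  proof -
    have "mv MaxAlg (mpow MaxAlg A ?s) (vadd MaxAlg x y) = vadd MaxAlg (\<rho> ^ ?s *\<^sub>R x) (\<rho> ^ ?s *\<^sub>R y)"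
      using xy V mv_vadd[OF mpow_nonneg[OF A], of MaxAlg] by metis
    also have "\<dots> = \<rho> ^ ?s *\<^sub>R vadd MaxAlg x y"
      using r0 by (simp add: vec_eq_iff max_mult_distrib_left)
    finally show ?thesis using V xy vadd_nonneg by blast
  qed
  show "a *\<^sub>R critical_column A p \<in> ?V" if "0 < a" "p \<in> {\<rho>} \<times> nodes (assoc_critical_graph A \<rho>)" for a p
  proof -
    have j: "fst p = \<rho>" "snd p \<in> nodes (assoc_critical_graph A \<rho>)" using that(2) by auto
    show ?thesis unfolding V critical_column_def j(1)
      using critical_column_in_eigencone[OF A r j(2)] critical_star_column(1)[OF A r] that(1)
      by (simp add: mv_scaleR nonneg_vec_def del: mv.simps sigma_num.simps)
  qed
  show "\<exists>a p. 0 < a \<and> p \<in> {\<rho>} \<times> nodes (assoc_critical_graph A \<rho>) \<and>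
      (\<forall>k. a * critical_column A p $ k \<le> z $ k) \<and> a * critical_column A p $ i = z $ i" if z: "z \<in> ?V" and i: "0 < z $ i" for z i
  proof -
    have z': "nonneg_vec z" "mv MaxAlg (mpow MaxAlg A (?s * 1)) z = \<rho> ^ (?s * 1) *\<^sub>R z" using z V by (simp_all only: mult_1_right)
    obtain l where l: "l \<in> nodes (assoc_critical_graph A \<rho>)" "0 < z $ l" "z $ l * critical_star A \<rho> $ i $ l = z $ i"
      using critical_column_tight[OF A r z' order_refl i] by blast
    have "z $ l * critical_star A \<rho> $ k $ l \<le> z $ k" for k by (rule critical_column_below[OF A r z' order_refl l(1)])
    then show ?thesis using l
      by (intro exI[of _ "z $ l"] exI[of _ "(\<rho>, l)"]) (simp add: critical_column_def column_nth)
  qed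
qed

theorem extremals_core_Max_eigencones:
  fixes A :: "real^'n^'n::finite"
  assumes A: "nonneg_mat A"
  shows "extremals MaxAlg (core MaxAlg A) = (\<Union>\<rho>\<in>Lambda MaxAlg A.
     extremals MaxAlg (eigencone MaxAlg (mpow MaxAlg A (sigma_num MaxAlg A \<rho>)) (\<rho> ^ sigma_num MaxAlg A \<rho>)))"
proof -
  have "(\<Union>\<rho>\<in>Lambda MaxAlg A.
     extremals MaxAlg (eigencone MaxAlg (mpow MaxAlg A (sigma_num MaxAlg A \<rho>)) (\<rho> ^ sigma_num MaxAlg A \<rho>)))
     = (\<Union>\<rho>\<in>Lambda MaxAlg A. {a *\<^sub>R critical_column A p | a p. 0 < a \<and> p \<in> {\<rho>} \<times> nodes (assoc_critical_graph A \<rho>)})"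
    by (rule SUP_cong[OF refl]) (rule extremals_eigencone_Max[OF A])
  also have "\<dots> = extremals MaxAlg (core MaxAlg A)"
    unfolding extremals_core_Max[OF A] critical_index_def Sigma_def by blast
  finally show ?thesis ..
qed

lemma normalized_extremals_core_Max:
  fixes A :: "real^'n^'n::finite"
  assumes A: "nonneg_mat A"
  shows "normalized_extremals MaxAlg (core MaxAlg A) =
    (\<Union>\<rho>\<in>Lambda MaxAlg A. \<Union>C\<in>sccs (assoc_critical_graph A \<rho>). critical_columns A \<rho> C)"
proof -
  have eq: "normalized_extremals MaxAlg (core MaxAlg A) = (\<lambda>p. normalization (critical_column A p)) ` critical_index A"
    by (rule normalized_extremals_eq[OF _ extremals_core_Max[OF A]]) (use critical_column_nonzero[OF A] in auto)
  have "(\<Union>C\<in>sccs (assoc_critical_graph A \<rho>). critical_columns A \<rho> C)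
      = (\<lambda>j. normalization (column j (critical_star A \<rho>))) ` nodes (assoc_critical_graph A \<rho>)"
    if r: "\<rho> \<in> Lambda MaxAlg A" for \<rho>
    using assoc_critical_component(3)[OF A r] assoc_critical_component_of[OF A r] unfolding critical_columns_def by blast
  then show ?thesis unfolding eq critical_index_def critical_column_def by (auto simp: image_iff) blast+
qed

text \<open>A closed walk of length \<open>k\<close> in a critical component makes the diagonal entries of \<open>A ^ k\<close> at its nodes
equal to \<open>\<rho> ^ k\<close>, so the component determines \<open>\<rho>\<close>.\<close>

lemma critical_component_eigenvalue_unique:
  fixes A :: "real^'n^'n::finite"
  assumes A: "nonneg_mat A" and r: "\<rho> \<in> Lambda MaxAlg A" "\<rho>' \<in> Lambda MaxAlg A"
    and C: "C \<in> sccs (assoc_critical_graph A \<rho>)" "C \<in> sccs (assoc_critical_graph A \<rho>')"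
  shows "\<rho> = \<rho>'"
proof -
  note c = assoc_critical_component[OF A r(1) C(1)] and c' = assoc_critical_component[OF A r(2) C(2)]
  obtain j where j: "j \<in> nodes C" using c(1) by (auto simp: strongly_connected_def)
  obtain k where k: "1 \<le> k" "(j, j) \<in> edges C ^^ k" using strongly_connected_closed_walk[OF c(1,2) j] by blast
  have "mpow MaxAlg A k $ j $ j = \<rho> ^ k"
    by (rule closed_critical_walk_power[OF A r(1) relpow_subset[OF k(2) c(4)]]) (use j c(3) in blast)
  moreover have "mpow MaxAlg A k $ j $ j = \<rho>' ^ k"
    by (rule closed_critical_walk_power[OF A r(2) relpow_subset[OF k(2) c'(4)]]) (use j c'(3) in blast)
  ultimately have "\<rho> ^ k = \<rho>' ^ k" by simp
  then show ?thesis using power_eq_imp_eq_base[of \<rho> k \<rho>'] Lambda_pos[OF r(1)] Lambda_pos[OF r(2)] k(1) by simp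
qed

text \<open>A vector determines the eigenvalue for which it is periodic, so a common vector belongs to a single \<open>\<rho>\<close>,
and proportional columns for the same \<open>\<rho>\<close> come from the same component.\<close>

lemma critical_columns_disjoint:
  fixes A :: "real^'n^'n::finite"
  assumes A: "nonneg_mat A" and r: "\<rho> \<in> Lambda MaxAlg A" "\<rho>' \<in> Lambda MaxAlg A"
    and C: "C \<in> sccs (assoc_critical_graph A \<rho>)" "C' \<in> sccs (assoc_critical_graph A \<rho>')"
    and x: "x \<in> critical_columns A \<rho> C" "x \<in> critical_columns A \<rho>' C'"
  shows "C = C'"
proof -
  note c = assoc_critical_component(3)[OF A r(1) C(1)] and c' = assoc_critical_component(3)[OF A r(2) C(2)]
  obtain i where i: "i \<in> nodes C" "x = normalization (column i (critical_star A \<rho>))" using x(1) unfolding critical_columns_def by blast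
  obtain j where j: "j \<in> nodes C'" "x = normalization (column j (critical_star A \<rho>'))" using x(2) unfolding critical_columns_def by blast
  have ic: "i \<in> nodes (assoc_critical_graph A \<rho>)" "j \<in> nodes (assoc_critical_graph A \<rho>')" using i(1) j(1) c c' by auto
  obtain b where b: "0 < b" "x = b *\<^sub>R column i (critical_star A \<rho>)" using normalization_multiple[OF critical_star_column[OF A r(1)]] i(2) by metis
  obtain b' where b': "0 < b'" "x = b' *\<^sub>R column j (critical_star A \<rho>')" using normalization_multiple[OF critical_star_column[OF A r(2)]] j(2) by metis
  have x0: "nonneg_vec x" "x \<noteq> 0" using b critical_star_column[OF A r(1), of i] by (auto simp: nonneg_vec_def)
  have "mv MaxAlg (mpow MaxAlg A (sigma_num MaxAlg A \<rho>)) x = \<rho> ^ sigma_num MaxAlg A \<rho> *\<^sub>R x"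
    unfolding b(2) using critical_column_in_eigencone[OF A r(1) ic(1)] b(1) by (simp add: mv_scaleR del: mv.simps sigma_num.simps)
  moreover have "mv MaxAlg (mpow MaxAlg A (sigma_num MaxAlg A \<rho>')) x = \<rho>' ^ sigma_num MaxAlg A \<rho>' *\<^sub>R x"
    unfolding b'(2) using critical_column_in_eigencone[OF A r(2) ic(2)] b'(1) by (simp add: mv_scaleR del: mv.simps sigma_num.simps)
  ultimately have eq: "\<rho> = \<rho>'"
    using periodic_eigenvalue_unique[OF A x0 _ sigma_Max_pos[OF A r(1)] Lambda_pos[OF r(1)] _ sigma_Max_pos[OF A r(2)] Lambda_pos[OF r(2)]] by blast
  obtain D where D: "D \<in> sccs (assoc_critical_graph A \<rho>)" "i \<in> nodes D" "j \<in> nodes D"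
    using critical_columns_proportional_iff[OF A r(1) ic(1), of j] ic(2) i(2) j(2) unfolding eq by metis
  show ?thesis using sccs_unique[OF C(1) D(1) i(1) D(2)] sccs_unique[OF C(2)[folded eq] D(1) j(1) D(3)] by simp
qed

lemma finite_sccs: "finite (sccs (G :: 'n::finite graph))"
  unfolding sccs_eq by simp

lemma card_normalized_extremals_core_Max:
  fixes A :: "real^'n^'n::finite"
  assumes A: "nonneg_mat A"
  shows "finite (normalized_extremals MaxAlg (core MaxAlg A))"
    "card (normalized_extremals MaxAlg (core MaxAlg A)) = (\<Sum>C\<in>critical_components A. sc_cyclicity C)"
proof -
  define f where "f C = (\<Union>\<rho>\<in>{\<rho> \<in> Lambda MaxAlg A. C \<in> sccs (assoc_critical_graph A \<rho>)}. critical_columns A \<rho> C)" for C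
  have f: "f C = critical_columns A \<rho> C" if "\<rho> \<in> Lambda MaxAlg A" "C \<in> sccs (assoc_critical_graph A \<rho>)" for \<rho> C
  proof -
    have "{\<rho> \<in> Lambda MaxAlg A. C \<in> sccs (assoc_critical_graph A \<rho>)} = {\<rho>}"
      using critical_component_eigenvalue_unique[OF A] that by blast
    then show ?thesis by (simp add: f_def)
  qed
  have eq: "normalized_extremals MaxAlg (core MaxAlg A) = (\<Union>C\<in>critical_components A. f C)"
    unfolding normalized_extremals_core_Max[OF A] critical_components_def using f by auto
  have finC: "finite (critical_components A)"
    unfolding critical_components_def using finite_Lambda_Max[OF A] finite_sccs by blast
  have fin: "finite (f C)" if C: "C \<in> critical_components A" for C
  proof -
    obtain \<rho> where "\<rho> \<in> Lambda MaxAlg A" "C \<in> sccs (assoc_critical_graph A \<rho>)"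
      using C by (auto simp: critical_components_def)
    then show ?thesis by (simp add: f critical_columns_def)
  qed
  show "finite (normalized_extremals MaxAlg (core MaxAlg A))" unfolding eq using finC fin by blast
  have "f C \<inter> f C' = {}" if cc: "C \<in> critical_components A" "C' \<in> critical_components A" "C \<noteq> C'" for C C'
  proof -
    obtain \<rho> where r: "\<rho> \<in> Lambda MaxAlg A" "C \<in> sccs (assoc_critical_graph A \<rho>)" using cc(1) by (auto simp: critical_components_def)
    obtain \<rho>' where r': "\<rho>' \<in> Lambda MaxAlg A" "C' \<in> sccs (assoc_critical_graph A \<rho>')" using cc(2) by (auto simp: critical_components_def)
    show ?thesis unfolding f[OF r] f[OF r'] using critical_columns_disjoint[OF A r(1) r'(1) r(2) r'(2)] cc(3) by blast
  qed
  then have "card (\<Union>C\<in>critical_components A. f C) = (\<Sum>C\<in>critical_components A. card (f C))"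
    using finC fin by (intro card_UN_disjoint) auto
  also have "\<dots> = (\<Sum>C\<in>critical_components A. sc_cyclicity C)"
  proof (rule sum.cong[OF refl])
    fix C assume "C \<in> critical_components A"
    then obtain \<rho> where r: "\<rho> \<in> Lambda MaxAlg A" "C \<in> sccs (assoc_critical_graph A \<rho>)" by (auto simp: critical_components_def)
    show "card (f C) = sc_cyclicity C" unfolding f[OF r] by (rule critical_columns_of_component(1)[OF A r])
  qed
  finally show "card (normalized_extremals MaxAlg (core MaxAlg A)) = (\<Sum>C\<in>critical_components A. sc_cyclicity C)"
    unfolding eq .
qed

section \<open>Extremals of the core in both algebras\<close>

theorem theorem6p5:
  fixes A :: "real ^ 'n ^ 'n::finite"
  assumes "nonneg_mat A"
  shows
    "(\<forall>alg. extremals alg (core alg A) =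
        (\<Union>\<rho>\<in>Lambda alg A.
          extremals alg (eigencone alg (mpow alg A (sigma_num alg A \<rho>)) (\<rho> ^ sigma_num alg A \<rho>))))
     \<and>
     (\<exists>X :: 'n graph \<Rightarrow> (real ^ 'n) set.
        (\<forall>\<mu>\<in>spectral_classes Nonneg A.
           X \<mu> \<subseteq> normalized_extremals Nonneg (core Nonneg A) \<and>
           card (X \<mu>) = sc_cyclicity \<mu> \<and>
           (\<forall>x\<in>X \<mu>. support x \<inter> nodes \<mu> \<noteq> {} \<and> (\<forall>i\<in>support x. node_accesses A i \<mu>)) \<and>
           simple_cycle_under Nonneg A (X \<mu>)) \<and>
        normalized_extremals Nonneg (core Nonneg A) \<subseteq> (\<Union>\<mu>\<in>spectral_classes Nonneg A. X \<mu>) \<and>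
        finite (normalized_extremals Nonneg (core Nonneg A)) \<and>
        card (normalized_extremals Nonneg (core Nonneg A)) =
          (\<Sum>\<mu>\<in>spectral_classes Nonneg A. sc_cyclicity \<mu>))
     \<and>
     ((\<forall>\<rho>\<in>Lambda MaxAlg A.
         kleene_converges (mpow MaxAlg (scaled_restriction A \<rho>) (sigma_num MaxAlg A \<rho>)) \<and>
         (\<forall>C\<in>sccs (assoc_critical_graph A \<rho>).
            critical_columns A \<rho> C \<subseteq> normalized_extremals MaxAlg (core MaxAlg A) \<and>
            card (critical_columns A \<rho> C) = sc_cyclicity C \<and>
            simple_cycle_under MaxAlg A (critical_columns A \<rho> C))) \<and>
      normalized_extremals MaxAlg (core MaxAlg A) \<subseteq>
        (\<Union>\<rho>\<in>Lambda MaxAlg A. \<Union>C\<in>sccs (assoc_critical_graph A \<rho>). critical_columns A \<rho> C) \<and>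
      finite (normalized_extremals MaxAlg (core MaxAlg A)) \<and>
      card (normalized_extremals MaxAlg (core MaxAlg A)) =
        (\<Sum>C\<in>critical_components A. sc_cyclicity C))"
proof (intro conjI allI ballI)
  note A = assms
  show "extremals alg (core alg A) = (\<Union>\<rho>\<in>Lambda alg A.
      extremals alg (eigencone alg (mpow alg A (sigma_num alg A \<rho>)) (\<rho> ^ sigma_num alg A \<rho>)))" for alg
    using extremals_core_Nonneg_eigencones[OF A] extremals_core_Max_eigencones[OF A] by (cases alg) (simp_all only:)
  show "\<exists>X :: 'n graph \<Rightarrow> (real ^ 'n) set.
        (\<forall>\<mu>\<in>spectral_classes Nonneg A.
           X \<mu> \<subseteq> normalized_extremals Nonneg (core Nonneg A) \<and>
           card (X \<mu>) = sc_cyclicity \<mu> \<and>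
           (\<forall>x\<in>X \<mu>. support x \<inter> nodes \<mu> \<noteq> {} \<and> (\<forall>i\<in>support x. node_accesses A i \<mu>)) \<and>
           simple_cycle_under Nonneg A (X \<mu>)) \<and>
        normalized_extremals Nonneg (core Nonneg A) \<subseteq> (\<Union>\<mu>\<in>spectral_classes Nonneg A. X \<mu>) \<and>
        finite (normalized_extremals Nonneg (core Nonneg A)) \<and>
        card (normalized_extremals Nonneg (core Nonneg A)) =
          (\<Sum>\<mu>\<in>spectral_classes Nonneg A. sc_cyclicity \<mu>)"
    by (rule extremals_by_spectral_class[OF A])
  show "normalized_extremals MaxAlg (core MaxAlg A) \<subseteq>
        (\<Union>\<rho>\<in>Lambda MaxAlg A. \<Union>C\<in>sccs (assoc_critical_graph A \<rho>). critical_columns A \<rho> C)"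
    by (rule equalityD1[OF normalized_extremals_core_Max[OF A]])
  show "finite (normalized_extremals MaxAlg (core MaxAlg A))"
    "card (normalized_extremals MaxAlg (core MaxAlg A)) = (\<Sum>C\<in>critical_components A. sc_cyclicity C)"
    by (rule card_normalized_extremals_core_Max[OF A])+
  fix \<rho> assume r: "\<rho> \<in> Lambda MaxAlg A"
  show "kleene_converges (mpow MaxAlg (scaled_restriction A \<rho>) (sigma_num MaxAlg A \<rho>))"
    by (rule critical_star_converges[OF A r])
  fix C assume C: "C \<in> sccs (assoc_critical_graph A \<rho>)"
  show "critical_columns A \<rho> C \<subseteq> normalized_extremals MaxAlg (core MaxAlg A)"
    unfolding normalized_extremals_core_Max[OF A] using r C by blast
  show "card (critical_columns A \<rho> C) = sc_cyclicity C" "simple_cycle_under MaxAlg A (critical_columns A \<rho> C)"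
    by (rule critical_columns_of_component[OF A r C])+
qed

end
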